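(* Let $T>0$ and let the sequence $\{f^n\}_{n\in\mathbb N}\subset AC([0,T];(\mathcal P_2^{\mathrm{cm}}(\mathbb R),d_{\mathcal A}))$ be such that $\sup_{n\in\mathbb N}\mathcal G_T(f^n)<\infty$ and $\mathcal E(f_0^n)\to\mathcal E(f_0)$ with $f_0^n\to f_0$ narrowly, where $f_0\in\mathcal P_2^{\mathrm{cm}}(\mathbb R)$. Then there exists some $f\in AC([0,T];(\mathcal P_2^{\mathrm{cm}}(\mathbb R),d_{\mathcal A}))$ (with initial value $f_0$) such that $f_t^n\to f_t$ narrowly for a.e. $t\in[0,T]$, and $$\liminf_{n\to\infty}\mathcal G_T(f^n)\ge\mathcal G_T(f).$$
   Context: Notation. $\mathbb R^2_{\neq}:=\{(v,v_* )\in\mathbb R^2: v\neq v_*\}$; $\mathcal P(\mathbb R)$ is the set of Borel probability measures; $\mathcal P_2^{\mathrm{cm}}(\mathbb R)$ is the set of $f\in\mathcal P(\mathbb R)$ with $\int|v|^2df<\infty$ and $\int v\,df=0$; $\mathcal M(\mathbb R^2_{\neq})$ is the set of finite signed Radon measures on $\mathbb R^2_{\neq}$. Products $f\otimes f$ are restricted to $\mathbb R^2_{\neq}$. Narrow convergence is convergence against bounded continuous functions. Fix $e\in[0,1)$ and set $\sigma_e(r)=\frac{1-e}{4}r$ for $r\ge0$. For $\varphi\in C^1(\mathbb R)$ let $\tilde\nabla\varphi(v,v_* )=\varphi'(v_* )-\varphi'(v)$. Nonlocal-local continuity equation. A pair $\{(f_t,U_t)\}_{t\in[0,T]}$ with $f_t\in\mathcal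 P(\mathbb R)$, $U_t\in\mathcal M(\mathbb R^2_{\neq})$, both weak-$*$ measurable in $t$, is a (weak) solution if $\int_0^T\iint_{\mathbb R^2_{\neq}}\sigma_e(|v-v_*|)\,d|U_t|\,dt<\infty$ and for every $\varphi\in C^1_c((0,T)\times\mathbb R)$ $$\int_0^T\int_{\mathbb R}\partial_t\varphi_t\,df_t\,dt+\int_0^T\iint_{\mathbb R^2_{\neq}}\sigma_e(|v-v_*|)\tilde\nabla\varphi_t\,dU_t\,dt=0.$$ Such $f$ is identified with its narrowly continuous representative. $\mathrm{CE}_T(\mu_0,\mu_T)$ denotes the solutions with $f_0=\mu_0$, $f_T=\mu_T$; $\mathrm{CE}_T$ the set of all solutions; $\mathrm{CE}:=\mathrm{CE}_1$. Action density. $\alpha(s,u)=u^2/s$ if $s>0$, $\alpha(s,u)=0$ if $u=0$, $\alpha(0,u)=+\infty$ if $u\neq0$; with $|\lambda|=f\otimes f+|U|$, $\mathcal A(f,U)=\iint_{\mathbb R^2_{\neq}}\alpha\big(\frac{d(f\otimes f)}{d|\lambda|},\frac{dU}{d|\lambda|}\big)\sigma_e(|v-v_*|)\,d|\lambda|$. Collision transport cost: $d_{\mathcal A}(\mu_0,\mu_1)^2=\inf\{\int_0^1\mathcal A(f_t,U_t)\,dt:(f,U)\in\mathrm{CE}(\mu_0,\mu_1)\}$. Absolutely continuous curves: $f\in AC([0,T];(X,d_{\mathcal A}))$, $X\subset\mathcal P(\mathbb R)$, means $f_t\in X$ and there is $m\in L^2(0,T)$ with $d_{\mathcal A}(f_{t_0},f_{t_1})\le\int_{t_0}^{t_1}m(t)\,dt$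 for all $0<t_0\le t_1<T$. Its metric derivative is $|f'|(t)=\lim_{h\to0}d_{\mathcal A}(f_{t+h},f_t)/|h|$ for a.e. $t$. For such $f$ there is a unique flux $\{U_t\}$ with $(f,U)\in\mathrm{CE}_T$ and $|f'|^2(t)=\mathcal A(f_t,U_t)$ for a.e. $t$. Energy, dissipation, De Giorgi functional: $\mathcal E(f)=\frac12\int v^2\,df(v)$; $\mathcal D(f)=\iint_{\mathbb R^2_{\neq}}|v-v_*|^2\sigma_e(|v-v_*|)\,d(f\otimes f)$; for $f\in AC([0,T];(\mathcal P_2^{\mathrm{cm}}(\mathbb R),d_{\mathcal A}))$, $$\mathcal G_T(f)=\mathcal E(f_T)-\mathcal E(f_0)+\frac12\int_0^T\mathcal A(f_t,U_t)\,dt+\frac12\int_0^T\mathcal D(f_t)\,dt,$$ where $U_t$ is the unique flux with $|f'|^2(t)=\mathcal A(f_t,U_t)$ for a.e. $t$.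
   Formalization: The narrow convergence of f^n_t to f_t for a.e. t is asserted along a subsequence (independent of t), since it fails for the full sequence, e.g. when f^n alternates between two different curves with the same initial value; the liminf inequality is for the full sequence. *)

theory Defs
  imports "HOL-Probability.Probability"
begin

section \<open>Finite signed measures\<close>

text \<open>
  A signed measure on the measurable space \<open>M\<close> is a real-valued set function; its values outside
  \<open>sets M\<close> are never used. On an open subset of the plane, every finite signed Borel measure is
  Radon, so no regularity condition is needed.
\<close>

definition signed_measure :: "'a measure \<Rightarrow> ('a set \<Rightarrow> real) \<Rightarrow> bool" where
  "signed_measure M U \<longleftrightarrow>
     (\<forall>A :: nat \<Rightarrow> 'a set. range A \<subseteq> sets M \<and> disjoint_family A \<longrightarrow>
        (\<lambda>i. U (A i)) sums U (\<Union>i. A i))"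

text \<open>
  The supremum below is over real numbers cast to \<^typ>\<open>ennreal\<close>; negative values are truncated
  to \<open>0\<close>, which is harmless because \<open>B = {}\<close> already contributes \<open>0\<close>.
\<close>

definition upper_variation :: "'a measure \<Rightarrow> ('a set \<Rightarrow> real) \<Rightarrow> 'a measure" where
  "upper_variation M U =
     measure_of (space M) (sets M) (\<lambda>A. SUP B \<in> {B \<in> sets M. B \<subseteq> A}. ennreal (U B))"

definition lower_variation :: "'a measure \<Rightarrow> ('a set \<Rightarrow> real) \<Rightarrow> 'a measure" where
  "lower_variation M U = upper_variation M (\<lambda>A. - U A)"

definition add_measure :: "'a measure \<Rightarrow> 'a measure \<Rightarrow> 'a measure" where
  "add_measure M N = measure_of (space M) (sets M) (\<lambda>A. emeasure M A + emeasure N A)"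

definition total_variation :: "'a measure \<Rightarrow> ('a set \<Rightarrow> real) \<Rightarrow> 'a measure" where
  "total_variation M U = add_measure (upper_variation M U) (lower_variation M U)"

definition signed_integral :: "'a measure \<Rightarrow> ('a set \<Rightarrow> real) \<Rightarrow> ('a \<Rightarrow> real) \<Rightarrow> real" where
  "signed_integral M U \<phi> =
     (\<integral>x. \<phi> x \<partial>upper_variation M U) - (\<integral>x. \<phi> x \<partial>lower_variation M U)"

definition signed_RN_deriv :: "'a measure \<Rightarrow> 'a measure \<Rightarrow> ('a set \<Rightarrow> real) \<Rightarrow> 'a \<Rightarrow> real" where
  "signed_RN_deriv L M U x =
     enn2real (RN_deriv L (upper_variation M U) x) - enn2real (RN_deriv L (lower_variation M U) x)"


section \<open>Probability measures, narrow convergence, weak-* measurability\<close>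

definition P2cm :: "real measure set" where
  "P2cm = {f. real_distribution f \<and> integrable f (\<lambda>v. v\<^sup>2) \<and> (\<integral>v. v \<partial>f) = 0}"

definition narrow_lim :: "('i \<Rightarrow> real measure) \<Rightarrow> real measure \<Rightarrow> 'i filter \<Rightarrow> bool" where
  "narrow_lim \<mu> \<nu> F \<longleftrightarrow>
     (\<forall>\<phi> :: real \<Rightarrow> real. continuous_on UNIV \<phi> \<and> bounded (range \<phi>) \<longrightarrow>
        ((\<lambda>i. \<integral>v. \<phi> v \<partial>\<mu> i) \<longlongrightarrow> (\<integral>v. \<phi> v \<partial>\<nu>)) F)"

definition narrowly_continuous_on :: "real set \<Rightarrow> (real \<Rightarrow> real measure) \<Rightarrow> bool" where
  "narrowly_continuous_on S f \<longleftrightarrow> (\<forall>t\<in>S. narrow_lim f (f t) (at t within S))"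

text \<open>The predual of the space of finite signed Radon measures on the locally compact space \<open>X\<close>.\<close>

definition C0 :: "'a::topological_space set \<Rightarrow> ('a \<Rightarrow> real) set" where
  "C0 X = {\<phi>. continuous_on X \<phi> \<and>
              (\<forall>\<epsilon>>0. \<exists>K. compact K \<and> K \<subseteq> X \<and> (\<forall>x \<in> X - K. \<bar>\<phi> x\<bar> < \<epsilon>))}"

definition off_diag :: "(real \<times> real) set" where
  "off_diag = {(v, w). v \<noteq> w}"

abbreviation borel_off_diag :: "(real \<times> real) measure" where
  "borel_off_diag \<equiv> restrict_space borel off_diag"

definition prod_off_diag :: "real measure \<Rightarrow> (real \<times> real) measure" where
  "prod_off_diag f = restrict_space (f \<Otimes>\<^sub>M f) off_diag"


section \<open>The nonlocal-local continuity equation\<close>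

definition \<sigma> :: "real \<Rightarrow> real \<Rightarrow> real" where
  "\<sigma> e r = (1 - e) / 4 * r"

definition nl_grad :: "(real \<Rightarrow> real) \<Rightarrow> real \<times> real \<Rightarrow> real" where
  "nl_grad \<phi> = (\<lambda>(v, w). deriv \<phi> w - deriv \<phi> v)"

text \<open>
  Elements of \<open>C\<^sup>1\<^sub>c((0,T) \<times> \<real>)\<close>, extended by zero to the plane; the first coordinate is time.
\<close>

definition C1c :: "real \<Rightarrow> (real \<times> real \<Rightarrow> real) set" where
  "C1c T = {\<phi>.
     (\<exists>D :: real \<times> real \<Rightarrow> (real \<times> real) \<Rightarrow>\<^sub>L real.
        (\<forall>z. (\<phi> has_derivative blinfun_apply (D z)) (at z)) \<and> continuous_on UNIV D) \<and>
     (\<exists>K. compact K \<and> K \<subseteq> {0<..<T} \<times> UNIV \<and> (\<forall>z. z \<notin> K \<longrightarrow> \<phi> z = 0))}"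

text \<open>
  Solutions are identified with their narrowly continuous representative, so narrow continuity on
  the closed interval is part of the definition. This is what gives meaning to the values of \<open>f\<close>
  at the end points.
\<close>

definition CE :: "real \<Rightarrow> real \<Rightarrow> (real \<Rightarrow> real measure) \<Rightarrow> (real \<Rightarrow> (real \<times> real) set \<Rightarrow> real) \<Rightarrow> bool"
  where
  "CE e T f U \<longleftrightarrow>
     (\<forall>t\<in>{0..T}. real_distribution (f t)) \<and>
     narrowly_continuous_on {0..T} f \<and>
     (\<forall>t\<in>{0..T}. signed_measure borel_off_diag (U t)) \<and>
     (\<forall>\<phi> \<in> C0 UNIV. (\<lambda>t. \<integral>v. \<phi> v \<partial>f t) \<in> borel_measurable (lebesgue_on {0..T})) \<and>
     (\<forall>\<phi> \<in> C0 off_diag. (\<lambda>t. signed_integral borel_off_diag (U t) \<phi>)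
        \<in> borel_measurable (lebesgue_on {0..T})) \<and>
     (\<integral>\<^sup>+t. (\<integral>\<^sup>+(v, w). ennreal (\<sigma> e \<bar>v - w\<bar>) \<partial>total_variation borel_off_diag (U t))
        \<partial>lebesgue_on {0..T}) < \<infinity> \<and>
     (\<forall>\<phi> \<in> C1c T.
        (\<integral>t. (\<integral>v. deriv (\<lambda>s. \<phi> (s, v)) t \<partial>f t) \<partial>lebesgue_on {0..T}) +
        (\<integral>t. signed_integral borel_off_diag (U t)
                (\<lambda>(v, w). \<sigma> e \<bar>v - w\<bar> * nl_grad (\<lambda>x. \<phi> (t, x)) (v, w)) \<partial>lebesgue_on {0..T}) = 0)"

definition CE_between :: "real \<Rightarrow> real \<Rightarrow> real measure \<Rightarrow> real measure \<Rightarrow>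
    ((real \<Rightarrow> real measure) \<times> (real \<Rightarrow> (real \<times> real) set \<Rightarrow> real)) set" where
  "CE_between e T \<mu>0 \<mu>T = {(f, U). CE e T f U \<and> f 0 = \<mu>0 \<and> f T = \<mu>T}"


section \<open>Action and collision transport cost\<close>

definition action_density :: "real \<Rightarrow> real \<Rightarrow> ennreal" where
  "action_density s u = (if u = 0 then 0 else if s > 0 then ennreal (u\<^sup>2 / s) else \<infinity>)"

definition action :: "real \<Rightarrow> real measure \<Rightarrow> ((real \<times> real) set \<Rightarrow> real) \<Rightarrow> ennreal" where
  "action e f U =
     (let L = add_measure (prod_off_diag f) (total_variation borel_off_diag U)
      in \<integral>\<^sup>+z. action_density (enn2real (RN_deriv L (prod_off_diag f) z))
                              (signed_RN_deriv L borel_off_diag U z)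
              * ennreal (\<sigma> e \<bar>fst z - snd z\<bar>) \<partial>L)"

definition ennreal_sqrt :: "ennreal \<Rightarrow> ennreal" where
  "ennreal_sqrt x = (if x = \<infinity> then \<infinity> else ennreal (sqrt (enn2real x)))"

definition dA :: "real \<Rightarrow> real measure \<Rightarrow> real measure \<Rightarrow> ennreal" where
  "dA e \<mu>0 \<mu>1 = ennreal_sqrt
     (INF (f, U) \<in> CE_between e 1 \<mu>0 \<mu>1. \<integral>\<^sup>+t. action e (f t) (U t) \<partial>lebesgue_on {0..1})"


section \<open>Absolutely continuous curves\<close>

text \<open>
  The metric inequality only concerns interior times; the end-point values are tied to the curve
  by the convention that curves are identified with their narrowly continuous representative.
\<close>

definition AC :: "real \<Rightarrow> real \<Rightarrow> real measure set \<Rightarrow> (real \<Rightarrow> real measure) set" where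
  "AC e T X = {f.
     (\<forall>t\<in>{0..T}. f t \<in> X) \<and>
     narrowly_continuous_on {0..T} f \<and>
     (\<exists>m :: real \<Rightarrow> real.
        m \<in> borel_measurable (lebesgue_on {0<..<T}) \<and>
        integrable (lebesgue_on {0<..<T}) (\<lambda>t. (m t)\<^sup>2) \<and>
        (\<forall>t0 t1. 0 < t0 \<and> t0 \<le> t1 \<and> t1 < T \<longrightarrow>
           enn2ereal (dA e (f t0) (f t1)) \<le> ereal (\<integral>t. m t \<partial>lebesgue_on {t0..t1})))}"

definition metric_deriv :: "real \<Rightarrow> (real \<Rightarrow> real measure) \<Rightarrow> real \<Rightarrow> ennreal" where
  "metric_deriv e f t = Lim (at 0) (\<lambda>h. dA e (f (t + h)) (f t) / ennreal \<bar>h\<bar>)"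

text \<open>
  The flux realising the metric derivative; for absolutely continuous curves it exists and is
  unique up to a null set of times.
\<close>

definition flux :: "real \<Rightarrow> real \<Rightarrow> (real \<Rightarrow> real measure) \<Rightarrow> real \<Rightarrow> (real \<times> real) set \<Rightarrow> real" where
  "flux e T f = (SOME U. CE e T f U \<and>
     (AE t in lebesgue_on {0..T}. (metric_deriv e f t)\<^sup>2 = action e (f t) (U t)))"


section \<open>Energy, dissipation and the De Giorgi functional\<close>

definition energy :: "real measure \<Rightarrow> real" where
  "energy f = 1 / 2 * (\<integral>v. v\<^sup>2 \<partial>f)"

definition dissipation :: "real \<Rightarrow> real measure \<Rightarrow> ennreal" where
  "dissipation e f = (\<integral>\<^sup>+(v, w). ennreal (\<bar>v - w\<bar>\<^sup>2 * \<sigma> e \<bar>v - w\<bar>) \<partial>prod_off_diag f)"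

text \<open>
  Extended-valued, since the dissipation of a measure with infinite third moment is infinite.
\<close>

definition De_Giorgi :: "real \<Rightarrow> real \<Rightarrow> (real \<Rightarrow> real measure) \<Rightarrow> ereal" where
  "De_Giorgi e T f =
     ereal (energy (f T) - energy (f 0))
     + ereal (1 / 2) * enn2ereal (\<integral>\<^sup>+t. action e (f t) (flux e T f t) \<partial>lebesgue_on {0..T})
     + ereal (1 / 2) * enn2ereal (\<integral>\<^sup>+t. dissipation e (f t) \<partial>lebesgue_on {0..T})"

end

theory Submission imports Defs begin

text \<open>
  The De Giorgi functional is an energy difference plus half the action plus half the dissipation. Each
  part is lower semicontinuous under narrow convergence at all times, so the theorem rests on
  compactness, and on showing that the flux in the functional, which is selected through the metric
  derivative, has no more action than the limit permits.

  The idea is to describe bounded action without a flux. By the Cauchy-Schwarz inequality a solution of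
  the continuity equation with action at most \<open>K\<close> satisfies, for all test functions \<open>phi\<close>, that the square
  of the integral of the time derivative of \<open>phi\<close> along the curve is at most \<open>K\<close> times the integral of
  the form \<open>qform\<close> of its velocity derivative (\<open>weak_bound\<close>, \<open>CE_weak_bound\<close>). This inequality passes to
  limits (\<open>weak_bound_limit\<close>). Conversely it says that the weak formulation is a bounded functional on
  gradients in a weighted space of square integrable functions; the Riesz representation yields a density,
  which is a limit of gradients, and thereby a flux with action at most \<open>K\<close> (\<open>optimal_flux_exists\<close>). That
  the density is integrable also without the weight, which vanishes on the diagonal, is
  \<open>gradient_L1_bound\<close>.

  A flux obtained in this way realises the metric derivative (\<open>metric_derivative\<close>): the cost between two
  times is at most the length, by arclength parametrisation (\<open>dA_le_length\<close>), and testing with the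
  approximating gradients shows that it cannot be smaller to first order. Hence a curve with a weak bound
  is absolutely continuous and the action of its flux obeys that bound (\<open>weak_bound_AC\<close>).
  Conversely an absolutely continuous curve has a weak bound (\<open>AC_weak_bound\<close>), since a small cost bounds
  increments by the form at one end point (\<open>near_increment\<close>).

  Along the given sequence the initial energies are bounded, so the functional bounds action and
  dissipation. Potentials with contracting derivative that approximate the energy have a form below the
  dissipation, which propagates the bound on second moments (\<open>energy_growth\<close>). Moments give tightness,
  the weak bound gives equicontinuity, and a subsequence converges at all times (\<open>curve_compactness\<close>). The
  subsequence is taken such that the functional tends to its limes inferior and its three parts converge.
\<close>

section \<open>Abbreviations\<close>

abbreviation (input) ind :: "'a set => 'a => 'b::zero_neq_one" where "ind == indicator"
abbreviation (input) Bor where "Bor == borel_measurable borel"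
abbreviation (input) contU where "contU == continuous_on UNIV"
abbreviation (input) rdist where "rdist == real_distribution"
abbreviation (input) leb where "leb T == lebesgue_on {0..T::real}"
abbreviation (input) nni where "nni == nn_integral"
abbreviation (input) sq where "sq f == f \<Otimes>\<^sub>M f"
abbreviation (input) wt where "wt e z == \<sigma> e (abs (fst z - snd z))"
abbreviation (input) seq_limit (infix "--->" 60) where "X ---> L == X \<longlonglongrightarrow> L"

lemmas lint_nonneg = Bochner_Integration.integral_nonneg
lemmas lint_cong = Bochner_Integration.integral_cong
lemmas lint_diff = Bochner_Integration.integral_diff
lemmas integrable_bd = Bochner_Integration.integrable_bound
lemmas integrable_plus = Bochner_Integration.integrable_add
lemmas integrable_dif = Bochner_Integration.integrable_diff
lemmas cont_bor = borel_measurable_continuous_onI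

section \<open>Lebesgue differentiation on the line\<close>

text \<open>Where \<open>h\<close> vanishes, outer regularity of the measure with density \<open>h\<close> gives an open set of small
 mass. The balls on which the mass is too large compared with the radius lie in it, and a disjoint
 family of them that covers almost all of their centres (Vitali) shows that these form a null set.\<close>

lemma zero_density_points:
 fixes h :: "real => real"
 assumes h[measurable]: "h : Bor" and hint: "integrable lborel h"
  and hpos: "!!x. 0 <= h x"
 shows "AE t in lborel. h t = 0 -->
  (ALL eps>0. EX dl>0. ALL r. 0 < r & r < dl --> (LBINT x. h x * ind (cball t r) x) <= eps * r)"
proof -
 define nu where "nu = density lborel (%x. ennreal (h x))"
 have [measurable_cong, simp]: "sets nu = sets borel" by (simp add: nu_def)
 have nuA: "emeasure nu A = ennreal (LBINT x. h x * ind A x)" if [measurable]: "A : sets borel" for A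
 proof -
  have "integrable lborel (%x. h x * ind A x)" by (rule integrable_bd[OF hint]) (auto simp: indicator_def)
  hence "(nni lborel (%x. ennreal (h x * ind A x))) = ennreal (LBINT x. h x * ind A x)" by (rule nn_integral_eq_integral) (auto simp: hpos)
  moreover have "emeasure nu A = (nni lborel (%x. ennreal (h x * ind A x)))"
   unfolding nu_def by (subst emeasure_density) (auto simp: indicator_def intro!: nn_integral_cong)
  ultimately show ?thesis by simp
 qed
 interpret nu: finite_measure nu using nuA[of UNIV] by (intro finite_measureI) (simp add: nu_def)
 define Z where "Z = {t. h t = 0}"
 have [measurable]: "Z : sets borel" unfolding Z_def by measurable
 have nuZ: "emeasure nu Z = 0" unfolding nuA[OF `Z : sets borel`] by (auto simp: Z_def indicator_def intro!: integral_eq_zero_AE)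
 define E where "E c = {t : Z. ALL d>0. EX r. 0 < r & r < d & ennreal (c * r) < emeasure nu (cball t r)}" for c
 have neg: "negligible (E c)" if c: "0 < c" for c
 proof (subst negligible_outer_le, intro allI impI)
  fix eps :: real assume eps: "0 < eps"
  define eps' where "eps' = eps * c / 2"
  have "0 < eps'" using eps c by (simp add: eps'_def)
  have "(INF U \<in> {U. Z \<subseteq> U & open U}. emeasure nu U) < ennreal eps'"
   using outer_regular[of nu Z] nuZ `0 < eps'` nu.finite_emeasure_space by (simp add: nu.emeasure_finite less_top)
  then obtain O' where O: "Z \<subseteq> O'" "open O'" "emeasure nu O' < ennreal eps'" by (auto simp: INF_less_iff)
  define K where "K = {p :: real * real. 0 < snd p & cball (fst p) (snd p) \<subseteq> O' &
   ennreal (c * snd p) < emeasure nu (cball (fst p) (snd p))}"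
  obtain C where C: "countable C" "C \<subseteq> K"
   "pairwise (%i j. disjnt (cball (fst i) (snd i)) (cball (fst j) (snd j))) C"
   "negligible (E c - (\<Union>i\<in>C. cball (fst i) (snd i)))"
  proof (rule Vitali_covering_theorem_cballs[of K snd "E c" fst])
   show "0 < snd i" if "i : K" for i using that by (simp add: K_def)
   fix x d :: real assume x: "x : E c" and d: "0 < d"
   obtain k where k: "0 < k" "cball x k \<subseteq> O'" using x O unfolding E_def open_contains_cball by blast
   obtain r where r: "0 < r" "r < min d k" "ennreal (c * r) < emeasure nu (cball x r)" using x d k unfolding E_def by (auto dest!: spec[of _ "min d k"])
   have "cball x r \<subseteq> O'" using k r by (meson cball_trans min_less_iff_conj less_imp_le order_trans subset_cball)
   thus "EX i. i : K & x : cball (fst i) (snd i) & snd i < d" using r by (intro exI[of _ "(x, r)"]) (auto simp: K_def)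
  qed
  define B where "B = (\<Union>i\<in>C. cball (fst i) (snd i))"
  have disj: "disjoint_family_on (%i. cball (fst i) (snd i)) C" using C(3) by (auto simp: disjoint_family_on_def pairwise_def disjnt_def)
  have Bs[measurable]: "B : sets borel" unfolding B_def using C(1) by (intro sets.countable_UN') auto
  have "emeasure lborel B = (nni (count_space C) (%i. emeasure lborel (cball (fst i) (snd i))))"
   unfolding B_def by (rule emeasure_UN_countable) (use C(1) disj in auto)
  also have "... <= (nni (count_space C) (%i. ennreal (2 / c) * emeasure nu (cball (fst i) (snd i))))"
  proof (rule nn_integral_mono)
   fix i assume "i : space (count_space C)"
   hence i: "i : K" using C by auto
   hence r: "0 < snd i" "ennreal (c * snd i) < emeasure nu (cball (fst i) (snd i))" by (auto simp: K_def)
   have "emeasure lborel (cball (fst i) (snd i)) = ennreal (2 * snd i)" using r by (simp add: cball_eq_atLeastAtMost)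
   also have "... = ennreal (2 / c) * ennreal (c * snd i)" using c r by (simp add: ennreal_mult[symmetric])
   also have "... <= ennreal (2 / c) * emeasure nu (cball (fst i) (snd i))" using r by (intro mult_left_mono) auto
   finally show "emeasure lborel (cball (fst i) (snd i)) <= ..." .
  qed
  also have "... = ennreal (2 / c) * (nni (count_space C) (%i. emeasure nu (cball (fst i) (snd i))))" by (rule nn_integral_cmult) auto
  also have "(nni (count_space C) (%i. emeasure nu (cball (fst i) (snd i)))) = emeasure nu B"
   unfolding B_def by (rule emeasure_UN_countable[symmetric]) (use C(1) disj in auto)
  also have "... <= emeasure nu O'" using C(2) O(2) by (intro emeasure_mono) (auto simp: B_def K_def)
  also have "... <= ennreal eps'" using O(3) by simp
  finally have "emeasure lborel B <= ennreal (2 / c) * ennreal eps'" by (simp add: mult_left_mono)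
  also have "... = ennreal eps" using c eps by (simp add: eps'_def ennreal_mult[symmetric])
  finally have eB: "emeasure lborel B <= ennreal eps" .
  hence Bl: "B : lmeasurable" by (intro fmeasurableI) (auto simp: le_less_trans[OF _ ennreal_less_top])
  have mB: "measure lebesgue B <= eps" using eB eps by (simp add: measure_def enn2real_leI)
  have nl: "E c - B : lmeasurable" "measure lebesgue (E c - B) = 0" using C(4) by (auto simp: B_def negligible_iff_measure)
  show "EX T. E c \<subseteq> T & T : lmeasurable & Sigma_Algebra.measure lebesgue T <= eps"
  proof (intro exI conjI)
   show "E c \<subseteq> B \<union> (E c - B)" by auto
   show "B \<union> (E c - B) : lmeasurable" by (rule fmeasurable.Un[OF Bl nl(1)])
   show "measure lebesgue (B \<union> (E c - B)) <= eps" using measure_Un_le[of B lebesgue "E c - B"] nl mB Bl by (auto dest: fmeasurableD)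
  qed
 qed
 have "AE t in lebesgue. ALL n::nat. t \<notin> E (1 / Suc n)"
  unfolding AE_all_countable using neg by (auto simp: AE_iff_null_sets negligible_iff_null_sets intro!: AE_not_in)
 hence "AE t in lborel. ALL n::nat. t \<notin> E (1 / Suc n)" by (simp add: AE_completion_iff)
 thus ?thesis
 proof (eventually_elim, intro impI allI)
  fix t eps assume t: "ALL n::nat. t \<notin> E (1 / Suc n)" and z: "h t = 0" and eps: "(0::real) < eps"
  obtain n :: nat where n: "1 / Suc n < eps" using eps nat_approx_posE by metis
  from t[rule_format, of n] z obtain d where d: "0 < d" "!!r. 0 < r ==> r < d ==> ~  ennreal (1 / Suc n * r) < emeasure nu (cball t r)" by (auto simp: E_def Z_def)
  show "EX dl>0. ALL r. 0 < r & r < dl --> (LBINT x. h x * ind (cball t r) x) <= eps * r"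
  proof (intro exI[of _ d] conjI allI impI)
   fix r assume r: "0 < r & r < d"
   have "ennreal (LBINT x. h x * ind (cball t r) x) <= ennreal (1 / Suc n * r)" using d(2)[of r] r nuA[of "cball t r"] unfolding not_less by simp
   hence "(LBINT x. h x * ind (cball t r) x) <= 1 / Suc n * r" using r by (simp add: ennreal_le_iff)
   also have "... <= eps * r" using n r by (intro mult_right_mono) auto
   finally show "(LBINT x. h x * ind (cball t r) x) <= eps * r" .
  qed (use d in auto)
 qed
qed

definition lebesgue_point :: "(real => real) => real => bool" where
 "lebesgue_point m t \<longleftrightarrow> (ALL eps>0. EX dl>0. ALL a b. a <= t & t <= b & a < b & b - a < dl -->
   abs ((LBINT x. m x * ind {a..b} x) - m t * (b - a)) <= eps * (b - a))"

text \<open>The previous lemma is applied to the positive part of \<open>m - q\<close> for all rational \<open>q\<close>: it vanishes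
 where \<open>m <= q\<close>, and \<open>q\<close> is then chosen slightly above the value of \<open>m\<close>.\<close>

lemma upper_lebesgue_points:
 fixes m :: "real => real"
 assumes m[measurable]: "m : Bor" and mint: "integrable lborel m"
 shows "AE t in lborel. ALL eps>0. EX dl>0. ALL a b. a <= t & t <= b & a < b & b - a < dl -->
   (LBINT x. m x * ind {a..b} x) - m t * (b - a) <= eps * (b - a)"
proof -
 define h where "h q n x = max 0 (m x - q) * ind {-real n..real n} x" for q :: real and n :: nat and x
 have ind: "integrable lborel (ind {a..b} :: real => real)" for a b :: real by (rule integrable_real_indicator) (auto simp: emeasure_lborel_Icc_eq)
 have hint: "integrable lborel (h q n)" for q n
 proof (rule integrable_bd)
  show "integrable lborel (%x. abs (m x) + abs q * ind {-real n..real n} x)" by (intro integrable_plus integrable_abs mint integrable_mult_right ind)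
  show "h q n : borel_measurable lborel" unfolding h_def by measurable
  show "AE x in lborel. norm (h q n x) <= norm (abs (m x) + abs q * ind {-real n..real n} x)" by (intro AE_I2) (auto simp: h_def indicator_def)
 qed
 have hm: "h q n : Bor" for q n unfolding h_def by measurable
 have h0: "0 <= h q n x" for q n x by (simp add: h_def)
 have "AE t in lborel. ALL q:\<rat>. ALL n. h q n t = 0 -->
  (ALL eps>0. EX dl>0. ALL r. 0 < r & r < dl --> (LBINT x. h q n x * ind (cball t r) x) <= eps * r)"
  by (subst AE_ball_countable[OF countable_rat], intro ballI, subst AE_all_countable, intro allI,
    rule zero_density_points[OF hm hint h0])
 thus ?thesis
 proof (eventually_elim, intro allI impI)
  fix t eps :: real assume H: "ALL q:\<rat>. ALL n. h q n t = 0 -->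
   (ALL eps>0. EX dl>0. ALL r. 0 < r & r < dl --> (LBINT x. h q n x * ind (cball t r) x) <= eps * r)"
   and eps: "0 < eps"
  obtain q where q: "q : \<rat>" "m t < q" "q < m t + eps / 2" using Rats_dense_in_real[of "m t" "m t + eps/2"] eps by auto
  obtain n :: nat where n: "abs t + 1 < real n" using reals_Archimedean2 by blast
  have "h q n t = 0" using q by (simp add: h_def)
  then obtain dl where dl: "0 < dl" "!!r. 0 < r ==> r < dl ==> (LBINT x. h q n x * ind (cball t r) x) <= eps / 2 * r" using H q(1) eps by (metis half_gt_zero)
  show "EX dl>0. ALL a b. a <= t & t <= b & a < b & b - a < dl -->
   (LBINT x. m x * ind {a..b} x) - m t * (b - a) <= eps * (b - a)"
  proof (intro exI[of _ "min dl 1"] conjI allI impI)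
   show "0 < min dl 1" using dl by auto
   fix a b assume ab: "a <= t & t <= b & a < b & b - a < min dl 1"
   have i1: "integrable lborel (%x. m x * ind {a..b} x)" by (rule integrable_bd[OF mint]) (auto simp: indicator_def)
   have i2: "integrable lborel (%x. q * ind {a..b} x)" by (intro integrable_mult_right ind)
   have i3: "integrable lborel (%x. h q n x * ind (cball t (b - a)) x)" by (rule integrable_bd[OF hint[of q n]]) (auto simp: indicator_def h_def)
   have "(LBINT x. m x * ind {a..b} x) - q * (b - a) =
     (LBINT x. m x * ind {a..b} x - q * ind {a..b} x)" using ab by (subst lint_diff[OF i1 i2]) auto
   also have "... <= (LBINT x. h q n x * ind (cball t (b - a)) x)"
   proof (rule integral_mono[OF _ i3])
    show "m x * ind {a..b} x - q * ind {a..b} x <= h q n x * ind (cball t (b - a)) x" for x using ab n by (auto simp: indicator_def h_def dist_real_def)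
   qed (use i1 i2 in auto)
   also have "... <= eps / 2 * (b - a)" using ab by (intro dl) auto
   finally have "(LBINT x. m x * ind {a..b} x) <= q * (b - a) + eps / 2 * (b - a)" by simp
   also have "... <= (m t + eps / 2) * (b - a) + eps / 2 * (b - a)" using q ab by (intro add_right_mono mult_right_mono) auto
   finally show "(LBINT x. m x * ind {a..b} x) - m t * (b - a) <= eps * (b - a)" by (simp add: algebra_simps)
  qed
 qed
qed

lemma AE_lebesgue_point:
 fixes m :: "real => real"
 assumes m[measurable]: "m : Bor" and mint: "integrable lborel m"
 shows "AE t in lborel. lebesgue_point m t"
proof -
 have "AE t in lborel. ALL eps>0. EX dl>0. ALL a b. a <= t & t <= b & a < b & b - a < dl -->
   (LBINT x. - m x * ind {a..b} x) - - m t * (b - a) <= eps * (b - a)" using upper_lebesgue_points[of "%x. - m x"] mint by simp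
 with upper_lebesgue_points[OF assms] show ?thesis
 proof eventually_elim
  case (elim t)
  show ?case unfolding lebesgue_point_def
  proof (intro allI impI)
   fix eps :: real assume eps: "0 < eps"
   obtain d1 where d1: "d1 > 0" "!!a b. a <= t & t <= b & a < b & b - a < d1 ==>
    (LBINT x. m x * ind {a..b} x) - m t * (b - a) <= eps * (b - a)" using elim(1) eps by metis
   obtain d2 where d2: "d2 > 0" "!!a b. a <= t & t <= b & a < b & b - a < d2 ==>
    (LBINT x. - m x * ind {a..b} x) - - m t * (b - a) <= eps * (b - a)" using elim(2) eps by metis
   show "EX dl>0. ALL a b. a <= t & t <= b & a < b & b - a < dl -->
     abs ((LBINT x. m x * ind {a..b} x) - m t * (b - a)) <= eps * (b - a)"
   proof (intro exI[of _ "min d1 d2"] conjI allI impI)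
    fix a b assume ab: "a <= t & t <= b & a < b & b - a < min d1 d2"
    have "(LBINT x. - m x * ind {a..b} x) = - (LBINT x. m x * ind {a..b} x)" by simp
    thus "abs ((LBINT x. m x * ind {a..b} x) - m t * (b - a)) <= eps * (b - a)" using d1(2)[of a b] d2(2)[of a b] ab by (auto simp: abs_le_iff)
   qed (use d1 d2 in auto)
  qed
 qed
qed

section \<open>A Riesz representation theorem in L2\<close>

lemma cauchy_schwarz_integral:
 fixes f g :: "'a => real"
 assumes [measurable]: "f : borel_measurable M" "g : borel_measurable M"
  and f: "integrable M (%x. (f x)^2)" and g: "integrable M (%x. (g x)^2)"
 shows "integrable M (%x. f x * g x)"
  and "(LINT x|M. f x * g x)^2 <= (LINT x|M. (f x)^2) * (LINT x|M. (g x)^2)"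
proof -
 have b: "abs (a * b) <= a^2 + b^2" for a b :: real
 proof -
  have "2 * (abs a * abs b) <= a^2 + b^2" using sum_squares_bound[of "abs a" "abs b"] by simp
  thus ?thesis using mult_nonneg_nonneg[of "abs a" "abs b"] unfolding abs_mult by linarith
 qed
 show fg: "integrable M (%x. f x * g x)" by (rule integrable_bd[OF integrable_plus[OF f g]])
   (use b in "auto intro!: AE_I2")
 let ?A = "LINT x|M. (f x)^2" and ?B = "LINT x|M. (g x)^2" and ?C = "LINT x|M. f x * g x"
 have q: "0 <= s^2 * ?A + 2 * s * t * ?C + t^2 * ?B" for s t
 proof -
  have "0 <= (LINT x|M. (s * f x + t * g x)^2)" by simp
  also have "(LINT x|M. (s * f x + t * g x)^2) = (LINT x|M. s^2 * (f x)^2 + 2 * s * t * (f x * g x) + t^2 * (g x)^2)"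
   by (intro lint_cong) (auto simp: power2_eq_square algebra_simps)
  also have "... = s^2 * ?A + 2 * s * t * ?C + t^2 * ?B" using f g fg by simp
  finally show ?thesis .
 qed
 have A0: "0 <= ?A" "0 <= ?B" by simp_all
 show "?C^2 <= ?A * ?B"
 proof (cases "?B = 0")
  case True
  have "?C = 0"
  proof (rule ccontr)
   assume C: "?C ~= 0"
   have "0 <= ?A + 2 * (- (?A + 1) / (2 * ?C)) * ?C" using q[of 1 "- (?A + 1) / (2 * ?C)"] True by simp
   with C show False by (simp add: field_simps)
  qed
  thus ?thesis by simp
 next
  case False
  have "0 <= ?B * (?A * ?B - ?C^2)" using q[of "?B" "- ?C"] by (simp add: power2_eq_square algebra_simps)
  thus ?thesis using False A0 by (simp add: zero_le_mult_iff)
 qed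
qed

text \<open>The values \<open>l\<close> are those of a bounded functional on a space of square integrable functions \<open>u\<close>.
 A minimising sequence of \<open>(integral of u^2) - 2 * l\<close> is Cauchy by the parallelogram identity, and its
 limit represents the functional. The sequence is part of the conclusion because the limit has to be
 recognised later as a limit of gradients; it converges fast enough to do so almost everywhere.\<close>

lemma riesz_representation_L2:
 fixes P :: "(('a => real) \<times> real) set" and K :: real
 assumes lin: "!!u l u' l' a b. (u, l) : P ==> (u', l') : P ==> (%x. a * u x + b * u' x, a * l + b * l') : P"
  and ne: "P ~= {}"
  and meas: "!!u l. (u, l) : P ==> u : borel_measurable N"
  and sq: "!!u l. (u, l) : P ==> integrable N (%x. (u x)^2)"
  and bd: "!!u l. (u, l) : P ==> l^2 <= K * (LINT x|N. (u x)^2)"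
  and K: "0 <= K"
 obtains U :: "nat => 'a => real" and L :: "nat => real" and z :: "'a => real"
 where "!!k. (U k, L k) : P"
  "z = (%x. if convergent (%k. U k x) then lim (%k. U k x) else 0)"
  "AE x in N. (%k. U k x) ---> z x"
  "integrable N (%x. (z x)^2)"
  "(LINT x|N. (z x)^2) <= K"
  "!!u l. (u, l) : P ==> l = (LINT x|N. z x * u x)"
  "!!k. (nni N (%x. ennreal ((z x - U k x)^2))) <= ennreal (4 * (1/16)^k)"
proof -
 define J where "J p = (LINT x|N. (fst p x)^2) - 2 * snd p" for p :: "('a => real) \<times> real"
 have Jlb: "- K <= J p" if "p : P" for p
 proof -
  obtain u l where p: "p = (u, l)" by force
  define S where "S = (LINT x|N. (u x)^2)"
  have "0 <= S" by (simp add: S_def)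
  have "l^2 <= K * S" using bd that by (simp add: p S_def)
  also have "... <= ((K + S) / 2)^2" using sum_squares_bound[of K S] by (simp add: power2_eq_square field_simps)
  finally have "abs l <= (K + S) / 2" using K `0 <= S` by (simp add: abs_le_square_iff[symmetric])
  thus ?thesis by (simp add: J_def p S_def[symmetric] abs_le_iff)
 qed
 define d where "d = Inf (J ` P)"
 have bdd: "bdd_below (J ` P)" using Jlb by (intro bdd_belowI2)
 have dle: "d <= J p" if "p : P" for p unfolding d_def using bdd that by (intro cINF_lower)
 define eps where "eps k = (1/16 :: real)^k" for k :: nat
 have "EX p:P. J p < d + eps k" for k
 proof -
  have "Inf (J ` P) < d + eps k" by (simp add: d_def eps_def)
  thus ?thesis using ne bdd by (subst (asm) cInf_less_iff) auto
 qed
 then obtain p where p: "!!k. p k : P" "!!k. J (p k) < d + eps k" by metis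
 define U where "U k = fst (p k)" for k
 define L where "L k = snd (p k)" for k
 have UP: "(U k, L k) : P" for k using p by (simp add: U_def L_def)
 have Um[measurable]: "U k : borel_measurable N" for k using meas UP by blast
 have Usq: "integrable N (%x. (U k x)^2)" for k using sq UP by blast
 have JU: "J (U k, L k) < d + eps k" for k using p by (simp add: U_def L_def)
 have diffsq: "integrable N (%x. (U i x - U j x)^2)" for i j using sq[OF lin[OF UP[of i] UP[of j], of 1 "-1"]] by simp
 have cauchy: "(LINT x|N. (U i x - U j x)^2) <= 2 * (eps i + eps j)" for i j
 proof -
  have mid: "(%x. 1/2 * U i x + 1/2 * U j x, 1/2 * L i + 1/2 * L j) : P" by (rule lin[OF UP UP])
  have midsq: "integrable N (%x. (1/2 * U i x + 1/2 * U j x)^2)" using sq[OF mid] .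
  have "(LINT x|N. (U i x - U j x)^2) = (LINT x|N. 2 * (U i x)^2 + 2 * (U j x)^2 - 4 * (1/2 * U i x + 1/2 * U j x)^2)"
   by (intro lint_cong) (auto simp: power2_eq_square algebra_simps)
  also have "... = 2 * (LINT x|N. (U i x)^2) + 2 * (LINT x|N. (U j x)^2) - 4 * (LINT x|N. (1/2 * U i x + 1/2 * U j x)^2)" using Usq midsq by simp
  also have "... = 2 * J (U i, L i) + 2 * J (U j, L j) - 4 * J (%x. 1/2 * U i x + 1/2 * U j x, 1/2 * L i + 1/2 * L j)" by (simp add: J_def)
  also have "... <= 2 * (eps i + eps j)" using JU[of i] JU[of j] dle[OF mid] by simp
  finally show ?thesis .
 qed
 have cauchy': "(LINT x|N. (U i x - U k x)^2) <= 4 * eps k" if "k <= i" for i k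
 proof -
  have "eps i <= eps k" using power_decreasing[OF that, of "1/16::real"] by (simp add: eps_def)
  thus ?thesis using cauchy[of i k] by simp
 qed
 have nnc: "(nni N (%x. ennreal ((U i x - U k x)^2))) <= ennreal (4 * eps k)" if "k <= i" for i k
  using cauchy'[OF that] by (subst nn_integral_eq_integral[OF diffsq]) (auto intro: ennreal_leI)
 have "(nni N (%x. (\<Sum>k. ennreal (4^k * (U (Suc k) x - U k x)^2)))) = (\<Sum>k. (nni N (%x. ennreal (4^k * (U (Suc k) x - U k x)^2))))"
  by (rule nn_integral_suminf) measurable
 also have "... <= (\<Sum>k. ennreal (4 * (1/4)^k))"
 proof (rule suminf_le)
  fix k
  have "(nni N (%x. ennreal (4^k * (U (Suc k) x - U k x)^2))) = ennreal (4^k) * (nni N (%x. ennreal ((U (Suc k) x - U k x)^2)))"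
   by (subst nn_integral_cmult[symmetric]) (auto simp: ennreal_mult)
  also have "... <= ennreal (4^k) * ennreal (4 * eps k)" by (intro mult_left_mono nnc) auto
  also have "... = ennreal (4^k * (4 * eps k))" by (simp add: eps_def ennreal_mult)
  also have "4^k * (4 * eps k) = 4 * (1/4)^k" by (simp add: eps_def power_divide power_mult_distrib[symmetric] field_simps)
  finally show "(nni N (%x. ennreal (4^k * (U (Suc k) x - U k x)^2))) <= ennreal (4 * (1/4)^k)" .
 qed auto
 also have "... < \<infinity>" by (subst suminf_ennreal2) (auto intro!: summable_mult summable_geometric)
 finally have "AE x in N. (\<Sum>k. ennreal (4^k * (U (Suc k) x - U k x)^2)) ~= \<infinity>" by (intro nn_integral_PInf_AE) auto
 hence conv: "AE x in N. convergent (%k. U k x)"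
 proof eventually_elim
  case (elim x)
  define s where "s = (\<Sum>k. ennreal (4^k * (U (Suc k) x - U k x)^2))"
  obtain C where C: "0 <= C" "s = ennreal C" using elim by (cases s) (auto simp: s_def)
  have "4^k * (U (Suc k) x - U k x)^2 <= C" for k
  proof -
   have "(\<Sum>k\<in>{k}. ennreal (4^k * (U (Suc k) x - U k x)^2)) <= s" unfolding s_def by (rule sum_le_suminf) auto
   thus ?thesis using C by simp
  qed
  moreover have "(2^k * abs (U (Suc k) x - U k x))^2 = 4^k * (U (Suc k) x - U k x)^2" for k
  proof -
   have "((2::real)^k)^2 = 4^k" by (simp add: power2_eq_square flip: power_mult_distrib)
   thus ?thesis by (simp add: power_mult_distrib)
  qed
  ultimately have "(2^k * abs (U (Suc k) x - U k x))^2 <= (sqrt C)^2" for k using C by simp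
  hence b: "2^k * abs (U (Suc k) x - U k x) <= sqrt C" for k by (rule power2_le_imp_le) (use C in auto)
  have "summable (%k. U (Suc k) x - U k x)"
  proof (rule summable_comparison_test')
   show "summable (%k. sqrt C * (1/2)^k)" by (intro summable_mult summable_geometric) auto
   show "norm (U (Suc k) x - U k x) <= sqrt C * (1/2)^k" if "0 <= k" for k using b[of k] by (simp add: power_divide field_simps)
  qed
  hence "convergent (%n. \<Sum>k<n. (U (Suc k) x - U k x))" by (simp add: summable_iff_convergent)
  moreover have "(\<Sum>k<n. (U (Suc k) x - U k x)) = U n x - U 0 x" for n by (rule sum_lessThan_telescope)
  ultimately have "convergent (%n. U n x - U 0 x)" by simp
  thus ?case using convergent_diff_const_right_iff by blast
 qed
 define z where "z = (%x. if convergent (%k. U k x) then lim (%k. U k x) else 0)"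
 have zm[measurable]: "z : borel_measurable N" unfolding z_def Cauchy_convergent_iff[symmetric]
  by (intro measurable_If borel_measurable_lim_metric sets_Collect_Cauchy Um) auto
 have zlim: "AE x in N. (%k. U k x) ---> z x" using conv by eventually_elim (simp add: z_def convergent_LIMSEQ_iff)
 have zU: "(nni N (%x. ennreal ((z x - U k x)^2))) <= ennreal (4 * eps k)" for k
 proof -
  have "(nni N (%x. ennreal ((z x - U k x)^2))) = (nni N (%x. liminf (%i. ennreal ((U i x - U k x)^2))))"
  proof (rule nn_integral_cong_AE, use zlim in eventually_elim)
   case (elim x)
   have "(%i. ennreal ((U i x - U k x)^2)) ---> ennreal ((z x - U k x)^2)" using elim by (intro tendsto_intros)
   thus ?case by (intro lim_imp_Liminf[symmetric]) simp_all
  qed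
  also have "... <= liminf (%i. \<integral>\<^sup>+x. ennreal ((U i x - U k x)^2) \<partial>N)" by (rule nn_integral_liminf) measurable
  also have "... <= ennreal (4 * eps k)" by (rule Liminf_le) (auto intro!: eventually_sequentiallyI[of k] nnc)
  finally show ?thesis .
 qed
 have zUi: "integrable N (%x. (z x - U k x)^2)" for k using zU[of k] by (intro integrableI_bounded) (auto simp: le_less_trans)
 have zUle: "(LINT x|N. (z x - U k x)^2) <= 4 * eps k" for k using zU[of k] by (subst (asm) nn_integral_eq_integral[OF zUi]) (auto simp: eps_def)
 have zsq: "integrable N (%x. (z x)^2)" by (rule integrable_bd[OF integrable_plus[OF
    integrable_mult_right[OF zUi[of 0], of 2] integrable_mult_right[OF Usq[of 0], of 2]]])
   (auto intro!: AE_I2, smt (verit) sum_squares_bound power2_sum power2_diff)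
 have epslim: "eps ---> 0" unfolding eps_def by (rule LIMSEQ_power_zero) auto
 have rep: "l = (LINT x|N. z x * v x)" if v: "(v, l) : P" for v l
 proof -
  have [measurable]: "v : borel_measurable N" and vs: "integrable N (%x. (v x)^2)" using meas sq v by blast+
  define V where "V = (LINT x|N. (v x)^2)"
  have lim: "(%k. LINT x|N. U k x * v x) ---> (LINT x|N. z x * v x)"
  proof -
   have "(%k. sqrt (4 * eps k * V)) ---> sqrt (4 * 0 * V)" by (intro tendsto_intros epslim)
   hence s0: "(%k. sqrt (4 * eps k * V)) ---> 0" by simp
   have "(%k. (LINT x|N. U k x * v x) - (LINT x|N. z x * v x)) ---> 0"
   proof (rule Lim_null_comparison[OF always_eventually s0], intro allI)
    fix k
    have "(LINT x|N. U k x * v x) - (LINT x|N. z x * v x) = - (LINT x|N. (z x - U k x) * v x)"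
     using cauchy_schwarz_integral(1)[of "U k" N v] cauchy_schwarz_integral(1)[of z N v] Usq zsq vs
     by (subst lint_diff[symmetric]) (auto simp: algebra_simps simp flip: Bochner_Integration.integral_minus)
    moreover have "(LINT x|N. (z x - U k x) * v x)^2 <= 4 * eps k * V" using cauchy_schwarz_integral(2)[of "%x. z x - U k x" N v, OF _ _ zUi vs]
      mult_right_mono[OF zUle[of k], of V] by (simp add: V_def)
    ultimately show "norm ((LINT x|N. U k x * v x) - (LINT x|N. z x * v x)) <= sqrt (4 * eps k * V)" by (simp add: real_le_rsqrt)
   qed
   thus ?thesis by (simp add: LIM_zero_iff)
  qed
  have ineq: "- eps k <= s^2 * V + 2 * s * ((LINT x|N. U k x * v x) - l)" for s k
  proof -
   have P': "(%x. 1 * U k x + s * v x, 1 * L k + s * l) : P" by (rule lin[OF UP v])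
   have uv: "integrable N (%x. U k x * v x)" using cauchy_schwarz_integral(1)[of "U k" N v] Usq vs by auto
   have "(LINT x|N. (U k x + s * v x)^2) = (LINT x|N. (U k x)^2 + 2 * s * (U k x * v x) + s^2 * (v x)^2)"
    by (intro lint_cong) (auto simp: power2_eq_square algebra_simps)
   also have "... = (LINT x|N. (U k x)^2) + 2 * s * (LINT x|N. U k x * v x) + s^2 * V" using Usq uv vs by (simp add: V_def)
   finally show ?thesis using dle[OF P'] JU[of k] by (simp add: J_def algebra_simps)
  qed
  define D where "D = (LINT x|N. z x * v x) - l"
  have q: "0 <= s^2 * V + 2 * s * D" for s
  proof (rule LIMSEQ_le)
   show "(%k. - eps k) ---> 0" using tendsto_minus[OF epslim] by simp
   show "(%k. s^2 * V + 2 * s * ((LINT x|N. U k x * v x) - l)) ---> s^2 * V + 2 * s * D" unfolding D_def by (intro tendsto_intros lim)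
   show "EX N'. ALL k>=N'. - eps k <= s^2 * V + 2 * s * ((LINT x|N. U k x * v x) - l)" using ineq by blast
  qed
  have "0 <= V" by (simp add: V_def)
  have "D = 0"
  proof (rule ccontr)
   assume D: "D ~= 0"
   have "0 <= (- D / (V + 1))^2 * V + 2 * (- D / (V + 1)) * D" by (rule q)
   also have "... = D^2 / (V + 1)^2 * (V - 2 * (V + 1))" using `0 <= V` by (simp add: power2_eq_square divide_simps) (simp add: algebra_simps)
   also have "... < 0" using D `0 <= V` by (intro mult_pos_neg) auto
   finally show False by simp
  qed
  thus ?thesis by (simp add: D_def)
 qed
 have zK: "(LINT x|N. (z x)^2) <= K"
 proof -
  define Z where "Z = (LINT x|N. (z x)^2)"
  have "0 <= Z" by (simp add: Z_def)
  have le: "Z <= K + 4 * eps k" for k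
  proof -
   have zu: "integrable N (%x. z x * U k x)" using cauchy_schwarz_integral(1)[of z N "U k"] Usq zsq by auto
   have "(LINT x|N. (z x - U k x)^2) = (LINT x|N. (z x)^2 - 2 * (z x * U k x) + (U k x)^2)" by (intro lint_cong) (auto simp: power2_eq_square algebra_simps)
   also have "... = Z - 2 * L k + (LINT x|N. (U k x)^2)" using zsq zu Usq rep[OF UP[of k]] by (simp add: Z_def)
   finally show ?thesis using zUle[of k] Jlb[OF UP[of k]] by (simp add: J_def)
  qed
  have "(%k. K + 4 * eps k) ---> K + 4 * 0" by (intro tendsto_intros epslim)
  thus ?thesis unfolding Z_def[symmetric] using le by (intro LIMSEQ_le_const[of "%k. K + 4 * eps k"]) auto
 qed
 show thesis by (rule that[of U L z]) (use UP zlim zsq zK rep zU in "auto simp: z_def eps_def")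
qed

section \<open>Variations of a signed measure\<close>

lemma add_measure_sets [simp]:
 "sets (add_measure M N) = sets M" "space (add_measure M N) = space M" unfolding add_measure_def by (simp_all add: sets.space_closed)

lemma emeasure_add_measure:
 assumes "sets M = sets N" "A : sets M"
 shows "emeasure (add_measure M N) A = emeasure M A + emeasure N A" unfolding add_measure_def
proof (rule emeasure_measure_of_sigma)
 show "sigma_algebra (space M) (sets M)" ..
 show "positive (sets M) (%A. emeasure M A + emeasure N A)" by (simp add: positive_def)
 show "countably_additive (sets M) (%A. emeasure M A + emeasure N A)"
 proof (rule countably_additiveI)
  fix B :: "nat => _" assume B: "range B \<subseteq> sets M" "disjoint_family B"
  have "(\<Sum>i. emeasure M (B i) + emeasure N (B i)) = (\<Sum>i. emeasure M (B i)) + (\<Sum>i. emeasure N (B i))" by (rule suminf_add[symmetric]) auto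
  also have "... = emeasure M (\<Union>i. B i) + emeasure N (\<Union>i. B i)" using B assms(1) by (simp add: suminf_emeasure)
  finally show "(\<Sum>i. emeasure M (B i) + emeasure N (B i)) = emeasure M (\<Union>i. B i) + emeasure N (\<Union>i. B i)" .
 qed
qed fact

lemma nn_integral_add_measure:
 assumes s: "sets M = sets N" and f: "f : borel_measurable M"
 shows "(nni (add_measure M N) (%x. f x)) = (nni M (%x. f x)) + (nni N (%x. f x))" using f
proof (induct rule: borel_measurable_induct)
 have sp: "space M = space N" using s by (rule sets_eq_imp_space_eq)
 {
  case (cong f g)
  have "integral\<^sup>N (add_measure M N) f = integral\<^sup>N (add_measure M N) g" "integral\<^sup>N M f = integral\<^sup>N M g"
   "integral\<^sup>N N f = integral\<^sup>N N g" by (rule nn_integral_cong; use cong sp in simp)+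
  thus ?case using cong by simp
 next
  case (set A)
  thus ?case using s by (simp add: emeasure_add_measure)
 next
  case (mult u c)
  hence [measurable]: "u : borel_measurable M" "u : borel_measurable N" "u : borel_measurable (add_measure M N)" using s by (auto cong: measurable_cong_sets)
  show ?case using mult by (simp add: nn_integral_cmult distrib_left)
 next
  case (add u v)
  hence [measurable]: "u : borel_measurable M" "u : borel_measurable N" "u : borel_measurable (add_measure M N)"
   "v : borel_measurable M" "v : borel_measurable N" "v : borel_measurable (add_measure M N)" using s by (auto cong: measurable_cong_sets)
  show ?case using add by (simp add: nn_integral_add ac_simps)
 next
  case (seq U)
  hence [measurable]: "!!i. U i : borel_measurable M" "!!i. U i : borel_measurable N" "!!i. U i : borel_measurable (add_measure M N)"
   using s by (auto cong: measurable_cong_sets)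
  have i: "incseq (%i. \<integral>\<^sup>+x. U i x \<partial>M)" "incseq (%i. \<integral>\<^sup>+x. U i x \<partial>N)" using seq by (auto simp: incseq_def le_fun_def intro!: nn_integral_mono)
  show ?case unfolding SUP_apply using seq i by (simp add: nn_integral_monotone_convergence_SUP ennreal_SUP_add)
 }
qed

text \<open>The values of the upper variation before it is known to be a measure.\<close>

definition sup_over_subsets :: "'a measure => ('a set => real) => 'a set => ennreal" where
 "sup_over_subsets M U A = (SUP B \<in> {B : sets M. B \<subseteq> A}. ennreal (U B))"

lemma signed_measure_empty: "signed_measure M U ==> U {} = 0"
proof -
 assume "signed_measure M U"
 hence "(%i::nat. U {}) sums U (\<Union>i::nat. {})" unfolding signed_measure_def by (elim allE[of _ "%_. {}"]) (auto simp: disjoint_family_on_def)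
 hence "(%i::nat. U {}) ---> 0" using sums_summable summable_LIMSEQ_zero by blast
 thus ?thesis by (simp add: LIMSEQ_const_iff)
qed

lemma signed_measure_sums:
 "signed_measure M U ==> range A \<subseteq> sets M ==> disjoint_family A ==> (%i::nat. U (A i)) sums U (\<Union>i. A i)" by (auto simp: signed_measure_def)

lemma signed_measure_Un:
 assumes U: "signed_measure M U" and A: "A : sets M" "B : sets M" "A \<inter> B = {}"
 shows "U (A \<union> B) = U A + U B"
proof -
 have "(%i. U (binaryset A B i)) sums U (\<Union>i. binaryset A B i)"
  using A by (intro signed_measure_sums[OF U]) (auto simp: binaryset_def disjoint_family_on_def split: if_splits)
 moreover have "(%i. U (binaryset A B i)) sums (U A + U B)" by (rule binaryset_sums) (rule signed_measure_empty[OF U])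
 ultimately show ?thesis by (simp add: UN_binaryset_eq sums_unique2)
qed

lemma signed_measure_Diff:
 assumes U: "signed_measure M U" and A: "A : sets M" "B : sets M" "B \<subseteq> A"
 shows "U (A - B) = U A - U B" using signed_measure_Un[OF U, of B "A - B"] A by (simp add: Un_absorb1)

lemma signed_measure_uminus: "signed_measure M U ==> signed_measure M (%A. - U A)" unfolding signed_measure_def using sums_minus by blast

lemma sup_over_subsets_ge: "B : sets M ==> B \<subseteq> A ==> ennreal (U B) <= sup_over_subsets M U A" unfolding sup_over_subsets_def by (rule SUP_upper) auto

lemma sup_over_subsets_add:
 assumes U: "signed_measure M U" and A: "A : sets M" "B : sets M" "A \<inter> B = {}"
 shows "sup_over_subsets M U A + sup_over_subsets M U B <= sup_over_subsets M U (A \<union> B)"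
proof -
 let ?V = "sup_over_subsets M U"
 have 1: "ennreal (U C) + ennreal (U D) <= ?V (A \<union> B)"
  if C: "C : sets M" "C \<subseteq> A" and D: "D : sets M" "D \<subseteq> B" for C D
 proof -
  have "ennreal (U C) <= ?V (A \<union> B)" "ennreal (U D) <= ?V (A \<union> B)" using that by (auto intro!: sup_over_subsets_ge)
  moreover have "ennreal (U (C \<union> D)) <= ?V (A \<union> B)" using that by (intro sup_over_subsets_ge) auto
  moreover have "U (C \<union> D) = U C + U D" using that A by (intro signed_measure_Un[OF U]) auto
  ultimately show ?thesis by (cases "0 <= U C"; cases "0 <= U D") (auto simp: ennreal_neg ennreal_plus)
 qed
 have 2: "ennreal (U C) + ?V B <= ?V (A \<union> B)" if C: "C : sets M" "C \<subseteq> A" for C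
 proof -
  have "(SUP D \<in> {D : sets M. D \<subseteq> B}. ennreal (U C) + ennreal (U D)) = ennreal (U C) + ?V B"
   unfolding sup_over_subsets_def by (rule ennreal_SUP_add_right[symmetric]) auto
  moreover have "(SUP D \<in> {D : sets M. D \<subseteq> B}. ennreal (U C) + ennreal (U D)) <= ?V (A \<union> B)" using C by (intro SUP_least 1) auto
  ultimately show ?thesis by simp
 qed
 have "(SUP C \<in> {C : sets M. C \<subseteq> A}. ennreal (U C) + ?V B) = ?V A + ?V B" unfolding sup_over_subsets_def[of M U A] by (rule ennreal_SUP_add_left) auto
 moreover have "(SUP C \<in> {C : sets M. C \<subseteq> A}. ennreal (U C) + ?V B) <= ?V (A \<union> B)" by (intro SUP_least 2) auto
 ultimately show ?thesis by simp
qed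

lemma ennreal_sum_le: "ennreal (\<Sum>i\<in>I. f i) <= (\<Sum>i\<in>I. ennreal (f i))"
proof -
 have "ennreal (\<Sum>i\<in>I. f i) <= ennreal (\<Sum>i\<in>I. max 0 (f i))" by (intro ennreal_leI sum_mono) auto
 also have "... = (\<Sum>i\<in>I. ennreal (max 0 (f i)))" by (rule sum_ennreal[symmetric]) auto
 finally show ?thesis by simp
qed

lemma countably_additive_sup_over_subsets:
 assumes U: "signed_measure M U"
 shows "countably_additive (sets M) (sup_over_subsets M U)"
proof (rule countably_additiveI)
 let ?V = "sup_over_subsets M U"
 fix A :: "nat => 'a set" assume A: "range A \<subseteq> sets M" "disjoint_family A"
 show "(\<Sum>i. ?V (A i)) = ?V (\<Union>i. A i)"
 proof (rule antisym)
  have "(\<Sum>i<n. ?V (A i)) <= ?V (\<Union>i<n. A i)" for n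
  proof (induction n)
   case (Suc n)
   have "(\<Sum>i<Suc n. ?V (A i)) <= ?V (\<Union>i<n. A i) + ?V (A n)" using Suc by (simp add: add_right_mono)
   also have "... <= ?V ((\<Union>i<n. A i) \<union> A n)"
   proof (rule sup_over_subsets_add[OF U])
    have "A i \<inter> A n = {}" if "i < n" for i using that by (intro disjoint_family_onD[OF A(2)]) auto
    thus "(\<Union>i<n. A i) \<inter> A n = {}" by auto
   qed (use A in auto)
   finally show ?case by (simp add: lessThan_Suc Un_commute)
  qed simp
  moreover have "?V (\<Union>i<n. A i) <= ?V (\<Union>i. A i)" for n unfolding sup_over_subsets_def by (rule SUP_subset_mono) auto
  ultimately have "(\<Sum>i<n. ?V (A i)) <= ?V (\<Union>i. A i)" for n using order_trans by blast
  thus "(\<Sum>i. ?V (A i)) <= ?V (\<Union>i. A i)" by (intro suminf_le_const) auto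
  show "?V (\<Union>i. A i) <= (\<Sum>i. ?V (A i))" unfolding sup_over_subsets_def[of M U "\<Union>i. A i"]
  proof (rule SUP_least)
   fix B assume "B : {B : sets M. B \<subseteq> (\<Union>i. A i)}"
   hence B: "B : sets M" "B \<subseteq> (\<Union>i. A i)" by auto
   have "(%i. U (B \<inter> A i)) sums U (\<Union>i. B \<inter> A i)" using A B by (intro signed_measure_sums[OF U]) (auto simp: disjoint_family_on_def)
   moreover have "(\<Union>i. B \<inter> A i) = B" using B by auto
   ultimately have "(%n. \<Sum>i<n. U (B \<inter> A i)) ---> U B" by (simp add: sums_def)
   hence "(%n. ennreal (\<Sum>i<n. U (B \<inter> A i))) ---> ennreal (U B)" by (rule tendsto_ennrealI)
   moreover have "ennreal (\<Sum>i<n. U (B \<inter> A i)) <= (\<Sum>i. ?V (A i))" for n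
   proof -
    have "ennreal (\<Sum>i<n. U (B \<inter> A i)) <= (\<Sum>i<n. ennreal (U (B \<inter> A i)))" by (rule ennreal_sum_le)
    also have "... <= (\<Sum>i<n. ?V (A i))" using A B by (intro sum_mono sup_over_subsets_ge) auto
    also have "... <= (\<Sum>i. ?V (A i))" by (rule sum_le_suminf) auto
    finally show ?thesis .
   qed
   ultimately show "ennreal (U B) <= (\<Sum>i. ?V (A i))" by (intro LIMSEQ_le_const2) auto
  qed
 qed
qed

lemma upper_variation_sets [simp]:
 "sets (upper_variation M U) = sets M" "space (upper_variation M U) = space M"
 "sets (lower_variation M U) = sets M" "space (lower_variation M U) = space M"
 "sets (total_variation M U) = sets M" "space (total_variation M U) = space M"
 unfolding upper_variation_def lower_variation_def total_variation_def by (simp_all add: sets.space_closed)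

lemma emeasure_upper_variation:
 assumes U: "signed_measure M U" and A: "A : sets M"
 shows "emeasure (upper_variation M U) A = sup_over_subsets M U A" unfolding upper_variation_def sup_over_subsets_def[symmetric]
proof (rule emeasure_measure_of_sigma)
 show "sigma_algebra (space M) (sets M)" ..
 show "positive (sets M) (sup_over_subsets M U)" using signed_measure_empty[OF U] by (simp add: positive_def sup_over_subsets_def cong: conj_cong)
qed (use A countably_additive_sup_over_subsets[OF U] in auto)

text \<open>Were the supremum infinite, one could split off, again and again, a piece of
 absolute mass at least one from a set of infinite variation; these pieces are disjoint, which
 contradicts countable additivity.\<close>

lemma finite_upper_variation:
 assumes U: "signed_measure M U"
 shows "finite_measure (upper_variation M U)"
proof (rule finite_measureI, rule ccontr)
 let ?V = "sup_over_subsets M U"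
 assume "~  emeasure (upper_variation M U) (space (upper_variation M U)) ~= \<infinity>"
 hence inf: "?V (space M) = \<infinity>" by (simp add: emeasure_upper_variation[OF U])
 define bad where "bad A \<longleftrightarrow> A : sets M & ?V A = \<infinity>" for A
 have step: "EX B. bad B & B \<subseteq> A & 1 <= abs (U (A - B))" if "bad A" for A
 proof -
  have A: "A : sets M" "?V A = \<infinity>" using that by (auto simp: bad_def)
  have "ennreal (abs (U A) + 1) < ?V A" using A by simp
  then obtain C where C: "C : sets M" "C \<subseteq> A" "ennreal (abs (U A) + 1) < ennreal (U C)" unfolding sup_over_subsets_def less_SUP_iff by auto
  have UC: "abs (U A) + 1 < U C" using C(3) by (subst (asm) ennreal_less_iff) auto
  have "?V C + ?V (A - C) = ?V A"
  proof (rule antisym)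
   show "?V C + ?V (A - C) <= ?V A" using sup_over_subsets_add[OF U, of C "A - C"] A C by (simp add: Un_absorb1)
   have "emeasure (upper_variation M U) (C \<union> (A - C)) <= emeasure (upper_variation M U) C + emeasure (upper_variation M U) (A - C)"
    using A C by (intro emeasure_subadditive) auto
   thus "?V A <= ?V C + ?V (A - C)" using A C by (simp add: emeasure_upper_variation[OF U] Un_absorb1)
  qed
  hence "?V C = \<infinity> | ?V (A - C) = \<infinity>" using A by (simp add: ennreal_add_eq_top)
  thus ?thesis
  proof
   assume "?V C = \<infinity>"
   thus ?thesis using A C UC by (intro exI[of _ C]) (auto simp: bad_def signed_measure_Diff[OF U])
  next
   assume "?V (A - C) = \<infinity>"
   thus ?thesis using A C UC by (intro exI[of _ "A - C"]) (auto simp: bad_def Diff_Diff_Int Int_absorb1)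
  qed
 qed
 have "EX A. ALL n::nat. bad (A n) & (A (Suc n) \<subseteq> A n & 1 <= abs (U (A n - A (Suc n))))"
  using dependent_nat_choice[of "%n. bad" "%n A B. B \<subseteq> A & 1 <= abs (U (A - B))"] inf step by (metis bad_def sets.top)
 then obtain A where A: "!!n::nat. bad (A n)" "!!n. A (Suc n) \<subseteq> A n" "!!n. 1 <= abs (U (A n - A (Suc n)))" by auto
 have dec: "A m \<subseteq> A n" if "n <= m" for m n using that A(2) lift_Suc_antimono_le[of A n m] by blast
 have "disjoint_family (%n. A n - A (Suc n))" unfolding disjoint_family_on_def
 proof (intro ballI impI)
  fix m n :: nat assume "m ~= n"
  thus "(A m - A (Suc m)) \<inter> (A n - A (Suc n)) = {}" using dec[of "Suc m" n] dec[of "Suc n" m] by (cases "m < n") auto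
 qed
 hence "(%n. U (A n - A (Suc n))) sums U (\<Union>n. A n - A (Suc n))" using A(1) by (intro signed_measure_sums[OF U]) (auto simp: bad_def)
 hence "(%n. U (A n - A (Suc n))) ---> 0" using sums_summable summable_LIMSEQ_zero by blast
 hence "\<forall>\<^sub>F n in sequentially. abs (U (A n - A (Suc n))) < 1" by (simp add: tendsto_iff)
 then obtain n where "abs (U (A n - A (Suc n))) < 1" by (auto simp: eventually_sequentially)
 with A(3)[of n] show False by simp
qed

lemma finite_lower_variation:
 "signed_measure M U ==> finite_measure (lower_variation M U)" unfolding lower_variation_def by (intro finite_upper_variation signed_measure_uminus)

text \<open>A set that nearly attains the total mass of the upper variation nearly misses the lower one;
 a Borel-Cantelli argument turns a sequence of such sets into an exact decomposition.\<close>

lemma hahn_decomposition: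
 assumes U: "signed_measure M U"
 obtains P where "P : sets M" "emeasure (lower_variation M U) P = 0"
  "emeasure (upper_variation M U) (space M - P) = 0"
proof -
 let ?p = "upper_variation M U" and ?n = "lower_variation M U"
 interpret p: finite_measure ?p by (rule finite_upper_variation[OF U])
 have pV: "emeasure ?p A = sup_over_subsets M U A" if "A : sets M" for A by (rule emeasure_upper_variation[OF U that])
 have nV: "emeasure ?n A = sup_over_subsets M (%A. - U A) A" if "A : sets M" for A
  unfolding lower_variation_def by (rule emeasure_upper_variation[OF signed_measure_uminus[OF U] that])
 define S where "S = measure ?p (space M)"
 have S: "sup_over_subsets M U (space M) = ennreal S" unfolding S_def using pV[OF sets.top] p.emeasure_eq_measure by simp
 have US: "U B <= S" if "B : sets M" for B
 proof -
  have "ennreal (U B) <= ennreal S" using sup_over_subsets_ge[of B M "space M" U] that S sets.sets_into_space by auto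
  thus ?thesis by (simp add: S_def ennreal_le_iff)
 qed
 have "EX B:sets M. S - (1/2)^k < U B" for k :: nat
 proof (cases "S - (1/2)^k < 0")
  case True thus ?thesis using signed_measure_empty[OF U] by (intro bexI[of _ "{}"]) auto
 next
  case False
  have "ennreal (S - (1/2)^k) < sup_over_subsets M U (space M)" unfolding S
  proof (rule ennreal_lessI)
   show "0 < S" using False zero_less_power[of "1/2::real" k] by linarith
  qed simp
  then obtain B where "B : sets M" "ennreal (S - (1/2)^k) < ennreal (U B)" unfolding sup_over_subsets_def less_SUP_iff by auto
  thus ?thesis using False by (intro bexI[of _ B]) (auto simp: ennreal_less_iff)
 qed
 then obtain B where B: "!!k::nat. B k : sets M" "!!k. S - (1/2)^k < U (B k)" by metis
 have nB: "emeasure ?n (B k) <= ennreal ((1/2)^k)" for k unfolding nV[OF B(1)] sup_over_subsets_def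
 proof (rule SUP_least)
  fix C assume "C : {C : sets M. C \<subseteq> B k}"
  hence C: "C : sets M" "C \<subseteq> B k" by auto
  have "U (B k - C) = U (B k) - U C" using C B by (intro signed_measure_Diff[OF U]) auto
  thus "ennreal (- U C) <= ennreal ((1/2)^k)" using US[of "B k - C"] B(1)[of k] B(2)[of k] C by (intro ennreal_leI) auto
 qed
 have pB: "emeasure ?p (space M - B k) <= ennreal ((1/2)^k)" for k unfolding pV[OF sets.compl_sets[OF B(1)]] sup_over_subsets_def
 proof (rule SUP_least)
  fix C assume "C : {C : sets M. C \<subseteq> space M - B k}"
  hence C: "C : sets M" "C \<inter> B k = {}" by auto
  have "U (C \<union> B k) = U C + U (B k)" using C B by (intro signed_measure_Un[OF U]) auto
  thus "ennreal (U C) <= ennreal ((1/2)^k)" using US[of "C \<union> B k"] B(1)[of k] B(2)[of k] C by (intro ennreal_leI) auto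
 qed
 have lim0: "(%m. ennreal (2 * (1/2)^m)) ---> 0"
 proof -
  have "(%m. 2 * (1/2::real)^m) ---> 2 * 0" by (intro tendsto_intros LIMSEQ_power_zero) auto
  thus ?thesis using tendsto_ennrealI by fastforce
 qed
 have lim1: "(%m. ennreal ((1/2)^m)) ---> 0"
 proof -
  have "(%m. (1/2::real)^m) ---> 0" by (intro LIMSEQ_power_zero) auto
  thus ?thesis using tendsto_ennrealI by fastforce
 qed
 define P where "P = (\<Inter>m. \<Union>k. B (k + m))"
 have P: "P : sets M" unfolding P_def using B by auto
 have "emeasure ?n P <= ennreal (2 * (1/2)^m)" for m
 proof -
  have "emeasure ?n P <= emeasure ?n (\<Union>k. B (k + m))" using B P by (intro emeasure_mono) (auto simp: P_def)
  also have "... <= (\<Sum>k. emeasure ?n (B (k + m)))" using B by (intro emeasure_subadditive_countably) auto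
  also have "... <= (\<Sum>k. ennreal ((1/2)^(k + m)))" by (intro suminf_le nB) auto
  also have "... = ennreal (\<Sum>k. (1/2)^(k + m))" by (rule suminf_ennreal2) (auto simp: power_add intro!: summable_mult2 summable_geometric)
  also have "(\<Sum>k. (1/2::real)^(k + m)) = 2 * (1/2)^m" by (simp add: power_add suminf_mult2[symmetric] summable_geometric suminf_geometric)
  finally show ?thesis .
 qed
 hence n0: "emeasure ?n P = 0" using LIMSEQ_le_const[OF lim0, of "emeasure ?n P"] by auto
 have "emeasure ?p (\<Inter>k. space M - B (k + m)) = 0" for m
 proof -
  have "emeasure ?p (\<Inter>k. space M - B (k + m)) <= ennreal ((1/2)^j)" if "m <= j" for j
  proof -
   have "emeasure ?p (\<Inter>k. space M - B (k + m)) <= emeasure ?p (space M - B j)"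
    using B that by (intro emeasure_mono) (auto dest!: spec[of _ "j - m"] INT_D[of _ _ _ "j - m"])
   also note pB
   finally show ?thesis .
  qed
  hence "EX N. ALL j>=N. emeasure ?p (\<Inter>k. space M - B (k + m)) <= ennreal ((1/2)^j)" by blast
  from LIMSEQ_le_const[OF lim1 this] show ?thesis by simp
 qed
 hence "emeasure ?p (\<Union>m. \<Inter>k. space M - B (k + m)) = 0" using B by (intro emeasure_UN_eq_0) auto
 moreover have "space M - P = (\<Union>m. \<Inter>k. space M - B (k + m))" by (auto simp: P_def)
 ultimately show thesis using that P n0 by auto
qed

section \<open>The weighted form of a test gradient, and its pairing with a flux\<close>

definition jap :: "real => real" where "jap v = sqrt (1 + v^2)"

text \<open>The square of the norm dual to the action: the action of a flux bounds its pairing with the gradient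
 \<open>psi (snd z) - psi (fst z)\<close> by the square root of this form. The function \<open>jap\<close> measures the
 size of a velocity; the weight grows linearly, so integrability of \<open>jap\<close> makes the form finite for
 bounded \<open>psi\<close>.\<close>

definition qform :: "real => real measure => (real => real) => real" where
 "qform e f psi = (LINT z|(sq f). wt e z * (psi (snd z) - psi (fst z))^2)"

lemma jap_pos: "0 < jap v" "1 <= jap v" "abs v <= jap v" "jap v <= 1 + abs v"
proof -
 show "1 <= jap v" by (simp add: jap_def)
 thus "0 < jap v" by simp
 show "abs v <= jap v" unfolding jap_def by (rule real_le_rsqrt) simp
 show "jap v <= 1 + abs v" unfolding jap_def by (rule real_le_lsqrt) (auto simp: power2_eq_square algebra_simps)
qed

lemma jap_measurable [measurable]: "jap : Bor" unfolding jap_def by measurable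

lemma \<sigma>_measurable [measurable]: "\<sigma> e : Bor" unfolding \<sigma>_def by measurable

lemma \<sigma>_nonneg: "e < 1 ==> 0 <= r ==> 0 <= \<sigma> e r" by (simp add: \<sigma>_def)

lemma \<sigma>_pos: "e < 1 ==> 0 < r ==> 0 < \<sigma> e r" by (simp add: \<sigma>_def)

lemma \<sigma>_0 [simp]: "\<sigma> e 0 = 0" by (simp add: \<sigma>_def)

lemma \<sigma>_le: "0 <= e ==> e < 1 ==> \<sigma> e (abs (v - w)) <= (jap v + jap w) / 4"
proof -
 assume e: "0 <= e" "e < 1"
 have "\<sigma> e (abs (v - w)) <= 1 / 4 * abs (v - w)" unfolding \<sigma>_def using e by (intro mult_right_mono) auto
 also have "... <= (jap v + jap w) / 4" using jap_pos(3)[of v] jap_pos(3)[of w] by simp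
 finally show ?thesis .
qed

lemma borel_measurable_fst_snd' [measurable]:
 "fst : borel_measurable (borel :: (real * real) measure)" "snd : borel_measurable (borel :: (real * real) measure)"
 by (auto intro!: cont_bor continuous_on_fst continuous_on_snd continuous_on_id)

lemma borel_measurable_fst_snd [measurable (raw)]:
 assumes "g : borel_measurable M"
 shows "(%x. fst (g x :: real * real)) : borel_measurable M" "(%x. snd (g x :: real * real)) : borel_measurable M"
 by (rule measurable_compose[OF assms borel_measurable_fst_snd'(1)], rule measurable_compose[OF assms borel_measurable_fst_snd'(2)])

lemma off_diag_sets [measurable, simp]: "off_diag : sets borel" "off_diag : sets (borel \<Otimes>\<^sub>M borel)"
proof -
 have "off_diag = {z. fst z ~= snd z}" by (auto simp: off_diag_def)
 moreover have "{z :: real * real. fst z ~= snd z} : sets borel" by (intro borel_open open_Collect_neq continuous_intros)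
 ultimately show "off_diag : sets borel" by simp
 thus "off_diag : sets (borel \<Otimes>\<^sub>M borel)" unfolding borel_prod .
qed

context
 fixes f :: "real measure" assumes f: "rdist f"
begin

interpretation real_distribution f by (rule f)
interpretation ff: pair_prob_space f f ..

lemma sets_pair_square [simp, measurable_cong]: "sets (sq f) = sets borel"
proof -
 have "sets (sq f) = sets (borel \<Otimes>\<^sub>M borel)" by (rule sets_pair_measure_cong) simp_all
 thus ?thesis unfolding borel_prod .
qed

lemma space_pair_square [simp]: "space (sq f) = UNIV" using sets_eq_imp_space_eq[OF sets_pair_square] by simp

lemma sets_prod_off_diag [simp, measurable_cong]: "sets (prod_off_diag f) = sets borel_off_diag"
 unfolding prod_off_diag_def by (rule sets_restrict_space_cong) (rule sets_pair_square)

lemma space_prod_off_diag [simp]: "space (prod_off_diag f) = off_diag" unfolding prod_off_diag_def by (simp add: space_restrict_space)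

lemma nn_integral_prod_off_diag:
 "(nni (prod_off_diag f) (%z. h z)) = (nni (sq f) (%z. h z * ind off_diag z))" unfolding prod_off_diag_def by (rule nn_integral_restrict_space) simp

lemma finite_prod_off_diag: "finite_measure (prod_off_diag f)"
 unfolding prod_off_diag_def by (rule finite_measure_restrict_space) (auto simp: ff.P.finite_measure_axioms)

lemma integrable_prod_off_diag:
 fixes h :: "real * real => real"
 assumes "!!v. h (v, v) = 0"
 shows "integrable (prod_off_diag f) h \<longleftrightarrow> integrable (sq f) h"
  and "(LINT z|prod_off_diag f. h z) = (LINT z|(sq f). h z)"
proof -
 have eq: "ind off_diag z * h z = h z" for z using assms by (cases z) (auto simp: off_diag_def indicator_def)
 show "integrable (prod_off_diag f) h \<longleftrightarrow> integrable (sq f) h" unfolding prod_off_diag_def by (subst integrable_restrict_space) (auto simp: eq)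
 show "(LINT z|prod_off_diag f. h z) = (LINT z|(sq f). h z)" unfolding prod_off_diag_def by (subst integral_restrict_space) (auto simp: eq)
qed

end

lemma action_density_le:
 assumes "g^2 <= a * q" "0 <= a" "0 <= q"
 shows "action_density q g <= ennreal a"
proof (cases "q = 0")
 case False
 thus ?thesis using assms by (auto simp: action_density_def intro!: ennreal_leI simp: field_simps)
qed (use assms in "auto simp: action_density_def")

text \<open>The flux-side Cauchy-Schwarz inequality. Mutual singularity of the two variations is what
 makes the pairing absolutely convergent as soon as the action is finite.\<close>

lemma action_density_pairing_le_action:
 assumes f: "rdist f" and U: "signed_measure borel_off_diag U" and e: "0 <= e" "e < 1"
  and xi[measurable]: "xi : Bor"
  and qi: "integrable (sq f) (%z. wt e z * (xi z)^2)"
 shows "action_density (LINT z|(sq f). wt e z * (xi z)^2)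
     (signed_integral borel_off_diag U (%z. wt e z * xi z)) <= action e f U"
proof (cases "action e f U = \<infinity>")
 case False
 define mu where "mu = prod_off_diag f"
 define p where "p = upper_variation borel_off_diag U"
 define n where "n = lower_variation borel_off_diag U"
 define L where "L = add_measure mu (total_variation borel_off_diag U)"
 define s where "s z = enn2real (RN_deriv L mu z)" for z
 define a where "a z = enn2real (RN_deriv L p z)" for z
 define b where "b z = enn2real (RN_deriv L n z)" for z
 define w where "w z = wt e z" for z :: "real * real"
 have [measurable]: "w : Bor" unfolding w_def by measurable
 have w0: "0 <= w z" for z using e by (simp add: w_def \<sigma>_nonneg)
 interpret p: finite_measure p unfolding p_def by (rule finite_upper_variation[OF U])
 interpret n: finite_measure n unfolding n_def by (rule finite_lower_variation[OF U])
 interpret mu: finite_measure mu unfolding mu_def by (rule finite_prod_off_diag[OF f])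
 have setsL[measurable_cong]: "sets L = sets borel_off_diag" "sets p = sets borel_off_diag" "sets n = sets borel_off_diag" "sets mu = sets borel_off_diag"
  by (simp_all add: L_def p_def n_def mu_def f)
 have spL: "space L = off_diag" "space p = off_diag" "space n = off_diag" "space mu = off_diag"
  using setsL[THEN sets_eq_imp_space_eq] by (simp_all add: space_restrict_space)
 have eL: "emeasure L A = emeasure mu A + (emeasure p A + emeasure n A)" if "A : sets borel_off_diag" for A
  unfolding L_def total_variation_def p_def[symmetric] n_def[symmetric] using that setsL by (subst emeasure_add_measure) (auto simp: emeasure_add_measure)
 have "off_diag : sets borel_off_diag" using sets.top[of borel_off_diag] by (simp add: space_restrict_space)
 then interpret L: finite_measure L by (intro finite_measureI) (simp add: eL spL ennreal_add_eq_top mu.emeasure_finite p.emeasure_finite n.emeasure_finite)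
 have ac: "absolutely_continuous L mu" "absolutely_continuous L p" "absolutely_continuous L n"
  unfolding absolutely_continuous_def using eL setsL by (auto simp: null_sets_def)
 have AEs: "AE z in L. RN_deriv L mu z = ennreal (s z)" "AE z in L. RN_deriv L p z = ennreal (a z)" "AE z in L. RN_deriv L n z = ennreal (b z)"
  unfolding s_def a_def b_def using L.RN_deriv_finite[of mu] L.RN_deriv_finite[of p] L.RN_deriv_finite[of n] ac setsL
   mu.sigma_finite_measure_axioms p.sigma_finite_measure_axioms n.sigma_finite_measure_axioms by (auto simp: less_top)
 have [measurable]: "s : borel_measurable L" "a : borel_measurable L" "b : borel_measurable L" unfolding s_def a_def b_def by measurable
 have s0: "0 <= s z" "0 <= a z" "0 <= b z" for z by (simp_all add: s_def a_def b_def)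
 have dens: "density L (%z. ennreal (s z)) = mu" "density L (%z. ennreal (a z)) = p" "density L (%z. ennreal (b z)) = n"
 proof -
  have 1: "density L (%z. ennreal (t z)) = N"
   if "AE z in L. RN_deriv L N z = ennreal (t z)" "absolutely_continuous L N" "sets N = sets L"
    "t : borel_measurable L" for t N
  proof -
   have "density L (%z. ennreal (t z)) = density L (RN_deriv L N)"
   proof (rule density_cong)
    show "(%z. ennreal (t z)) : borel_measurable L" using that(4) by measurable
    show "AE z in L. ennreal (t z) = RN_deriv L N z" using that(1) by eventually_elim simp
   qed simp
   also have "... = N" using that by (intro L.density_RN_deriv) auto
   finally show ?thesis .
  qed
  show "density L (%z. ennreal (s z)) = mu" by (rule 1[OF AEs(1) ac(1)]) (auto simp: setsL)
  show "density L (%z. ennreal (a z)) = p" by (rule 1[OF AEs(2) ac(2)]) (auto simp: setsL)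
  show "density L (%z. ennreal (b z)) = n" by (rule 1[OF AEs(3) ac(3)]) (auto simp: setsL)
 qed
 obtain P where P: "P : sets borel_off_diag" "emeasure n P = 0" "emeasure p (space borel_off_diag - P) = 0"
  using hahn_decomposition[OF U] unfolding p_def n_def by blast
 have nP: "AE z in L. z : P --> b z = 0"
 proof -
  have "AE z in density L (%z. ennreal (b z)). z \<notin> P" unfolding dens using P setsL by (intro AE_not_in) auto
  thus ?thesis by (subst (asm) AE_density) (auto elim!: eventually_mono simp: s0 order.antisym not_less)
 qed
 have pP: "AE z in L. z \<notin> P --> a z = 0"
 proof -
  have "AE z in density L (%z. ennreal (a z)). z \<notin> (space borel_off_diag - P)"
   unfolding dens using P(3) sets.compl_sets[OF P(1)] setsL by (intro AE_not_in null_setsI) simp_all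
  hence "AE z in L. 0 < ennreal (a z) --> z \<notin> space borel_off_diag - P" by (subst (asm) AE_density) auto
  thus ?thesis using AE_space[of L] by eventually_elim (use s0 in "auto simp: spL space_restrict_space order.antisym not_less")
 qed
 have [measurable]: "xi : borel_measurable L" "w : borel_measurable L" using setsL by (auto intro!: measurable_restrict_space1 cong: measurable_cong_sets)
 define A where "A = enn2real (action e f U)"
 have A: "action e f U = ennreal A" "0 <= A" using False by (simp_all add: A_def less_top)
 have act: "(nni L (%z. action_density (s z) (a z - b z) * ennreal (w z))) = ennreal A"
  unfolding A(1)[symmetric] action_def Let_def L_def[symmetric] mu_def[symmetric] s_def a_def b_def
   signed_RN_deriv_def p_def n_def w_def by simp
 have adm: "(%z. action_density (s z) (a z - b z)) : borel_measurable L" unfolding action_density_def by measurable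
 have fin: "AE z in L. action_density (s z) (a z - b z) * ennreal (w z) ~= \<infinity>" by (rule nn_integral_PInf_AE) (use act adm in auto)
 have fin': "AE z in L. s z = 0 --> a z - b z = 0" using fin AE_space[of L]
 proof eventually_elim
  case (elim z)
  have "0 < w z" using elim(2) e by (cases z) (auto simp: spL off_diag_def w_def intro!: \<sigma>_pos)
  thus ?case using elim(1) by (auto simp: action_density_def ennreal_top_mult split: if_splits)
 qed
 define F where "F z = (if s z = 0 then 0 else sqrt (w z / s z) * (a z - b z))" for z
 define G where "G z = sqrt (w z * s z) * xi z" for z
 have [measurable]: "F : borel_measurable L" "G : borel_measurable L" unfolding F_def G_def by measurable
 have F2: "ennreal ((F z)^2) = action_density (s z) (a z - b z) * ennreal (w z)" if "s z = 0 --> a z - b z = 0" for z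
  using that s0[of z] w0[of z] by (auto simp: F_def action_density_def power_mult_distrib ennreal_mult[symmetric] mult_ac)
 have "(nni L (%z. ennreal ((F z)^2))) = ennreal A" unfolding act[symmetric] by (rule nn_integral_cong_AE, use fin' in eventually_elim) (rule F2)
 hence Fi: "integrable L (%z. (F z)^2)" "(LINT z|L. (F z)^2) = A" using A(2) by (auto intro!: integrableI_bounded simp: integral_eq_nn_integral)
 have qi': "integrable mu (%z. w z * (xi z)^2)" "(LINT z|mu. w z * (xi z)^2) = (LINT z|(sq f). w z * (xi z)^2)"
  unfolding mu_def using integrable_prod_off_diag[OF f, of "%z. w z * (xi z)^2"] qi by (auto simp: w_def)
 have G2: "(G z)^2 = s z * (w z * (xi z)^2)" for z using s0[of z] w0[of z] by (simp add: G_def power_mult_distrib mult_ac)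
 have Gi: "integrable L (%z. (G z)^2)" "(LINT z|L. (G z)^2) = (LINT z|(sq f). w z * (xi z)^2)" unfolding G2 using qi' s0 unfolding dens(1)[symmetric]
  by (auto simp: integrable_real_density integral_real_density)
 have FG: "AE z in L. F z * G z = (a z - b z) * (w z * xi z)" using fin'
 proof eventually_elim
  case (elim z)
  show ?case
  proof (cases "s z = 0")
   case False
   hence "sqrt (w z / s z) * sqrt (w z * s z) = w z" using s0[of z] w0[of z] by (simp add: real_sqrt_mult[symmetric])
   thus ?thesis using False by (simp add: F_def G_def mult_ac)
  qed (use elim in "simp add: F_def")
 qed
 note cs = cauchy_schwarz_integral[of F L G, OF _ _ Fi(1) Gi(1)]
 have ui: "integrable L (%z. (a z - b z) * (w z * xi z))" using cs(1) by (rule integrable_cong_AE_imp) (use FG in "auto simp: eq_commute")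
 have ai: "integrable L (%z. a z * (w z * xi z))" by (rule integrable_bd[OF ui]; use nP pP in "simp, (eventually_elim, auto simp: abs_mult)?")
 have bi: "integrable L (%z. b z * (w z * xi z))" using integrable_dif[OF ai ui] by (simp add: algebra_simps)
 have "signed_integral borel_off_diag U (%z. wt e z * xi z) = (LINT z|p. w z * xi z) - (LINT z|n. w z * xi z)" by (simp add: signed_integral_def p_def n_def w_def)
 also have "... = (LINT z|L. a z * (w z * xi z)) - (LINT z|L. b z * (w z * xi z))" unfolding dens(2,3)[symmetric] using s0 by (simp add: integral_real_density)
 also have "... = (LINT z|L. (a z - b z) * (w z * xi z))" using ai bi by (simp add: algebra_simps flip: lint_diff)
 also have "... = (LINT z|L. F z * G z)" using FG by (intro integral_cong_AE) (auto simp: eq_commute)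
 finally have "(signed_integral borel_off_diag U (%z. wt e z * xi z))^2 <= A * (LINT z|(sq f). w z * (xi z)^2)" using cs(2) Fi(2) Gi(2) by simp
 thus ?thesis unfolding A(1) w_def using A(2) e by (intro action_density_le) (auto intro!: integral_nonneg_AE simp: \<sigma>_nonneg)
qed simp

lemma signed_integral_le_total_variation:
 assumes h[measurable]: "h : borel_measurable M" "k : borel_measurable M"
  and b: "!!z. z : space M ==> abs (h z) <= k z"
 shows "ennreal (abs (signed_integral M U h)) <= (nni (total_variation M U) (%z. ennreal (k z)))"
proof -
 have 1: "ennreal (abs (LINT z|N. h z)) <= (nni N (%z. ennreal (k z)))" if s: "sets N = sets M" for N
 proof -
  have "ennreal (norm (LINT z|N. h z)) <= (nni N (%z. ennreal (norm (h z))))"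
   by (cases "integrable N h") (use integral_norm_bound_ennreal[of N h] in "simp_all add: not_integrable_integral_eq")
  also have "... <= (nni N (%z. ennreal (k z)))" using b sets_eq_imp_space_eq[OF s] by (intro nn_integral_mono ennreal_leI) auto
  finally show ?thesis by simp
 qed
 have "ennreal (abs (signed_integral M U h)) <= ennreal (abs (\<integral>z. h z \<partial>upper_variation M U) + abs (\<integral>z. h z \<partial>lower_variation M U))"
  unfolding signed_integral_def by (intro ennreal_leI) simp
 also have "... <= (nni (upper_variation M U) (%z. ennreal (k z))) + (nni (lower_variation M U) (%z. ennreal (k z)))"
  using 1[of "upper_variation M U"] 1[of "lower_variation M U"] by (simp add: ennreal_plus add_mono)
 also have "... = (nni (total_variation M U) (%z. ennreal (k z)))"
  unfolding total_variation_def by (rule nn_integral_add_measure[symmetric]) (auto cong: measurable_cong_sets)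
 finally show ?thesis .
qed

section \<open>Signed measures given by a density\<close>

lemma signed_density:
 fixes zt :: "'a => real"
 assumes mu: "finite_measure mu" and s: "sets mu = sets M" and zt: "integrable mu zt"
 defines "U \<equiv> %A. LINT x|mu. ind A x * zt x"
 shows "signed_measure M U"
  and "upper_variation M U = density mu (%x. ennreal (zt x))"
  and "lower_variation M U = density mu (%x. ennreal (- zt x))"
  and "total_variation M U = density mu (%x. ennreal (abs (zt x)))"
proof -
 have [measurable]: "zt : borel_measurable mu" using zt by simp
 have upper: "signed_measure M (%A. LINT x|mu. ind A x * zt x) &
  upper_variation M (%A. LINT x|mu. ind A x * zt x) = density mu (%x. ennreal (zt x))"
  if zt: "integrable mu zt" for zt :: "'a => real"
 proof -
  have [measurable]: "zt : borel_measurable mu" using zt by simp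
  define U where "U A = (LINT x|mu. ind A x * zt x)" for A
  define p where "p = density mu (%x. ennreal (zt x))"
  define n where "n = density mu (%x. ennreal (- zt x))"
  have sp: "sets p = sets M" "sets n = sets M" by (simp_all add: p_def n_def s)
  have ep: "emeasure (density mu (%x. ennreal (eta x))) A = ennreal (LINT x|mu. ind A x * max 0 (eta x))"
   if eta: "integrable mu eta" and A: "A : sets M" for eta :: "'a => real" and A
  proof -
   have [measurable]: "eta : borel_measurable mu" "A : sets mu" using eta A s by auto
   have "integrable mu (%x. ind A x * max 0 (eta x))" by (rule integrable_bd[OF eta]) (auto simp: indicator_def)
   hence "(nni mu (%x. ennreal (ind A x * max 0 (eta x)))) = ennreal (LINT x|mu. ind A x * max 0 (eta x))" by (intro nn_integral_eq_integral) auto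
   moreover have "emeasure (density mu (%x. ennreal (eta x))) A = (nni mu (%x. ennreal (ind A x * max 0 (eta x))))"
    by (subst emeasure_density) (auto simp: indicator_def max_def ennreal_neg intro!: nn_integral_cong)
   ultimately show ?thesis by simp
  qed
  note epp = ep[OF zt, folded p_def] and enn = ep[OF integrable_minus[OF zt], folded n_def]
  have spc: "space mu = space M" using s by (rule sets_eq_imp_space_eq)
  interpret p: finite_measure p by (rule finite_measureI) (use epp[of "space M"] in "simp add: p_def spc")
  interpret n: finite_measure n by (rule finite_measureI) (use enn[of "space M"] in "simp add: n_def spc")
  have UA: "U A = measure p A - measure n A" if A: "A : sets M" for A
  proof -
   have [measurable]: "A : sets mu" using A s by simp
   have i: "integrable mu (%x. ind A x * max 0 (zt x))" "integrable mu (%x. ind A x * max 0 (- zt x))" by (rule integrable_bd[OF zt]; auto simp: indicator_def)+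
   have "U A = (LINT x|mu. ind A x * max 0 (zt x) - ind A x * max 0 (- zt x))" unfolding U_def by (intro lint_cong) (auto simp: max_def)
   also have "... = measure p A - measure n A" using i epp[OF A] enn[OF A] by (simp add: measure_def integral_nonneg_AE)
   finally show ?thesis .
  qed
  have sm: "signed_measure M U" unfolding signed_measure_def
  proof (intro allI impI)
   fix A :: "nat => 'a set" assume A: "range A \<subseteq> sets M & disjoint_family A"
   have "(%i. measure p (A i) - measure n (A i)) sums (measure p (\<Union>i. A i) - measure n (\<Union>i. A i))"
    using A sp by (intro sums_diff p.finite_measure_UNION n.finite_measure_UNION) auto
   moreover have "(%i. U (A i)) = (%i. measure p (A i) - measure n (A i))" using A by (intro ext UA) auto
   moreover have "U (\<Union>i. A i) = measure p (\<Union>i. A i) - measure n (\<Union>i. A i)" using A by (intro UA) auto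
   ultimately show "(%i. U (A i)) sums U (\<Union>i. A i)" by simp
  qed
  have "upper_variation M U = p"
  proof (rule measure_eqI)
   fix A assume "A : sets (upper_variation M U)"
   hence A: "A : sets M" by simp
   define B where "B = A \<inter> {x : space mu. 0 < zt x}"
   have [measurable]: "A : sets mu" using A s by simp
   have "B : sets mu" unfolding B_def by measurable
   hence Bs: "B : sets M" using s by simp
   have "U B = measure p A"
   proof -
    have "U B = (LINT x|mu. ind A x * max 0 (zt x))" unfolding U_def by (intro lint_cong) (auto simp: B_def indicator_def max_def)
    thus ?thesis using epp[OF A] by (simp add: measure_def integral_nonneg_AE)
   qed
   hence "ennreal (measure p A) <= sup_over_subsets M U A" using sup_over_subsets_ge[of B M A U] Bs by (auto simp: B_def)
   moreover have "sup_over_subsets M U A <= emeasure p A" unfolding sup_over_subsets_def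
   proof (rule SUP_least)
    fix C assume "C : {B : sets M. B \<subseteq> A}"
    hence C: "C : sets M" "C \<subseteq> A" by auto
    have "ennreal (U C) <= ennreal (measure p C)" using UA[OF C(1)] by (intro ennreal_leI) simp
    also have "... <= emeasure p A" using C A sp by (simp add: p.emeasure_eq_measure[symmetric] emeasure_mono)
    finally show "ennreal (U C) <= emeasure p A" .
   qed
   ultimately show "emeasure (upper_variation M U) A = emeasure p A" using emeasure_upper_variation[OF sm A] by (simp add: p.emeasure_eq_measure antisym)
  qed (simp add: sp)
  thus ?thesis using sm unfolding U_def p_def by simp
 qed
 show "signed_measure M U" "upper_variation M U = density mu (%x. ennreal (zt x))" using upper[OF zt] by (simp_all add: U_def)
 have neg: "(%A. - U A) = (%A. LINT x|mu. ind A x * - zt x)" by (simp add: U_def)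
 show lo: "lower_variation M U = density mu (%x. ennreal (- zt x))" unfolding lower_variation_def neg using upper[OF integrable_minus[OF zt]] by simp
 show "total_variation M U = density mu (%x. ennreal (abs (zt x)))"
 proof (rule measure_eqI)
  fix A assume "A : sets (total_variation M U)"
  hence A[measurable]: "A : sets mu" "A : sets M" using s by auto
  have "emeasure (total_variation M U) A = (nni mu (%x. ennreal (zt x) * ind A x)) + (nni mu (%x. ennreal (- zt x) * ind A x))"
   unfolding total_variation_def lo `upper_variation M U = _` by (subst emeasure_add_measure) (auto simp: emeasure_density)
  also have "... = (nni mu (%x. ennreal (abs (zt x)) * ind A x))"
   by (subst nn_integral_add[symmetric]) (auto intro!: nn_integral_cong simp: indicator_def abs_if ennreal_neg)
  also have "... = emeasure (density mu (%x. ennreal (abs (zt x)))) A" by (subst emeasure_density) auto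
  finally show "emeasure (total_variation M U) A = emeasure (density mu (%x. ennreal (abs (zt x)))) A" .
 qed (simp add: s)
qed

lemma signed_integral_density_flux:
 fixes zt h :: "'a => real"
 assumes mu: "finite_measure mu" and s: "sets mu = sets M" and zt: "integrable mu zt"
  and h[measurable]: "h : borel_measurable mu" and hi: "integrable mu (%x. zt x * h x)"
 shows "signed_integral M (%A. LINT x|mu. ind A x * zt x) h = (LINT x|mu. zt x * h x)"
proof -
 have [measurable]: "zt : borel_measurable mu" using zt by simp
 have d: "density mu (%x. ennreal (eta x)) = density mu (%x. ennreal (max 0 (eta x)))" for eta :: "'a => real" by simp
 have i: "integrable mu (%x. max 0 (zt x) * h x)" "integrable mu (%x. max 0 (- zt x) * h x)"
  by (rule integrable_bd[OF hi]; auto simp: abs_mult intro!: mult_right_mono)+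
 have "signed_integral M (%A. LINT x|mu. ind A x * zt x) h =
   (LINT x|density mu (%x. ennreal (max 0 (zt x))). h x) - (\<integral>x. h x \<partial>density mu (%x. ennreal (max 0 (- zt x))))"
  unfolding signed_integral_def signed_density(2,3)[OF mu s zt] d[of zt] d[of "%x. - zt x"] ..
 also have "... = (LINT x|mu. max 0 (zt x) * h x) - (LINT x|mu. max 0 (- zt x) * h x)" by (intro arg_cong2[where f="(-)"] integral_real_density) auto
 also have "... = (LINT x|mu. max 0 (zt x) * h x - max 0 (- zt x) * h x)" using i by simp
 also have "... = (LINT x|mu. zt x * h x)" by (intro lint_cong) (auto simp: max_def)
 finally show ?thesis .
qed

lemma action_density_flux:
 assumes f: "rdist f" and zt: "integrable (prod_off_diag f) zt"
 shows "action e f (%A. LINT x|prod_off_diag f. ind A x * zt x) =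
  (nni (prod_off_diag f) (%z. ennreal ((zt z)^2) * ennreal (wt e z)))"
proof -
 define mu where "mu = prod_off_diag f"
 interpret mu: finite_measure mu unfolding mu_def by (rule finite_prod_off_diag[OF f])
 have s: "sets mu = sets borel_off_diag" by (simp add: mu_def f)
 have [measurable]: "zt : borel_measurable mu" using zt by (simp add: mu_def)
 have [measurable]: "(%z. wt e z) : borel_measurable mu" unfolding measurable_cong_sets[OF s refl] by (rule measurable_restrict_space1) measurable
 define U where "U = (%A. LINT x|mu. ind A x * zt x)"
 note D = signed_density[OF mu.finite_measure_axioms s zt[folded mu_def], folded U_def]
 define L where "L = add_measure mu (total_variation borel_off_diag U)"
 have L: "L = density mu (%x. ennreal (1 + abs (zt x)))"
 proof (rule measure_eqI)
  show "sets L = sets (density mu (%x. ennreal (1 + abs (zt x))))" by (simp add: L_def)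
  fix A assume "A : sets L"
  hence A[measurable]: "A : sets mu" by (simp add: L_def)
  have "emeasure L A = (nni mu (%x. ind A x)) + (nni mu (%x. ennreal (abs (zt x)) * ind A x))"
   unfolding L_def D(4) by (subst emeasure_add_measure) (auto simp: emeasure_density)
  also have "... = (nni mu (%x. ennreal (1 + abs (zt x)) * ind A x))"
   by (subst nn_integral_add[symmetric]) (auto intro!: nn_integral_cong simp: indicator_def ennreal_plus)
  finally show "emeasure L A = emeasure (density mu (%x. ennreal (1 + abs (zt x)))) A" by (simp add: emeasure_density)
 qed
 have "integrable mu (%x. 1 + abs (zt x))" using zt by (simp add: mu_def[symmetric])
 hence "(nni mu (%x. ennreal (1 + abs (zt x)))) < \<infinity>" by (subst nn_integral_eq_integral) auto
 then interpret L: finite_measure L by (intro finite_measureI) (auto simp: L emeasure_density)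
 define k where "k x = inverse (1 + abs (zt x))" for x
 have dk: "density L (%x. ennreal (k x * max 0 (eta x))) = density mu (%x. ennreal (eta x))"
  if [measurable]: "eta : borel_measurable mu" for eta :: "_ => real"
 proof -
  have "density L (%x. ennreal (k x * max 0 (eta x))) = density mu (%x. ennreal (1 + abs (zt x)) * ennreal (k x * max 0 (eta x)))"
   unfolding L k_def by (subst density_density_eq) auto
  also have "... = density mu (%x. ennreal (eta x))"
  proof (rule density_cong)
   show "AE x in mu. ennreal (1 + abs (zt x)) * ennreal (k x * max 0 (eta x)) = ennreal (eta x)"
   proof (rule AE_I2)
    fix x
    have e: "(1 + abs (zt x)) * (k x * max 0 (eta x)) = max 0 (eta x)" by (simp add: k_def)
    have "ennreal (1 + abs (zt x)) * ennreal (k x * max 0 (eta x)) = ennreal ((1 + abs (zt x)) * (k x * max 0 (eta x)))"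
     by (rule ennreal_mult[symmetric]) (auto simp: k_def)
    hence "ennreal (1 + abs (zt x)) * ennreal (k x * max 0 (eta x)) = ennreal (max 0 (eta x))" unfolding e .
    thus "ennreal (1 + abs (zt x)) * ennreal (k x * max 0 (eta x)) = ennreal (eta x)" by simp
   qed
  qed (auto simp: k_def)
  finally show ?thesis .
 qed
 have kL: "k : borel_measurable L" "zt : borel_measurable L" unfolding k_def L by measurable
 note [measurable] = kL
 have R1: "AE x in L. ennreal (k x) = RN_deriv L mu x"
 proof (rule L.RN_deriv_unique)
  show "density L (%x. ennreal (k x)) = mu" using dk[of "%_. 1"] by (simp add: density_1)
 qed measurable
 have R2: "AE x in L. ennreal (k x * max 0 (zt x)) = RN_deriv L (upper_variation borel_off_diag U) x" by (rule L.RN_deriv_unique) (use dk[of zt] D(2) in auto)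
 have R3: "AE x in L. ennreal (k x * max 0 (- zt x)) = RN_deriv L (lower_variation borel_off_diag U) x"
  by (rule L.RN_deriv_unique) (use dk[of "%x. - zt x"] D(3) in auto)
 have "action e f U = (nni L (%z. action_density (k z) (k z * zt z) * ennreal (wt e z)))" unfolding action_def Let_def mu_def[symmetric] L_def[symmetric]
 proof (rule nn_integral_cong_AE, use R1 R2 R3 in eventually_elim)
  case (elim z)
  have k0: "0 <= k z" by (simp add: k_def)
  have "signed_RN_deriv L borel_off_diag U z = k z * max 0 (zt z) - k z * max 0 (- zt z)" unfolding signed_RN_deriv_def elim(2,3)[symmetric] using k0 by simp
  also have "... = k z * zt z" by (auto simp: max_def)
  finally show ?case unfolding elim(1)[symmetric] using k0 by simp
 qed
 also have "... = (nni mu (%z. ennreal (1 + abs (zt z)) * (action_density (k z) (k z * zt z) * ennreal (wt e z))))"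
  unfolding L by (subst nn_integral_density) (auto simp: k_def action_density_def)
 also have "... = (nni mu (%z. ennreal ((zt z)^2) * ennreal (wt e z)))"
 proof (rule nn_integral_cong)
  fix z
  have k0: "0 < k z" by (simp add: k_def)
  have "(1 + abs (zt z)) * ((k z * zt z)^2 / k z) = (zt z)^2" using k0 by (simp add: power2_eq_square) (simp add: k_def)
  moreover have "ennreal (1 + abs (zt z)) * ennreal ((k z * zt z)^2 / k z) = ennreal ((1 + abs (zt z)) * ((k z * zt z)^2 / k z))"
   using k0 by (intro ennreal_mult[symmetric]) auto
  ultimately have "ennreal (1 + abs (zt z)) * action_density (k z) (k z * zt z) = ennreal ((zt z)^2)"
   using k0 by (auto simp: action_density_def simp del: ennreal_plus)
  thus "ennreal (1 + abs (zt z)) * (action_density (k z) (k z * zt z) * ennreal (wt e z)) = ennreal ((zt z)^2) * ennreal (wt e z)"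
   by (simp add: mult.assoc[symmetric])
 qed
 finally show ?thesis unfolding U_def mu_def .
qed

section \<open>Marginals and the size of the gradient form\<close>

lemma pair_marginals:
 assumes "prob_space M"
 shows "distr (sq M) M fst = M" "distr (sq M) M snd = M"
proof -
 interpret prob_space M by fact
 interpret pp: pair_prob_space M M ..
 show 1: "distr (sq M) M fst = M" by (rule distr_pair_fst)
 have "distr (sq M) M snd = distr (distr (sq M) (sq M) (%(x, y). (y, x))) M snd" using pp.distr_pair_swap by simp
 also have "... = distr (sq M) M (snd \<circ> (%(x, y). (y, x)))" by (rule distr_distr) measurable
 also have "snd \<circ> (%(x, y). (y, x)) = (fst :: 'a \<times> 'a => 'a)" by (auto simp: fun_eq_iff)
 finally show "distr (sq M) M snd = M" using 1 by simp
qed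

lemma integral_pair_marginals:
 fixes h :: "'a => real"
 assumes M: "prob_space M" and [measurable]: "h : borel_measurable M"
 shows "integrable (sq M) (%z. h (fst z)) \<longleftrightarrow> integrable M h"
  "integrable (sq M) (%z. h (snd z)) \<longleftrightarrow> integrable M h"
  "(LINT z|(sq M). h (fst z)) = (LINT x|M. h x)"
  "(LINT z|(sq M). h (snd z)) = (LINT x|M. h x)"
  "(nni (sq M) (%z. ennreal (h (fst z)))) = (nni M (%x. ennreal (h x)))" using integrable_distr_eq[of fst "sq M" M h] integrable_distr_eq[of snd "sq M" M h]
  integral_distr[of fst "sq M" M h] integral_distr[of snd "sq M" M h]
  nn_integral_distr[of fst "sq M" M "%x. ennreal (h x)"] by (simp_all add: pair_marginals[OF M])

lemma real_distribution_measurable: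
 "rdist f ==> h : Bor ==> h : borel_measurable f"
 "rdist f ==> k : Bor ==> k : borel_measurable (sq f)"
proof -
 assume f: "rdist f"
 interpret real_distribution f by fact
 show "h : Bor ==> h : borel_measurable f" by simp
 show "k : Bor ==> k : borel_measurable (sq f)" using sets_pair_square[OF f] by (simp cong: measurable_cong_sets)
qed

lemma real_distribution_prob: "rdist f ==> prob_space f" by (simp add: real_distribution_def)

definition jmean :: "real measure => real" where "jmean f = (LINT v|f. jap v)"

lemma jmean_ge_1: "rdist f ==> integrable f jap ==> 1 <= jmean f"
proof -
 assume f: "rdist f" and j: "integrable f jap"
 interpret real_distribution f by fact
 have "(LINT v|f. 1) <= (LINT v|f. jap v)" by (rule integral_mono[OF _ j]) (auto simp: jap_pos)
 thus ?thesis using prob_space by (simp add: jmean_def)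
qed

lemma integrable_jap_sum:
 assumes f: "rdist f" and j: "integrable f jap"
 shows "integrable (sq f) (%z. jap (fst z) + jap (snd z))"
  and "(LINT z|(sq f). jap (fst z) + jap (snd z)) = 2 * jmean f"
proof -
 have m: "jap : borel_measurable f" using f by (rule real_distribution_measurable) simp
 note P = integral_pair_marginals[OF real_distribution_prob[OF f] m]
 show "integrable (sq f) (%z. jap (fst z) + jap (snd z))" using P j by simp
 show "(LINT z|(sq f). jap (fst z) + jap (snd z)) = 2 * jmean f" using P j by (simp add: jmean_def)
qed

lemma integrable_by_jap:
 assumes f: "rdist f" and j: "integrable f jap" and h: "h : Bor"
  and b: "!!v. abs (h v) <= C * jap v"
 shows "integrable f (h :: real => real)" by (rule integrable_bd[OF integrable_mult_right[OF j, of C]])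
  (use real_distribution_measurable(1)[OF f h] order_trans[OF b abs_ge_self] in "auto intro!: AE_I2")

lemma integrable_by_jap2:
 assumes f: "rdist f" and j: "integrable f jap" and h: "h : Bor"
  and b: "!!z. abs (h z) <= C * (jap (fst z) + jap (snd z))"
 shows "integrable (sq f) (h :: real * real => real)" by (rule integrable_bd[OF integrable_mult_right[OF integrable_jap_sum(1)[OF f j], of C]])
  (use real_distribution_measurable(2)[OF f h] order_trans[OF b abs_ge_self] in "auto intro!: AE_I2")

lemma gradient_weight_bound:
 assumes e: "0 <= e" "e < 1" and b: "!!v. abs (psi v) <= C"
 shows "0 <= \<sigma> e (abs (v - w)) * (psi w - psi v)^2" "\<sigma> e (abs (v - w)) * (psi w - psi v)^2 <= C^2 * (jap v + jap w)"
proof -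
 have s: "0 <= \<sigma> e (abs (v - w))" using e by (simp add: \<sigma>_nonneg)
 thus "0 <= \<sigma> e (abs (v - w)) * (psi w - psi v)^2" by simp
 have "abs (psi w - psi v) <= 2 * C" using b[of v] b[of w] by linarith
 hence "(psi w - psi v)^2 <= (2 * C)^2" by (metis abs_le_square_iff abs_of_nonneg abs_ge_zero order_trans)
 hence "\<sigma> e (abs (v - w)) * (psi w - psi v)^2 <= (jap v + jap w) / 4 * (2 * C)^2" using \<sigma>_le[OF e, of v w] s by (intro mult_mono) (auto simp: jap_pos less_imp_le)
 also have "... = C^2 * (jap v + jap w)" by (simp add: power2_eq_square algebra_simps)
 finally show "\<sigma> e (abs (v - w)) * (psi w - psi v)^2 <= C^2 * (jap v + jap w)" .
qed

lemma qform_measurable [measurable]: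
 assumes [measurable]: "psi : Bor"
 shows "(%z. wt e z * (psi (snd z) - psi (fst z))^2) : borel_measurable (borel :: (real * real) measure)" unfolding borel_prod[symmetric] by measurable

lemma qform_integrable:
 assumes e: "0 <= e" "e < 1" and f: "rdist f" and j: "integrable f jap"
  and psi: "psi : Bor" and b: "!!v. abs (psi v) <= C"
 shows "integrable (sq f) (%z. wt e z * (psi (snd z) - psi (fst z))^2)"
proof (rule integrable_by_jap2[OF f j qform_measurable[OF psi], where C="C^2"])
 fix z :: "real * real"
 show "abs (wt e z * (psi (snd z) - psi (fst z))^2) <= C^2 * (jap (fst z) + jap (snd z))"
  using gradient_weight_bound[where psi=psi and C=C, OF e b, of "fst z" "snd z"] by simp
qed

lemma qform_nonneg: "e < 1 ==> 0 <= qform e f psi" unfolding qform_def by (intro integral_nonneg_AE AE_I2) (simp add: \<sigma>_nonneg)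

lemma qform_le:
 assumes e: "0 <= e" "e < 1" and f: "rdist f" and j: "integrable f jap"
  and psi: "psi : Bor" and b: "!!v. abs (psi v) <= C"
 shows "qform e f psi <= 2 * C^2 * jmean f"
proof -
 have "qform e f psi <= (LINT z|(sq f). C^2 * (jap (fst z) + jap (snd z)))" unfolding qform_def
  by (intro integral_mono qform_integrable[OF e f j psi b] integrable_mult_right integrable_jap_sum f j gradient_weight_bound[where psi=psi and C=C, OF e b])
 also have "... = 2 * C^2 * jmean f" using integrable_jap_sum[OF f j] by simp
 finally show ?thesis .
qed

section \<open>Test functions with bounded derivative\<close>

text \<open>The function together with its derivative. Unlike compactly supported functions, this class contains
 the trigonometric functions, which determine measures, and \<open>jap\<close>, which controls moments.\<close>

definition lipC1 :: "(real => real) => (real => real) => real => bool" where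
 "lipC1 phi psi C \<longleftrightarrow> (ALL x. (phi has_real_derivative psi x) (at x)) & contU psi & (ALL x. abs (psi x) <= C)"

lemma lipC1D:
 assumes "lipC1 phi psi C"
 shows "(phi has_real_derivative psi x) (at x)" "contU psi" "abs (psi x) <= C" "0 <= C"
  "contU phi" "phi : Bor" "psi : Bor"
proof -
 show 1: "(phi has_real_derivative psi x) (at x)" "contU psi" "abs (psi x) <= C" for x using assms by (auto simp: lipC1_def)
 show "0 <= C" using 1(3)[of 0] by linarith
 show 2: "contU phi" using 1(1) by (auto intro!: continuous_at_imp_continuous_on DERIV_isCont)
 show "phi : Bor" "psi : Bor" using 1(2) 2 by (auto intro: cont_bor)
qed

lemma lipC1_lipschitz:
 assumes "lipC1 phi psi C" shows "abs (phi x - phi y) <= C * abs (x - y)"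
proof (cases x y rule: linorder_cases)
 case less
 obtain z where "phi y - phi x = (y - x) * psi z" using MVT2[OF less, of phi psi] lipC1D(1)[OF assms] by auto
 hence "abs (phi x - phi y) = abs (psi z) * abs (x - y)" by (metis abs_minus_commute abs_mult mult.commute)
 thus ?thesis using lipC1D(3)[OF assms, of z] by (simp add: mult_right_mono)
next
 case greater
 obtain z where "phi x - phi y = (x - y) * psi z" using MVT2[OF greater, of phi psi] lipC1D(1)[OF assms] by auto
 hence "abs (phi x - phi y) = abs (psi z) * abs (x - y)" by (metis abs_mult mult.commute)
 thus ?thesis using lipC1D(3)[OF assms, of z] by (simp add: mult_right_mono)
qed simp

lemma lipC1_growth:
 assumes "lipC1 phi psi C" shows "abs (phi x) <= (abs (phi 0) + C) * jap x"
proof -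
 have "abs (phi x) <= abs (phi 0) + C * abs x" using lipC1_lipschitz[OF assms, of x 0] by simp
 also have "... <= abs (phi 0) * jap x + C * jap x" using jap_pos[of x] lipC1D(4)[OF assms] mult_left_mono[OF jap_pos(2)[of x], of "abs (phi 0)"]
  by (intro add_mono mult_left_mono) auto
 finally show ?thesis by (simp add: algebra_simps)
qed

lemma lipC1_integrable:
 assumes "lipC1 phi psi C" "rdist f" "integrable f jap" shows "integrable f phi"
 by (rule integrable_by_jap[OF assms(2,3) lipC1D(6)[OF assms(1)] lipC1_growth[OF assms(1)]])

lemma lipC1_jap: "lipC1 jap (%v. v / jap v) 1"
proof -
 have p: "0 < 1 + x^2" for x :: real by (simp add: add_pos_nonneg)
 have "(jap has_real_derivative x / jap x) (at x)" for x unfolding jap_def using p[of x] by (auto intro!: derivative_eq_intros simp: field_simps)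
 moreover have "contU (%v. v / jap v)" unfolding jap_def using p by (intro continuous_intros) (auto simp: less_imp_neq[symmetric])
 moreover have "abs (x / jap x) <= 1" for x using jap_pos[of x] by (simp add: abs_divide)
 ultimately show ?thesis by (auto simp: lipC1_def)
qed

lemma lipC1_cos: "lipC1 (%x. cos (s * x)) (%x. - s * sin (s * x)) (abs s)"
 unfolding lipC1_def by (auto intro!: derivative_eq_intros continuous_intros simp: abs_mult intro: mult_left_le)

lemma lipC1_sin: "lipC1 (%x. sin (s * x)) (%x. s * cos (s * x)) (abs s)"
 unfolding lipC1_def by (auto intro!: derivative_eq_intros continuous_intros simp: abs_mult intro: mult_left_le)

text \<open>Levy's continuity theorem: sines and cosines are in the class.\<close>

lemma weak_conv_by_lipC1:
 assumes mu: "!!n. rdist (mu n)" "rdist M"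
  and c: "!!phi psi C. lipC1 phi psi C ==> (!!x. abs (phi x) <= 1) ==> (%n. LINT v|mu n. phi v) ---> (LINT v|M. phi v)"
 shows "weak_conv_m mu M"
proof (rule levy_continuity[OF mu])
 fix s
 have ch: "char N s = Complex (LINT v|N. cos (s * v)) (LINT v|N. sin (s * v))" if "rdist N" for N
 proof -
  interpret real_distribution N by fact
  have i: "integrable N (%v. cos (s * v))" "integrable N (%v. sin (s * v))" by (rule integrable_const_bound[of _ 1]; simp)+
  have "char N s = (LINT v|N. complex_of_real (cos (s * v)) + \<i> * complex_of_real (sin (s * v)))"
   unfolding char_def by (intro lint_cong) (simp_all add: exp_Euler cos_of_real sin_of_real flip: of_real_mult)
  also have "... = complex_of_real (LINT v|N. cos (s * v)) + \<i> * complex_of_real (LINT v|N. sin (s * v))"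
   using i by (subst Bochner_Integration.integral_add) (auto intro!: integrable_of_real)
  finally show ?thesis by (simp add: complex_eq_iff)
 qed
 have "(%n. Complex (LINT v|mu n. cos (s * v)) (LINT v|mu n. sin (s * v))) ---> Complex (LINT v|M. cos (s * v)) (LINT v|M. sin (s * v))"
  by (intro tendsto_Complex c[OF lipC1_cos] c[OF lipC1_sin]) auto
 thus "(%n. char (mu n) s) ---> char M s" using mu by (simp add: ch)
qed

lemma narrow_lim_iff_weak_conv:
 assumes mu: "!!n. rdist (mu n)" "rdist M"
 shows "narrow_lim mu M sequentially \<longleftrightarrow> weak_conv_m mu M"
proof
 assume "narrow_lim mu M sequentially"
 thus "weak_conv_m mu M" by (intro integral_bdd_continuous_conv_imp_weak_conv mu)
   (auto simp: narrow_lim_def bounded_iff intro: continuous_at_imp_continuous_on)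
next
 assume w: "weak_conv_m mu M"
 show "narrow_lim mu M sequentially" unfolding narrow_lim_def
 proof (intro allI impI)
  fix phi :: "real => real" assume phi: "contU phi & bounded (range phi)"
  then obtain B where "!!x. norm (phi x) <= B" by (auto simp: bounded_iff)
  thus "(%n. LINT v|mu n. phi v) ---> (LINT v|M. phi v)"
   using phi by (intro weak_conv_imp_integral_bdd_continuous_conv[OF mu w]) (auto simp: continuous_on_eq_continuous_at)
 qed
qed

lemma real_distribution_eqI:
 assumes "rdist M" "rdist N"
  and c: "!!phi psi C. lipC1 phi psi C ==> (!!x. abs (phi x) <= 1) ==> (LINT v|M. phi v) = (LINT v|N. phi v)"
 shows "M = N"
proof (rule Levy_uniqueness[OF assms(1,2)], rule ext)
 fix s
 have "weak_conv_m (%n. M) N" using assms by (intro weak_conv_by_lipC1) (simp_all add: c)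
 hence "(%n. char M s) ---> char N s" using assms by (intro levy_continuity1)
 thus "char M s = char N s" by (simp add: LIMSEQ_const_iff)
qed

section \<open>Continuity of double integrals under narrow and first-moment convergence\<close>

lemma skorohod_coupling:
 assumes mu: "!!n. rdist (mu n)" "rdist M" and w: "weak_conv_m mu M"
 shows "EX (Om :: real measure) (Y :: nat => real => real) (Z :: real => real).
  prob_space Om & (ALL n. Y n : borel_measurable Om) & Z : borel_measurable Om &
  (ALL n. mu n = distr Om borel (Y n)) & M = distr Om borel Z &
  (ALL n. sq (mu n) = distr (sq Om) borel (%z. (Y n (fst z), Y n (snd z)))) &
  sq M = distr (sq Om) borel (%z. (Z (fst z), Z (snd z))) &
  (ALL om:space Om. (%n. Y n om) ---> Z om)"
proof -
 from Skorohod[OF mu w] obtain Om :: "real measure" and Y :: "nat => real => real" and Z where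
  s: "prob_space Om" "ALL n. Y n : borel_measurable Om" "ALL n. distr Om borel (Y n) = mu n" "Z : measurable Om lborel"
  "distr Om borel Z = M" "ALL x:space Om. (%n. Y n x) ---> Z x" by blast
 have Z: "Z : borel_measurable Om" using s(4) by (simp add: measurable_lborel1)
 have pr: "sq N = distr (sq Om) borel (%z. (W (fst z), W (snd z)))"
  if N: "rdist N" "distr Om borel W = N" and W: "W : borel_measurable Om" for N W
 proof -
  interpret real_distribution N by fact
  have "distr Om borel W \<Otimes>\<^sub>M distr Om borel W = distr (sq Om) (borel \<Otimes>\<^sub>M borel) (%(x, y). (W x, W y))"
   by (rule pair_measure_distr[OF W W]) (use N sigma_finite_measure_axioms in simp)
  thus ?thesis unfolding N(2) borel_prod by (simp add: case_prod_beta')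
 qed
 have p: "sq (mu n) = distr (sq Om) borel (%z. (Y n (fst z), Y n (snd z)))" for n using pr[OF mu(1)] s by blast
 have pM: "sq M = distr (sq Om) borel (%z. (Z (fst z), Z (snd z)))" using pr[OF mu(2)] s Z by blast
 show ?thesis by (intro exI[of _ Om] exI[of _ Y] exI[of _ Z] conjI allI p pM Z) (use s in auto)
qed

text \<open>Under the Skorohod coupling the two variables converge almost surely and their moments converge, so
 a dominated convergence argument with a varying dominating function applies on the product space.\<close>

lemma weak_moment_conv:
 fixes H :: "nat => real => real => real" and H' :: "real => real => real"
 assumes mu: "!!n. rdist (mu n)" "rdist M" and w: "weak_conv_m mu M"
  and j: "!!n. integrable (mu n) jap" "integrable M jap" and jc: "(%n. jmean (mu n)) ---> jmean M"
  and Hm: "!!n. (%z. H n (fst z) (snd z)) : Bor" "(%z. H' (fst z) (snd z)) : Bor"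
  and Hb: "!!n x y. abs (H n x y) <= C * (jap x + jap y)"
  and Hc: "!!x y X Y. X ---> x ==> Y ---> y ==> (%n. H n (X n) (Y n)) ---> H' x y"
 shows "(%n. \<integral>z. H n (fst z) (snd z) \<partial>(sq (mu n))) ---> (LINT z|(sq M). H' (fst z) (snd z))"
proof -
 obtain Om :: "real measure" and Y :: "nat => real => real" and Z where
  Om: "prob_space Om" and [measurable]: "!!n. Y n : borel_measurable Om" "Z : borel_measurable Om" and
  d: "!!n. mu n = distr Om borel (Y n)" "M = distr Om borel Z"
  "!!n. sq (mu n) = distr (sq Om) borel (%z. (Y n (fst z), Y n (snd z)))"
  "sq M = distr (sq Om) borel (%z. (Z (fst z), Z (snd z)))"
  and lim: "!!om. om : space Om ==> (%n. Y n om) ---> Z om" using skorohod_coupling[OF mu w] by blast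
 interpret prob_space Om by fact
 interpret pp: pair_prob_space Om Om ..
 have C0: "0 <= C" using Hb[of 0 0 0] by (simp add: jap_def)
 have H'b: "abs (H' x y) <= C * (jap x + jap y)" for x y by (rule LIMSEQ_le_const2[OF tendsto_rabs[OF Hc[OF tendsto_const tendsto_const]]]) (use Hb in blast)
 have jY: "integrable Om (%om. jap (Y n om))" "(LINT om|Om. jap (Y n om)) = jmean (mu n)" for n
  using j(1)[of n] unfolding jmean_def d(1) by (simp_all add: integrable_distr_eq integral_distr)
 have jZ: "integrable Om (%om. jap (Z om))" "(LINT om|Om. jap (Z om)) = jmean M"
  using j(2) unfolding jmean_def d(2) by (simp_all add: integrable_distr_eq integral_distr)
 have jap_cont: "isCont jap x" for x using lipC1D(1)[OF lipC1_jap] by (rule DERIV_isCont)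
 have nnY: "(nni Om (%om. ennreal (norm (jap (Y n om))))) = ennreal (jmean (mu n))" for n
  using jY(2)[of n] by (subst nn_integral_eq_integral) (use jY(1)[of n] in "auto simp: jap_pos less_imp_le abs_of_pos")
 have nnZ: "(nni Om (%om. ennreal (norm (jap (Z om))))) = ennreal (jmean M)"
  using jZ(2) by (subst nn_integral_eq_integral) (use jZ(1) in "auto simp: jap_pos less_imp_le abs_of_pos")
 define dd where "dd n om = abs (jap (Y n om) - jap (Z om))" for n om
 have [measurable]: "dd n : borel_measurable Om" for n unfolding dd_def by measurable
 have ddi: "integrable Om (dd n)" for n unfolding dd_def using jY(1) jZ(1) by auto
 have dd0: "(%n. LINT om|Om. dd n om) ---> 0"
 proof -
  have "(%n. \<integral>\<^sup>+om. norm (jap (Y n om) - jap (Z om)) \<partial>Om) ---> 0"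
  proof (rule Scheffe_lemma1[OF jY(1) jZ(1)])
   show "AE om in Om. (%n. jap (Y n om)) ---> jap (Z om)" using lim by (intro AE_I2 isCont_tendsto_compose[OF jap_cont])
   have "(%n. ennreal (jmean (mu n))) ---> ennreal (jmean M)" using jc by (rule tendsto_ennrealI)
   thus "limsup (%n. \<integral>\<^sup>+om. ennreal (norm (jap (Y n om))) \<partial>Om) <= (nni Om (%om. ennreal (norm (jap (Z om)))))" unfolding nnY nnZ by (simp add: lim_imp_Limsup)
  qed
  moreover have "(nni Om (%om. norm (jap (Y n om) - jap (Z om)))) = ennreal (LINT om|Om. dd n om)" for n
   using ddi[of n] by (subst nn_integral_eq_integral[symmetric]) (auto simp: dd_def)
  ultimately show ?thesis by (simp add: tendsto_ennreal_iff[of _ _ 0, simplified] integral_nonneg_AE dd_def)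
 qed
 define E where "E n z = H n (Y n (fst z)) (Y n (snd z)) - H' (Z (fst z)) (Z (snd z))" for n z
 define D where "D z = 2 * C * (jap (Z (fst z)) + jap (Z (snd z)))" for z
 have Hmeas: "(%z. H n (V (fst z)) (V (snd z))) : borel_measurable (sq Om)" "(%z. H' (V (fst z)) (V (snd z))) : borel_measurable (sq Om)"
  if [measurable]: "V : borel_measurable Om" for V n
 proof -
  have m: "(%z. (V (fst z), V (snd z))) : measurable (sq Om) borel" unfolding borel_prod[symmetric] by measurable
  show "(%z. H n (V (fst z)) (V (snd z))) : borel_measurable (sq Om)" "(%z. H' (V (fst z)) (V (snd z))) : borel_measurable (sq Om)"
   using measurable_compose[OF m Hm(1)[of n]] measurable_compose[OF m Hm(2)] by simp_all
 qed
 have [measurable]: "E n : borel_measurable (sq Om)" for n unfolding E_def using Hmeas by measurable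
 have [measurable]: "D : borel_measurable (sq Om)" unfolding D_def by measurable
 have D0: "0 <= D z" for z using C0 by (simp add: D_def jap_pos less_imp_le add_nonneg_nonneg)
 have mj: "integrable (sq Om) (%z. h (fst z)) = integrable Om h" "integrable (sq Om) (%z. h (snd z)) = integrable Om h"
  "(LINT z|(sq Om). h (fst z)) = (LINT x|Om. h x)" "(LINT z|(sq Om). h (snd z)) = (LINT x|Om. h x)"
  if "h : borel_measurable Om" for h :: "real => real" using integral_pair_marginals[OF Om that] by simp_all
 have Di: "integrable (sq Om) D" unfolding D_def using mj(1,2)[of "%om. jap (Z om)"] jZ(1) by (intro integrable_mult_right integrable_plus) auto
 have ddp: "integrable (sq Om) (%z. C * (dd n (fst z) + dd n (snd z)))"
  "(LINT z|(sq Om). C * (dd n (fst z) + dd n (snd z))) = 2 * C * (LINT om|Om. dd n om)" for n using mj[of "dd n"] ddi[of n] by (simp_all add: algebra_simps)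
 have Eb: "abs (E n z) <= min (abs (E n z)) (D z) + C * (dd n (fst z) + dd n (snd z))" for n z
 proof -
  have "abs (E n z) <= C * (jap (Y n (fst z)) + jap (Y n (snd z))) + C * (jap (Z (fst z)) + jap (Z (snd z)))"
   unfolding E_def using Hb[of n "Y n (fst z)" "Y n (snd z)"] H'b[of "Z (fst z)" "Z (snd z)"] by linarith
  also have "... <= C * (jap (Z (fst z)) + dd n (fst z) + (jap (Z (snd z)) + dd n (snd z))) + C * (jap (Z (fst z)) + jap (Z (snd z)))"
   using C0 by (intro add_mono mult_left_mono order_refl) (auto simp: dd_def)
  also have "... = D z + C * (dd n (fst z) + dd n (snd z))" by (simp add: D_def algebra_simps)
  finally show ?thesis using C0 by (auto simp: min_def dd_def intro!: mult_nonneg_nonneg)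
 qed
 have mini: "integrable (sq Om) (%z. min (abs (E n z)) (D z))" for n by (rule integrable_bd[OF Di]) (auto intro!: AE_I2 simp: D0 min_def)
 have lim0: "(%n. LINT z|(sq Om). min (abs (E n z)) (D z)) ---> (LINT z|(sq Om). 0)"
 proof (rule integral_dominated_convergence[OF _ _ Di])
  show "AE z in sq Om. (%n. min (abs (E n z)) (D z)) ---> 0"
  proof (rule AE_I2)
   fix z assume z: "z : space (sq Om)"
   hence "(%n. Y n (fst z)) ---> Z (fst z)" "(%n. Y n (snd z)) ---> Z (snd z)" by (auto intro!: lim simp: space_pair_measure)
   hence "(%n. H n (Y n (fst z)) (Y n (snd z))) ---> H' (Z (fst z)) (Z (snd z))" by (rule Hc)
   hence "(%n. E n z) ---> 0" unfolding E_def by (simp add: LIM_zero_iff)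
   hence "(%n. min (abs (E n z)) (D z)) ---> min (abs 0) (D z)" by (intro tendsto_intros)
   thus "(%n. min (abs (E n z)) (D z)) ---> 0" using D0[of z] by simp
  qed
  show "AE z in sq Om. norm (min (abs (E n z)) (D z)) <= D z" for n using D0 by (auto intro!: AE_I2 simp: min_def)
 qed auto
 have Ei: "integrable (sq Om) (E n)" for n by (rule integrable_bd[OF integrable_plus[OF mini[of n] ddp(1)[of n]]])
   (use Eb in "auto intro!: AE_I2 order_trans[OF Eb] abs_ge_self")
 have up: "abs (LINT z|(sq Om). E n z) <= (LINT z|(sq Om). min (abs (E n z)) (D z)) + 2 * C * (LINT om|Om. dd n om)" for n
 proof -
  have "abs (LINT z|(sq Om). E n z) <= (LINT z|(sq Om). abs (E n z))" by (rule integral_abs_bound)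
  also have "... <= (LINT z|(sq Om). min (abs (E n z)) (D z) + C * (dd n (fst z) + dd n (snd z)))"
   using Ei[of n] mini[of n] ddp(1)[of n] Eb by (intro integral_mono) auto
  also have "... = (LINT z|(sq Om). min (abs (E n z)) (D z)) + 2 * C * (LINT om|Om. dd n om)" unfolding Bochner_Integration.integral_add[OF mini ddp(1)] ddp(2) ..
  finally show ?thesis .
 qed
 have "(%n. (LINT z|(sq Om). min (abs (E n z)) (D z)) + 2 * C * (LINT om|Om. dd n om)) ---> 0 + 2 * C * 0" using lim0 dd0 by (intro tendsto_intros) simp
 hence lim1: "(%n. (LINT z|(sq Om). min (abs (E n z)) (D z)) + 2 * C * (LINT om|Om. dd n om)) ---> 0" by simp
 have EE: "(%n. LINT z|(sq Om). E n z) ---> 0" by (rule Lim_null_comparison[OF _ lim1]) (use up in "auto intro!: always_eventually")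
 have H'i: "integrable (sq Om) (%z. H' (Z (fst z)) (Z (snd z)))" by (rule integrable_bd[OF Di])
   (use Hmeas H'b C0 in "auto intro!: AE_I2 order_trans[OF H'b] simp: D_def jap_pos less_imp_le add_nonneg_nonneg mult_right_mono")
 have Hi: "integrable (sq Om) (%z. H n (Y n (fst z)) (Y n (snd z)))" for n using integrable_plus[OF Ei[of n] H'i] by (simp add: E_def)
 have pm: "(%z. (V (fst z), V (snd z))) : measurable (sq Om) borel" if [measurable]: "V : borel_measurable Om" for V :: "real => real"
  unfolding borel_prod[symmetric] by measurable
 have "(LINT z|(sq (mu n)). H n (fst z) (snd z)) = (LINT z|(sq Om). H n (Y n (fst z)) (Y n (snd z)))" for n
  unfolding d(3) using integral_distr[OF pm Hm(1)[of n], of "Y n"] by simp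
 moreover have "(LINT z|(sq M). H' (fst z) (snd z)) = (LINT z|(sq Om). H' (Z (fst z)) (Z (snd z)))" unfolding d(4) using integral_distr[OF pm Hm(2), of Z] by simp
 moreover have "(LINT z|(sq Om). E n z) = (LINT z|(sq Om). H n (Y n (fst z)) (Y n (snd z))) - (LINT z|(sq Om). H' (Z (fst z)) (Z (snd z)))" for n
  unfolding E_def using Hi H'i by simp
 ultimately show ?thesis using EE by (simp add: LIM_zero_iff)
qed

lemma weak_moment_conv1:
 fixes h :: "nat => real => real" and h' :: "real => real"
 assumes mu: "!!n. rdist (mu n)" "rdist M" and w: "weak_conv_m mu M"
  and j: "!!n. integrable (mu n) jap" "integrable M jap" and jc: "(%n. jmean (mu n)) ---> jmean M"
  and hm: "!!n. h n : Bor" "h' : Bor"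
  and hb: "!!n x. abs (h n x) <= C * jap x"
  and hc: "!!x X. X ---> x ==> (%n. h n (X n)) ---> h' x"
 shows "(%n. LINT v|mu n. h n v) ---> (LINT v|M. h' v)"
proof -
 have "0 <= C" using hb[of 0 0] by (simp add: jap_def)
 hence b: "abs (h n x) <= C * (jap x + jap y)" for n x y using hb[of n x] jap_pos(1)[of y] mult_left_mono[of "jap x" "jap x + jap y" C] by simp
 have "(%n. \<integral>z. h n (fst z) \<partial>(sq (mu n))) ---> (LINT z|(sq M). h' (fst z))"
 proof (intro weak_moment_conv[OF mu w j jc, where C=C] b hc)
  have [measurable]: "k : Bor ==> (%z. k (fst z)) : borel_measurable (borel :: (real * real) measure)" for k :: "real => real"
   by (rule measurable_compose[OF borel_measurable_fst_snd'(1)])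
  show "(%z. h n (fst z)) : borel_measurable (borel :: (real * real) measure)" "(%z. h' (fst z)) : borel_measurable (borel :: (real * real) measure)" for n
   using hm by auto
 qed
 moreover have "(LINT z|(sq N). k (fst z)) = (LINT v|N. k v)" if "rdist N" "k : Bor" for N and k :: "real => real"
  using integral_pair_marginals(3)[OF real_distribution_prob[OF that(1)] real_distribution_measurable(1)[OF that]] .
 ultimately show ?thesis using mu hm by simp
qed

lemma qform_conv:
 assumes e: "0 <= e" "e < 1" and mu: "!!n. rdist (mu n)" "rdist M" and w: "weak_conv_m mu M"
  and j: "!!n. integrable (mu n) jap" "integrable M jap" and jc: "(%n. jmean (mu n)) ---> jmean M"
  and m: "!!n. psi n : Bor" "psi' : Bor"
  and b: "!!n x. abs (psi n x) <= C" and c: "!!x X. X ---> x ==> (%n. psi n (X n)) ---> psi' x"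
 shows "(%n. qform e (mu n) (psi n)) ---> qform e M psi'" unfolding qform_def
proof (rule weak_moment_conv[OF mu w j jc, where C="C^2" and H="%n x y. \<sigma> e (abs (x - y)) * (psi n y - psi n x)^2" and H'="%x y. \<sigma> e (abs (x - y)) * (psi' y - psi' x)^2"])
 show "(%z. wt e z * (psi n (snd z) - psi n (fst z))^2) : Bor" for n by (rule qform_measurable[OF m(1)])
 show "(%z. wt e z * (psi' (snd z) - psi' (fst z))^2) : Bor" by (rule qform_measurable[OF m(2)])
 show "abs (\<sigma> e (abs (x - y)) * (psi n y - psi n x)^2) <= C^2 * (jap x + jap y)" for n x y
  using gradient_weight_bound[where psi="psi n" and C=C, OF e b, of x y] by simp
 show "(%n. \<sigma> e (abs (X n - Y n)) * (psi n (Y n) - psi n (X n))^2) ---> \<sigma> e (abs (x - y)) * (psi' y - psi' x)^2" if "X ---> x" "Y ---> y" for x y X Y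
  unfolding \<sigma>_def by (intro tendsto_intros that c)
qed

lemma nn_integral_liminf_weak:
 assumes mu: "!!n. rdist (mu n)" "rdist M" and w: "weak_conv_m mu M"
  and h: "contU h" and h0: "!!z. 0 <= h z"
 shows "(nni (sq M) (%z. ennreal (h z))) <= liminf (%n. \<integral>\<^sup>+z. ennreal (h z) \<partial>(sq (mu n)))"
proof -
 obtain Om :: "real measure" and Y :: "nat => real => real" and Z where
  Om: "prob_space Om" and [measurable]: "!!n. Y n : borel_measurable Om" "Z : borel_measurable Om" and
  d: "!!n. mu n = distr Om borel (Y n)" "M = distr Om borel Z"
  "!!n. sq (mu n) = distr (sq Om) borel (%z. (Y n (fst z), Y n (snd z)))"
  "sq M = distr (sq Om) borel (%z. (Z (fst z), Z (snd z)))"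
  and lim: "!!om. om : space Om ==> (%n. Y n om) ---> Z om" using skorohod_coupling[OF mu w] by blast
 have hm[measurable]: "h : Bor" by (rule cont_bor[OF h])
 have pm[measurable]: "(%z. (V (fst z), V (snd z))) : measurable (sq Om) borel" if [measurable]: "V : borel_measurable Om" for V :: "real => real"
  unfolding borel_prod[symmetric] by measurable
 have "(nni (sq M) (%z. ennreal (h z))) = (nni (sq Om) (%z. ennreal (h (Z (fst z), Z (snd z)))))" unfolding d(4) by (rule nn_integral_distr[OF pm]) auto
 also have "... = (nni (sq Om) (%z. liminf (%n. ennreal (h (Y n (fst z), Y n (snd z))))))"
 proof (rule nn_integral_cong)
  fix z assume "z : space (sq Om)"
  hence "(%n. Y n (fst z)) ---> Z (fst z)" "(%n. Y n (snd z)) ---> Z (snd z)" by (auto intro!: lim simp: space_pair_measure)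
  hence "(%n. h (Y n (fst z), Y n (snd z))) ---> h (Z (fst z), Z (snd z))"
   using h by (intro isCont_tendsto_compose[where g=h] tendsto_Pair) (auto simp: continuous_on_eq_continuous_at)
  thus "ennreal (h (Z (fst z), Z (snd z))) = liminf (%n. ennreal (h (Y n (fst z), Y n (snd z))))" by (intro lim_imp_Liminf[symmetric] tendsto_ennrealI) auto
 qed
 also have "... <= liminf (%n. \<integral>\<^sup>+z. ennreal (h (Y n (fst z), Y n (snd z))) \<partial>(sq Om))" by (rule nn_integral_liminf) measurable
 also have "(%n. \<integral>\<^sup>+z. ennreal (h (Y n (fst z), Y n (snd z))) \<partial>(sq Om)) = (%n. \<integral>\<^sup>+z. ennreal (h z) \<partial>(sq (mu n)))"
  unfolding d(3) by (intro ext nn_integral_distr[symmetric, OF pm]) auto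
 finally show ?thesis .
qed

text \<open>Bounded second moments make the first moments uniformly integrable.\<close>

lemma second_moment_limit:
 assumes mu: "!!n. rdist (mu n)" "rdist M" and w: "weak_conv_m mu M"
  and i: "!!n. integrable (mu n) (%v. v^2)" and B: "!!n. (LINT v|mu n. v^2) <= B"
 shows "integrable M (%v. v^2)" "ennreal (LINT v|M. v^2) <= liminf (%n. ennreal (LINT v|mu n. v^2))"
  "integrable (mu n) jap" "integrable M jap" "(%n. jmean (mu n)) ---> jmean M"
  "(%n. LINT v|mu n. v) ---> (LINT v|M. v)"
proof -
 have nn: "(nni (sq N) (%z. ennreal ((fst z)^2))) = (nni N (%v. ennreal (v^2)))" if "rdist N" for N
 proof -
  have "(%v. v^2) : borel_measurable N" using that by (rule real_distribution_measurable) measurable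
  from integral_pair_marginals(5)[OF real_distribution_prob[OF that] this] show ?thesis .
 qed
 have nni: "(nni (mu n) (%v. ennreal (v^2))) = ennreal (LINT v|mu n. v^2)" for n by (rule nn_integral_eq_integral[OF i]) simp
 have "(nni (sq M) (%z. ennreal ((fst z)^2))) <= liminf (%n. \<integral>\<^sup>+z. ennreal ((fst z)^2) \<partial>(sq (mu n)))"
  by (rule nn_integral_liminf_weak[OF mu w]) (auto intro!: continuous_intros)
 hence le: "(nni M (%v. ennreal (v^2))) <= liminf (%n. ennreal (LINT v|mu n. v^2))" using mu by (simp add: nn nni)
 also have "... <= ennreal B" using B by (intro Liminf_le) (auto intro!: always_eventually ennreal_leI)
 finally have leB: "(nni M (%v. ennreal (v^2))) <= ennreal B" .
 have sqm: "(%v. v^2) : borel_measurable M" using mu(2) by (rule real_distribution_measurable) measurable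
 show i': "integrable M (%v. v^2)" using leB sqm by (intro integrableI_bounded) (auto intro: le_less_trans)
 show "ennreal (LINT v|M. v^2) <= liminf (%n. ennreal (LINT v|mu n. v^2))" using le by (subst (asm) nn_integral_eq_integral[OF i']) auto
 have B': "(LINT v|M. v^2) <= B"
 proof -
  have "0 <= (LINT v|mu 0. v^2)" by (rule lint_nonneg) auto
  hence "0 <= B" using B[of 0] by (rule order_trans)
  thus ?thesis using leB by (subst (asm) nn_integral_eq_integral[OF i']) auto
 qed
 have ji: "integrable N jap" if N: "rdist N" "integrable N (%v. v^2)" for N
 proof -
  interpret real_distribution N by fact
  have "jap v <= 1 + v^2" for v unfolding jap_def by (rule real_le_lsqrt) (auto intro: self_le_power)
  thus ?thesis by (intro integrable_bd[OF integrable_plus[OF integrable_const[of 1] N(2)]])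
    (auto intro!: AE_I2 simp: jap_pos less_imp_le abs_of_pos)
 qed
 show j: "integrable (mu n) jap" "integrable M jap" for n using ji mu i i' by auto
 have tail: "abs (jmean N - (LINT v|N. min (jap v) R)) <= (1 + B) / R"
  if N: "rdist N" "integrable N (%v. v^2)" "(LINT v|N. v^2) <= B" and R: "0 < R" for N R
 proof -
  interpret real_distribution N by fact
  have ib: "integrable N (%v. min (jap v) R)" by (rule integrable_const_bound[of _ R]) (use R in "auto intro!: AE_I2 simp: jap_pos less_imp_le min_def abs_of_pos")
  have "jmean N - (LINT v|N. min (jap v) R) = (LINT v|N. jap v - min (jap v) R)" unfolding jmean_def using ji[OF N(1,2)] ib by simp
  moreover have "(LINT v|N. jap v - min (jap v) R) <= (LINT v|N. (1 + v^2) / R)"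
  proof (rule integral_mono)
   show "jap v - min (jap v) R <= (1 + v^2) / R" for v
   proof (cases "jap v <= R")
    case False
    have "jap v * R <= jap v * jap v" using False jap_pos[of v] by (intro mult_left_mono) auto
    also have "... = 1 + v^2" by (simp add: jap_def)
    finally have "jap v <= (1 + v^2) / R" using R by (simp add: field_simps)
    thus ?thesis using False R by (simp add: min_def)
   qed (use R in simp)
  qed (use ji[OF N(1,2)] ib N(2) in auto)
  moreover have "(LINT v|N. (1 + v^2) / R) <= (1 + B) / R" using N R prob_space by (simp add: divide_right_mono)
  moreover have "0 <= (LINT v|N. jap v - min (jap v) R)" by (intro integral_nonneg_AE) auto
  ultimately show ?thesis by simp
 qed
 show jc: "(%n. jmean (mu n)) ---> jmean M"
 proof (rule LIMSEQ_I)
  fix r :: real assume r: "0 < r"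
  define R where "R = 4 * (1 + abs B) / r"
  have R: "0 < R" using r by (simp add: R_def)
  have RB: "(1 + B) / R <= r / 4" using r by (simp add: R_def field_simps)
  have "(%n. LINT v|mu n. min (jap v) R) ---> (LINT v|M. min (jap v) R)"
  proof (rule weak_conv_imp_integral_bdd_continuous_conv[OF mu w, where B=R])
   show "isCont (%v. min (jap v) R) x" for x by (intro continuous_min continuous_const DERIV_isCont[OF lipC1D(1)[OF lipC1_jap]])
   show "norm (min (jap v) R) <= R" for v using R jap_pos(1)[of v] by (simp add: min_def)
  qed
  then obtain n0 where n0: "!!n. n >= n0 ==> norm ((LINT v|mu n. min (jap v) R) - (LINT v|M. min (jap v) R)) < r / 4" using r LIMSEQ_D[of _ _ "r/4"] by fastforce
  show "EX n0. ALL n>=n0. norm (jmean (mu n) - jmean M) < r"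
  proof (intro exI allI impI)
   fix n assume "n0 <= n"
   from n0[OF this] tail[OF mu(1) i B R, of n] tail[OF mu(2) i' B' R] RB r
   show "norm (jmean (mu n) - jmean M) < r" unfolding real_norm_def by linarith
  qed
 qed
 show "(%n. LINT v|mu n. v) ---> (LINT v|M. v)" by (rule weak_moment_conv1[OF mu w j jc, where C=1]) (auto simp: jap_pos)
qed

section \<open>Narrowly continuous curves as kernels\<close>

lemma narrowly_continuous_kernel:
 fixes g :: "real => real measure"
 assumes rd: "!!t. rdist (g t)"
  and c: "!!phi :: real => real. contU phi ==> bounded (range phi) ==> contU (%t. LINT v|g t. phi v)"
 shows "g : borel \<rightarrow>\<^sub>M prob_algebra borel"
proof (rule measurable_prob_algebra_generated)
 show "sets (borel :: real measure) = sigma_sets UNIV (range (%a. {..a}))" by (subst borel_eq_atMost) simp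
 show "Int_stable (range (%a::real. {..a}))" by (auto simp: Int_stable_def)
 show "prob_space (g a)" "sets (g a) = sets borel" for a using rd[of a] by (auto simp: real_distribution_def real_distribution_axioms_def)
 fix A :: "real set" assume "A : range (%a. {..a})"
 then obtain x where A: "A = {..x}" by auto
 have m: "(%t. LINT v|g t. cts_step x (x + inverse (real (Suc n))) v) : Bor" for n
 proof (rule cont_bor, rule c)
  show "contU (cts_step x (x + inverse (real (Suc n))))" by (intro uniformly_continuous_imp_continuous cts_step_uniformly_continuous) simp
  show "bounded (range (cts_step x (x + inverse (real (Suc n)))))" by (intro boundedI[of _ 1]) (auto simp: cts_step_def)
 qed
 have lim: "(%n. LINT v|g t. cts_step x (x + inverse (real (Suc n))) v) ---> cdf (g t) x" for t
 proof -
  interpret real_distribution "g t" by (rule rd)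
  have "(%n. cdf (g t) (x + inverse (real (Suc n)))) ---> cdf (g t) x" using cdf_is_right_cont[of x] unfolding continuous_within
  proof (rule filterlim_compose)
   show "filterlim (%n. x + inverse (real (Suc n))) (at_right x) sequentially"
    unfolding filterlim_at by (intro conjI always_eventually allI LIMSEQ_inverse_real_of_nat_add) auto
  qed
  thus ?thesis by (rule tendsto_sandwich[OF always_eventually always_eventually tendsto_const, rotated 2])
    (auto intro!: cdf_cts_step)
 qed
 have "(%t. cdf (g t) x) : Bor" by (rule borel_measurable_LIMSEQ_real[OF lim m])
 moreover have "emeasure (g t) A = ennreal (cdf (g t) x)" for t
 proof -
  interpret real_distribution "g t" by (rule rd)
  show ?thesis by (simp add: A cdf_def emeasure_eq_measure)
 qed
 ultimately show "(%t. emeasure (g t) A) : Bor" by simp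
qed auto

section \<open>Test functions in space-time\<close>

definition C1fun :: "(real * real => real) => bool" where
 "C1fun u \<longleftrightarrow> (EX D :: real * real => (real * real) \<Rightarrow>\<^sub>L real.
  (ALL z. (u has_derivative blinfun_apply (D z)) (at z)) & contU D)"

lemma C1fun_continuous: "C1fun u ==> contU u" unfolding C1fun_def by (metis continuous_at_imp_continuous_on has_derivative_continuous)

lemma C1fun_mult:
 assumes "C1fun u" "C1fun v" shows "C1fun (%z. u z * v z)"
proof -
 obtain Du where u: "!!z. (u has_derivative blinfun_apply (Du z)) (at z)" "contU Du" using assms by (auto simp: C1fun_def)
 obtain Dv where v: "!!z. (v has_derivative blinfun_apply (Dv z)) (at z)" "contU Dv" using assms by (auto simp: C1fun_def)
 have "((%z. u z * v z) has_derivative blinfun_apply (u z *\<^sub>R Dv z + v z *\<^sub>R Du z)) (at z)" for z using has_derivative_mult[OF u(1)[of z] v(1)[of z]]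
  by (rule has_derivative_eq_rhs) (auto simp: fun_eq_iff blinfun.add_left blinfun.scaleR_left)
 moreover have "contU (%z. u z *\<^sub>R Dv z + v z *\<^sub>R Du z)" using assms[THEN C1fun_continuous] u v by (intro continuous_intros)
 ultimately show ?thesis unfolding C1fun_def by (intro exI[of _ "%z. u z *\<^sub>R Dv z + v z *\<^sub>R Du z"]) auto
qed

lemma C1fun_lin:
 assumes "C1fun u" "C1fun v" shows "C1fun (%z. a * u z + b * v z)"
proof -
 obtain Du where u: "!!z. (u has_derivative blinfun_apply (Du z)) (at z)" "contU Du" using assms by (auto simp: C1fun_def)
 obtain Dv where v: "!!z. (v has_derivative blinfun_apply (Dv z)) (at z)" "contU Dv" using assms by (auto simp: C1fun_def)
 have "((%z. a * u z + b * v z) has_derivative blinfun_apply (a *\<^sub>R Du z + b *\<^sub>R Dv z)) (at z)" for z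
  using has_derivative_add[OF has_derivative_mult_right[OF u(1)[of z], of a] has_derivative_mult_right[OF v(1)[of z], of b]]
  by (rule has_derivative_eq_rhs) (auto simp: fun_eq_iff blinfun.add_left blinfun.scaleR_left)
 moreover have "contU (%z. a *\<^sub>R Du z + b *\<^sub>R Dv z)" using u v by (intro continuous_intros)
 ultimately show ?thesis unfolding C1fun_def by (intro exI[of _ "%z. a *\<^sub>R Du z + b *\<^sub>R Dv z"]) auto
qed

lemma C1fun_fst:
 assumes "!!t. (eta has_real_derivative eta' t) (at t)" "contU eta'" shows "C1fun (%z. eta (fst z))" unfolding C1fun_def
proof (intro exI conjI allI)
 fix z :: "real * real"
 have "((%z. eta (fst z)) has_derivative (%h. fst h * eta' (fst z))) (at z)"
 proof -
  have "(eta has_derivative (%h. h * eta' (fst z))) (at (fst z))" using assms(1)[of "fst z"] by (simp add: has_field_derivative_def mult_commute_abs)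
  thus ?thesis by (rule has_derivative_compose[OF has_derivative_fst[OF has_derivative_ident]])
 qed
 thus "((%z. eta (fst z)) has_derivative blinfun_apply (eta' (fst z) *\<^sub>R fst_blinfun)) (at z)"
  by (rule has_derivative_eq_rhs) (auto simp: fun_eq_iff blinfun.scaleR_left)
 show "contU (%z :: real * real. eta' (fst z) *\<^sub>R (fst_blinfun :: (real * real) \<Rightarrow>\<^sub>L real))" by (intro continuous_intros continuous_on_compose2[OF assms(2)]) auto
qed

lemma C1fun_snd:
 assumes "!!t. (eta has_real_derivative eta' t) (at t)" "contU eta'" shows "C1fun (%z. eta (snd z))" unfolding C1fun_def
proof (intro exI conjI allI)
 fix z :: "real * real"
 have "((%z. eta (snd z)) has_derivative (%h. snd h * eta' (snd z))) (at z)"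
 proof -
  have "(eta has_derivative (%h. h * eta' (snd z))) (at (snd z))" using assms(1)[of "snd z"] by (simp add: has_field_derivative_def mult_commute_abs)
  thus ?thesis by (rule has_derivative_compose[OF has_derivative_snd[OF has_derivative_ident]])
 qed
 thus "((%z. eta (snd z)) has_derivative blinfun_apply (eta' (snd z) *\<^sub>R snd_blinfun)) (at z)"
  by (rule has_derivative_eq_rhs) (auto simp: fun_eq_iff blinfun.scaleR_left)
 show "contU (%z :: real * real. eta' (snd z) *\<^sub>R (snd_blinfun :: (real * real) \<Rightarrow>\<^sub>L real))" by (intro continuous_intros continuous_on_compose2[OF assms(2)]) auto
qed

lemma C1fun_partials:
 assumes "C1fun u"
 shows "EX ut uv. contU ut & contU uv &
  (ALL t v. ((%s. u (s, v)) has_real_derivative ut (t, v)) (at t)) &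
  (ALL t v. ((%x. u (t, x)) has_real_derivative uv (t, v)) (at v))"
proof -
 obtain D where D: "!!z. (u has_derivative blinfun_apply (D z)) (at z)" "contU D" using assms by (auto simp: C1fun_def)
 have 1: "((%s. u (s, v)) has_real_derivative D (t, v) (1, 0)) (at t)" for t v
 proof -
  have "((%s. u (s, v)) has_derivative (%h. D (t, v) (h, 0))) (at t)"
   by (rule has_derivative_compose[where g=u and f="%s. (s, v)", OF has_derivative_Pair[OF has_derivative_ident has_derivative_const] D(1)])
  moreover have "(%h. D (t, v) (h, 0)) = (*) (D (t, v) (1, 0))"
  proof
   fix h show "D (t, v) (h, 0) = D (t, v) (1, 0) * h"
    using blinfun.scaleR_right[of "D (t, v)" h "(1, 0)"] by (metis mult.commute mult.right_neutral mult_zero_right real_scaleR_def scaleR_Pair)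
  qed
  ultimately show ?thesis unfolding has_field_derivative_def by simp
 qed
 have 2: "((%x. u (t, x)) has_real_derivative D (t, v) (0, 1)) (at v)" for t v
 proof -
  have "((%x. u (t, x)) has_derivative (%h. D (t, v) (0, h))) (at v)"
   by (rule has_derivative_compose[where g=u and f="%x. (t, x)", OF has_derivative_Pair[OF has_derivative_const has_derivative_ident] D(1)])
  moreover have "(%h. D (t, v) (0, h)) = (*) (D (t, v) (0, 1))"
  proof
   fix h show "D (t, v) (0, h) = D (t, v) (0, 1) * h"
    using blinfun.scaleR_right[of "D (t, v)" h "(0, 1)"] by (metis mult.commute mult.right_neutral mult_zero_right real_scaleR_def scaleR_Pair)
  qed
  ultimately show ?thesis unfolding has_field_derivative_def by simp
 qed
 have c: "contU (%z. D z h)" for h by (intro continuous_intros D(2))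
 show ?thesis by (rule exI[of _ "%z. D z (1, 0)"], rule exI[of _ "%z. D z (0, 1)"]) (use 1 2 c in auto)
qed

lemma C1c_alt: "phi : C1c T \<longleftrightarrow> C1fun phi & (EX K. compact K & K \<subseteq> {0<..<T} \<times> UNIV & (ALL z. z \<notin> K --> phi z = 0))" by (auto simp: C1c_def C1fun_def)

text \<open>The partial derivatives of a test function, together with a box containing its support.\<close>

definition test_data where
 "test_data T phi phit phiv a b R C \<longleftrightarrow> 0 < a & a <= b & b < T & 0 < R & 0 <= C &
  contU phi & contU phit & contU phiv &
  (ALL t v. ((%s. phi (s, v)) has_real_derivative phit (t, v)) (at t)) &
  (ALL t v. ((%x. phi (t, x)) has_real_derivative phiv (t, v)) (at v)) &
  (ALL t v. t \<notin> {a..b} | v \<notin> {-R..R} --> phi (t, v) = 0 & phit (t, v) = 0 & phiv (t, v) = 0) &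
  (ALL z. abs (phi z) <= C & abs (phit z) <= C & abs (phiv z) <= C)"

lemma test_data_exists:
 assumes "phi : C1c T" "0 < T"
 shows "EX phit phiv a b R C. test_data T phi phit phiv a b R C"
proof -
 obtain K where K: "compact K" "K \<subseteq> {0<..<T} \<times> UNIV" "!!z. z \<notin> K ==> phi z = 0" and C1: "C1fun phi" using assms(1) by (auto simp: C1c_alt)
 obtain phit phiv where P: "contU phit" "contU phiv"
  "!!t v. ((%s. phi (s, v)) has_real_derivative phit (t, v)) (at t)"
  "!!t v. ((%x. phi (t, x)) has_real_derivative phiv (t, v)) (at v)" using C1fun_partials[OF C1] by blast
 have "EX a b. 0 < a & a <= b & b < T & (ALL z:K. fst z : {a..b})"
 proof (cases "K = {}")
  case True thus ?thesis using assms(2) by (intro exI[of _ "T/2"]) auto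
 next
  case False
  have c: "compact (fst ` K)" "fst ` K ~= {}" using K(1) False by (auto intro!: compact_continuous_image continuous_intros)
  obtain a where a: "a : fst ` K" "ALL x:fst ` K. a <= x" using compact_attains_inf[OF c] by auto
  obtain b where b: "b : fst ` K" "ALL x:fst ` K. x <= b" using compact_attains_sup[OF c] by auto
  show ?thesis using a b K(2) by (intro exI[of _ a] exI[of _ b]) auto
 qed
 then obtain a b where ab: "0 < a" "a <= b" "b < T" "!!z. z : K ==> fst z : {a..b}" by auto
 have "bounded (snd ` K)" using K(1) by (auto intro!: compact_imp_bounded compact_continuous_image continuous_intros)
 then obtain R0 where R0: "!!z. z : K ==> abs (snd z) <= R0" by (auto simp: bounded_iff)
 define R where "R = abs R0 + 1"
 have R: "0 < R" "!!z. z : K ==> snd z : {-R..R}" using R0 by (auto simp: R_def abs_le_iff intro: order_trans) (smt (verit) R0)+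
 have z0: "phi (t, v) = 0" if "t \<notin> {a..b} | v \<notin> {-R..R}" for t v using that ab(4)[of "(t, v)"] R(2)[of "(t, v)"] K(3)[of "(t, v)"] by auto
 have zt: "phit (t, v) = 0" if h: "t \<notin> {a..b} | v \<notin> {-R..R}" for t v
 proof -
  define S where "S = (if t \<notin> {a..b} then - {a..b} else UNIV)"
  have "open S" "t : S" by (auto simp: S_def intro: open_Compl)
  moreover have "phi (s, v) = 0" if "s : S" for s using that h by (intro z0) (auto simp: S_def split: if_splits)
  ultimately have "((%s. phi (s, v)) has_real_derivative 0) (at t)" using has_field_derivative_transform_within_open[of "%s. 0" 0 t S "%s. phi (s, v)"] by simp
  thus ?thesis using P(3) DERIV_unique by blast
 qed
 have zv: "phiv (t, v) = 0" if h: "t \<notin> {a..b} | v \<notin> {-R..R}" for t v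
 proof -
  define S where "S = (if v \<notin> {-R..R} then - {-R..R} else UNIV)"
  have "open S" "v : S" by (auto simp: S_def intro: open_Compl)
  moreover have "phi (t, s) = 0" if "s : S" for s using that h by (intro z0) (auto simp: S_def split: if_splits)
  ultimately have "((%s. phi (t, s)) has_real_derivative 0) (at v)" using has_field_derivative_transform_within_open[of "%s. 0" 0 v S "%s. phi (t, s)"] by simp
  thus ?thesis using P(4) DERIV_unique by blast
 qed
 have bdd: "EX B. ALL z. abs (h z) <= B" if "contU h" "!!t v. t \<notin> {a..b} | v \<notin> {-R..R} ==> h (t, v) = 0" for h :: "real * real => real"
 proof -
  have "compact (h ` ({a..b} \<times> {-R..R}))" by (intro compact_continuous_image compact_Times continuous_on_subset[OF that(1)]) auto
  then obtain B where B: "!!z. z : {a..b} \<times> {-R..R} ==> abs (h z) <= B" by (force dest!: compact_imp_bounded simp: bounded_iff)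
  have "abs (h z) <= max B 0" for z
  proof (cases "z : {a..b} \<times> {-R..R}")
   case True thus ?thesis using B[OF True] by simp
  next
   case False
   hence "h z = 0" using that(2)[of "fst z" "snd z"] by (cases z) auto
   thus ?thesis by simp
  qed
  thus ?thesis by blast
 qed
 have cphi: "contU phi" by (rule C1fun_continuous[OF C1])
 obtain B1 B2 B3 where B: "!!z. abs (phi z) <= B1" "!!z. abs (phit z) <= B2" "!!z. abs (phiv z) <= B3" using bdd[OF cphi z0] bdd[OF P(1) zt] bdd[OF P(2) zv] by blast
 define C where "C = max (max B1 B2) (max B3 0)"
 have "0 <= C" "!!z. abs (phi z) <= C & abs (phit z) <= C & abs (phiv z) <= C" using B by (auto simp: C_def le_max_iff_disj)
 hence "test_data T phi phit phiv a b R C" unfolding test_data_def using ab R cphi P z0 zt zv by auto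
 thus ?thesis by blast
qed

lemma test_data_deriv:
 assumes "test_data T phi phit phiv a b R C"
 shows "deriv (%s. phi (s, v)) t = phit (t, v)" "deriv (%x. phi (t, x)) v = phiv (t, v)" using assms by (auto simp: test_data_def intro: DERIV_imp_deriv)

lemma test_data_lipC1:
 assumes "test_data T phi phit phiv a b R C"
 shows "lipC1 (%x. phi (t, x)) (%x. phiv (t, x)) C" using assms unfolding test_data_def lipC1_def
 by (auto intro!: continuous_on_compose2[where g=phiv and t=UNIV] continuous_intros)

lemma C1c_times_step:
 assumes u: "C1fun u" and R: "!!t v. R < abs v ==> u (t, v) = 0"
  and eta: "!!t. (eta has_real_derivative eta' t) (at t)" "contU eta'"
  and ab: "0 < a" "b < T" "!!t. t \<notin> {a..b} ==> eta t = 0"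
 shows "(%z. eta (fst z) * u z) : C1c T" unfolding C1c_alt
proof (intro conjI exI allI impI)
 show "C1fun (%z. eta (fst z) * u z)" by (intro C1fun_mult C1fun_fst[OF eta] u)
 show "compact ({a..b} \<times> {-R..R})" by (intro compact_Times) auto
 show "{a..b} \<times> {-R..R} \<subseteq> {0<..<T} \<times> UNIV" using ab by auto
 fix z assume "z \<notin> {a..b} \<times> {-R..R}"
 thus "eta (fst z) * u z = 0" using ab(3) R by (cases z) (auto simp: not_le abs_if split: if_splits)
qed

lemma C1c_lin: "phi : C1c T ==> psi : C1c T ==> (%z. a * phi z + b * psi z) : C1c T" unfolding C1c_alt
proof (elim conjE exE, intro conjI)
 fix K K' assume "compact K" "compact K'" "K \<subseteq> {0<..<T} \<times> UNIV" "K' \<subseteq> {0<..<T} \<times> UNIV"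
  "ALL z. z \<notin> K --> phi z = 0" "ALL z. z \<notin> K' --> psi z = 0"
 thus "EX K. compact K & K \<subseteq> {0<..<T} \<times> UNIV & (ALL z. z \<notin> K --> a * phi z + b * psi z = 0)" by (intro exI[of _ "K \<union> K'"]) auto
qed (rule C1fun_lin)

section \<open>Cut-offs in velocity and steps in time\<close>

lemma DERIV_pos_part_sq: "((%x::real. (max 0 x)^2) has_real_derivative 2 * max 0 x) (at x)"
proof (cases x "0::real" rule: linorder_cases)
 case less
 have "((%x::real. 0) has_real_derivative 0) (at x)" by simp
 hence "((%x::real. (max 0 x)^2) has_real_derivative 0) (at x)" by (rule has_field_derivative_transform_within_open[of _ _ _ "{..<0}"]) (use less in auto)
 thus ?thesis using less by simp
next
 case greater
 have "((%x::real. x^2) has_real_derivative 2 * x) (at x)" by (auto intro!: derivative_eq_intros)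
 hence "((%x::real. (max 0 x)^2) has_real_derivative 2 * x) (at x)" by (rule has_field_derivative_transform_within_open[of _ _ _ "{0<..}"]) (use greater in auto)
 thus ?thesis using greater by simp
next
 case equal
 have "(%h::real. (max 0 h)^2 / h) \<midarrow>0\<rightarrow> 0"
 proof (rule Lim_null_comparison)
  show "\<forall>\<^sub>F h in at 0. norm ((max 0 h)^2 / h) <= abs h" by (intro always_eventually allI) (auto simp: max_def power2_eq_square abs_mult)
  show "((%h::real. abs h) \<longlongrightarrow> 0) (at 0)" using tendsto_rabs[OF tendsto_ident_at[of 0 UNIV]] by simp
 qed
 thus ?thesis using equal by (simp add: DERIV_def)
qed

definition bump :: "real => real" where "bump x = (max 0 (1 - x^2))^2"
definition bump' :: "real => real" where "bump' x = - 4 * x * max 0 (1 - x^2)"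

lemma bump_props:
 "(bump has_real_derivative bump' x) (at x)" "0 <= bump x" "bump x <= 1" "1 <= abs x ==> bump x = 0"
 "1 <= abs x ==> bump' x = 0" "abs (bump' x) <= 4" "contU bump'" "bump 0 = 1" "bump' 0 = 0"
proof -
 have "((%x. (max 0 (1 - x^2))^2) has_real_derivative (2 * max 0 (1 - x^2)) * (- 2 * x)) (at x)"
  by (rule DERIV_chain2[where g="%x. 1 - x^2" and f="%y. (max 0 y)^2", OF DERIV_pos_part_sq]) (auto intro!: derivative_eq_intros)
 thus "(bump has_real_derivative bump' x) (at x)" unfolding bump_def bump'_def by (simp add: mult_ac)
 show "0 <= bump x" by (simp add: bump_def)
 show "bump x <= 1" unfolding bump_def by (rule power_le_one) auto
 have m: "max 0 (1 - x^2) = 0" if "1 <= abs x"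
 proof -
  have "1 <= x^2" using that by (metis abs_le_square_iff abs_one one_power2)
  thus ?thesis by simp
 qed
 show "1 <= abs x ==> bump x = 0" "1 <= abs x ==> bump' x = 0" using m by (simp_all add: bump_def bump'_def)
 show "abs (bump' x) <= 4"
 proof (cases "1 <= abs x")
  case True thus ?thesis using m by (simp add: bump'_def)
 next
  case False
  hence "abs x * max 0 (1 - x^2) <= 1 * 1" by (intro mult_mono) auto
  thus ?thesis by (simp add: bump'_def abs_mult)
 qed
 show "contU bump'" unfolding bump'_def by (intro continuous_intros)
qed (simp_all add: bump_def bump'_def)

definition cut :: "real => (real => real) => real => real" where
 "cut R phi x = phi x * bump (x / R)"
definition cut' :: "real => (real => real) => (real => real) => real => real" where
 "cut' R phi psi x = psi x * bump (x / R) + phi x * bump' (x / R) / R"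

lemma cut_lipC1:
 assumes L: "lipC1 phi psi C" and R: "1 <= R"
 shows "lipC1 (cut R phi) (cut' R phi psi) (C + 4 * (abs (phi 0) + C))"
  "R < abs x ==> cut R phi x = 0" "abs (cut R phi x) <= abs (phi x)" "abs (cut R phi x) <= abs (phi 0) + C * R"
proof -
 have D: "(cut R phi has_real_derivative cut' R phi psi x) (at x)" for x
 proof -
  have "((%x. bump (x / R)) has_real_derivative bump' (x / R) * (1 / R)) (at x)"
   by (rule DERIV_chain2[OF bump_props(1)]) (use R in "auto intro!: derivative_eq_intros")
  from DERIV_mult[OF lipC1D(1)[OF L, of x] this] show ?thesis unfolding cut_def cut'_def by (simp add: mult_ac)
 qed
 have c: "contU (cut' R phi psi)"
 proof -
  have r: "contU (%x. x / R)" using R by (intro continuous_intros) auto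
  have "contU bump" by (intro continuous_at_imp_continuous_on ballI DERIV_isCont[OF bump_props(1)])
  hence 1: "contU (%x. bump (x / R))" by (rule continuous_on_compose2[OF _ r]) simp
  have 2: "contU (%x. bump' (x / R))" by (rule continuous_on_compose2[OF bump_props(7) r]) simp
  show ?thesis unfolding cut'_def[abs_def] using R by (intro continuous_intros 1 2 lipC1D(2,5)[OF L]) auto
 qed
 have phib: "abs (phi x) <= abs (phi 0) + C * R" if "abs x <= R" for x
 proof -
  have "abs (phi x) <= abs (phi 0) + C * abs x" using lipC1_lipschitz[OF L, of x 0] by simp
  thus ?thesis using mult_left_mono[OF that lipC1D(4)[OF L]] by linarith
 qed
 have b: "abs (cut' R phi psi x) <= C + 4 * (abs (phi 0) + C)" for x
 proof -
  have 1: "abs (psi x * bump (x / R)) <= C * 1" unfolding abs_mult using lipC1D(3)[OF L, of x] bump_props(2,3)[of "x / R"] by (intro mult_mono) auto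
  have 2: "abs (phi x * bump' (x / R) / R) <= 4 * (abs (phi 0) + C)"
  proof (cases "abs x <= R")
   case True
   have "abs (phi x) / R <= (abs (phi 0) + C * R) / R" using phib[OF True] R by (intro divide_right_mono) auto
   also have "... <= abs (phi 0) + C" using R mult_left_mono[of 1 R "abs (phi 0)"] by (simp add: field_simps)
   finally have "abs (phi x) / R * abs (bump' (x / R)) <= (abs (phi 0) + C) * 4" using bump_props(6)[of "x / R"] lipC1D(4)[OF L] by (intro mult_mono) auto
   thus ?thesis using R by (simp add: abs_mult abs_divide mult_ac)
  next
   case False
   hence "1 <= abs (x / R)" using R by (simp add: abs_divide)
   thus ?thesis using bump_props(5)[of "x / R"] lipC1D(4)[OF L] by simp
  qed
  show ?thesis unfolding cut'_def using 1 2 by linarith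
 qed
 show "lipC1 (cut R phi) (cut' R phi psi) (C + 4 * (abs (phi 0) + C))" using D c b by (simp add: lipC1_def)
 have z: "cut R phi x = 0" if "R <= abs x" for x
 proof -
  have "1 <= abs (x / R)" using R that by (simp add: abs_divide)
  thus ?thesis using bump_props(4)[of "x / R"] by (simp add: cut_def)
 qed
 thus "R < abs x ==> cut R phi x = 0" by simp
 show 3: "abs (cut R phi x) <= abs (phi x)" for x using bump_props(2,3)[of "x / R"] by (simp add: cut_def abs_mult mult_left_le)
 show "abs (cut R phi x) <= abs (phi 0) + C * R"
 proof (cases "abs x <= R")
  case True thus ?thesis using 3[of x] phib by force
 next
  case False thus ?thesis using z[of x] lipC1D(4)[OF L] R by simp
 qed
qed

lemma cut_limit:
 assumes L: "lipC1 phi psi C"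
 shows "(%n. cut (real (Suc n)) phi x) ---> phi x" "(%n. cut' (real (Suc n)) phi psi x) ---> psi x"
proof -
 have l: "(%n. x / real (Suc n)) ---> 0" using LIMSEQ_inverse_real_of_nat[THEN tendsto_mult_left, of x] by (simp add: divide_inverse)
 have b: "(%n. bump (x / real (Suc n))) ---> bump 0" using l by (rule isCont_tendsto_compose[OF DERIV_isCont[OF bump_props(1)]])
 have b': "(%n. bump' (x / real (Suc n))) ---> bump' 0"
  using l bump_props(7) by (intro isCont_tendsto_compose[where g=bump']) (auto simp: continuous_on_eq_continuous_at)
 have "(%n. phi x * bump (x / real (Suc n))) ---> phi x * 1" using b by (intro tendsto_intros) (simp add: bump_props)
 thus "(%n. cut (real (Suc n)) phi x) ---> phi x" by (simp add: cut_def)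
 have "(%n. psi x * bump (x / real (Suc n)) + phi x * (bump' (x / real (Suc n)) * inverse (real (Suc n)))) ---> psi x * 1 + phi x * (0 * 0)"
  using b b' by (intro tendsto_intros LIMSEQ_inverse_real_of_nat) (simp_all add: bump_props)
 thus "(%n. cut' (real (Suc n)) phi psi x) ---> psi x" by (simp add: cut'_def divide_inverse mult.assoc)
qed

text \<open>The smooth step is the integral of a tent function: a quadratic spline rising from zero to
 one on the unit interval.\<close>

definition tent :: "real => real" where
 "tent x = 4 * (max 0 x - 2 * max 0 (x - 1/2) + max 0 (x - 1))"
definition step :: "real => real" where
 "step x = 2 * ((max 0 x)^2 - 2 * (max 0 (x - 1/2))^2 + (max 0 (x - 1))^2)"

lemma step_props:
 "(step has_real_derivative tent x) (at x)" "contU tent" "0 <= tent x" "tent x <= 2"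
 "x \<notin> {0..1} ==> tent x = 0" "x <= 0 ==> step x = 0" "1 <= x ==> step x = 1" "0 <= step x" "step x <= 1" "mono step"
proof -
 have d: "((%x. (max 0 (x - c))^2) has_real_derivative 2 * max 0 (x - c)) (at x)" for x c :: real
 proof -
  have "((%x. x - c) has_real_derivative 1) (at x)" by (auto intro!: derivative_eq_intros)
  from DERIV_chain2[OF DERIV_pos_part_sq[of "x - c"] this] show ?thesis by simp
 qed
 show D: "(step has_real_derivative tent x) (at x)" for x
 proof -
  have "((%x. 2 * ((max 0 x)^2 - 2 * (max 0 (x - 1/2))^2 + (max 0 (x - 1))^2)) has_real_derivative
   2 * (2 * max 0 x - 2 * (2 * max 0 (x - 1/2)) + 2 * max 0 (x - 1))) (at x)" by (intro DERIV_cmult DERIV_add DERIV_diff d DERIV_pos_part_sq)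
  thus ?thesis by (simp add: step_def[abs_def] tent_def algebra_simps)
 qed
 show "contU tent" unfolding tent_def by (intro continuous_intros)
 show t0: "0 <= tent x" for x by (auto simp: tent_def max_def)
 show "tent x <= 2" "x \<notin> {0..1} ==> tent x = 0" by (auto simp: tent_def max_def)
 show s0: "step x = 0" if "x <= 0" for x using that by (simp add: step_def max_def)
 show s1: "step x = 1" if "1 <= x" for x using that by (simp add: step_def max_def power2_eq_square algebra_simps)
 show m: "mono step"
 proof (rule monoI)
  fix x y :: real assume "x <= y"
  thus "step x <= step y" using DERIV_nonneg_imp_nondecreasing[of x y step] D t0 by blast
 qed
 show "0 <= step x" using monoD[OF m, of "min x 0" x] s0[of "min x 0"] by simp
 show "step x <= 1" using monoD[OF m, of x "max x 1"] s1[of "max x 1"] by simp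
qed

lemma tent_integral:
 "integrable lborel tent" "(LBINT x. tent x) = 1"
proof -
 have eq: "tent = (%x. ind {0..1} x *\<^sub>R tent x)" using step_props(5) by (auto simp: indicator_def fun_eq_iff)
 have i: "set_integrable lborel {0..1} tent" by (intro borel_integrable_atLeastAtMost' continuous_on_subset[OF step_props(2)]) auto
 thus "integrable lborel tent" unfolding set_integrable_def eq[symmetric] .
 have "(LBINT x. ind {0..1} x *\<^sub>R tent x) = step 1 - step 0" by (rule integral_FTC_atLeastAtMost)
   (auto intro!: continuous_on_subset[OF step_props(2)] has_field_derivative_at_within[OF step_props(1)]
    simp: has_real_derivative_iff_has_vector_derivative[symmetric])
 thus "(LBINT x. tent x) = 1" using step_props(6)[of 0] step_props(7)[of 1] eq by simp
qed

lemma tent_average: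
 assumes Phi: "contU Phi" and dl: "!!n. 0 < dl n" "dl ---> 0" and c: "c ---> s"
 shows "(%n. LBINT r. tent ((r - c n) / dl n) / dl n * Phi r) ---> Phi s"
  "integrable lborel (%r. tent ((r - c n) / dl n) / dl n * Phi r)"
proof -
 have Phic: "isCont Phi x" for x using Phi by (simp add: continuous_on_eq_continuous_at)
 have [measurable]: "Phi : Bor" "tent : Bor" using Phi step_props(2) by (auto intro: cont_bor)
 have cs: "contU (%x. Phi (c n + dl n * x))" for n by (intro continuous_on_compose2[OF Phi] continuous_intros) auto
 have eq: "(LBINT r. tent ((r - c n) / dl n) / dl n * Phi r) = (LBINT x. tent x * Phi (c n + dl n * x))" for n
 proof -
  have "(LBINT r. tent ((r - c n) / dl n) / dl n * Phi r) =
    abs (dl n) *\<^sub>R (LBINT x. tent ((c n + dl n * x - c n) / dl n) / dl n * Phi (c n + dl n * x))" by (rule lborel_integral_real_affine) (use dl(1)[of n] in simp)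
  also have "... = (LBINT x. abs (dl n) * (tent ((c n + dl n * x - c n) / dl n) / dl n * Phi (c n + dl n * x)))" by simp
  also have "... = (LBINT x. tent x * Phi (c n + dl n * x))" by (rule lint_cong) (use dl(1)[of n] in auto)
  finally show ?thesis .
 qed
 have ii: "integrable lborel (%x. tent x * Phi (c n + dl n * x))" for n
 proof -
  have "integrable lborel (%x. ind {0..1} x *\<^sub>R (tent x * Phi (c n + dl n * x)))" by (rule borel_integrable_atLeastAtMost'[unfolded set_integrable_def])
    (intro continuous_intros continuous_on_subset[OF step_props(2)] continuous_on_subset[OF cs]; simp)
  moreover have "(%x. ind {0..1} x *\<^sub>R (tent x * Phi (c n + dl n * x))) = (%x. tent x * Phi (c n + dl n * x))"
   using step_props(5) by (auto simp: indicator_def fun_eq_iff)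
  ultimately show ?thesis by metis
 qed
 show "integrable lborel (%r. tent ((r - c n) / dl n) / dl n * Phi r)"
  using ii[of n] dl(1)[of n] lborel_integrable_real_affine_iff[of "dl n" "%r. tent ((r - c n) / dl n) / dl n * Phi r" "c n"] by simp
 have "EX B. ALL n. ALL x:{0..1}. abs (Phi (c n + dl n * x)) <= B"
 proof -
  obtain B1 where B1: "!!n. abs (c n) <= B1" using convergent_imp_Bseq[of c] c by (auto simp: convergent_def Bseq_def)
  obtain B2 where B2: "!!n. abs (dl n) <= B2" using convergent_imp_Bseq[of dl] dl by (auto simp: convergent_def Bseq_def)
  have "compact (Phi ` {-(B1+B2)..B1+B2})" by (intro compact_continuous_image continuous_on_subset[OF Phi]) auto
  then obtain B where B: "!!y. y : {-(B1+B2)..B1+B2} ==> abs (Phi y) <= B" by (force dest!: compact_imp_bounded simp: bounded_iff)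
  have "abs (c n + dl n * x) <= B1 + B2" if "x : {0..1}" for n x
  proof -
   have "abs (dl n * x) <= abs (dl n) * 1" unfolding abs_mult using that by (intro mult_left_mono) auto
   thus ?thesis using B1[of n] B2[of n] by linarith
  qed
  note bd = this
  show ?thesis
  proof (intro exI[of _ B] allI ballI B)
   fix n :: nat and y :: real assume "y : {0..1}"
   thus "c n + dl n * y : {-(B1+B2)..B1+B2}" using bd[of y n] by (auto simp: abs_le_iff)
  qed
 qed
 then obtain B where B: "!!n x. x : {0..1} ==> abs (Phi (c n + dl n * x)) <= B" by blast
 have "(%n. LBINT x. tent x * Phi (c n + dl n * x)) ---> (LBINT x. tent x * Phi s)"
 proof (rule integral_dominated_convergence[where w="%x. tent x * B"])
  show "AE x in lborel. (%n. tent x * Phi (c n + dl n * x)) ---> tent x * Phi s"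
  proof (intro AE_I2 tendsto_mult tendsto_const isCont_tendsto_compose[OF Phic])
   fix x :: real
   have "(%n. c n + dl n * x) ---> s + 0 * x" by (intro tendsto_intros c dl)
   thus "(%n. c n + dl n * x) ---> s" by simp
  qed
  show "AE x in lborel. norm (tent x * Phi (c n + dl n * x)) <= tent x * B" for n
  proof (intro AE_I2)
   fix x show "norm (tent x * Phi (c n + dl n * x)) <= tent x * B" using B[of x n] step_props(3)[of x] step_props(5)[of x]
    by (cases "x : {0..1}") (auto simp: abs_mult intro: mult_left_mono)
  qed
  show "integrable lborel (%x. tent x * B)" using tent_integral(1) by simp
 qed auto
 thus "(%n. LBINT r. tent ((r - c n) / dl n) / dl n * Phi r) ---> Phi s" unfolding eq using tent_integral by simp
qed

text \<open>Smooth approximations of the indicator of a time interval. Testing the derivative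
 of such an approximation against a continuous function recovers the increment of the latter.\<close>

lemma time_cutoffs:
 fixes s t :: real assumes st: "s < t"
 shows "EX eta eta' a b. (ALL n::nat. (ALL r. (eta n has_real_derivative eta' n r) (at r)) & contU (eta' n) &
   s < a n & b n < t & (ALL r. r \<notin> {a n..b n} --> eta n r = 0) & (ALL r. 0 <= eta n r & eta n r <= 1)) &
  (ALL r. s < r & r < t --> (%n. eta n r) ---> 1) &
  (ALL Phi. contU Phi --> (%n. LBINT r. eta' n r * Phi r) ---> Phi s - Phi t)"
proof -
 define dl where "dl n = (t - s) / 4 * inverse (real (Suc n))" for n
 define a where "a n = s + dl n" for n
 define b where "b n = t - dl n" for n
 define eta where "eta n r = step ((r - a n) / dl n) - step ((r - (t - 2 * dl n)) / dl n)" for n r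
 define eta' where "eta' n r = tent ((r - a n) / dl n) / dl n - tent ((r - (t - 2 * dl n)) / dl n) / dl n" for n r
 have dl0: "0 < dl n" for n using st by (simp add: dl_def)
 have dl1: "4 * dl n <= t - s" for n
 proof -
  have "inverse (real (Suc n)) <= 1" by (simp add: field_simps)
  thus ?thesis using st mult_left_mono[of "inverse (real (Suc n))" 1 "t - s"] by (simp add: dl_def)
 qed
 have dll: "dl ---> 0" unfolding dl_def using tendsto_mult_left[OF LIMSEQ_inverse_real_of_nat, of "(t - s) / 4"] by simp
 have al: "a ---> s" unfolding a_def using tendsto_add[OF tendsto_const dll, of s] by simp
 have cl: "(%n. t - 2 * dl n) ---> t" using tendsto_diff[OF tendsto_const tendsto_mult_left[OF dll, of 2], of t] by simp
 have D: "(eta n has_real_derivative eta' n r) (at r)" for n r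
 proof -
  have d: "((%r. step ((r - c) / dl n)) has_real_derivative tent ((r - c) / dl n) * (1 / dl n)) (at r)" for c
   by (rule DERIV_chain2[OF step_props(1)]) (use dl0[of n] in "auto intro!: derivative_eq_intros")
  show ?thesis unfolding eta_def[abs_def] eta'_def using DERIV_diff[OF d d] by simp
 qed
 have c': "contU (eta' n)" for n unfolding eta'_def using dl0[of n] by (intro continuous_intros continuous_on_compose2[OF step_props(2)]) auto
 have supp: "eta n r = 0" if "r \<notin> {a n..b n}" for n r
 proof (cases "r < a n")
  case True
  hence "(r - a n) / dl n <= 0" "(r - (t - 2 * dl n)) / dl n <= 0" using dl0[of n] dl1[of n] by (auto simp: a_def divide_le_0_iff)
  thus ?thesis by (simp add: eta_def step_props(6))
 next
  case False
  hence "b n < r" using that by auto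
  hence "1 <= (r - a n) / dl n" "1 <= (r - (t - 2 * dl n)) / dl n" using dl0[of n] dl1[of n] by (auto simp: a_def b_def field_simps)
  thus ?thesis by (simp add: eta_def step_props(7))
 qed
 have rng: "0 <= eta n r & eta n r <= 1" for n r
 proof -
  have "(r - (t - 2 * dl n)) / dl n <= (r - a n) / dl n" using dl0[of n] dl1[of n] by (intro divide_right_mono) (auto simp: a_def)
  hence "step ((r - (t - 2 * dl n)) / dl n) <= step ((r - a n) / dl n)" by (rule monoD[OF step_props(10)])
  moreover have "step ((r - a n) / dl n) <= 1" "0 <= step ((r - (t - 2 * dl n)) / dl n)" by (rule step_props)+
  ultimately show ?thesis by (simp add: eta_def)
 qed
 have one: "(%n. eta n r) ---> 1" if "s < r" "r < t" for r
 proof (rule tendsto_eventually)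
  have "\<forall>\<^sub>F n in sequentially. dl n < min (r - s) (t - r) / 2" using dll that by (intro order_tendstoD(2)) auto
  thus "\<forall>\<^sub>F n in sequentially. eta n r = 1"
  proof eventually_elim
   case (elim n)
   have "1 <= (r - a n) / dl n" "(r - (t - 2 * dl n)) / dl n <= 0" using dl0[of n] elim by (auto simp: a_def field_simps divide_le_0_iff min_def split: if_splits)
   thus ?case by (simp add: eta_def step_props(6,7))
  qed
 qed
 have lim: "(%n. LBINT r. eta' n r * Phi r) ---> Phi s - Phi t" if Phi: "contU Phi" for Phi
 proof -
  have "(LBINT r. eta' n r * Phi r) = (LBINT r. tent ((r - a n) / dl n) / dl n * Phi r)
    - (LBINT r. tent ((r - (t - 2 * dl n)) / dl n) / dl n * Phi r)" for n using tent_average(2)[OF Phi dl0 dll al, of n] tent_average(2)[OF Phi dl0 dll cl, of n]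
   unfolding eta'_def by (subst lint_diff[symmetric]) (auto simp: algebra_simps)
  thus ?thesis using tendsto_diff[OF tent_average(1)[OF Phi dl0 dll al] tent_average(1)[OF Phi dl0 dll cl]] by simp
 qed
 have "s < a n" "b n < t" for n using dl0[of n] by (auto simp: a_def b_def)
 thus ?thesis by (intro exI[of _ eta] exI[of _ eta'] exI[of _ a] exI[of _ b]) (use D c' supp rng one lim in blast)
qed

section \<open>Curves of probability measures\<close>

text \<open>Curves are extended to the whole line by freezing them outside a time interval, which avoids all
 side conditions on times.\<close>

locale narrow_curve =
 fixes g :: "real => real measure"
 assumes rd: "rdist (g t)"
  and cont: "contU phi ==> bounded (range phi) ==> contU (%t. LINT v|g t. (phi v :: real))"
begin

lemma kernel: "g : borel \<rightarrow>\<^sub>M prob_algebra borel" by (rule narrowly_continuous_kernel[OF rd cont])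

lemma kernel2: "(%t. sq (g t)) : borel \<rightarrow>\<^sub>M subprob_algebra (borel :: (real * real) measure)"
 using measurable_prob_algebraD[OF measurable_pair_prob[OF kernel kernel]] unfolding borel_prod .

lemma nn_measurable2:
 fixes h :: "real * (real * real) => ennreal"
 assumes "h : Bor"
 shows "(%t. \<integral>\<^sup>+z. h (t, z) \<partial>(sq (g t))) : Bor"
 using nn_integral_measurable_subprob_algebra2[of "%t z. h (t, z)" borel "borel :: (real * real) measure", OF _ kernel2] assms
 by (simp add: borel_prod case_prod_beta')

lemma integral_measurable2:
 fixes h :: "real * (real * real) => real"
 assumes h[measurable]: "h : Bor"
 shows "(%t. \<integral>z. h (t, z) \<partial>(sq (g t))) : Bor"
proof -
 have m: "(%t. \<integral>\<^sup>+z. ennreal (k (t, z)) \<partial>(sq (g t))) : Bor"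
  if "k : Bor" for k :: "real * (real * real) => real" using that by (intro nn_measurable2[of "%x. ennreal (k x)"]) measurable
 have hz: "(%z. h (t, z)) : borel_measurable (sq (g t))" for t
 proof (rule real_distribution_measurable(2)[OF rd])
  have "(%z :: real * real. (t, z)) : borel \<rightarrow>\<^sub>M borel" by (intro cont_bor continuous_intros)
  thus "(%z. h (t, z)) : Bor" using h by (rule measurable_compose)
 qed
 define G where "G t = (if (nni (sq (g t)) (%z. ennreal (abs (h (t, z))))) < \<infinity> then
  enn2real (nni (sq (g t)) (%z. ennreal (h (t, z)))) - enn2real (nni (sq (g t)) (%z. ennreal (- h (t, z)))) else 0)" for t
 have [measurable]: "(%t. \<integral>\<^sup>+z. ennreal (h (t, z)) \<partial>(sq (g t))) : Bor"
  "(%t. \<integral>\<^sup>+z. ennreal (- h (t, z)) \<partial>(sq (g t))) : Bor"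
  "(%t. \<integral>\<^sup>+z. ennreal (abs (h (t, z))) \<partial>(sq (g t))) : Bor" using m[of h] m[of "%x. - h x"] m[of "%x. abs (h x)"] by auto
 have "G : Bor" unfolding G_def by measurable
 moreover have "(LINT z|(sq (g t)). h (t, z)) = G t" for t
 proof (cases "integrable (sq (g t)) (%z. h (t, z))")
  case True
  hence "(nni (sq (g t)) (%z. ennreal (abs (h (t, z))))) < \<infinity>" by (simp add: integrable_iff_bounded)
  thus ?thesis using real_lebesgue_integral_def[OF True] by (simp add: G_def)
 next
  case False
  hence "~  (nni (sq (g t)) (%z. ennreal (abs (h (t, z))))) < \<infinity>" using hz[of t] by (simp add: integrable_iff_bounded)
  thus ?thesis using False by (simp add: G_def not_integrable_integral_eq)
 qed
 ultimately show ?thesis by simp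
qed

lemma qform_time_measurable:
 assumes "(%x. psi (fst x) (snd x)) : borel_measurable (borel :: (real * real) measure)"
 shows "(%t. qform e (g t) (psi t)) : Bor"
proof -
 have c: "(%x::real * (real * real). (fst x, fst (snd x))) : borel \<rightarrow>\<^sub>M borel" "(%x::real * (real * real). (fst x, snd (snd x))) : borel \<rightarrow>\<^sub>M borel"
  "(%x::real * (real * real). abs (fst (snd x) - snd (snd x))) : borel \<rightarrow>\<^sub>M borel" by (intro cont_bor continuous_intros)+
 have "(%x. wt e (snd x) * (psi (fst x) (snd (snd x)) - psi (fst x) (fst (snd x)))^2) : borel_measurable (borel :: (real * (real * real)) measure)"
  using measurable_compose[OF c(1) assms] measurable_compose[OF c(2) assms] measurable_compose[OF c(3) \<sigma>_measurable[of e]]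
  by (intro borel_measurable_times borel_measurable_power borel_measurable_diff) auto
 from integral_measurable2[OF this] show ?thesis by (simp add: qform_def)
qed

lemma qform_time_measurable1:
 assumes "psi : Bor" shows "(%t. qform e (g t) psi) : Bor" by (rule qform_time_measurable) (rule measurable_compose[OF borel_measurable_fst_snd'(2) assms])

lemma weak_conv_seq: "t ---> s ==> weak_conv_m (%n. g (t n)) (g s)"
proof -
 assume t: "t ---> s"
 have "narrow_lim (%n. g (t n)) (g s) sequentially" unfolding narrow_lim_def
  using cont t by (auto simp: continuous_on_eq_continuous_at intro!: isCont_tendsto_compose[where g="%t. LINT v|g t. _ v"])
 thus ?thesis using narrow_lim_iff_weak_conv[of "%n. g (t n)" "g s"] rd by blast
qed

end

locale tame_curve = narrow_curve +
 assumes mom: "integrable (g t) jap" and mom_cont: "contU (%t. jmean (g t))"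
begin

lemma lipC1_cont: assumes "lipC1 phi psi C" shows "contU (%t. LINT v|g t. phi v)" unfolding continuous_on_sequentially comp_def
proof (intro allI ballI impI, elim conjE)
 fix t :: "nat => real" and s :: real assume "t ---> s"
 thus "(%n. LINT v|g (t n). phi v) ---> (LINT v|g s. phi v)"
 proof (intro weak_moment_conv1[where C="abs (phi 0) + C" and h="%_. phi" and h'=phi] rd mom weak_conv_seq lipC1_growth[OF assms] lipC1D(6)[OF assms])
  assume t: "t ---> s"
  show "(%n. jmean (g (t n))) ---> jmean (g s)"
   using mom_cont t by (intro isCont_tendsto_compose[where g="%t. jmean (g t)"]) (auto simp: continuous_on_eq_continuous_at)
  show "(%n. phi (X n)) ---> phi x" if "X ---> x" for X x by (rule isCont_tendsto_compose[OF DERIV_isCont[OF lipC1D(1)[OF assms]] that])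
 qed
qed

end

definition clamp_time :: "real => real => real => real" where "clamp_time a b t = max a (min b t)"

lemma clamp_time_in [simp]: "a <= b ==> clamp_time a b t : {a..b}" "t : {a..b} ==> clamp_time a b t = t" by (auto simp: clamp_time_def)

lemma clamp_time_clamp [simp]: "a <= b ==> clamp_time a b (clamp_time a b t) = clamp_time a b t" by (auto simp: clamp_time_def)

lemma clamp_time_cont: "contU (clamp_time a b)" unfolding clamp_time_def by (intro continuous_intros)

lemma narrow_curve_clamp:
 assumes rd: "!!t. t : {a..b} ==> rdist (f t)" and c: "narrowly_continuous_on {a..b} f" and ab: "a <= b"
 shows "narrow_curve (f \<circ> clamp_time a b)"
proof (rule narrow_curve.intro)
 show "rdist ((f \<circ> clamp_time a b) t)" for t using clamp_time_in(1)[OF ab, of t] by (simp add: rd)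
 fix phi :: "real => real" assume phi: "contU phi" "bounded (range phi)"
 have "continuous_on {a..b} (%t. LINT v|f t. phi v)" using c phi by (auto simp: narrowly_continuous_on_def narrow_lim_def continuous_on_def)
 thus "contU (%t. \<integral>v. phi v \<partial>(f \<circ> clamp_time a b) t)"
  using continuous_on_compose2[OF _ clamp_time_cont[of a b], of "{a..b}" "%t. LINT v|f t. phi v"] clamp_time_in(1)[OF ab] by (auto simp: image_subset_iff)
qed

lemma narrow_curve_restrict:
 assumes "narrow_curve g" "!!t. t : S ==> f t = g t" shows "narrowly_continuous_on S f" unfolding narrowly_continuous_on_def narrow_lim_def
proof (intro ballI allI impI)
 fix t and phi :: "real => real" assume t: "t : S" and phi: "contU phi & bounded (range phi)"
 interpret narrow_curve g by fact
 have "((%t. LINT v|g t. phi v) \<longlongrightarrow> (LINT v|g t. phi v)) (at t within S)" using cont[of phi] phi by (metis UNIV_I continuous_on_def subset_UNIV tendsto_within_subset)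
 thus "((%i. LINT v|f i. phi v) \<longlongrightarrow> (LINT v|f t. phi v)) (at t within S)"
  unfolding assms(2)[OF t] by (rule Lim_transform_within[OF _ zero_less_one]) (use assms(2) in auto)
qed

section \<open>Lebesgue integrals over a time interval\<close>

lemma lebesgue_on_integral:
 fixes h :: "real => real"
 assumes [measurable]: "h : Bor"
 shows "(LINT t|lebesgue_on {a..b}. h t) = (LBINT t. h t * ind {a..b} t)"
  "integrable (lebesgue_on {a..b}) h \<longleftrightarrow> integrable lborel (%t. h t * ind {a..b} t)"
 by (simp_all add: integral_restrict_space integrable_restrict_space integral_completion integrable_completion mult.commute)

lemma lebesgue_on_nn_integral:
 fixes h :: "real => ennreal"
 assumes [measurable]: "h : Bor"
 shows "(nni (lebesgue_on {a..b}) (%t. h t)) = (nni lborel (%t. h t * ind {a..b} t))" by (simp add: nn_integral_restrict_space nn_integral_completion)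

lemma AE_lebesgue_on:
 assumes "AE t in lborel. P t" shows "AE t in lebesgue_on {a..b :: real}. P t"
 using AE_completion[OF assms] by (subst AE_restrict_space_iff) (auto elim: eventually_mono)

lemma borel_measurable_lebesgue_on:
 "h : Bor ==> h : borel_measurable (lebesgue_on S)" by (intro measurable_restrict_space1 measurable_completion) simp

section \<open>The weak formulation and its consequences for two times\<close>

definition timeL :: "real => (real => real measure) => (real * real => real) => real" where
 "timeL T g phi = (LINT t|leb T. (LINT v|g t. deriv (%s. phi (s, v)) t))"

text \<open>Bounded action without a flux: the weak formulation, in which a flux has been eliminated by the
 Cauchy-Schwarz inequality. Being an inequality between integrals of the curve only, it is stable under
 narrow convergence.\<close>

definition weak_bound :: "real => real => (real => real measure) => real => bool" where
 "weak_bound e T g K \<longleftrightarrow> (ALL phi:C1c T. (timeL T g phi)^2 <=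
  K * (LBINT t. qform e (g t) (%x. deriv (%y. phi (t, y)) x) * ind {0..T} t))"

lemma timeL_cong: "(!!t. t : {0..T} ==> f t = g t) ==> timeL T f phi = timeL T g phi" unfolding timeL_def by (intro lint_cong) auto

lemma weak_bound_cong:
 assumes "!!t. t : {0..T} ==> f t = g t" shows "weak_bound e T f K \<longleftrightarrow> weak_bound e T g K"
proof -
 have 1: "(LBINT t. qform e (f t) (psi t) * ind {0..T} t) = (LBINT t. qform e (g t) (psi t) * ind {0..T} t)" for psi
  using assms by (intro lint_cong) (auto simp: indicator_def)
 have 2: "timeL T f phi = timeL T g phi" for phi using assms by (rule timeL_cong)
 show ?thesis unfolding weak_bound_def 2 1[of "%t x. deriv (%y. _ (t, y)) x"] ..
qed

lemma qform_zero [simp]: "qform e f (%x. 0) = 0" by (simp add: qform_def)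

lemma qform_scale: "qform e f (%x. c * psi x) = c^2 * qform e f psi"
proof -
 have "qform e f (%x. c * psi x) = (LINT z|(sq f). c^2 * (wt e z * (psi (snd z) - psi (fst z))^2))"
  unfolding qform_def by (intro lint_cong) (auto simp: power2_eq_square algebra_simps)
 thus ?thesis unfolding qform_def by simp
qed

lemma integrable_bounded_interval:
 fixes h :: "real => real"
 assumes [measurable]: "h : Bor" and b: "!!t. t : {a..b} ==> abs (h t) <= B"
 shows "integrable lborel (%t. h t * ind {a..b} t)"
proof (rule integrable_bd)
 show "integrable lborel (%t. B * ind {a..b} t :: real)" by (intro integrable_mult_right integrable_real_indicator) (auto simp: emeasure_lborel_Icc_eq)
 show "AE t in lborel. norm (h t * ind {a..b} t) <= norm (B * ind {a..b} t :: real)" using order_trans[OF b abs_ge_self] by (intro AE_I2) (auto simp: indicator_def)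
qed measurable

lemma DERIV_zero_outside:
 assumes "!!t. (eta has_real_derivative eta' t) (at t)" "!!t. t \<notin> {a..b} ==> eta t = 0" "r \<notin> {a..b}"
 shows "eta' r = (0::real)"
proof -
 have "((%s. 0) has_real_derivative 0) (at r)" by simp
 hence "(eta has_real_derivative 0) (at r)" by (rule has_field_derivative_transform_within_open[of _ _ _ "- {a..b}"]) (use assms(2,3) in auto)
 thus ?thesis using assms(1) DERIV_unique by blast
qed

lemma (in narrow_curve) timeL_step:
 assumes eta: "!!t. (eta has_real_derivative eta' t) (at t)" "!!t. t \<notin> {a..b} ==> eta t = 0" "0 < a" "b < T" "contU eta'"
  and phi: "contU phi" "bounded (range phi)"
 shows "timeL T g (%z. eta (fst z) * phi (snd z)) = (LBINT r. eta' r * (LINT v|g r. phi v))"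
proof -
 have [measurable]: "(%t. LINT v|g t. phi v) : Bor" "eta' : Bor" using cont[OF phi] eta(5) by (auto intro: cont_bor)
 have d: "deriv (%s. eta s * phi v) t = eta' t * phi v" for t v by (intro DERIV_imp_deriv DERIV_cmult_right eta)
 have "timeL T g (%z. eta (fst z) * phi (snd z)) = (LINT t|leb T. eta' t * (LINT v|g t. phi v))" unfolding timeL_def by (simp add: d)
 also have "... = (LBINT t. eta' t * (LINT v|g t. phi v) * ind {0..T} t)" by (rule lebesgue_on_integral) measurable
 also have "... = (LBINT r. eta' r * (LINT v|g r. phi v))"
 proof (intro lint_cong refl)
  fix r show "eta' r * (LINT v|g r. phi v) * ind {0..T} r = eta' r * (LINT v|g r. phi v)"
  proof (cases "r : {a..b}")
   case True thus ?thesis using eta(3,4) by (auto simp: indicator_def)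
  next
   case False
   have "eta' r = 0" using eta(1,2) False by (intro DERIV_zero_outside[of eta eta' a b r]) auto
   thus ?thesis by simp
  qed
 qed
 finally show ?thesis .
qed

lemma (in narrow_curve) increment_by_time_test:
 assumes st: "0 <= s" "s < t" "t <= T" and phi: "contU phi" "bounded (range phi)"
  and B: "!!eta eta' a b. (!!r. (eta has_real_derivative eta' r) (at r)) ==> contU eta' ==> s < a ==> b < t ==>
   (!!r. r \<notin> {a..b} ==> eta r = 0) ==> (!!r. 0 <= eta r & eta r <= 1) ==> abs (timeL T g (%z. eta (fst z) * phi (snd z))) <= B"
 shows "abs ((LINT v|g t. phi v) - (LINT v|g s. phi v)) <= B"
proof -
 obtain eta eta' a b where H: "!!n::nat. (ALL r. (eta n has_real_derivative eta' n r) (at r)) & contU (eta' n) &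
   s < a n & b n < t & (ALL r. r \<notin> {a n..b n} --> eta n r = 0) & (ALL r. 0 <= eta n r & eta n r <= 1)"
  "!!Phi. contU Phi ==> (%n. LBINT r. eta' n r * Phi r) ---> Phi s - Phi t" using time_cutoffs[OF st(2)] by blast
 have "abs (LBINT r. eta' n r * (LINT v|g r. phi v)) <= B" for n
  using B[of "eta n" "eta' n" "a n" "b n"] H(1)[of n] timeL_step[of "eta n" "eta' n" "a n" "b n" T phi] st phi by auto
 hence "abs ((LINT v|g s. phi v) - (LINT v|g t. phi v)) <= B" by (intro LIMSEQ_le_const2[OF tendsto_rabs[OF H(2)[OF cont[OF phi]]]]) auto
 thus ?thesis by (simp add: abs_minus_commute)
qed

text \<open>Testing with a cut-off of \<open>phi\<close> in velocity times a step in time; both cut-offs are then removed by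
 dominated convergence.\<close>

lemma (in narrow_curve) weak_bound_two_time:
 assumes e: "0 <= e" "e < 1" and W: "weak_bound e T g K" "0 <= K"
  and M: "!!t. t : {0..T} ==> integrable (g t) jap & jmean (g t) <= M"
  and L: "lipC1 phi psi C" and st: "0 <= s" "s <= t" "t <= T"
 shows "((LINT v|g t. phi v) - (LINT v|g s. phi v))^2 <= K * (LBINT r. qform e (g r) psi * ind {s..t} r)"
proof (cases "s = t")
 case True
 thus ?thesis using W(2) e by (auto intro!: mult_nonneg_nonneg lint_nonneg simp: qform_nonneg)
next
 case False
 hence st': "s < t" using st by simp
 define C' where "C' = C + 4 * (abs (phi 0) + C)"
 define p where "p n = cut (real (Suc n)) phi" for n
 define p' where "p' n = cut' (real (Suc n)) phi psi" for n
 have Lp: "lipC1 (p n) (p' n) C'" for n unfolding p_def p'_def C'_def by (rule cut_lipC1(1)[OF L]) simp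
 have qb: "0 <= qform e (g r) h" "qform e (g r) h <= 2 * D^2 * M"
  if "r : {0..T}" "lipC1 k h D" for r k h D
 proof -
  show "0 <= qform e (g r) h" using e by (simp add: qform_nonneg)
  have "qform e (g r) h <= 2 * D^2 * jmean (g r)" using M[OF that(1)] lipC1D(3,7)[OF that(2)] by (intro qform_le[OF e rd]) auto
  also have "... <= 2 * D^2 * M" using M[OF that(1)] by (intro mult_left_mono) auto
  finally show "qform e (g r) h <= 2 * D^2 * M" .
 qed
 have qm[measurable]: "(%r. qform e (g r) h) : Bor" if "lipC1 k h D" for k h D by (rule qform_time_measurable1[OF lipC1D(7)[OF that]])
 have qi: "integrable lborel (%r. qform e (g r) h * ind {s..t} r)" if "lipC1 k h D" for k h D
  by (rule integrable_bounded_interval[OF qm[OF that], where B="2 * D^2 * M"]) (use qb[OF _ that] st in auto)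
 have sq: "abs ((LINT v|g t. p n v) - (LINT v|g s. p n v)) <= sqrt (K * (LBINT r. qform e (g r) (p' n) * ind {s..t} r))" for n
 proof (rule increment_by_time_test[OF st(1) st' st(3) lipC1D(5)[OF Lp]])
  have "abs (p n v) <= abs (phi 0) + C * real (Suc n)" for v unfolding p_def by (rule cut_lipC1(4)[OF L]) simp
  thus "bounded (range (p n))" by (intro boundedI[where B="abs (phi 0) + C * real (Suc n)"]) auto
  fix eta eta' a b assume eta: "!!r. (eta has_real_derivative eta' r) (at r)" "contU eta'" "s < a" "b < t"
   "!!r. r \<notin> {a..b} ==> eta r = 0" "!!r. 0 <= eta r & eta r <= 1"
  have [measurable]: "eta : Bor" using eta(1) by (intro cont_bor continuous_at_imp_continuous_on ballI DERIV_isCont)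
  have inC: "(%z. eta (fst z) * p n (snd z)) : C1c T"
  proof (rule C1c_times_step[where u="%z. p n (snd z)" and R="real (Suc n)", OF C1fun_snd[OF lipC1D(1,2)[OF Lp]] _ eta(1,2)])
   show "p n (snd (t, v)) = 0" if "real (Suc n) < abs v" for t v using cut_lipC1(2)[OF L _ that] by (simp add: p_def)
  qed (use eta st in auto)
  have d: "deriv (%y. eta (fst (r, y)) * p n (snd (r, y))) x = eta r * p' n x" for r x by (simp add: DERIV_imp_deriv[OF DERIV_cmult[OF lipC1D(1)[OF Lp]]])
  have "(timeL T g (%z. eta (fst z) * p n (snd z)))^2 <= K * (LBINT r. qform e (g r) (%x. eta r * p' n x) * ind {0..T} r)"
   using W(1) inC unfolding weak_bound_def d[symmetric] by blast
  also have "... <= K * (LBINT r. qform e (g r) (p' n) * ind {s..t} r)"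
  proof (intro mult_left_mono W(2) integral_mono qi[OF Lp])
   have le: "qform e (g r) (%x. eta r * p' n x) * ind {0..T} r <= qform e (g r) (p' n) * ind {s..t} r"
    "0 <= qform e (g r) (%x. eta r * p' n x) * ind {0..T} r" for r
   proof -
    show "0 <= qform e (g r) (%x. eta r * p' n x) * ind {0..T} r" using e by (simp add: qform_nonneg)
    show "qform e (g r) (%x. eta r * p' n x) * ind {0..T} r <= qform e (g r) (p' n) * ind {s..t} r"
    proof (cases "r : {a..b}")
     case True
     hence r: "r : {s..t}" "r : {0..T}" using eta(3,4) st by auto
     have "(eta r)^2 * qform e (g r) (p' n) <= 1 * qform e (g r) (p' n)" using qb(1)[OF r(2) Lp] eta(6)[of r] by (intro mult_right_mono power_le_one) auto
     thus ?thesis using r by (simp add: qform_scale)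
    next
     case False thus ?thesis using eta(5)[of r] qform_nonneg[of e "g r" "p' n"] e by (simp add: qform_scale)
    qed
   qed
   show "qform e (g r) (%x. eta r * p' n x) * ind {0..T} r <= qform e (g r) (p' n) * ind {s..t} r" for r by (rule le)
   have m: "(%r. qform e (g r) (%x. eta r * p' n x) * ind {0..T} r) : Bor" unfolding qform_scale using qm[OF Lp] by measurable
   show "integrable lborel (%r. qform e (g r) (%x. eta r * p' n x) * ind {0..T} r)"
    by (rule integrable_bd[OF qi[OF Lp]]) (use m le in "auto intro!: AE_I2 order_trans[OF le(1) abs_ge_self] simp: abs_of_nonneg")
  qed
  finally show "abs (timeL T g (%z. eta (fst z) * p n (snd z))) <= sqrt (K * (LBINT r. qform e (g r) (p' n) * ind {s..t} r))"
   by (rule real_le_rsqrt[of "abs _", unfolded power2_abs])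
 qed
 have b1: "((LINT v|g t. p n v) - (LINT v|g s. p n v))^2 <= K * (LBINT r. qform e (g r) (p' n) * ind {s..t} r)" for n
 proof -
  have "0 <= K * (LBINT r. qform e (g r) (p' n) * ind {s..t} r)" using W(2) e by (auto intro!: mult_nonneg_nonneg lint_nonneg simp: qform_nonneg)
  thus ?thesis using sq[of n] by (metis abs_ge_zero power2_abs power_mono real_sqrt_pow2)
 qed
 have lim1: "(%n. LINT v|g r. p n v) ---> (LINT v|g r. phi v)" if "r : {0..T}" for r
 proof (rule integral_dominated_convergence[where w="%v. abs (phi v)"])
  show "integrable (g r) (%v. abs (phi v))" using lipC1_integrable[OF L rd, of r] M[OF that] by simp
  show "phi : borel_measurable (g r)" "p n : borel_measurable (g r)" for n using real_distribution_measurable(1)[OF rd] lipC1D(6)[OF L] lipC1D(6)[OF Lp] by blast+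
  show "AE v in g r. (%n. p n v) ---> phi v" unfolding p_def by (intro AE_I2 cut_limit(1)[OF L])
  show "AE v in g r. norm (p n v) <= abs (phi v)" for n unfolding p_def by (intro AE_I2) (simp add: cut_lipC1(3)[OF L])
 qed
 have lim2: "(%n. qform e (g r) (p' n)) ---> qform e (g r) psi" if "r : {0..T}" for r unfolding qform_def
 proof (rule integral_dominated_convergence[where w="%z. C'^2 * (jap (fst z) + jap (snd z))"])
  show "integrable (sq (g r)) (%z. C'^2 * (jap (fst z) + jap (snd z)))" using integrable_jap_sum(1)[OF rd, of r] M[OF that] by simp
  show "(%z. wt e z * (psi (snd z) - psi (fst z))^2) : borel_measurable (sq (g r))"
   "(%z. wt e z * (p' n (snd z) - p' n (fst z))^2) : borel_measurable (sq (g r))" for n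
   by (rule real_distribution_measurable(2)[OF rd qform_measurable[OF lipC1D(7)[OF L]]],
     rule real_distribution_measurable(2)[OF rd qform_measurable[OF lipC1D(7)[OF Lp]]])
  show "AE z in sq (g r). (%n. wt e z * (p' n (snd z) - p' n (fst z))^2) ---> wt e z * (psi (snd z) - psi (fst z))^2"
   unfolding p'_def by (intro AE_I2 tendsto_intros cut_limit(2)[OF L])
  show "AE z in sq (g r). norm (wt e z * (p' n (snd z) - p' n (fst z))^2) <= C'^2 * (jap (fst z) + jap (snd z))" for n
   using gradient_weight_bound[where psi="p' n" and C=C', OF e lipC1D(3)[OF Lp]] by (intro AE_I2) simp
 qed
 have lim3: "(%n. LBINT r. qform e (g r) (p' n) * ind {s..t} r) ---> (LBINT r. qform e (g r) psi * ind {s..t} r)"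
 proof (rule integral_dominated_convergence[where w="%r. 2 * C'^2 * M * ind {s..t} r"])
  show "integrable lborel (%r. 2 * C'^2 * M * ind {s..t} r :: real)" by (intro integrable_mult_right integrable_real_indicator) (auto simp: emeasure_lborel_Icc_eq)
  show "(%r. qform e (g r) psi * ind {s..t} r) : borel_measurable lborel" "(%r. qform e (g r) (p' n) * ind {s..t} r) : borel_measurable lborel" for n
   using qm[OF L] qm[OF Lp] by measurable
  show "AE r in lborel. (%n. qform e (g r) (p' n) * ind {s..t} r) ---> qform e (g r) psi * ind {s..t} r" using lim2 st by (intro AE_I2) (auto simp: indicator_def)
  show "AE r in lborel. norm (qform e (g r) (p' n) * ind {s..t} r) <= 2 * C'^2 * M * ind {s..t} r" for n
   using qb[OF _ Lp] st by (intro AE_I2) (auto simp: indicator_def)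
 qed
 show ?thesis
 proof (rule LIMSEQ_le)
  show "(%n. ((LINT v|g t. p n v) - (LINT v|g s. p n v))^2) ---> ((LINT v|g t. phi v) - (LINT v|g s. phi v))^2" by (intro tendsto_intros lim1) (use st in auto)
  show "(%n. K * (LBINT r. qform e (g r) (p' n) * ind {s..t} r)) ---> K * (LBINT r. qform e (g r) psi * ind {s..t} r)" by (intro tendsto_intros lim3)
 qed (use b1 in blast)
qed

lemma weak_bound_tame:
 assumes e: "0 <= e" "e < 1" and T: "0 <= T" and g: "narrow_curve g" "!!t. g t = g (clamp_time 0 T t)"
  and W: "weak_bound e T g K" "0 <= K" and M: "!!t. t : {0..T} ==> integrable (g t) jap & jmean (g t) <= M"
 shows "tame_curve g"
proof -
 interpret narrow_curve g by fact
 have M0: "0 <= M" using M[of 0] jmean_ge_1[OF rd, of 0] T by force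
 have 1: "(jmean (g t) - jmean (g s))^2 <= K * (2 * M) * (t - s)" if st: "0 <= s" "s <= t" "t <= T" for s t
 proof -
  have "(jmean (g t) - jmean (g s))^2 <= K * (LBINT r. qform e (g r) (%v. v / jap v) * ind {s..t} r)"
   unfolding jmean_def by (rule weak_bound_two_time[OF e W M lipC1_jap st])
  also have "... <= K * (LBINT r. 2 * M * ind {s..t} r)"
  proof (intro mult_left_mono W(2) integral_mono)
   have b: "qform e (g r) (%v. v / jap v) <= 2 * M" if "r : {s..t}" for r
   proof -
    have r: "r : {0..T}" using that st by auto
    have "qform e (g r) (%v. v / jap v) <= 2 * 1^2 * jmean (g r)" using M[OF r] lipC1D(3,7)[OF lipC1_jap] by (intro qform_le[OF e rd]) auto
    thus ?thesis using M[OF r] by simp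
   qed
   show "integrable lborel (%r. qform e (g r) (%v. v / jap v) * ind {s..t} r)"
    by (rule integrable_bounded_interval[where B="2 * M"]) (use b qform_nonneg[OF e(2)] in "auto intro!: qform_time_measurable1 lipC1D(7)[OF lipC1_jap]")
   show "integrable lborel (%r. 2 * M * ind {s..t} r :: real)" by (intro integrable_mult_right integrable_real_indicator) (auto simp: emeasure_lborel_Icc_eq)
   show "qform e (g r) (%v. v / jap v) * ind {s..t} r <= 2 * M * ind {s..t} r" for r using b by (simp add: indicator_def)
  qed
  finally show ?thesis using st by (simp add: mult.assoc)
 qed
 define D where "D = sqrt (K * (2 * M))"
 have 2: "abs (jmean (g t) - jmean (g s)) <= D * sqrt (abs (t - s))" if "s : {0..T}" "t : {0..T}" for s t
 proof -
  have "(jmean (g t) - jmean (g s))^2 <= K * (2 * M) * abs (t - s)" using 1[of s t] 1[of t s] that by (cases "s <= t") (auto simp: power2_commute)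
  hence "sqrt ((jmean (g t) - jmean (g s))^2) <= sqrt (K * (2 * M) * abs (t - s))" by (rule real_sqrt_le_mono)
  thus ?thesis by (simp add: D_def real_sqrt_mult)
 qed
 have "continuous_on {0..T} (%t. jmean (g t))" unfolding continuous_on_def
 proof
  fix s assume s: "s : {0..T}"
  have "((%t. D * sqrt (abs (t - s))) \<longlongrightarrow> D * sqrt (abs (s - s))) (at s within {0..T})" by (intro tendsto_intros)
  hence z: "((%t. D * sqrt (abs (t - s))) \<longlongrightarrow> 0) (at s within {0..T})" by simp
  have "((%t. jmean (g t) - jmean (g s)) \<longlongrightarrow> 0) (at s within {0..T})"
   by (rule Lim_null_comparison[OF _ z]) (use 2[OF s] in "auto simp: eventually_at intro!: exI[of _ 1]")
  thus "((%t. jmean (g t)) \<longlongrightarrow> jmean (g s)) (at s within {0..T})" by (simp add: LIM_zero_iff)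
 qed
 hence "contU (%t. jmean (g (clamp_time 0 T t)))"
  using clamp_time_in(1)[OF T] by (intro continuous_on_compose2[OF _ clamp_time_cont, of "{0..T}" "%t. jmean (g t)"]) auto
 hence c: "contU (%t. jmean (g t))" using g(2) by simp
 show ?thesis
 proof (intro tame_curve.intro g(1) tame_curve_axioms.intro c)
  show "integrable (g t) jap" for t using M[OF clamp_time_in(1)[OF T], of t] g(2)[of t] by simp
 qed
qed

lemma tame_bounded:
 assumes "tame_curve g"
 shows "EX M. ALL t:{a..b}. jmean (g t) <= M"
proof -
 interpret tame_curve g by fact
 have "compact ((%t. jmean (g t)) ` {a..b})" by (intro compact_continuous_image continuous_on_subset[OF mom_cont]) auto
 hence "bounded ((%t. jmean (g t)) ` {a..b})" by (rule compact_imp_bounded)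
 thus ?thesis unfolding bounded_iff by (force intro: order_trans[OF abs_ge_self])
qed

lemma tame_two_time:
 assumes e: "0 <= e" "e < 1" and g: "tame_curve g" and W: "weak_bound e T g K" "0 <= K"
  and L: "lipC1 phi psi C" and st: "0 <= s" "s <= t" "t <= T"
 shows "((LINT v|g t. phi v) - (LINT v|g s. phi v))^2 <= K * (LBINT r. qform e (g r) psi * ind {s..t} r)"
proof -
 interpret tame_curve g by fact
 obtain M where M: "ALL t:{0..T}. jmean (g t) <= M" using tame_bounded[OF g] by blast
 show ?thesis by (rule weak_bound_two_time[OF e W _ L st]) (use M mom in auto)
qed

lemma tame_two_time_sup:
 assumes e: "0 <= e" "e < 1" and g: "tame_curve g" and W: "weak_bound e T g K" "0 <= K"
  and L: "lipC1 phi psi C" and st: "s : {0..T}" "t : {0..T}" and Q: "!!r. r : {0..T} ==> qform e (g r) psi <= Q"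
 shows "((LINT v|g t. phi v) - (LINT v|g s. phi v))^2 <= K * Q * abs (t - s)"
proof -
 interpret tame_curve g by fact
 have 1: "((LINT v|g t. phi v) - (LINT v|g s. phi v))^2 <= K * Q * (t - s)" if st: "0 <= s" "s <= t" "t <= T" for s t
 proof -
  have "((LINT v|g t. phi v) - (LINT v|g s. phi v))^2 <= K * (LBINT r. qform e (g r) psi * ind {s..t} r)" by (rule tame_two_time[OF e g W L st])
  also have "... <= K * (LBINT r. Q * ind {s..t} r)"
  proof (intro mult_left_mono W(2) integral_mono)
   have Q': "qform e (g r) psi <= Q" if "r : {s..t}" for r using Q that st by auto
   show "integrable lborel (%r. qform e (g r) psi * ind {s..t} r)"
    by (rule integrable_bounded_interval[where B=Q]) (use Q' qform_nonneg[OF e(2)] in "auto intro!: qform_time_measurable1 lipC1D(7)[OF L]")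
   show "integrable lborel (%r. Q * ind {s..t} r :: real)" by (intro integrable_mult_right integrable_real_indicator) (auto simp: emeasure_lborel_Icc_eq)
   show "qform e (g r) psi * ind {s..t} r <= Q * ind {s..t} r" for r using Q' by (simp add: indicator_def)
  qed
  finally show ?thesis using st by (simp add: mult.assoc)
 qed
 show ?thesis using 1[of s t] 1[of t s] st by (cases "s <= t") (auto simp: power2_commute)
qed

text \<open>The supremum of the first moments controls its own growth with exponent one half only, hence
 is bounded by the moment at a single time.\<close>

lemma tame_moment_bound:
 assumes e: "0 <= e" "e < 1" and g: "tame_curve g" and W: "weak_bound e T g K" "0 <= K" and T: "0 <= T"
  and st: "s : {0..T}" "t : {0..T}"
 shows "jmean (g t) <= 2 * jmean (g s) + 2 * K * T"
proof -
 interpret tame_curve g by fact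
 obtain r where r: "r : {0..T}" "ALL u:{0..T}. jmean (g u) <= jmean (g r)"
  using continuous_attains_sup[of "{0..T}" "%t. jmean (g t)"] T continuous_on_subset[OF mom_cont] by auto
 define M where "M = jmean (g r)"
 have pos: "0 <= jmean (g s)" "0 <= M" using jmean_ge_1[OF rd mom] unfolding M_def by (meson order_trans zero_le_one)+
 have "qform e (g u) (%v. v / jap v) <= 2 * M" if "u : {0..T}" for u
 proof -
  have "qform e (g u) (%v. v / jap v) <= 2 * 1^2 * jmean (g u)" using lipC1D(3,7)[OF lipC1_jap] by (intro qform_le[OF e rd mom]) auto
  thus ?thesis using r(2) that by (fastforce simp: M_def)
 qed
 from tame_two_time_sup[OF e g W lipC1_jap st(1) r(1) this]
 have "(M - jmean (g s))^2 <= K * (2 * M) * abs (r - s)" by (simp add: jmean_def M_def)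
 also have "... <= K * (2 * M) * T" using W(2) pos r(1) st(1) by (intro mult_left_mono) auto
 also have "... = 2 * (K * T) * M" by simp
 also have "... <= (K * T + M / 2)^2"
 proof -
  have "0 <= (K * T - M / 2)^2" by simp
  thus ?thesis by (simp add: power2_eq_square algebra_simps)
 qed
 finally have "M - jmean (g s) <= K * T + M / 2" by (rule power2_le_imp_le) (use W(2) T pos in simp)
 hence "M <= 2 * jmean (g s) + 2 * K * T" by simp
 thus ?thesis using r(2) st(2) unfolding M_def by force
qed

section \<open>Solutions of the continuity equation with finite action\<close>

lemma CE_D:
 assumes "CE e T f U"
 shows "t : {0..T} ==> rdist (f t)" "narrowly_continuous_on {0..T} f" "t : {0..T} ==> signed_measure borel_off_diag (U t)"
  "(nni (leb T) (%t. (nni (total_variation borel_off_diag (U t)) (%z. ennreal (wt e z))))) < \<infinity>"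
  "phi : C1c T ==> timeL T f phi = - (LINT t|leb T. signed_integral borel_off_diag (U t)
   (%z. wt e z * (deriv (%x. phi (t, x)) (snd z) - deriv (%x. phi (t, x)) (fst z))))" using assms unfolding CE_def timeL_def nl_grad_def
 by (auto simp: case_prod_beta' add_eq_0_iff)

lemma measurable_borel_off_diag:
 "h : Bor ==> h : borel_measurable borel_off_diag" by (rule measurable_restrict_space1) simp

lemma abs_integral_le_nn_integral:
 fixes h :: "'a => real"
 shows "ennreal (abs (LINT x|M. h x)) <= (nni M (%x. ennreal (abs (h x))))"
 by (cases "integrable M h") (use integral_norm_bound_ennreal[of M h] in "simp_all add: not_integrable_integral_eq")

lemma CE_timeL_bound:
 assumes e: "e < 1" and T: "0 < T" and CE: "CE e T f U" and phi: "phi : C1c T"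
  and C: "0 < C" "!!t x. abs (deriv (%y. phi (t, y)) x) <= C"
 shows "abs (timeL T f phi) <= 2 * C * enn2real (nni (leb T) (%t. (nni (total_variation borel_off_diag (U t)) (%z. ennreal (wt e z)))))"
proof -
 define S where "S = (nni (leb T) (%t. (nni (total_variation borel_off_diag (U t)) (%z. ennreal (wt e z)))))"
 define h where "h t = signed_integral borel_off_diag (U t)
  (%z. wt e z * (deriv (%x. phi (t, x)) (snd z) - deriv (%x. phi (t, x)) (fst z)))" for t
 obtain phit phiv a b R C' where td: "test_data T phi phit phiv a b R C'" using test_data_exists[OF phi T] by blast
 note dv = test_data_deriv(2)[OF td]
 have cv: "contU (%x. phiv (t, x))" for t using lipC1D(2)[OF test_data_lipC1[OF td]] .
 have ab: "ennreal (abs (h t / (2 * C))) <= (nni (total_variation borel_off_diag (U t)) (%z. ennreal (wt e z)))" for t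
 proof -
  have [measurable]: "(%x. phiv (t, x)) : Bor" using cv by (rule cont_bor)
  have sc: "h t / (2 * C) = signed_integral borel_off_diag (U t)
   (%z. wt e z * (phiv (t, snd z) - phiv (t, fst z)) / (2 * C))" unfolding h_def signed_integral_def dv by (simp add: diff_divide_distrib)
  show ?thesis unfolding sc
  proof (rule signed_integral_le_total_variation)
   show "(%z. wt e z * (phiv (t, snd z) - phiv (t, fst z)) / (2 * C)) : borel_measurable borel_off_diag"
    "(%z. wt e z) : borel_measurable borel_off_diag" by (rule measurable_borel_off_diag; unfold borel_prod[symmetric]; measurable)+
   fix z
   have "abs (phiv (t, snd z) - phiv (t, fst z)) <= 2 * C" using C(2)[of t "snd z"] C(2)[of t "fst z"] unfolding dv by linarith
   hence "abs (phiv (t, snd z) - phiv (t, fst z)) / (2 * C) <= 1" using C by simp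
   hence "wt e z * (abs (phiv (t, snd z) - phiv (t, fst z)) / (2 * C)) <= wt e z * 1" using e by (intro mult_left_mono) (auto simp: \<sigma>_nonneg)
   thus "abs (wt e z * (phiv (t, snd z) - phiv (t, fst z)) / (2 * C)) <= wt e z" using C e by (simp add: abs_mult abs_divide \<sigma>_nonneg)
  qed
 qed
 have "ennreal (abs ((LINT t|leb T. h t / (2 * C)))) <= (nni (leb T) (%t. ennreal (abs (h t / (2 * C)))))" by (rule abs_integral_le_nn_integral)
 also have "... <= S" unfolding S_def by (intro nn_integral_mono ab)
 finally have "ennreal (abs ((LINT t|leb T. h t / (2 * C)))) <= S" .
 moreover have "S < \<infinity>" using CE_D(4)[OF CE] by (simp add: S_def)
 ultimately have "abs ((LINT t|leb T. h t / (2 * C))) <= enn2real S" by (metis enn2real_ennreal enn2real_mono abs_ge_zero infinity_ennreal_def)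
 moreover have "timeL T f phi = - (LINT t|leb T. h t)" using CE_D(5)[OF CE phi] by (simp add: h_def)
 ultimately show ?thesis using C(1) by (simp add: S_def abs_divide field_simps)
qed

text \<open>The flux pairs finitely with the weight, so increments of cut-offs of \<open>jap\<close> are bounded by the
 Lipschitz constant times that total, uniformly in the cut-off.\<close>

lemma CE_moments:
 assumes e: "e < 1" and T: "0 < T" and CE: "CE e T f U" and s: "s : {0..T}" "integrable (f s) jap"
 shows "EX M. ALL t:{0..T}. integrable (f t) jap & jmean (f t) <= M"
proof -
 define g where "g = f \<circ> clamp_time 0 T"
 have fg: "f t = g t" if "t : {0..T}" for t using that by (simp add: g_def)
 interpret narrow_curve g unfolding g_def by (rule narrow_curve_clamp) (use CE_D[OF CE] T in auto)
 define S where "S = enn2real (nni (leb T) (%t. (nni (total_variation borel_off_diag (U t)) (%z. ennreal (wt e z)))))"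
 define p where "p n = cut (real (Suc n)) jap" for n
 define p' where "p' n = cut' (real (Suc n)) jap (%v. v / jap v)" for n
 have j0: "abs (jap 0) = 1" by (simp add: jap_def)
 have Lp: "lipC1 (p n) (p' n) 9" for n unfolding p_def p'_def using cut_lipC1(1)[OF lipC1_jap, of "real (Suc n)"] j0 by simp
 have p0: "0 <= p n v" "p n v <= jap v" for n v using bump_props(2,3)[of "v / real (Suc n)"] jap_pos(1)[of v] by (auto simp: p_def cut_def mult_left_le)
 have incr: "abs ((LINT v|g u. p n v) - (LINT v|g r. p n v)) <= 18 * S" if ru: "0 <= r" "r < u" "u <= T" for n r u
 proof (rule increment_by_time_test[OF ru lipC1D(5)[OF Lp]])
  have "abs (p n v) <= 1 + 1 * real (Suc n)" for v unfolding p_def using cut_lipC1(4)[OF lipC1_jap, of "real (Suc n)" v] j0 by simp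
  thus "bounded (range (p n))" by (intro boundedI[where B="1 + 1 * real (Suc n)"]) auto
  fix eta eta' a b assume eta: "!!r. (eta has_real_derivative eta' r) (at r)" "contU eta'" "r < a" "b < u"
   "!!r. r \<notin> {a..b} ==> eta r = 0" "!!r. 0 <= eta r & eta r <= 1"
  have inC: "(%z. eta (fst z) * p n (snd z)) : C1c T"
  proof (rule C1c_times_step[where u="%z. p n (snd z)" and R="real (Suc n)", OF C1fun_snd[OF lipC1D(1,2)[OF Lp]] _ eta(1,2)])
   show "p n (snd (t, v)) = 0" if "real (Suc n) < abs v" for t v using cut_lipC1(2)[OF lipC1_jap _ that] by (simp add: p_def)
  qed (use eta ru in auto)
  have d: "deriv (%y. eta (fst (r, y)) * p n (snd (r, y))) x = eta r * p' n x" for r x by (simp add: DERIV_imp_deriv[OF DERIV_cmult[OF lipC1D(1)[OF Lp]]])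
  have "abs (timeL T f (%z. eta (fst z) * p n (snd z))) <= 2 * 9 * S" unfolding S_def
  proof (rule CE_timeL_bound[OF e T CE inC])
   show "abs (deriv (%y. eta (fst (t, y)) * p n (snd (t, y))) x) <= 9" for t x
    unfolding d abs_mult using eta(6)[of t] lipC1D(3)[OF Lp, of n x] mult_mono[of "abs (eta t)" 1 "abs (p' n x)" 9] by simp
  qed simp
  thus "abs (timeL T g (%z. eta (fst z) * p n (snd z))) <= 18 * S" using timeL_cong[OF fg] by simp
 qed
 have S0: "0 <= S" by (simp add: S_def)
 have incr': "(LINT v|g t. p n v) <= jmean (g s) + 18 * S" if "t : {0..T}" for n t
 proof -
  have "(LINT v|g s. p n v) <= jmean (g s)" unfolding jmean_def
  proof (rule integral_mono)
   show "integrable (g s) jap" using s fg by simp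
   thus "integrable (g s) (p n)" by (rule integrable_by_jap[OF rd _ lipC1D(6)[OF Lp], where C=1]) (use p0[of n] in auto)
  qed (rule p0)
  moreover have "(LINT v|g t. p n v) <= (LINT v|g s. p n v) + 18 * S"
   using incr[of s t n] incr[of t s n] s(1) that S0 by (cases s t rule: linorder_cases) (auto simp: abs_le_iff)
  ultimately show ?thesis by linarith
 qed
 have fin: "integrable (g t) jap & jmean (g t) <= jmean (g s) + 18 * S" if "t : {0..T}" for t
 proof -
  have [measurable]: "jap : borel_measurable (g t)" "p n : borel_measurable (g t)" for n
   using real_distribution_measurable(1)[OF rd] lipC1D(6)[OF Lp] lipC1D(6)[OF lipC1_jap] by blast+
  interpret gt: real_distribution "g t" by (rule rd)
  have "(nni (g t) (%v. ennreal (jap v))) = (nni (g t) (%v. liminf (%n. ennreal (p n v))))"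
   unfolding p_def by (intro nn_integral_cong lim_imp_Liminf[symmetric] tendsto_ennrealI cut_limit(1)[OF lipC1_jap]) auto
  also have "... <= liminf (%n. \<integral>\<^sup>+v. ennreal (p n v) \<partial>g t)" by (rule nn_integral_liminf) measurable
  also have "... <= ennreal (jmean (g s) + 18 * S)"
  proof (rule Liminf_le, rule sequentially_bot, intro always_eventually allI)
   fix n
   have "norm (p n v) <= 1 + 1 * real (Suc n)" for v using cut_lipC1(4)[OF lipC1_jap, of "real (Suc n)" v] j0 by (simp add: p_def)
   hence "integrable (g t) (p n)" by (intro gt.integrable_const_bound[where B="1 + 1 * real (Suc n)"] AE_I2) auto
   hence "(nni (g t) (%v. ennreal (p n v))) = ennreal (LINT v|g t. p n v)" by (rule nn_integral_eq_integral) (simp add: p0)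
   thus "(nni (g t) (%v. ennreal (p n v))) <= ennreal (jmean (g s) + 18 * S)" using incr'[OF that] by (simp add: ennreal_leI)
  qed
  finally have le: "(nni (g t) (%v. ennreal (jap v))) <= ennreal (jmean (g s) + 18 * S)" .
  hence i: "integrable (g t) jap" by (intro integrableI_bounded) (auto simp: jap_pos less_imp_le abs_of_pos intro: le_less_trans)
  have "0 <= jmean (g s)" unfolding jmean_def by (intro lint_nonneg) (simp add: jap_pos less_imp_le)
  moreover have "ennreal (jmean (g t)) <= ennreal (jmean (g s) + 18 * S)"
   using le nn_integral_eq_integral[OF i] unfolding jmean_def[of "g t"] by (simp add: jap_pos less_imp_le del: ennreal_plus)
  ultimately show ?thesis using i S0 by (subst (asm) ennreal_le_iff) auto
 qed
 show ?thesis using fin fg by (intro exI[of _ "jmean (g s) + 18 * S"]) auto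
qed

lemma CE_weak_bound:
 assumes e: "0 <= e" "e < 1" and T: "0 < T" and CE: "CE e T f U"
  and K: "(nni (leb T) (%t. action e (f t) (U t))) <= ennreal K" "0 <= K"
  and M: "!!t. t : {0..T} ==> integrable (f t) jap & jmean (f t) <= M"
 shows "weak_bound e T f K" unfolding weak_bound_def
proof
 fix phi assume phi: "phi : C1c T"
 define g where "g = f \<circ> clamp_time 0 T"
 have fg: "f t = g t" if "t : {0..T}" for t using that by (simp add: g_def)
 interpret narrow_curve g unfolding g_def by (rule narrow_curve_clamp) (use CE_D[OF CE] T in auto)
 obtain phit phiv a b R C where td: "test_data T phi phit phiv a b R C" using test_data_exists[OF phi T] by blast
 note dv = test_data_deriv(2)[OF td]
 define h where "h t = signed_integral borel_off_diag (U t)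
  (%z. wt e z * (phiv (t, snd z) - phiv (t, fst z)))" for t
 define q where "q t = qform e (g t) (%x. phiv (t, x))" for t
 have L: "timeL T f phi = - (LINT t|leb T. h t)" using CE_D(5)[OF CE phi] by (simp add: h_def dv)
 have [measurable]: "phiv : Bor" using td by (auto simp: test_data_def intro: cont_bor)
 have qm[measurable]: "q : Bor" unfolding q_def by (rule qform_time_measurable[where psi="%t x. phiv (t, x)"]) simp
 have q0: "0 <= q t" for t unfolding q_def by (rule qform_nonneg[OF e(2)])
 have lt: "lipC1 (%x. phi (t, x)) (%x. phiv (t, x)) C" for t by (rule test_data_lipC1[OF td])
 have qb: "q t <= 2 * C^2 * M" if "t : {0..T}" for t
 proof -
  have "q t <= 2 * C^2 * jmean (g t)" unfolding q_def using M[OF that] fg[OF that] lipC1D(3,7)[OF lt] by (intro qform_le[OF e rd]) auto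
  also have "... <= 2 * C^2 * M" using M[OF that] fg[OF that] by (intro mult_left_mono) auto
  finally show ?thesis .
 qed
 have qi: "integrable (leb T) q" unfolding lebesgue_on_integral(2)[OF qm] by (rule integrable_bounded_interval[OF qm]) (use qb q0 in auto)
 have "(LBINT t. qform e (f t) (%x. deriv (%y. phi (t, y)) x) * ind {0..T} t) = (LBINT t. q t * ind {0..T} t)"
  unfolding q_def dv by (intro lint_cong) (auto simp: indicator_def fg)
 also have "... = (LINT t|leb T. q t)" by (rule lebesgue_on_integral(1)[OF qm, symmetric])
 finally have rhs: "(LBINT t. qform e (f t) (%x. deriv (%y. phi (t, y)) x) * ind {0..T} t) = (LINT t|leb T. q t)" .
 have le: "action_density (q t) (h t) <= action e (f t) (U t)" if t: "t : {0..T}" for t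
 proof -
  have [measurable]: "(%x. phiv (t, x)) : Bor" by (rule lipC1D(7)[OF lt])
  have "(%z. phiv (t, snd z) - phiv (t, fst z)) : borel_measurable (borel :: (real * real) measure)" unfolding borel_prod[symmetric] by measurable
  moreover have "integrable (sq (f t)) (%z. wt e z * (phiv (t, snd z) - phiv (t, fst z))^2)"
   using M[OF t] lipC1D(3,7)[OF lt] CE_D(1)[OF CE t] by (intro qform_integrable[OF e]) auto
  ultimately show ?thesis using action_density_pairing_le_action[OF CE_D(1)[OF CE t] CE_D(3)[OF CE t] e, of "%z. phiv (t, snd z) - phiv (t, fst z)"]
   unfolding h_def q_def fg[OF t, symmetric] qform_def by simp
 qed
 show "(timeL T f phi)^2 <= K * (LBINT t. qform e (f t) (%x. deriv (%y. phi (t, y)) x) * ind {0..T} t)" unfolding rhs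
 proof (cases "integrable (leb T) h")
  case False
  thus "(timeL T f phi)^2 <= K * (LINT t|leb T. q t)" using K(2) q0 by (simp add: L not_integrable_integral_eq lint_nonneg)
 next
  case True
  hence [measurable]: "h : borel_measurable (leb T)" by simp
  have [measurable]: "q : borel_measurable (leb T)" using qi by simp
  have adm: "(%t. action_density (q t) (h t)) : borel_measurable (leb T)" unfolding action_density_def by measurable
  have "(nni (leb T) (%t. action_density (q t) (h t))) <= (nni (leb T) (%t. action e (f t) (U t)))" using le by (intro nn_integral_mono) auto
  also note K(1)
  finally have adK: "(nni (leb T) (%t. action_density (q t) (h t))) <= ennreal K" .
  have "AE t in leb T. action_density (q t) (h t) ~= \<infinity>" by (rule nn_integral_PInf_AE[OF adm]) (use adK in "auto simp: top_unique")
  hence ae: "AE t in leb T. q t = 0 --> h t = 0" by eventually_elim (auto simp: action_density_def split: if_splits)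
  define F where "F t = (if q t = 0 then 0 else h t / sqrt (q t))" for t
  have [measurable]: "F : borel_measurable (leb T)" unfolding F_def by measurable
  have "(nni (leb T) (%t. ennreal ((F t)^2))) = (nni (leb T) (%t. action_density (q t) (h t)))" by (rule nn_integral_cong_AE, use ae in eventually_elim)
    (use q0 in "auto simp: F_def action_density_def power_divide order.not_eq_order_implies_strict less_le")
  hence F: "(nni (leb T) (%t. ennreal ((F t)^2))) <= ennreal K" using adK by simp
  hence Fi: "integrable (leb T) (%t. (F t)^2)" by (intro integrableI_bounded) (auto intro: le_less_trans)
  have FK: "(LINT t|leb T. (F t)^2) <= K" using F K(2) by (subst (asm) nn_integral_eq_integral[OF Fi]) auto
  have Gi: "integrable (leb T) (%t. (sqrt (q t))^2)" using qi q0 by simp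
  have "(LINT t|leb T. h t) = (LINT t|leb T. F t * sqrt (q t))" by (rule integral_cong_AE) (use ae in "auto simp: F_def elim!: eventually_mono")
  hence "(timeL T f phi)^2 = (LINT t|leb T. F t * sqrt (q t))^2" by (simp add: L)
  also have "... <= (LINT t|leb T. (F t)^2) * (LINT t|leb T. (sqrt (q t))^2)" by (rule cauchy_schwarz_integral(2)[OF _ _ Fi Gi]) measurable
  also have "... <= K * (LINT t|leb T. q t)" using FK q0 by (auto intro!: mult_right_mono lint_nonneg)
  finally show "(timeL T f phi)^2 <= K * (LINT t|leb T. q t)" .
 qed
qed

lemma CE_tame:
 assumes e: "0 <= e" "e < 1" and T: "0 < T" and CE: "CE e T f U"
  and K: "(nni (leb T) (%t. action e (f t) (U t))) <= ennreal K" "0 <= K"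
  and s: "s : {0..T}" "integrable (f s) jap"
 shows "tame_curve (f \<circ> clamp_time 0 T)" "weak_bound e T (f \<circ> clamp_time 0 T) K"
proof -
 obtain M where M: "!!t. t : {0..T} ==> integrable (f t) jap & jmean (f t) <= M" using CE_moments[OF e(2) T CE s] by blast
 have W: "weak_bound e T f K" by (rule CE_weak_bound[OF e T CE K M])
 thus W': "weak_bound e T (f \<circ> clamp_time 0 T) K" by (subst weak_bound_cong[where g=f]) auto
 show "tame_curve (f \<circ> clamp_time 0 T)"
 proof (rule weak_bound_tame[OF e _ _ _ W' K(2)])
  show "narrow_curve (f \<circ> clamp_time 0 T)" by (rule narrow_curve_clamp) (use CE_D[OF CE] T in auto)
  show "(f \<circ> clamp_time 0 T) t = (f \<circ> clamp_time 0 T) (clamp_time 0 T t)" for t using T by simp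
  show "integrable ((f \<circ> clamp_time 0 T) t) jap & jmean ((f \<circ> clamp_time 0 T) t) <= M" if "t : {0..T}" for t using M[OF that] that by simp
 qed (use T in simp)
qed

section \<open>The cost controls increments, with the gradient form at one end point only\<close>

lemma dA_curve:
 assumes "dA e mu nu < ennreal b" "0 <= b"
 shows "EX f U. CE e 1 f U & f 0 = mu & f 1 = nu & (nni (lebesgue_on {0..1}) (%t. action e (f t) (U t))) <= ennreal (b^2)"
proof -
 define I where "I = (INF (f, U) \<in> CE_between e 1 mu nu. \<integral>\<^sup>+t. action e (f t) (U t) \<partial>lebesgue_on {0..1})"
 have s: "ennreal_sqrt I < ennreal b" using assms(1) by (simp add: dA_def I_def)
 hence fin: "I ~= \<infinity>" by (auto simp: ennreal_sqrt_def)
 hence "sqrt (enn2real I) < b" using s by (simp add: ennreal_sqrt_def ennreal_less_iff)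
 hence "enn2real I < b^2" using power_strict_mono[of "sqrt (enn2real I)" b 2] by simp
 hence "I < ennreal (b^2)" using fin by (metis enn2real_nonneg ennreal_enn2real_if ennreal_less_iff infinity_ennreal_def)
 then obtain p where "p : CE_between e 1 mu nu" "(case p of (f, U) => \<integral>\<^sup>+t. action e (f t) (U t) \<partial>lebesgue_on {0..1}) < ennreal (b^2)"
  unfolding I_def INF_less_iff by blast
 then obtain f U where "(f, U) : CE_between e 1 mu nu" "(nni (lebesgue_on {0..1}) (%t. action e (f t) (U t))) < ennreal (b^2)" by (cases p) auto
 thus ?thesis by (intro exI[of _ f] exI[of _ U]) (auto simp: CE_between_def less_imp_le)
qed

lemma dA_tame:
 assumes e: "0 <= e" "e < 1" and b: "0 <= b" and d: "dA e mu nu < ennreal b | dA e nu mu < ennreal b" and mu: "integrable mu jap"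
 shows "EX g s s'. tame_curve g & weak_bound e 1 g (b^2) & s : {0..1} & s' : {0..1} & g s = mu & g s' = nu"
proof -
 have "EX f U s s'. CE e 1 f U & (nni (lebesgue_on {0..1}) (%t. action e (f t) (U t))) <= ennreal (b^2) & s : {0..1} & s' : {0..1} & f s = mu & f s' = nu" using d
 proof
  assume "dA e mu nu < ennreal b"
  then obtain f U where "CE e 1 f U" "f 0 = mu" "f 1 = nu" "(nni (lebesgue_on {0..1}) (%t. action e (f t) (U t))) <= ennreal (b^2)" using dA_curve[OF _ b] by blast
  thus ?thesis by (intro exI[of _ f] exI[of _ U] exI[of _ 0] exI[of _ 1]) auto
 next
  assume "dA e nu mu < ennreal b"
  then obtain f U where "CE e 1 f U" "f 0 = nu" "f 1 = mu" "(nni (lebesgue_on {0..1}) (%t. action e (f t) (U t))) <= ennreal (b^2)" using dA_curve[OF _ b] by blast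
  thus ?thesis by (intro exI[of _ f] exI[of _ U] exI[of _ 1] exI[of _ 0]) auto
 qed
 then obtain f U s s' where f: "CE e 1 f U" "(nni (lebesgue_on {0..1}) (%t. action e (f t) (U t))) <= ennreal (b^2)"
  "s : {0..1}" "s' : {0..1}" "f s = mu" "f s' = nu" by blast
 thus ?thesis using CE_tame[OF e zero_less_one f(1,2) _ f(3)] mu by (intro exI[of _ "f \<circ> clamp_time 0 1"] exI[of _ s] exI[of _ s']) auto
qed

text \<open>A curve of small cost that connects the two measures stays close to the given one, so its gradient
 form can be replaced by the form at that end point. Otherwise curves of vanishing cost would exist whose
 forms stay away from it, contradicting the continuity of the form.\<close>

lemma near_increment:
 assumes e: "0 <= e" "e < 1" and mu: "rdist mu" "integrable mu jap" and L: "lipC1 phi psi C" and eps: "0 < eps"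
 shows "EX dl>0. ALL nu a. 0 <= a & a < dl & (dA e mu nu <= ennreal a | dA e nu mu <= ennreal a) -->
  abs ((LINT v|nu. phi v) - (LINT v|mu. phi v)) <= a * (sqrt (qform e mu psi) + eps)"
proof (rule ccontr)
 define Q where "Q = sqrt (qform e mu psi) + eps"
 have Q: "0 < Q" "qform e mu psi < Q^2"
 proof -
  have s: "0 <= sqrt (qform e mu psi)" using qform_nonneg[OF e(2)] by simp
  thus "0 < Q" using eps unfolding Q_def by (rule add_nonneg_pos)
  have "qform e mu psi = (sqrt (qform e mu psi))^2" using qform_nonneg[OF e(2)] by simp
  also have "... < Q^2" using s eps unfolding Q_def by (intro power_strict_mono) auto
  finally show "qform e mu psi < Q^2" .
 qed
 assume "~  ?thesis"
 hence H: "EX nu a. 0 <= a & a < dl & (dA e mu nu <= ennreal a | dA e nu mu <= ennreal a) & a * Q < abs ((LINT v|nu. phi v) - (LINT v|mu. phi v))" if "0 < dl" for dl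
  using that unfolding Q_def by (meson not_le)
 have "EX g s s' b. tame_curve g & weak_bound e 1 g (b^2) & s : {0..1} & s' : {0..1} & g s = mu &
  0 < b & b < inverse (real (Suc n)) & b * Q < abs ((LINT v|g s'. phi v) - (LINT v|g s. phi v))" for n
 proof -
  obtain nu a where a: "0 <= a" "a < inverse (real (Suc n))" "dA e mu nu <= ennreal a | dA e nu mu <= ennreal a"
   "a * Q < abs ((LINT v|nu. phi v) - (LINT v|mu. phi v))" using H[of "inverse (real (Suc n))"] by auto
  have "a < abs ((LINT v|nu. phi v) - (LINT v|mu. phi v)) / Q" using a(4) Q by (simp add: field_simps)
  then obtain b where b: "a < b" "b < min (inverse (real (Suc n))) (abs ((LINT v|nu. phi v) - (LINT v|mu. phi v)) / Q)"
   using dense[of a "min (inverse (real (Suc n))) (abs ((LINT v|nu. phi v) - (LINT v|mu. phi v)) / Q)"] a(2) by auto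
  have "ennreal a < ennreal b" using a b by (simp add: ennreal_less_iff)
  hence "dA e mu nu < ennreal b | dA e nu mu < ennreal b" using a(3) by (auto intro: le_less_trans)
  then obtain g s s' where "tame_curve g & weak_bound e 1 g (b^2) & s : {0..1} & s' : {0..1} & g s = mu & g s' = nu"
   using dA_tame[OF e, of b mu nu] a b mu(2) by auto
  thus ?thesis using a(1) b Q(1) by (intro exI[of _ g] exI[of _ s] exI[of _ s'] exI[of _ b]) (auto simp: field_simps)
 qed
 then obtain g s s' b where g: "!!n. tame_curve (g n)" "!!n. weak_bound e 1 (g n) ((b n)^2)" "!!n. s n : {0..1}" "!!n. s' n : {0..1}"
  "!!n. g n (s n) = mu" "!!n::nat. 0 < b n" "!!n. b n < inverse (real (Suc n))" "!!n. b n * Q < abs ((LINT v|g n (s' n). phi v) - (LINT v|g n (s n). phi v))"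
  by metis
 have b1: "b n <= 1" for n
 proof -
  have "inverse (real (Suc n)) <= 1" by (simp add: field_simps)
  thus ?thesis using g(7)[of n] by linarith
 qed
 have b0: "b ---> 0" by (rule tendsto_sandwich[OF _ _ tendsto_const LIMSEQ_inverse_real_of_nat]) (use g(6,7) in "auto intro!: always_eventually less_imp_le")
 have rdg: "rdist (g n r)" "integrable (g n r) jap" for n r using g(1)[of n] unfolding tame_curve_def tame_curve_axioms_def narrow_curve_def by auto
 define M where "M = 2 * jmean mu + 2"
 have Mb: "jmean (g n r) <= M" if "r : {0..1}" for n r
 proof -
  have "jmean (g n r) <= 2 * jmean (g n (s n)) + 2 * (b n)^2 * 1" by (rule tame_moment_bound[OF e g(1)[of n] g(2)[of n] _ _ g(3)[of n] that]) auto
  moreover have "(b n)^2 <= 1" using b1[of n] g(6)[of n] by (intro power_le_one) auto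
  ultimately show ?thesis by (simp add: M_def g(5))
 qed
 have inc: "((LINT v|g n r. xi v) - (LINT v|mu. xi v))^2 <= (b n)^2 * (2 * D^2 * M)" if r: "r : {0..1}" and Lxi: "lipC1 xi zt D" for xi zt D n r
 proof -
  have "qform e (g n u) zt <= 2 * D^2 * M" if "u : {0..1}" for u
  proof -
   have "qform e (g n u) zt <= 2 * D^2 * jmean (g n u)" using lipC1D(3,7)[OF Lxi] rdg by (intro qform_le[OF e]) auto
   thus ?thesis using mult_left_mono[OF Mb[OF that, of n], of "2 * D^2"] by simp
  qed
  from tame_two_time_sup[OF e g(1)[of n] g(2)[of n] _ Lxi g(3)[of n] r this]
  have "((LINT v|g n r. xi v) - (LINT v|mu. xi v))^2 <= (b n)^2 * (2 * D^2 * M) * abs (r - s n)" by (simp add: g(5))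
  also have "... <= (b n)^2 * (2 * D^2 * M) * 1" using r g(3)[of n] Mb[OF r, of n] jmean_ge_1[OF rdg, of n r] by (intro mult_left_mono) auto
  finally show ?thesis by simp
 qed
 have "EX r:{0..1}. Q^2 <= qform e (g n r) psi" for n
 proof (rule ccontr)
  assume "~  ?thesis"
  hence "!!r. r : {0..1} ==> qform e (g n r) psi <= Q^2" by (simp add: not_le less_imp_le)
  from tame_two_time_sup[OF e g(1)[of n] g(2)[of n] _ L g(3)[of n] g(4)[of n] this]
  have "((LINT v|g n (s' n). phi v) - (LINT v|g n (s n). phi v))^2 <= (b n)^2 * Q^2 * abs (s' n - s n)" by simp
  also have "... <= (b n)^2 * Q^2 * 1" using g(3)[of n] g(4)[of n] by (intro mult_left_mono) auto
  also have "... = (b n * Q)^2" by (simp add: power_mult_distrib)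
  finally have "abs ((LINT v|g n (s' n). phi v) - (LINT v|g n (s n). phi v)) <= abs (b n * Q)" by (simp add: abs_le_square_iff)
  thus False using g(8)[of n] g(6)[of n] Q by simp
 qed
 then obtain r where r: "!!n. r n : {0..1}" "!!n. Q^2 <= qform e (g n (r n)) psi" by metis
 define ka where "ka n = g n (r n)" for n
 have conv: "(%n. LINT v|ka n. xi v) ---> (LINT v|mu. xi v)" if Lxi: "lipC1 xi zt D" for xi zt D
 proof -
  have "(%n. b n * sqrt (2 * D^2 * M)) ---> 0 * sqrt (2 * D^2 * M)" by (intro tendsto_intros b0)
  hence z: "(%n. b n * sqrt (2 * D^2 * M)) ---> 0" by simp
  have "norm ((LINT v|ka n. xi v) - (LINT v|mu. xi v)) <= b n * sqrt (2 * D^2 * M)" for n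
   using real_sqrt_le_mono[OF inc[OF r(1)[of n] Lxi, of n]] g(6)[of n] by (simp add: ka_def real_sqrt_mult)
  hence "(%n. (LINT v|ka n. xi v) - (LINT v|mu. xi v)) ---> 0" by (intro Lim_null_comparison[OF always_eventually z]) auto
  thus ?thesis by (simp add: LIM_zero_iff)
 qed
 have "(%n. qform e (ka n) psi) ---> qform e mu psi"
 proof (rule qform_conv[OF e, where psi="%_. psi" and C=C])
  show "rdist (ka n)" "integrable (ka n) jap" for n using rdg by (auto simp: ka_def)
  thus "weak_conv_m ka mu" using conv mu(1) by (intro weak_conv_by_lipC1) auto
  show "(%n. jmean (ka n)) ---> jmean mu" unfolding jmean_def by (rule conv[OF lipC1_jap])
  show "(%n. psi (X n)) ---> psi x" if "X ---> x" for X x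
   using lipC1D(2)[OF L] that by (intro isCont_tendsto_compose[where g=psi]) (auto simp: continuous_on_eq_continuous_at)
 qed (use mu lipC1D(3,7)[OF L] in auto)
 hence "Q^2 <= qform e mu psi" by (rule LIMSEQ_le_const) (use r(2) in "auto simp: ka_def")
 thus False using Q(2) by simp
qed

declare borel_measurable_fst_snd [measurable del] borel_measurable_fst_snd' [measurable del]

section \<open>Curves of bounded speed\<close>

definition primitive :: "(real => real) => real => real" where
 "primitive m t = (LBINT x. m x * ind {..t} x)"

lemma integrable_times_indicator:
 "integrable lborel m ==> A : sets borel ==> integrable lborel (%x. m x * ind A x :: real)"
 using integrable_mult_indicator[of A lborel m] by (simp add: mult.commute)

lemma primitive_diff:
 assumes m: "integrable lborel m" and st: "s <= t"
 shows "primitive m t - primitive m s = (LBINT x. m x * ind {s..t} x)"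
proof -
 have "primitive m t - primitive m s = (LBINT x. m x * ind {..t} x - m x * ind {..s} x)"
  unfolding primitive_def by (rule lint_diff[symmetric]) (intro integrable_times_indicator[OF m]; simp)+
 also have "... = (LBINT x. m x * ind {s..t} x)"
 proof (rule integral_cong_AE)
  show "AE x in lborel. m x * ind {..t} x - m x * ind {..s} x = m x * ind {s..t} x"
   using AE_lborel_singleton[of s] by eventually_elim (use st in "auto simp: indicator_def")
 qed (use m in measurable)
 finally show ?thesis .
qed

lemma primitive_mono:
 assumes "integrable lborel m" "!!x. 0 <= m x" "s <= t" shows "primitive m s <= primitive m t"
proof -
 have "0 <= (LBINT x. m x * ind {s..t} x)" using assms(2) by (intro lint_nonneg) auto
 thus ?thesis using primitive_diff[OF assms(1,3)] by simp
qed

lemma primitive_cont: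
 assumes m: "integrable lborel m" shows "contU (primitive m)" unfolding continuous_on_sequentially comp_def
proof (intro allI ballI impI, elim conjE)
 fix t :: "nat => real" and s assume t: "t ---> s"
 have [measurable]: "m : Bor" using m by simp
 show "(%n. primitive m (t n)) ---> primitive m s" unfolding primitive_def
 proof (rule integral_dominated_convergence[where w="%x. abs (m x)"])
  show "AE x in lborel. (%n. m x * ind {..t n} x) ---> m x * ind {..s} x" using AE_lborel_singleton[of s]
  proof eventually_elim
   case (elim x)
   have "\<forall>\<^sub>F n in sequentially. (ind {..t n} x :: real) = ind {..s} x"
   proof (cases "x < s")
    case True
    from order_tendstoD(1)[OF t True] show ?thesis by eventually_elim (use True in "auto simp: indicator_def")
   next
    case False
    hence "s < x" using elim by simp
    from order_tendstoD(2)[OF t `s < x`] show ?thesis by eventually_elim (use `s < x` in "auto simp: indicator_def")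
   qed
   thus ?case by (intro tendsto_mult tendsto_const tendsto_eventually)
  qed
 qed (use m in "auto simp: indicator_def")
qed

definition lipC1c :: "(real => real) => (real => real) => real => bool" where
 "lipC1c phi psi C \<longleftrightarrow> lipC1 phi psi C & bounded (range phi) & (EX R. ALL v. R < abs v --> phi v = 0)"

text \<open>A local bound, in terms of an increasing function \<open>W\<close> of time, against the gradient form at the base
 point alone. It follows from a bound of the collision cost and is preserved by changes of time.\<close>

definition speed_bound :: "real => (real => real measure) => (real => real) => real => real => bool" where
 "speed_bound e g W a b \<longleftrightarrow> (ALL phi psi C x eps. lipC1c phi psi C & x : {a..b} & 0 < eps -->
  (EX d>0. ALL y:{a..b}. abs (y - x) < d -->
   abs ((LINT v|g y. phi v) - (LINT v|g x. phi v)) <= abs (W y - W x) * (sqrt (qform e (g x) psi) + eps)))"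

lemma test_data_lipC1c:
 assumes "test_data T phi phit phiv a b R C" shows "lipC1c (%x. phi (t, x)) (%x. phiv (t, x)) C" unfolding lipC1c_def
proof (intro conjI exI[of _ R] allI impI test_data_lipC1[OF assms])
 show "bounded (range (%x. phi (t, x)))" using assms by (intro boundedI[where B=C]) (auto simp: test_data_def)
 show "phi (t, v) = 0" if "R < abs v" for v
 proof -
  have "v \<notin> {-R..R}" using that by auto
  thus ?thesis using assms unfolding test_data_def by blast
 qed
qed

text \<open>The set of intervals on which the inequality holds is closed under concatenation and contains all
 short intervals around each point, so Bolzano's bisection lemma applies.\<close>

lemma local_to_global_increment:
 fixes Phi W :: "real => real"
 assumes st: "s <= t" and R: "0 <= R" and W: "!!x y. x <= y ==> W x <= W y"
  and loc: "!!x eps. x : {s..t} ==> 0 < eps ==> EX d>0. ALL y:{s..t}. abs (y - x) < d --> abs (Phi y - Phi x) <= abs (W y - W x) * (R + eps)"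
 shows "abs (Phi t - Phi s) <= R * (W t - W s)"
proof -
 have 1: "abs (Phi t - Phi s) <= (W t - W s) * (R + eps)" if eps: "0 < eps" for eps
 proof -
  let ?c = "clamp_time s t"
  have mono: "?c x <= ?c y" if "x <= y" for x y using that by (auto simp: clamp_time_def)
  define P where "P x y \<longleftrightarrow> abs (Phi (?c y) - Phi (?c x)) <= (W (?c y) - W (?c x)) * (R + eps)" for x y
  have "P s t"
  proof (rule Bolzano[OF st])
   fix a b c assume P: "P a b" "P b c"
   have "abs (Phi (?c c) - Phi (?c a)) <= abs (Phi (?c c) - Phi (?c b)) + abs (Phi (?c b) - Phi (?c a))" by linarith
   thus "P a c" using P unfolding P_def by (simp add: algebra_simps)
  next
   fix x assume x: "s <= x" "x <= t"
   then obtain d where d: "d > 0" "!!y. y : {s..t} ==> abs (y - x) < d ==> abs (Phi y - Phi x) <= abs (W y - W x) * (R + eps)" using loc[of x eps] eps by auto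
   have cx: "?c x = x" using x by simp
   show "EX d>0. ALL a b. a <= x & x <= b & b - a < d --> P a b"
   proof (intro exI[of _ d] conjI d(1) allI impI)
    fix a b assume ab: "a <= x & x <= b & b - a < d"
    have c: "?c a : {s..t}" "?c b : {s..t}" "abs (?c a - x) < d" "abs (?c b - x) < d" "?c a <= x" "x <= ?c b" using st x ab by (auto simp: clamp_time_def)
    have "abs (Phi (?c b) - Phi x) <= (W (?c b) - W x) * (R + eps)" using d(2)[OF c(2,4)] W[OF c(6)] by simp
    moreover have "abs (Phi x - Phi (?c a)) <= (W x - W (?c a)) * (R + eps)" using d(2)[OF c(1,3)] W[OF c(5)] by (simp add: abs_minus_commute)
    moreover have "abs (Phi (?c b) - Phi (?c a)) <= abs (Phi (?c b) - Phi x) + abs (Phi x - Phi (?c a))" by linarith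
    ultimately show "P a b" unfolding P_def by (simp add: algebra_simps)
   qed
  qed
  thus ?thesis using st by (simp add: P_def)
 qed
 have "((%eps. (W t - W s) * (R + eps)) \<longlongrightarrow> (W t - W s) * (R + 0)) (at_right 0)" by (intro tendsto_intros)
 hence "abs (Phi t - Phi s) <= (W t - W s) * (R + 0)"
  by (rule tendsto_lowerbound) (use 1 in "auto simp: eventually_at_right_less intro: eventually_mono[OF eventually_at_right_less]")
 thus ?thesis by (simp add: mult.commute)
qed

lemma (in tame_curve) gradient_form_jointly_continuous:
 assumes e: "0 <= e" "e < 1" and td: "test_data T phi phit phiv a b R C"
 shows "contU (%p. qform e (g (fst p)) (%x. phiv (snd p, x)))" unfolding continuous_on_sequentially comp_def
proof (intro allI ballI impI, elim conjE)
 fix p :: "nat => real * real" and q assume p: "p ---> q"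
 have v: "contU phiv" using td by (auto simp: test_data_def)
 show "(%n. qform e (g (fst (p n))) (%x. phiv (snd (p n), x))) ---> qform e (g (fst q)) (%x. phiv (snd q, x))"
 proof (rule qform_conv[OF e rd rd _ mom mom, where C=C])
  show "weak_conv_m (%n. g (fst (p n))) (g (fst q))" by (intro weak_conv_seq tendsto_fst p)
  show "(%n. jmean (g (fst (p n)))) ---> jmean (g (fst q))"
   using mom_cont tendsto_fst[OF p] by (intro isCont_tendsto_compose[where g="%t. jmean (g t)"]) (auto simp: continuous_on_eq_continuous_at)
  show "(%x. phiv (snd (p n), x)) : Bor" "(%x. phiv (snd q, x)) : Bor" for n by (rule lipC1D(7)[OF test_data_lipC1[OF td]])+
  show "abs (phiv (snd (p n), x)) <= C" for n x using td by (auto simp: test_data_def)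
  show "(%n. phiv (snd (p n), X n)) ---> phiv (snd q, x)" if "X ---> x" for x X using v tendsto_Pair[OF tendsto_snd[OF p] that]
   by (intro isCont_tendsto_compose[where g=phiv]) (auto simp: continuous_on_eq_continuous_at)
 qed
qed

text \<open>Along the curve, the integral of the test function at the current time changes for two reasons:
 the test function moves, which contributes the integral of its time derivative, and the measure
 moves, which the speed bound controls. The sum of both effects vanishes over the whole interval, and
 the local estimates are added up by \<open>local_to_global_increment\<close>.\<close>

lemma speed_bound_weak_form:
 assumes e: "0 <= e" "e < 1" and g: "tame_curve g" and td: "test_data T phi phit phiv a b R C"
  and m: "m : Bor" "integrable lborel m" "!!x. 0 <= m x"
  and S: "speed_bound e g W al be" and Wm: "!!s t. al <= s ==> s <= t ==> t <= be ==> W t - W s = (LBINT x. m x * ind {s..t} x)"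
  and albe: "al < a" "b < be" "0 <= al" "be <= T"
 shows "abs (timeL T g phi) <= (LBINT r. m r * sqrt (qform e (g r) (%x. phiv (r, x))) * ind {al..be} r)"
proof -
 interpret tame_curve g by fact
 note [measurable] = m(1)
 have ab: "a <= b" and cphi: "contU phi" and ct: "contU phit"
  and dt: "!!t v. ((%s. phi (s, v)) has_real_derivative phit (t, v)) (at t)"
  and z: "!!t v. t \<notin> {a..b} ==> phi (t, v) = 0" "!!t v. t \<notin> {a..b} ==> phit (t, v) = 0"
  and bd: "!!z. abs (phi z) <= C" "!!z. abs (phit z) <= C" and C0: "0 <= C" using td by (auto simp: test_data_def)
 define Q where "Q r = sqrt (qform e (g r) (%x. phiv (r, x)))" for r
 have Qc: "contU Q" unfolding Q_def
  by (intro continuous_on_real_sqrt continuous_on_compose2[OF gradient_form_jointly_continuous[OF e td], of _ "%r. (r, r)", simplified] continuous_intros)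
 have Q0: "0 <= Q r" for r by (simp add: Q_def qform_nonneg e)
 have [measurable]: "Q : Bor" by (rule cont_bor[OF Qc])
 have sec: "(%v. h (t, v)) : Bor" if "contU h" for h :: "real * real => real" and t by (intro cont_bor continuous_on_compose2[OF that] continuous_intros) auto
 have ib: "integrable (g s) (%v. h (t, v))" if h: "contU h" "!!z. abs (h z) <= C" for h :: "real * real => real" and s t
 proof -
  interpret gs: real_distribution "g s" by (rule rd)
  show ?thesis by (rule gs.integrable_const_bound[where B=C, OF _ real_distribution_measurable(1)[OF rd sec[OF h(1)]]]) (use h(2) in auto)
 qed
 have wk: "(%n. LINT v|g (u n). h n v) ---> (LINT v|g s. h' v)"
  if "u ---> s" "!!n. h n : Bor" "h' : Bor" "!!n v. abs (h n v) <= C" "!!x X. X ---> x ==> (%n. h n (X n)) ---> h' x"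
  for u :: "nat => real" and s h h'
 proof (rule weak_moment_conv1[OF rd rd weak_conv_seq[OF that(1)] mom mom _ that(2,3) _ that(5)])
  show "(%n. jmean (g (u n))) ---> jmean (g s)"
   using mom_cont that(1) by (intro isCont_tendsto_compose[where g="%t. jmean (g t)"]) (auto simp: continuous_on_eq_continuous_at)
  show "abs (h n v) <= C * jap v" for n v using that(4)[of n v] mult_left_mono[OF jap_pos(2) C0, of v] by simp
 qed
 have tc: "(%n. phit (u n, X n)) ---> phit (s, x)" if "u ---> s" "X ---> x" for u X s x
  using ct tendsto_Pair[OF that] by (intro isCont_tendsto_compose[where g=phit]) (auto simp: continuous_on_eq_continuous_at)
 define p where "p t = (LINT v|g t. phit (t, v))" for t
 have pc: "contU p" unfolding continuous_on_sequentially comp_def p_def by (intro allI ballI impI, elim conjE) (intro wk sec ct bd tc)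
 have mv: "EX xi. abs (xi - x) <= abs (y - x) & phi (y, v) - phi (x, v) = phit (xi, v) * (y - x)" for x y v
 proof (cases "x = y")
  case False
  hence "min x y < max x y" by auto
  from MVT2[OF this, of "%s. phi (s, v)" "%s. phit (s, v)"] dt
  obtain xi where "min x y < xi" "xi < max x y" "phi (max x y, v) - phi (min x y, v) = (max x y - min x y) * phit (xi, v)" by blast
  thus ?thesis by (intro exI[of _ xi]) (auto simp: min_def max_def algebra_simps split: if_splits)
 qed auto
 have kd: "((%y. (LINT v|g y. phi (y, v) - phi (x, v)) / (y - x)) \<longlongrightarrow> p x) (at x within {al..be})" for x unfolding tendsto_at_iff_sequentially comp_def
 proof (intro allI impI)
  fix u assume u: "ALL i. u i : {al..be} - {x}" "u ---> x"
  define h where "h n v = (phi (u n, v) - phi (x, v)) / (u n - x)" for n v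
  have "EX xi. abs (xi - x) <= abs (u n - x) & h n v = phit (xi, v)" for n v using mv[of x "u n" v] u(1) by (fastforce simp: h_def)
  then obtain xi where xi: "!!n v. abs (xi n v - x) <= abs (u n - x)" "!!n v. h n v = phit (xi n v, v)" by metis
  have "(%n. LINT v|g (u n). h n v) ---> p x" unfolding p_def
  proof (rule wk[OF u(2) _ sec[OF ct]])
   show "h n : Bor" for n unfolding h_def by (intro borel_measurable_divide borel_measurable_diff sec cphi) auto
   show "abs (h n v) <= C" for n v unfolding xi(2) by (rule bd)
   show "(%n. h n (X n)) ---> phit (x, y)" if "X ---> y" for y X unfolding xi(2)
   proof (rule tc[OF _ that])
    have "(%n. abs (u n - x)) ---> 0" using u(2) by (simp add: LIM_zero tendsto_rabs_zero)
    hence "(%n. xi n (X n) - x) ---> 0" by (rule Lim_null_comparison[rotated]) (use xi(1) in auto)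
    thus "(%n. xi n (X n)) ---> x" by (simp add: LIM_zero_iff)
   qed
  qed
  thus "(%n. (LINT v|g (u n). phi (u n, v) - phi (x, v)) / (u n - x)) ---> p x" by (simp add: h_def)
 qed
 define P where "P t = integral {al..t} p" for t
 define D where "D t = (LINT v|g t. phi (t, v))" for t
 define I where "I = (LBINT r. m r * Q r * ind {al..be} r)"
 have albe': "al <= be" using albe ab by simp
 obtain M where M: "ALL r:{al..be}. Q r <= M" using continuous_attains_sup[of "{al..be}" Q] albe' continuous_on_subset[OF Qc] by auto
 have I1: "integrable lborel (%r. m r * Q r * ind {al..be} r)"
 proof (rule integrable_bd[OF integrable_mult_right[OF m(2), of M]])
  have "0 <= M" using bspec[OF M, of al] Q0[of al] albe' by simp
  thus "AE r in lborel. norm (m r * Q r * ind {al..be} r) <= norm (M * m r)"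
   using M m(3) Q0 by (intro AE_I2) (auto simp: indicator_def abs_mult mult.commute[of M] intro!: mult_left_mono)
 qed measurable
 have main: "abs (P be) <= I + eta * ((LBINT r. m r * ind {al..be} r) + (be - al))" if eta: "0 < eta" for eta
 proof -
  define n where "n r = m r * Q r * ind {al..be} r + eta * (m r * ind {al..be} r)" for r
  have ni: "integrable lborel n" unfolding n_def by (intro integrable_plus I1 integrable_mult_right integrable_times_indicator m(2)) simp
  have n0: "0 <= n r" for r using m(3) Q0 eta by (simp add: n_def)
  define V where "V t = primitive n t + eta * t" for t
  have Vm: "V x <= V y" if "x <= y" for x y using primitive_mono[OF ni n0 that] that eta by (auto simp: V_def intro!: add_mono mult_left_mono)
  have Wn: "abs (W y - W x) * c + eta * abs (y - x) <= abs (V y - V x)"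
   if xy: "x : {al..be}" "y : {al..be}" and c: "ALL r. abs (r - x) <= abs (y - x) --> c <= Q r + eta" for x y c
  proof -
   define l where "l = min x y"
   define h where "h = max x y"
   have lh: "al <= l" "l <= h" "h <= be" using xy by (auto simp: l_def h_def)
   have "(W h - W l) * c = (LBINT r. c * (m r * ind {l..h} r))" using Wm[OF lh] by simp
   also have "... <= (LBINT r. n r * ind {l..h} r)"
   proof (rule integral_mono)
    fix r show "c * (m r * ind {l..h} r) <= n r * ind {l..h} r"
    proof (cases "r : {l..h}")
     case True
     hence "r : {al..be}" "abs (r - x) <= abs (y - x)" using lh by (auto simp: l_def h_def)
     thus ?thesis using True c mult_right_mono[OF _ m(3), of c "Q r + eta" r] by (simp add: n_def algebra_simps)
    qed simp
   qed (intro integrable_mult_right integrable_times_indicator m(2) ni; simp)+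
   also have "... = primitive n h - primitive n l" using primitive_diff[OF ni lh(2)] by simp
   finally have "(W h - W l) * c + eta * (h - l) <= V h - V l" by (simp add: V_def algebra_simps)
   moreover have "0 <= W h - W l" unfolding Wm[OF lh] using m(3) by (intro lint_nonneg) auto
   moreover have "V l <= V h" by (rule Vm[OF lh(2)])
   ultimately show ?thesis by (cases "x <= y") (auto simp: l_def h_def min_def max_def)
  qed
  have loc: "EX d>0. ALL y:{al..be}. abs (y - x) < d --> abs ((D y - P y) - (D x - P x)) <= abs (V y - V x) * (1 + eps)"
   if x: "x : {al..be}" and eps: "0 < eps" for x eps
  proof -
   have "(P has_real_derivative p x) (at x within {al..be})" unfolding P_def[abs_def] by (rule integral_has_real_derivative[OF continuous_on_subset[OF pc] x]) simp
   hence "((%y. (P y - P x) / (y - x)) \<longlongrightarrow> p x) (at x within {al..be})" by (simp add: has_field_derivative_iff)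
   from tendsto_diff[OF kd this]
   have "((%y. ((LINT v|g y. phi (y, v) - phi (x, v)) - (P y - P x)) / (y - x)) \<longlongrightarrow> 0) (at x within {al..be})" by (simp add: diff_divide_distrib)
   from tendstoD[OF this eta] obtain d1 where d1: "0 < d1" "!!y. y : {al..be} ==> y ~= x ==> dist y x < d1 ==>
    abs ((LINT v|g y. phi (y, v) - phi (x, v)) - (P y - P x)) / abs (y - x) < eta" by (auto simp: eventually_at)
   obtain d2 where d2: "0 < d2" "ALL y:{al..be}. abs (y - x) < d2 --> abs ((LINT v|g y. phi (x, v)) - (LINT v|g x. phi (x, v))) <= abs (W y - W x) * (Q x + eta / 2)"
    using S[unfolded speed_bound_def, rule_format, of "%v. phi (x, v)" "%v. phiv (x, v)" C x "eta / 2"] test_data_lipC1c[OF td] x eta unfolding Q_def by auto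
   obtain d3 where d3: "0 < d3" "!!r. abs (r - x) < d3 ==> abs (Q r - Q x) < eta / 2"
    using Qc eta unfolding continuous_on_iff dist_real_def by (metis UNIV_I half_gt_zero)
   show ?thesis
   proof (intro exI[of _ "min d1 (min d2 d3)"] conjI ballI impI)
    show "0 < min d1 (min d2 d3)" using d1 d2 d3 by simp
    fix y assume y: "y : {al..be}" "abs (y - x) < min d1 (min d2 d3)"
    have "abs ((LINT v|g y. phi (y, v) - phi (x, v)) - (P y - P x)) <= eta * abs (y - x)"
     using d1(2)[OF y(1)] y(2) by (cases "y = x") (auto simp: dist_real_def divide_less_eq)
    moreover have "(LINT v|g y. phi (y, v) - phi (x, v)) = D y - (LINT v|g y. phi (x, v))" unfolding D_def by (rule lint_diff) (intro ib cphi bd)+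
    moreover have "abs ((LINT v|g y. phi (x, v)) - D x) <= abs (W y - W x) * (Q x + eta / 2)" using d2(2) y by (auto simp: D_def)
    moreover have "abs (W y - W x) * (Q x + eta / 2) + eta * abs (y - x) <= abs (V y - V x)"
    proof (rule Wn[OF x y(1)], intro allI impI)
     fix r assume "abs (r - x) <= abs (y - x)"
     hence "abs (Q r - Q x) < eta / 2" using y(2) by (intro d3(2)) auto
     thus "Q x + eta / 2 <= Q r + eta" by linarith
    qed
    ultimately have "abs ((D y - P y) - (D x - P x)) <= abs (V y - V x)" by linarith
    thus "abs ((D y - P y) - (D x - P x)) <= abs (V y - V x) * (1 + eps)" using eps mult_left_mono[of 1 "1 + eps" "abs (V y - V x)"] by simp
   qed
  qed
  have D0: "D al = 0" "D be = 0" using albe z(1) by (auto simp: D_def)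
  have "abs ((D be - P be) - (D al - P al)) <= 1 * (V be - V al)" by (rule local_to_global_increment[OF albe' _ Vm loc]) auto
  also have "V be - V al = (LBINT r. n r * ind {al..be} r) + eta * (be - al)" using primitive_diff[OF ni albe'] by (simp add: V_def algebra_simps)
  also have "(LBINT r. n r * ind {al..be} r) = (LBINT r. n r)" by (intro lint_cong) (auto simp: n_def indicator_def)
  also have "... = I + eta * (LBINT r. m r * ind {al..be} r)"
   unfolding n_def I_def by (subst Bochner_Integration.integral_add[OF I1]) (auto intro!: integrable_mult_right integrable_times_indicator m(2))
  finally show ?thesis using D0 by (simp add: P_def algebra_simps)
 qed
 have "((%eta. I + eta * ((LBINT r. m r * ind {al..be} r) + (be - al))) \<longlongrightarrow> I + 0 * ((LBINT r. m r * ind {al..be} r) + (be - al))) (at_right 0)"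
  by (intro tendsto_intros)
 hence "abs (P be) <= I + 0 * ((LBINT r. m r * ind {al..be} r) + (be - al))"
  by (rule tendsto_lowerbound) (use main in "auto intro: eventually_mono[OF eventually_at_right_less]")
 moreover have "P be = timeL T g phi"
 proof -
  have [measurable]: "p : Bor" by (rule cont_bor[OF pc])
  have "P be = (LBINT r. p r * ind {al..be} r)"
   using set_borel_integral_eq_integral(2)[of "{al..be}" p] borel_integrable_atLeastAtMost'[OF continuous_on_subset[OF pc], of al be]
   by (simp add: P_def set_lebesgue_integral_def mult.commute)
  also have "... = (LBINT r. p r * ind {0..T} r)"
  proof (intro lint_cong refl)
   fix r
   show "p r * ind {al..be} r = p r * ind {0..T} r"
   proof (cases "r : {a..b}")
    case True thus ?thesis using albe by (auto simp: indicator_def)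
   next
    case False thus ?thesis by (simp add: p_def z(2))
   qed
  qed
  also have "... = timeL T g phi" unfolding timeL_def test_data_deriv(1)[OF td] p_def[symmetric] by (rule lebesgue_on_integral(1)[symmetric]) measurable
  finally show ?thesis .
 qed
 ultimately show ?thesis by (simp add: I_def Q_def)
qed

lemma speed_bound_weak_bound:
 assumes e: "0 <= e" "e < 1" and g: "tame_curve g" and td: "test_data T phi phit phiv a b R C"
  and m: "m : Bor" "integrable lborel m" "!!x. 0 <= m x" "integrable lborel (%x. (m x)^2)"
  and S: "speed_bound e g W al be" and Wm: "!!s t. al <= s ==> s <= t ==> t <= be ==> W t - W s = (LBINT x. m x * ind {s..t} x)"
  and albe: "al < a" "b < be" "0 <= al" "be <= T"
 shows "(timeL T g phi)^2 <= (LBINT x. (m x)^2) * (LBINT t. qform e (g t) (%x. deriv (%y. phi (t, y)) x) * ind {0..T} t)"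
proof -
 interpret tame_curve g by fact
 note [measurable] = m(1)
 define q where "q r = qform e (g r) (%x. phiv (r, x))" for r
 have qc: "contU q" unfolding q_def
  by (rule continuous_on_compose2[OF gradient_form_jointly_continuous[OF e td], of _ "%r. (r, r)", simplified]) (intro continuous_intros)
 have [measurable]: "q : Bor" by (rule cont_bor[OF qc])
 have q0: "0 <= q r" for r by (simp add: q_def qform_nonneg e)
 have qi: "integrable lborel (%r. q r * ind A r)" if "A = {0..T} | A = {al..be}" for A
 proof -
  have "integrable lborel (%r. ind {s..t} r *\<^sub>R q r)" for s t
   by (rule borel_integrable_atLeastAtMost'[unfolded set_integrable_def]) (rule continuous_on_subset[OF qc], simp)
  thus ?thesis using that by (auto simp: mult.commute)
 qed
 define N where "N r = sqrt (q r) * ind {al..be} r" for r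
 have [measurable]: "N : Bor" unfolding N_def by measurable
 have N2: "(N r)^2 = q r * ind {al..be} r" for r using q0 by (simp add: N_def power_mult_distrib indicator_def)
 have "abs (timeL T g phi) <= (LBINT r. m r * N r)" using speed_bound_weak_form[OF e g td m(1-3) S Wm albe] by (simp add: N_def q_def mult.assoc)
 hence "(timeL T g phi)^2 <= (LBINT r. m r * N r)^2" by (metis abs_ge_zero power2_abs power_mono)
 also have "... <= (LBINT x. (m x)^2) * (LBINT r. (N r)^2)" by (rule cauchy_schwarz_integral(2)) (use m qi in "auto simp: N2")
 also have "... <= (LBINT x. (m x)^2) * (LBINT r. q r * ind {0..T} r)"
  unfolding N2 using albe q0 by (intro mult_left_mono integral_mono lint_nonneg qi disjI1 disjI2 refl) (auto simp: indicator_def)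
 finally show ?thesis unfolding q_def test_data_deriv(2)[OF td] .
qed

section \<open>Absolutely continuous curves satisfy a weak bound\<close>

lemma P2cm_D:
 assumes "f : P2cm"
 shows "rdist f" "integrable f (%v. v^2)" "(LINT v|f. v) = 0" "integrable f jap"
proof -
 show 1: "rdist f" "integrable f (%v. v^2)" "(LINT v|f. v) = 0" using assms by (auto simp: P2cm_def)
 have "weak_conv_m (%n. f) f" by (intro weak_conv_by_lipC1 1(1)) auto
 thus "integrable f jap" using second_moment_limit(4)[of "%n. f" f "LINT v|f. v^2"] 1 by simp
qed

lemma AC_speed:
 assumes "f : AC e T X"
 shows "EX m. m : Bor & integrable lborel m & (ALL x. 0 <= m x) & integrable lborel (%x. (m x)^2) &
  (ALL s t. 0 < s & s <= t & t < T --> dA e (f s) (f t) <= ennreal (LBINT x. m x * ind {s..t} x))"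
proof -
 obtain m where m: "m : borel_measurable (lebesgue_on {0<..<T})" "integrable (lebesgue_on {0<..<T}) (%t. (m t)^2)"
  "!!s t. 0 < s ==> s <= t ==> t < T ==> enn2ereal (dA e (f s) (f t)) <= ereal (LINT t|lebesgue_on {s..t}. m t)" using assms by (auto simp: AC_def)
 define m0 where "m0 t = ind {0<..<T} t *\<^sub>R (abs (m t))" for t
 have "m0 : borel_measurable lebesgue" unfolding m0_def using m(1) by (subst borel_measurable_restrict_space_iff[symmetric]) auto
 then obtain n where n: "n : borel_measurable lborel" "AE x in lborel. m0 x = n x" using completion_ex_borel_measurable_real[of m0 lborel] by auto
 define m' where "m' x = abs (n x)" for x
 have m'm[measurable]: "m' : Bor" using n(1) by (simp add: m'_def[abs_def])
 have ae: "AE x in lborel. m0 x = m' x" using n(2)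
 proof eventually_elim
  case (elim x)
  have "0 <= m0 x" by (simp add: m0_def indicator_def)
  thus ?case using elim by (simp add: m'_def)
 qed
 have ae': "AE x in lebesgue. m0 x = m' x" by (rule AE_completion[OF ae])
 have m0m: "m0 : borel_measurable lebesgue" by fact
 have "integrable lebesgue (%t. ind {0<..<T} t *\<^sub>R (m t)\<^sup>2)" using m(2) by (simp add: integrable_restrict_space)
 hence "integrable lebesgue (%t. (m' t)^2)"
 proof (rule integrable_cong_AE_imp)
  show "(%t. (m' t)^2) : borel_measurable lebesgue" by (intro measurable_completion) simp
  show "AE t in lebesgue. ind {0<..<T} t *\<^sub>R (m t)\<^sup>2 = (m' t)^2" using ae'
  proof eventually_elim
   case (elim t)
   have "(m0 t)^2 = ind {0<..<T} t *\<^sub>R (m t)\<^sup>2" by (simp add: m0_def indicator_def)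
   thus ?case using elim by simp
  qed
 qed
 hence m2: "integrable lborel (%t. (m' t)^2)" by (simp add: integrable_completion)
 have m1: "integrable lborel m'"
 proof (rule integrable_bd)
  show "integrable lborel (%t. (m' t)^2 + ind {0..T} t)" using m2 by (intro integrable_plus integrable_real_indicator) (auto simp: emeasure_lborel_Icc_eq)
  show "AE x in lborel. norm (m' x) <= norm ((m' x)^2 + ind {0..T} x)" using ae
  proof eventually_elim
   case (elim x)
   have "abs (m' x) <= (m' x)^2 + 1" using zero_le_power2[of "abs (m' x) - 1/2"] by (simp add: power2_eq_square algebra_simps)
   moreover have "m' x = 0" if "x \<notin> {0..T}" using elim that by (auto simp: m0_def indicator_def)
   ultimately show ?case by (cases "x : {0..T}") auto
  qed
 qed measurable
 have "dA e (f s) (f t) <= ennreal (LBINT x. m' x * ind {s..t} x)" if st: "0 < s" "s <= t" "t < T" for s t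
 proof -
  have sub: "{s..t} \<subseteq> {0<..<T}" using st by auto
  have i: "integrable lebesgue (%x. m' x * ind {s..t} x)" using integrable_times_indicator[OF m1, of "{s..t}"] by (simp add: integrable_completion)
  have "(LINT x|lebesgue_on {s..t}. m x) = (LINT x|lebesgue. ind {s..t} x *\<^sub>R m x)" by (simp add: integral_restrict_space)
  also have "... <= (LINT x|lebesgue. m' x * ind {s..t} x)"
  proof (cases "integrable lebesgue (%x. ind {s..t} x *\<^sub>R m x)")
   case True
   thus ?thesis
   proof (rule integral_mono_AE[OF _ i])
    show "AE x in lebesgue. ind {s..t} x *\<^sub>R m x <= m' x * ind {s..t} x" using ae' by eventually_elim (use sub in "auto simp: m0_def indicator_def subset_iff")
   qed
  next
   case False
   thus ?thesis by (auto simp: not_integrable_integral_eq m'_def intro!: lint_nonneg)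
  qed
  also have "... = (LBINT x. m' x * ind {s..t} x)" by (rule integral_completion) measurable
  finally have "enn2ereal (dA e (f s) (f t)) <= ereal (LBINT x. m' x * ind {s..t} x)" using m(3)[OF st] by (meson ereal_less_eq(3) order_trans)
  moreover have "0 <= (LBINT x. m' x * ind {s..t} x)" by (intro lint_nonneg) (simp add: m'_def)
  ultimately show ?thesis by (metis enn2ereal_ennreal less_eq_ennreal.rep_eq)
 qed
 thus ?thesis using m1 m2 m'm by (intro exI[of _ m']) (auto simp: m'_def)
qed

lemma dA_jmean:
 assumes e: "0 <= e" "e < 1" and b: "0 <= b" and d: "dA e mu nu < ennreal b | dA e nu mu < ennreal b" and mu: "integrable mu jap"
 shows "jmean nu <= 2 * jmean mu + 2 * b^2"
proof -
 obtain g s s' where g: "tame_curve g" "weak_bound e 1 g (b^2)" "s : {0..1}" "s' : {0..1}" "g s = mu" "g s' = nu" using dA_tame[OF e b d mu] by blast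
 show ?thesis using tame_moment_bound[OF e g(1,2) _ _ g(3,4)] g(5,6) by simp
qed

text \<open>The cost bound becomes a local speed bound with the primitive of \<open>m\<close>; the weak form of the speed bound
 and the Cauchy-Schwarz inequality in time give the weak bound with the square integral of \<open>m\<close>.\<close>

lemma AC_weak_bound:
 assumes e: "0 <= e" "e < 1" and T: "0 < T" and f: "f : AC e T P2cm"
 shows "EX K>=0. weak_bound e T f K"
  and "EX M. ALL t:{0..T}. integrable (f t) jap & jmean (f t) <= M"
proof -
 have P: "f t : P2cm" if "t : {0..T}" for t using f that by (auto simp: AC_def)
 have nc: "narrowly_continuous_on {0..T} f" using f by (auto simp: AC_def)
 obtain m where m: "m : Bor" "integrable lborel m" "!!x. 0 <= m x" "integrable lborel (%x. (m x)^2)"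
  "!!s t. 0 < s ==> s <= t ==> t < T ==> dA e (f s) (f t) <= ennreal (LBINT x. m x * ind {s..t} x)" using AC_speed[OF f] by blast
 define W where "W = primitive m"
 have Wm: "x <= y ==> W x <= W y" for x y unfolding W_def by (rule primitive_mono[OF m(2,3)])
 have Wc: "contU W" unfolding W_def by (rule primitive_cont[OF m(2)])
 have dW: "dA e (f s) (f t) <= ennreal (abs (W t - W s)) | dA e (f t) (f s) <= ennreal (abs (W t - W s))"
  if "s : {0<..<T}" "t : {0<..<T}" for s t
 proof (cases "s <= t")
  case True
  thus ?thesis using m(5)[of s t] that primitive_diff[OF m(2) True] Wm[OF True] by (simp add: W_def)
 next
  case False
  thus ?thesis using m(5)[of t s] that primitive_diff[OF m(2), of t s] Wm[of t s] by (simp add: W_def abs_minus_commute)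
 qed
 have loc: "EX d>0. ALL y:{0<..<T}. abs (y - x) < d --> abs ((LINT v|f y. phi v) - (LINT v|f x. phi v)) <= abs (W y - W x) * (sqrt (qform e (f x) psi) + eps)"
  if x: "x : {0<..<T}" and eps: "0 < eps" and L: "lipC1 phi psi C" for x eps phi psi C
 proof -
  have "f x : P2cm" using P x by auto
  from near_increment[OF e P2cm_D(1,4)[OF this] L eps] obtain dl where dl: "0 < dl"
   "!!nu a. 0 <= a ==> a < dl ==> dA e (f x) nu <= ennreal a | dA e nu (f x) <= ennreal a ==>
    abs ((LINT v|nu. phi v) - (LINT v|f x. phi v)) <= a * (sqrt (qform e (f x) psi) + eps)" by blast
  obtain d where d: "0 < d" "!!y. dist y x < d ==> dist (W y) (W x) < dl" using Wc dl(1) unfolding continuous_on_iff by (metis UNIV_I)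
  show ?thesis by (intro exI[of _ d] conjI d(1) ballI impI dl(2) dW[OF x]) (use d(2) in "auto simp: dist_real_def")
 qed
 show Mex: "EX M. ALL t:{0..T}. integrable (f t) jap & jmean (f t) <= M"
 proof -
  define b where "b = (LBINT x. m x) + 1"
  have b0: "0 <= (LBINT x. m x)" using m(3) by (intro lint_nonneg) auto
  have Wb: "abs (W t - W s) <= (LBINT x. m x)" for s t
  proof -
   have "0 <= W t" "W t <= (LBINT x. m x)" for t
   proof -
    show "0 <= W t" unfolding W_def primitive_def using m(3) by (intro lint_nonneg) auto
    show "W t <= (LBINT x. m x)" unfolding W_def primitive_def using m(2,3) by (intro integral_mono integrable_times_indicator) (auto simp: indicator_def)
   qed
   from this[of t] this[of s] show ?thesis by simp
  qed
  have h: "T / 2 : {0<..<T}" "T / 2 : {0..T}" using T by auto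
  have i: "jmean (f t) <= 2 * jmean (f (T / 2)) + 2 * b^2" if t: "t : {0<..<T}" for t
  proof (rule dA_jmean[OF e _ _ P2cm_D(4)[OF P[OF h(2)]]])
   have "ennreal (abs (W t - W (T / 2))) < ennreal b" using Wb[of t "T / 2"] by (intro ennreal_lessI) (auto simp: b_def b0 add_nonneg_pos)
   thus "dA e (f (T / 2)) (f t) < ennreal b | dA e (f t) (f (T / 2)) < ennreal b" using dW[OF h(1) t] by (auto intro: le_less_trans)
  qed (simp add: b_def b0)
  define M where "M = max (max (jmean (f 0)) (jmean (f T))) (2 * jmean (f (T / 2)) + 2 * b^2)"
  have "jmean (f t) <= M" if "t : {0..T}" for t using i[of t] that by (cases "t = 0 | t = T") (auto simp: M_def le_max_iff_disj)
  thus ?thesis using P2cm_D(4)[OF P] by blast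
 qed
 show "EX K>=0. weak_bound e T f K"
 proof (intro exI[of _ "LBINT x. (m x)^2"] conjI)
  show "0 <= (LBINT x. (m x)^2)" by simp
  show "weak_bound e T f (LBINT x. (m x)^2)" unfolding weak_bound_def
  proof
   fix phi assume phi: "phi : C1c T"
   obtain phit phiv a b R C where td: "test_data T phi phit phiv a b R C" using test_data_exists[OF phi T] by blast
   have ab: "0 < a" "a <= b" "b < T" using td by (auto simp: test_data_def)
   define al where "al = a / 2"
   define be where "be = (b + T) / 2"
   have albe: "0 < al" "al < a" "b < be" "be < T" "al <= be" using ab by (auto simp: al_def be_def)
   define g where "g = f \<circ> clamp_time al be"
   have fg: "f t = g t" if "t : {al..be}" for t using that by (simp add: g_def)
   have sub: "{al..be} \<subseteq> {0<..<T}" "{al..be} \<subseteq> {0..T}" using albe by auto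
   have nc': "narrowly_continuous_on {al..be} f" using nc sub(2) unfolding narrowly_continuous_on_def narrow_lim_def by (meson subsetD tendsto_within_subset)
   have ncg: "narrow_curve g" unfolding g_def by (rule narrow_curve_clamp[OF _ nc' albe(5)]) (use P P2cm_D(1) sub in auto)
   have cl: "clamp_time al be t : {al..be}" for t using clamp_time_in(1)[OF albe(5)] .
   have cj: "continuous_on {al..be} (%t. jmean (f t))" unfolding continuous_on_def
   proof
    fix x assume x: "x : {al..be}"
    then obtain d where d: "0 < d" "!!y. y : {0<..<T} ==> abs (y - x) < d ==> abs (jmean (f y) - jmean (f x)) <= abs (W y - W x) * (sqrt (qform e (f x) (%v. v / jap v)) + 1)"
     using loc[OF _ zero_less_one lipC1_jap, of x] sub unfolding jmean_def by blast
    have "((%y. abs (W y - W x) * (sqrt (qform e (f x) (%v. v / jap v)) + 1)) \<longlongrightarrow> abs (W x - W x) * (sqrt (qform e (f x) (%v. v / jap v)) + 1)) (at x within {al..be})"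
     using Wc by (intro tendsto_intros) (metis UNIV_I continuous_on_def subset_UNIV tendsto_within_subset)
    hence z: "((%y. abs (W y - W x) * (sqrt (qform e (f x) (%v. v / jap v)) + 1)) \<longlongrightarrow> 0) (at x within {al..be})" by simp
    have "((%y. jmean (f y) - jmean (f x)) \<longlongrightarrow> 0) (at x within {al..be})"
     by (rule Lim_null_comparison[OF _ z]) (use d sub in "auto simp: eventually_at dist_real_def subset_iff intro!: exI[of _ d]")
    thus "((%t. jmean (f t)) \<longlongrightarrow> jmean (f x)) (at x within {al..be})" by (simp add: LIM_zero_iff)
   qed
   have tame: "tame_curve g"
   proof (intro tame_curve.intro ncg tame_curve_axioms.intro)
    show "integrable (g t) jap" for t using P2cm_D(4)[OF P[OF subsetD[OF sub(2) cl[of t]]]] by (simp add: g_def)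
    show "contU (%t. jmean (g t))" unfolding g_def comp_def by (rule continuous_on_compose2[OF cj clamp_time_cont]) (use cl in auto)
   qed
   have S: "speed_bound e g W al be" unfolding speed_bound_def lipC1c_def
   proof (intro allI impI, elim conjE)
    fix phi psi C x eps assume L: "lipC1 phi psi C" and x: "x : {al..be}" and eps: "(0::real) < eps"
    obtain d where d: "0 < d" "ALL y:{0<..<T}. abs (y - x) < d --> abs ((LINT v|f y. phi v) - (LINT v|f x. phi v)) <= abs (W y - W x) * (sqrt (qform e (f x) psi) + eps)"
     using loc[OF subsetD[OF sub(1) x] eps L] by blast
    show "EX d>0. ALL y:{al..be}. abs (y - x) < d --> abs ((LINT v|g y. phi v) - (LINT v|g x. phi v)) <= abs (W y - W x) * (sqrt (qform e (g x) psi) + eps)"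
    proof (intro exI[of _ d] conjI ballI impI d(1))
     fix y assume "y : {al..be}" "abs (y - x) < d"
     thus "abs ((LINT v|g y. phi v) - (LINT v|g x. phi v)) <= abs (W y - W x) * (sqrt (qform e (g x) psi) + eps)"
      using d(2) subsetD[OF sub(1), of y] fg[of y] fg[OF x] by metis
    qed
   qed
   have tl: "timeL T f phi = timeL T g phi" unfolding timeL_def test_data_deriv(1)[OF td]
   proof (rule lint_cong[OF refl])
    fix t show "(LINT v|f t. phit (t, v)) = (LINT v|g t. phit (t, v))"
    proof (cases "t : {a..b}")
     case True thus ?thesis using fg[of t] albe by auto
    next
     case False thus ?thesis using td by (simp add: test_data_def)
    qed
   qed
   have ql: "(LBINT t. qform e (f t) (%x. deriv (%y. phi (t, y)) x) * ind {0..T} t) = (LBINT t. qform e (g t) (%x. deriv (%y. phi (t, y)) x) * ind {0..T} t)"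
    unfolding test_data_deriv(2)[OF td]
   proof (intro lint_cong refl)
    fix t show "qform e (f t) (%x. phiv (t, x)) * ind {0..T} t = qform e (g t) (%x. phiv (t, x)) * ind {0..T} t"
    proof (cases "t : {a..b}")
     case True thus ?thesis using fg[of t] albe by auto
    next
     case False thus ?thesis using td by (simp add: test_data_def)
    qed
   qed
   show "(timeL T f phi)^2 <= (LBINT x. (m x)^2) * (LBINT t. qform e (f t) (%x. deriv (%y. phi (t, y)) x) * ind {0..T} t)"
    unfolding tl ql by (rule speed_bound_weak_bound[OF e tame td m(1-4) S]) (use albe primitive_diff[OF m(2)] in "auto simp: W_def")
  qed
 qed
qed

section \<open>Integrability of a limit of gradients\<close>

lemma bounded_integrable1:
 fixes h :: "real => real"
 assumes f: "rdist f" and h: "h : Bor" "!!v. abs (h v) <= B"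
 shows "integrable f h"
proof -
 interpret real_distribution f by fact
 show ?thesis by (rule integrable_const_bound[where B=B]) (use h in auto)
qed

text \<open>If the measure charges both half-lines \<open>{..c}\<close> and \<open>{d..}\<close>, then every point is far from one of them.
 Hence any two points are joined by a chain of at most three jumps of length at least \<open>(d - c) / 2\<close>
 through any given \<open>u <= c\<close> and \<open>d <= x\<close>, and on such jumps the weight is bounded below. Averaging
 over \<open>u\<close> and \<open>x\<close> bounds the unweighted integral.\<close>

lemma gradient_L1_bound:
 assumes e: "0 <= e" "e < 1" and f: "rdist f"
  and cd: "c < d" "0 < measure f {..c}" "0 < measure f {d..}"
 shows "EX K s. 0 <= K & 0 < s & (ALL psi. psi : Bor -->
  integrable (sq f) (%z. wt e z * (psi (snd z) - psi (fst z))^2) -->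
  (nni (sq f) (%z. ennreal (abs (psi (snd z) - psi (fst z))))) <= ennreal (K * (1 + qform e f psi / s)))"
proof -
 interpret real_distribution f by fact
 interpret ff: pair_prob_space f f ..
 have f1: "emeasure f UNIV = 1" using emeasure_space_1 by simp
 define dl where "dl = (d - c) / 2"
 define s where "s = \<sigma> e dl"
 have dl: "0 < dl" "0 < s" using cd e by (auto simp: dl_def s_def \<sigma>_pos)
 define p where "p = measure f {..c}"
 define r where "r = measure f {d..}"
 have pr: "0 < p * r" "emeasure f {..c} = ennreal p" "emeasure f {d..} = ennreal r" using cd by (auto simp: p_def r_def emeasure_eq_measure)
 show ?thesis
 proof (rule exI[of _ "5 / (p * r)"], rule exI[of _ s], intro conjI allI impI dl(2))
  show "0 <= 5 / (p * r)" using pr by simp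
  fix psi :: "real => real"
  assume psi[measurable]: "psi : Bor"
   and qi: "integrable (sq f) (%z. wt e z * (psi (snd z) - psi (fst z))^2)"
  have q0: "0 <= wt e z * (psi (snd z) - psi (fst z))^2" for z using e by (simp add: \<sigma>_nonneg)
  define D where "D v w = ennreal (abs (psi w - psi v))" for v w
  define F where "F v w = (if dl <= abs (v - w) then D v w else 0)" for v w
  have [measurable]: "(%z. D (fst z) (snd z)) : borel_measurable (sq f)" "(%z. F (fst z) (snd z)) : borel_measurable (sq f)"
   unfolding measurable_cong_sets[OF sets_pair_square[OF f] refl] F_def D_def borel_prod[symmetric] by measurable
  have Fm[measurable]: "F v : borel_measurable f" "(%u. F u x) : borel_measurable f" for v x
   unfolding measurable_cong_sets[OF events_eq_borel refl] F_def[abs_def] D_def by measurable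
  define h where "h v = (nni f (%x. F v x))" for v
  have [measurable]: "h : borel_measurable f" unfolding h_def using borel_measurable_nn_integral_fst[of "%z. F (fst z) (snd z)" f] by simp
  define J where "J = (nni f (%u. h u))"
  have "J = (nni (sq f) (%z. F (fst z) (snd z)))" unfolding J_def h_def using nn_integral_fst[of "%z. F (fst z) (snd z)" f] by simp
  also have "... <= (nni (sq f) (%z. ennreal (1 + wt e z * (psi (snd z) - psi (fst z))^2 / s)))"
  proof (intro nn_integral_mono)
   fix z :: "real * real"
   show "F (fst z) (snd z) <= ennreal (1 + wt e z * (psi (snd z) - psi (fst z))^2 / s)"
   proof (cases "dl <= abs (fst z - snd z)")
    case True
    define t where "t = psi (snd z) - psi (fst z)"
    have "s <= wt e z" using True e unfolding s_def \<sigma>_def by (intro mult_left_mono) auto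
    hence "t^2 <= wt e z * t^2 / s" using dl mult_right_mono[of s "wt e z" "t^2"] by (simp add: le_divide_eq mult.commute)
    moreover have "abs t <= 1 + t^2" using zero_le_power2[of "abs t - 1/2"] by (simp add: power2_eq_square algebra_simps)
    ultimately show ?thesis using True unfolding F_def D_def t_def by (simp add: ennreal_leI)
   qed (simp add: F_def)
  qed
  also have "... = ennreal (1 + qform e f psi / s)" using qi q0 dl ff.P.prob_space by (subst nn_integral_eq_integral) (simp_all add: qform_def add_nonneg_nonneg)
  finally have J: "J <= ennreal (1 + qform e f psi / s)" .
  have chain: "ind {d..} x * (ind {..c} u * D v w) <= F v u + F v x + F u x + F w u + F w x" for u x v w
  proof (cases "u <= c & d <= x")
   case True
   have far: "y <= c + dl ==> dl <= abs (y - x)" "c + dl <= y ==> dl <= abs (y - u)" for y using True unfolding dl_def by argo+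
   have ux: "dl <= abs (u - x)" using far(1)[of u] True dl(1) by simp
   define A where "A y = abs (psi u - psi y) * of_bool (c + dl <= y)" for y
   define B where "B y = abs (psi x - psi y) * of_bool (y < c + dl)" for y
   have "abs (psi w - psi v) <= A v + B v + abs (psi x - psi u) + A w + B w" unfolding A_def B_def
    by (cases "c + dl <= v"; cases "c + dl <= w") (simp_all add: abs_le_iff, linarith+)
   hence "D v w <= ennreal (A v) + ennreal (B v) + ennreal (abs (psi x - psi u)) + ennreal (A w) + ennreal (B w)"
    unfolding D_def by (subst ennreal_plus[symmetric], simp_all add: A_def B_def ennreal_leI flip: ennreal_plus)
   also have "... <= F v u + F v x + F u x + F w u + F w x" using far ux by (intro add_mono) (auto simp: A_def B_def F_def D_def)
   finally show ?thesis using True by simp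
  qed auto
  have 1: "ennreal r * (ind {..c} u * D v w) <= F v u + h v + h u + F w u + h w" for u v w
  proof -
   have "ennreal r * (ind {..c} u * D v w) = (nni f (%x. ind {d..} x * (ind {..c} u * D v w)))" by (simp add: nn_integral_multc pr)
   also have "... <= (nni f (%x. F v u + F v x + F u x + F w u + F w x))" by (intro nn_integral_mono chain)
   also have "... = F v u + h v + h u + F w u + h w" by (simp add: nn_integral_add h_def f1)
   finally show ?thesis .
  qed
  have 2: "ennreal p * (ennreal r * D v w) <= 2 * h v + J + 2 * h w" for v w
  proof -
   have "ennreal p * (ennreal r * D v w) = (nni f (%u. ennreal r * (ind {..c} u * D v w)))" by (simp add: nn_integral_cmult nn_integral_multc pr mult_ac)
   also have "... <= (nni f (%u. F v u + h v + h u + F w u + h w))" by (intro nn_integral_mono 1)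
   also have "... = h v + h v + J + h w + h w" by (simp add: nn_integral_add J_def f1 flip: h_def)
   finally show ?thesis by (simp add: mult_2 add_ac)
  qed
  define A where "A = (nni (sq f) (%z. D (fst z) (snd z)))"
  have "ennreal (p * r) * A = (\<integral>\<^sup>+v. \<integral>\<^sup>+w. ennreal p * (ennreal r * D v w) \<partial>f \<partial>f)"
  proof -
   have "ennreal (p * r) * A = (nni (sq f) (%z. ennreal p * (ennreal r * D (fst z) (snd z))))"
    unfolding A_def by (simp add: nn_integral_cmult ennreal_mult' p_def r_def mult.assoc)
   thus ?thesis using nn_integral_fst[of "%z. ennreal p * (ennreal r * D (fst z) (snd z))" f] by simp
  qed
  also have "... <= (\<integral>\<^sup>+v. \<integral>\<^sup>+w. 2 * h v + J + 2 * h w \<partial>f \<partial>f)" by (intro nn_integral_mono 2)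
  also have "... = (2 + 1 + 2) * J" by (simp add: nn_integral_add nn_integral_cmult f1 J_def[symmetric] del: numeral_plus_numeral add_numeral_special one_add_one)
    (simp only: distrib_right mult_1_left)
  also have "... = 5 * J" by simp
  also have "... <= 5 * ennreal (1 + qform e f psi / s)" using J by (intro mult_left_mono) auto
  finally have "ennreal (1 / (p * r)) * (ennreal (p * r) * A) <= ennreal (1 / (p * r)) * (5 * ennreal (1 + qform e f psi / s))" by (intro mult_left_mono) auto
  also have "ennreal (1 / (p * r)) * (ennreal (p * r) * A) = A"
  proof -
   have "ennreal (1 / y) * ennreal y = 1" if "0 < y" for y :: real using that by (subst ennreal_mult[symmetric]) auto
   from this[OF pr(1)] show ?thesis by (simp add: mult.assoc[symmetric])
  qed
  also have "ennreal (1 / (p * r)) * (5 * ennreal (1 + qform e f psi / s)) = ennreal (5 / (p * r) * (1 + qform e f psi / s))"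
  proof -
   have *: "ennreal (1 / y) * (5 * ennreal x) = ennreal (5 / y * x)" if "0 < y" "0 <= x" for x y :: real
   proof -
    have "ennreal (5 / y * x) = ennreal (1 / y) * ennreal (5 * x)" using that by (subst ennreal_mult[symmetric]) auto
    thus ?thesis using that by (simp add: ennreal_mult)
   qed
   show ?thesis by (rule *[OF pr(1)]) (use dl(2) qform_nonneg[OF e(2), of f psi] in simp)
  qed
  finally show "(nni (sq f) (%z. ennreal (abs (psi (snd z) - psi (fst z))))) <= ennreal (5 / (p * r) * (1 + qform e f psi / s))" by (simp add: A_def D_def)
 qed
qed

text \<open>If no pair \<open>c < d\<close> separates the mass, rational rectangles show that the diagonal has full
 product measure, so the measure is a point mass.\<close>

lemma point_mass_or_spread:
 assumes f: "rdist f"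
 shows "emeasure (prod_off_diag f) off_diag = 0 | (EX c d. c < d & 0 < measure f {..c} & 0 < measure f {d..})"
proof (rule disjCI)
 assume no: "~  (EX c d. c < d & 0 < measure f {..c} & 0 < measure f {d..})"
 interpret real_distribution f by fact
 interpret ff: pair_prob_space f f ..
 have z: "measure f {..c} = 0 | measure f {d..} = 0" if "c < d" for c d using no that by (metis less_eq_real_def measure_nonneg)
 define R where "R = (\<Union>c\<in>\<rat>. \<Union>d\<in>{d : \<rat>. c < d}. ({..c} \<times> {d..}) \<union> ({d..} \<times> {..c} :: (real * real) set))"
 have cs: "({..c} \<times> {d..}) \<union> ({d..} \<times> {..c}) : null_sets (sq f)" if "c < d" for c d :: real
 proof (rule null_setsI)
  have s: "{..c} \<times> {d..} : sets (sq f)" "{d..} \<times> {..c} : sets (sq f)" by (intro pair_measureI; simp)+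
  have "emeasure (sq f) ({..c} \<times> {d..}) = 0" "emeasure (sq f) ({d..} \<times> {..c}) = 0"
   using z[OF that] emeasure_pair_measure_Times[of "{..c}" f "{d..}"] emeasure_pair_measure_Times[of "{d..}" f "{..c}"] by (auto simp: emeasure_eq_measure)
  thus "emeasure (sq f) (({..c} \<times> {d..}) \<union> ({d..} \<times> {..c})) = 0" using emeasure_subadditive[OF s] by simp
  show "({..c} \<times> {d..}) \<union> ({d..} \<times> {..c}) : sets (sq f)" using s by auto
 qed
 have cq: "countable {d : \<rat>. c < (d::real)}" for c by (rule countable_subset[OF _ countable_rat]) auto
 have R: "R : null_sets (sq f)" unfolding R_def by (intro null_sets_UN' countable_rat cq cs) auto
 have "off_diag \<subseteq> R"
 proof
  fix z :: "real * real" assume "z : off_diag"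
  then obtain v w where vw: "z = (v, w)" "v ~= w" by (auto simp: off_diag_def)
  have ex: "EX c:\<rat>. EX d:\<rat>. c < d & x <= c & d <= y" if xy: "x < y" for x y :: real
  proof -
   obtain c where c: "c : \<rat>" "x < c" "c < y" using Rats_dense_in_real[OF xy] by blast
   obtain d where d: "d : \<rat>" "c < d" "d < y" using Rats_dense_in_real[OF c(3)] by blast
   show ?thesis using c d by (intro bexI[of _ c] bexI[of _ d]) auto
  qed
  show "z : R"
  proof (cases "v < w")
   case True thus ?thesis using ex[OF True] by (auto simp: R_def vw)
  next
   case False
   hence "w < v" using vw by simp
   thus ?thesis using ex[OF `w < v`] by (auto simp: R_def vw)
  qed
 qed
 hence "emeasure (sq f) off_diag = 0" by (rule emeasure_eq_0[OF null_setsD2[OF R] null_setsD1[OF R]])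
 thus "emeasure (prod_off_diag f) off_diag = 0"
  unfolding prod_off_diag_def by (subst emeasure_restrict_space) (auto simp: space_pair_square[OF f] sets_pair_square[OF f])
qed

lemma gradient_limit_L1:
 assumes e: "0 <= e" "e < 1" and f: "rdist f" "integrable f jap"
  and psi: "!!k. psi k : Bor" "!!k v. abs (psi k v) <= C k"
  and zt: "zt : Bor" and B: "!!k. qform e f (psi k) <= B"
  and lim: "AE z in prod_off_diag f. (%k. psi k (snd z) - psi k (fst z)) ---> zt z"
 shows "(nni (prod_off_diag f) (%z. ennreal (abs (zt z)))) < \<infinity>" using point_mass_or_spread[OF f(1)]
proof
 assume "emeasure (prod_off_diag f) off_diag = 0"
 hence "AE z in prod_off_diag f. False"
  using AE_I[of "prod_off_diag f" "%_. False" off_diag] sets.top[of "prod_off_diag f"] by (simp add: space_prod_off_diag[OF f(1)])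
 hence "AE z in prod_off_diag f. ennreal (abs (zt z)) = 0" by (rule eventually_mono) simp
 hence "(nni (prod_off_diag f) (%z. ennreal (abs (zt z)))) = (nni (prod_off_diag f) (%z. 0))" by (rule nn_integral_cong_AE)
 thus ?thesis by simp
next
 assume "EX c d. c < d & 0 < measure f {..c} & 0 < measure f {d..}"
 then obtain K s where K: "0 <= K" "0 < s" "!!psi. psi : Bor ==>
  integrable (sq f) (%z. wt e z * (psi (snd z) - psi (fst z))^2) ==>
  (nni (sq f) (%z. ennreal (abs (psi (snd z) - psi (fst z))))) <= ennreal (K * (1 + qform e f psi / s))" using gradient_L1_bound[OF e f(1)] by blast
 interpret real_distribution f by (rule f)
 interpret ff: pair_prob_space f f ..
 have gm: "(%z. psi k (snd z) - psi k (fst z)) : borel_measurable (borel :: (real * real) measure)" for k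
  unfolding borel_prod[symmetric] using psi(1)[of k] by measurable
 have om: "h : borel_measurable (prod_off_diag f)" if "h : Bor" for h :: "real * real => real"
  using measurable_borel_off_diag[OF that] sets_prod_off_diag[OF f(1)] by (simp cong: measurable_cong_sets)
 have kb: "(nni (prod_off_diag f) (%z. ennreal (abs (psi k (snd z) - psi k (fst z))))) <= ennreal (K * (1 + B / s))" for k
 proof -
  have "(nni (prod_off_diag f) (%z. ennreal (abs (psi k (snd z) - psi k (fst z))))) <= (nni (sq f) (%z. ennreal (abs (psi k (snd z) - psi k (fst z)))))"
   unfolding nn_integral_prod_off_diag[OF f(1)] by (intro nn_integral_mono) (auto simp: indicator_def)
  also have "... <= ennreal (K * (1 + qform e f (psi k) / s))" by (intro K(3) psi(1) qform_integrable[OF e f psi])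
  also have "... <= ennreal (K * (1 + B / s))" using K(1,2) B by (intro ennreal_leI mult_left_mono add_left_mono divide_right_mono) auto
  finally show ?thesis .
 qed
 have "(nni (prod_off_diag f) (%z. ennreal (abs (zt z)))) = (nni (prod_off_diag f) (%z. liminf (%k. ennreal (abs (psi k (snd z) - psi k (fst z))))))"
 proof (rule nn_integral_cong_AE, use lim in eventually_elim)
  case (elim z)
  thus ?case by (intro lim_imp_Liminf[symmetric] tendsto_ennrealI tendsto_rabs) auto
 qed
 also have "... <= liminf (%k. \<integral>\<^sup>+z. ennreal (abs (psi k (snd z) - psi k (fst z))) \<partial>prod_off_diag f)" by (rule nn_integral_liminf) (use om[OF gm] in measurable)
 also have "... <= ennreal (K * (1 + B / s))" by (rule Liminf_le) (auto intro!: always_eventually kb)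
 also have "... < \<infinity>" by simp
 finally show ?thesis .
qed

section \<open>The space-time measure of a curve\<close>

text \<open>The product measures of all times, weighted by the kinetic factor and integrated over the time interval.
 Fluxes of finite action correspond to its square integrable functions.\<close>

definition st_measure :: "real => real => (real => real measure) => (real * (real * real)) measure" where
 "st_measure e T g = density (density lborel (ind {0..T}) \<bind> (%t. distr (sq (g t)) borel (Pair t)))
  (%x. ennreal (wt e (snd x)))"

lemma weight_measurable:
 "(%z. wt e z) : borel_measurable (borel :: (real * real) measure)"
 "(%x. wt e (snd x)) : borel_measurable (borel :: (real * (real * real)) measure)"
proof -
 have "(%z :: real * real. abs (fst z - snd z)) : borel \<rightarrow>\<^sub>M borel" "(%x :: real * (real * real). abs (fst (snd x) - snd (snd x))) : borel \<rightarrow>\<^sub>M borel"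
  by (intro cont_bor continuous_intros)+
 from this[THEN measurable_compose[OF _ \<sigma>_measurable]]
 show "(%z. wt e z) : borel_measurable (borel :: (real * real) measure)"
  "(%x. wt e (snd x)) : borel_measurable (borel :: (real * (real * real)) measure)" by simp_all
qed

lemma Pair_section:
 fixes h :: "real * (real * real) => 'b :: topological_space"
 assumes "h : Bor" shows "(%z. h (t, z)) : Bor" by (rule measurable_compose[OF _ assms]) (intro cont_bor continuous_intros)

context narrow_curve
begin

lemma st_kernel: "(%t. distr (sq (g t)) borel (Pair t)) : borel \<rightarrow>\<^sub>M subprob_algebra (borel :: (real * (real * real)) measure)"
proof (rule measurable_distr2[OF _ kernel2])
 have "case_prod Pair = (%x :: real * (real * real). x)" by auto
 thus "case_prod Pair : borel \<Otimes>\<^sub>M borel \<rightarrow>\<^sub>M (borel :: (real * (real * real)) measure)" by (simp add: borel_prod)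
qed

lemma sets_st [simp, measurable_cong]: "sets (st_measure e T g) = sets borel" unfolding st_measure_def by (simp add: sets_bind[where N=borel])

lemma space_st [simp]: "space (st_measure e T g) = UNIV" using sets_eq_imp_space_eq[OF sets_st] by simp

lemma gg_measurable: "k : Bor ==> k : borel_measurable (sq (g t))" using sets_pair_square[OF rd] by (simp cong: measurable_cong_sets)

lemma nn_integral_st:
 assumes h[measurable]: "h : Bor"
 shows "(nni (st_measure e T g) (%x. h x)) =
  (nni lborel (%t. ind {0..T} t * (nni (sq (g t)) (%z. ennreal (wt e z) * h (t, z)))))"
proof -
 define B where "B = density lborel (ind {0..T} :: real => ennreal)"
 have [simp, measurable_cong]: "sets B = sets borel" by (simp add: B_def)
 define K where "K t = distr (sq (g t)) borel (Pair t)" for t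
 have Kb: "K : B \<rightarrow>\<^sub>M subprob_algebra borel" using st_kernel unfolding K_def by (simp cong: measurable_cong_sets)
 note [measurable] = weight_measurable
 define w where "w x = ennreal (wt e (snd x))" for x :: "real * (real * real)"
 have [measurable]: "w : Bor" unfolding w_def by measurable
 have sB: "sets (B \<bind> K) = sets borel" by (rule sets_bind) (simp_all add: K_def B_def)
 have pm: "Pair t : sq (g t) \<rightarrow>\<^sub>M borel" for t :: real unfolding measurable_cong_sets[OF sets_pair_square[OF rd] refl] by (intro cont_bor continuous_intros)
 have mI: "(%t. \<integral>\<^sup>+z. w (t, z) * h (t, z) \<partial>(sq (g t))) : Bor" by (rule nn_measurable2[where h="%x. w x * h x"]) measurable
 have "(nni (st_measure e T g) (%x. h x)) = (nni (B \<bind> K) (%x. w x * h x))" unfolding st_measure_def B_def[symmetric] K_def[symmetric] w_def[symmetric]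
  by (rule nn_integral_density) (simp_all add: measurable_cong_sets[OF sB refl])
 also have "... = (nni B (%t. (nni (K t) (%x. w x * h x))))" by (rule nn_integral_bind[OF _ Kb]) measurable
 also have "... = (nni B (%t. (nni (sq (g t)) (%z. w (t, z) * h (t, z)))))" unfolding K_def by (intro nn_integral_cong nn_integral_distr[OF pm]) measurable
 also have "... = (nni lborel (%t. ind {0..T} t * (nni (sq (g t)) (%z. w (t, z) * h (t, z)))))" unfolding B_def by (rule nn_integral_density) (use mI in auto)
 finally show ?thesis by (simp add: w_def)
qed

lemma integral_st:
 fixes h :: "real * (real * real) => real"
 assumes e: "e < 1" and h[measurable]: "h : Bor" and i: "integrable (st_measure e T g) h"
 defines "I t \<equiv> (LINT z|(sq (g t)). wt e z * h (t, z))"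
 shows "AE t in lborel. t : {0..T} --> integrable (sq (g t)) (%z. wt e z * h (t, z))"
  "integrable lborel (%t. I t * ind {0..T} t)" "(LINT x|st_measure e T g. h x) = (LBINT t. I t * ind {0..T} t)"
proof -
 note [measurable] = weight_measurable
 have w0: "0 <= \<sigma> e (abs r)" for r using e by (simp add: \<sigma>_nonneg)
 define J where "J k t = (LINT z|(sq (g t)). wt e z * k (t, z))" for k :: "real * (real * real) => real" and t
 have pos: "(AE t in lborel. t : {0..T} --> integrable (sq (g t)) (%z. wt e z * k (t, z))) &
  integrable lborel (%t. J k t * ind {0..T} t) & (LINT x|st_measure e T g. k x) = (LBINT t. J k t * ind {0..T} t)"
  if k[measurable]: "k : Bor" and k0: "!!x. 0 <= k x" and ki: "integrable (st_measure e T g) k" for k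
 proof -
  define A where "A t = (nni (sq (g t)) (%z. ennreal (wt e z) * ennreal (k (t, z))))" for t
  have Am[measurable]: "A : Bor" unfolding A_def by (rule nn_measurable2[where h="%x. ennreal (wt e (snd x)) * ennreal (k x)", simplified]) measurable
  have km: "(%z. wt e z * k (t, z)) : borel_measurable (sq (g t))" for t by (intro gg_measurable borel_measurable_times weight_measurable Pair_section[OF k])
  have A': "A t = (nni (sq (g t)) (%z. ennreal (wt e z * k (t, z))))" for t unfolding A_def using k0 w0 by (simp add: ennreal_mult)
  have JA: "J k t = enn2real (A t)" for t unfolding J_def A' by (rule integral_eq_nn_integral[OF km]) (simp add: k0 w0)
  have tot: "(nni lborel (%t. ind {0..T} t * A t)) = ennreal (LINT x|st_measure e T g. k x)"
   unfolding A_def using nn_integral_st[of "%x. ennreal (k x)" e T] nn_integral_eq_integral[OF ki] k0 by simp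
  have "AE t in lborel. ind {0..T} t * A t ~= \<infinity>" by (rule nn_integral_PInf_AE) (use tot in auto)
  hence fin: "AE t in lborel. t : {0..T} --> A t < \<infinity>" by eventually_elim (auto simp: indicator_def less_top)
  have 1: "AE t in lborel. t : {0..T} --> integrable (sq (g t)) (%z. wt e z * k (t, z))" using fin
  proof eventually_elim
   case (elim t)
   show ?case
   proof
    assume "t : {0..T}"
    hence "A t < \<infinity>" using elim by blast
    thus "integrable (sq (g t)) (%z. wt e z * k (t, z))" using km[of t] k0 w0 unfolding A' by (intro integrableI_bounded) (auto simp: abs_mult)
   qed
  qed
  have eqn: "(nni lborel (%t. ennreal (J k t * ind {0..T} t))) = ennreal (LINT x|st_measure e T g. k x)" unfolding tot[symmetric]
   by (rule nn_integral_cong_AE, use fin in eventually_elim) (auto simp: JA indicator_def)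
  have Jm: "(%t. J k t * ind {0..T} t) : borel_measurable lborel" unfolding JA by measurable
  have J0: "0 <= J k t * ind {0..T} t" for t by (simp add: JA)
  have 2: "integrable lborel (%t. J k t * ind {0..T} t)" by (rule integrableI_bounded[OF Jm]) (use eqn J0 in simp)
  have "0 <= (LINT x|st_measure e T g. k x)" using k0 by (intro lint_nonneg) auto
  hence 3: "(LINT x|st_measure e T g. k x) = (LBINT t. J k t * ind {0..T} t)" using eqn nn_integral_eq_integral[OF 2] J0 by (simp add: lint_nonneg)
  show ?thesis using 1 2 3 by blast
 qed
 define hp where "hp x = max 0 (h x)" for x
 define hn where "hn x = max 0 (- h x)" for x
 have P: "hp : Bor" "hn : Bor" "!!x. 0 <= hp x" "!!x. 0 <= hn x"
  "integrable (st_measure e T g) hp" "integrable (st_measure e T g) hn" unfolding hp_def hn_def using i by auto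
 have hpn: "h = (%x. hp x - hn x)" by (auto simp: hp_def hn_def max_def)
 note p = pos[OF P(1,3,5)] and n = pos[OF P(2,4,6)]
 show ae: "AE t in lborel. t : {0..T} --> integrable (sq (g t)) (%z. wt e z * h (t, z))"
  using p[THEN conjunct1] n[THEN conjunct1] by eventually_elim (simp add: hpn right_diff_distrib)
 have Iae: "AE t in lborel. I t * ind {0..T} t = J hp t * ind {0..T} t - J hn t * ind {0..T} t" using p[THEN conjunct1] n[THEN conjunct1]
  by eventually_elim (auto simp: I_def J_def hpn right_diff_distrib indicator_def)
 have Im: "(%t. I t * ind {0..T} t) : borel_measurable lborel" unfolding I_def using integral_measurable2[of "%x. wt e (snd x) * h x"] by simp
 have d: "integrable lborel (%t. J hp t * ind {0..T} t - J hn t * ind {0..T} t)" using p n by simp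
 show "integrable lborel (%t. I t * ind {0..T} t)" by (rule integrable_cong_AE_imp[OF d Im]) (use Iae in "auto elim: eventually_mono")
 have "(LBINT t. I t * ind {0..T} t) = (LBINT t. J hp t * ind {0..T} t - J hn t * ind {0..T} t)" by (rule integral_cong_AE[OF Im _ Iae]) (use d in simp)
 also have "... = (LINT x|st_measure e T g. hp x) - (LINT x|st_measure e T g. hn x)" using p n by simp
 also have "... = (LINT x|st_measure e T g. h x)" unfolding hpn using P by simp
 finally show "(LINT x|st_measure e T g. h x) = (LBINT t. I t * ind {0..T} t)" ..
qed

lemma AE_st:
 assumes e: "e < 1" and P: "{x. P x} : sets borel" and ae: "AE x in st_measure e T g. P x"
 shows "AE t in lborel. t : {0..T} --> (AE z in prod_off_diag (g t). P (t, z))"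
proof -
 have N: "{x. ~  P x} : sets borel" using sets.compl_sets[OF P] by (simp add: Compl_eq_Diff_UNIV[symmetric] Collect_neg_eq)
 define k where "k = (ind {x. ~  P x} :: real * (real * real) => ennreal)"
 have km[measurable]: "k : Bor" unfolding k_def using N by measurable
 note [measurable] = weight_measurable
 define A where "A t = (nni (sq (g t)) (%z. ennreal (wt e z) * k (t, z)))" for t
 have Am[measurable]: "A : Bor" unfolding A_def by (rule nn_measurable2[where h="%x. ennreal (wt e (snd x)) * k x", simplified]) measurable
 have "(nni (st_measure e T g) (%x. k x)) = (nni (st_measure e T g) (%x. 0))" by (rule nn_integral_cong_AE, use ae in eventually_elim) (auto simp: k_def)
 hence "(nni lborel (%t. ind {0..T} t * A t)) = 0" using nn_integral_st[OF km, of e T] by (simp add: A_def)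
 hence "AE t in lborel. ind {0..T} t * A t = 0" by (subst (asm) nn_integral_0_iff_AE) auto
 thus ?thesis
 proof eventually_elim
  case (elim t)
  show ?case
  proof
   assume t: "t : {0..T}"
   have m: "(%z. ennreal (wt e z) * k (t, z)) : borel_measurable (sq (g t))"
    by (intro gg_measurable borel_measurable_times_ennreal measurable_compose[OF weight_measurable(1)] measurable_ennreal Pair_section[OF km])
   have "A t = 0" using elim t by simp
   hence "AE z in sq (g t). ennreal (wt e z) * k (t, z) = 0" unfolding A_def by (subst (asm) nn_integral_0_iff_AE[OF m])
   hence "AE z in sq (g t). z : off_diag --> P (t, z)"
   proof eventually_elim
    case (elim z)
    show ?case
    proof
     assume "z : off_diag"
     hence "0 < wt e z" using e by (cases z) (auto simp: off_diag_def intro!: \<sigma>_pos)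
     thus "P (t, z)" using elim by (auto simp: k_def indicator_def split: if_splits)
    qed
   qed
   thus "AE z in prod_off_diag (g t). P (t, z)"
    unfolding prod_off_diag_def by (subst AE_restrict_space_iff) (auto simp: space_pair_square[OF rd] sets_pair_square[OF rd])
  qed
 qed
qed

end

section \<open>Existence of an optimal flux\<close>

definition pairing :: "real => (real => real measure) => (real * (real * real) => real) => (real * real => real) => real => real" where
 "pairing e g zt phi t = (LINT z|(sq (g t)). wt e z * (zt (t, z) *
  (deriv (%y. phi (t, y)) (snd z) - deriv (%y. phi (t, y)) (fst z))))"

definition flux_form :: "real => (real => real measure) => (real * (real * real) => real) => real => real" where
 "flux_form e g zt t = (LINT z|(sq (g t)). wt e z * (zt (t, z))^2)"

definition density_flux :: "(real => real measure) => (real * (real * real) => real) => real => (real * real) set => real" where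
 "density_flux g zt t A = (LINT z|prod_off_diag (g t). ind A z * zt (t, z))"

lemma C0_bounded:
 assumes "phi : C0 X" shows "EX B. ALL x:X. abs (phi x) <= B"
proof -
 obtain K where K: "compact K" "K \<subseteq> X" "ALL x:X - K. abs (phi x) < 1" using assms by (auto simp: C0_def dest!: spec[of _ 1])
 have "compact (phi ` K)" using K assms by (intro compact_continuous_image) (auto simp: C0_def intro: continuous_on_subset)
 then obtain B where B: "ALL x:K. abs (phi x) <= B" by (force dest!: compact_imp_bounded simp: bounded_iff)
 have "abs (phi x) <= max B 1" if "x : X" for x
 proof (cases "x : K")
  case True thus ?thesis using B by (simp add: le_max_iff_disj)
 next
  case False thus ?thesis using K(3) that by (simp add: le_max_iff_disj less_imp_le)
 qed
 thus ?thesis by blast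
qed

lemma weight_times_product:
 assumes e: "e < 1" and zt2: "integrable M (%z. wt e z * (zt z)^2)" and u2: "integrable M (%z. wt e z * (u z)^2)"
  and m: "(%z. wt e z) : borel_measurable M" "zt : borel_measurable M" "u : borel_measurable M"
 shows "integrable M (%z. wt e z * (zt z * u z))"
  "(LINT z|M. wt e z * (zt z * u z))^2 <= (LINT z|M. wt e z * (zt z)^2) * (LINT z|M. wt e z * (u z)^2)"
proof -
 define s where "s z = sqrt (wt e z)" for z :: "real * real"
 have ss: "s z * s z = wt e z" for z using e by (simp add: s_def \<sigma>_nonneg)
 have [measurable]: "s : borel_measurable M" unfolding s_def using m(1) by measurable
 note [measurable] = m
 have sq: "(s z * zt z)^2 = wt e z * (zt z)^2" "(s z * u z)^2 = wt e z * (u z)^2"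
  "(s z * zt z) * (s z * u z) = wt e z * (zt z * u z)" for z unfolding ss[symmetric] by (simp_all add: power2_eq_square mult_ac)
 note cs = cauchy_schwarz_integral[of "%z. s z * zt z" M "%z. s z * u z", unfolded sq, OF _ _ zt2 u2]
 show "integrable M (%z. wt e z * (zt z * u z))"
  "(LINT z|M. wt e z * (zt z * u z))^2 <= (LINT z|M. wt e z * (zt z)^2) * (LINT z|M. wt e z * (u z)^2)" using cs by measurable
qed

text \<open>The functional given by the weak formulation is represented, in the closure of
 the test gradients, by a function on space-time. As a pointwise limit of gradients this function
 is integrable for almost every time also without the weight, hence is the density of a flux; at the
 exceptional times the flux is set to zero.\<close>

lemma optimal_flux_exists:
 assumes e: "0 <= e" "e < 1" and T: "0 < T" and g: "tame_curve g" and W: "weak_bound e T g K" "0 <= K"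
 shows "EX zt phis. zt : Bor &
  integrable lborel (%t. flux_form e g zt t * ind {0..T} t) &
  (LBINT t. flux_form e g zt t * ind {0..T} t) <= K &
  CE e T g (density_flux g zt) &
  (ALL t. action e (g t) (density_flux g zt t) = ennreal (flux_form e g zt t)) &
  (ALL t. integrable (sq (g t)) (%z. wt e z * (zt (t, z))^2)) &
  (ALL phi:C1c T. timeL T g phi = - (LBINT t. pairing e g zt phi t * ind {0..T} t)) &
  (ALL k::nat. phis k : C1c T) &
  (AE t in lborel. t : {0..T} --> (%k. pairing e g zt (phis k) t) ---> flux_form e g zt t &
   (%k. qform e (g t) (%x. deriv (%y. phis k (t, y)) x)) ---> flux_form e g zt t)"
proof -
 interpret tame_curve g by fact
 note [measurable] = weight_measurable
 define N where "N = st_measure e T g"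
 have Ns[simp, measurable_cong]: "sets N = sets borel" by (simp add: N_def)
 have w0: "0 <= \<sigma> e (abs r)" for r using e by (simp add: \<sigma>_nonneg)
 define u where "u phi x = deriv (%y. phi (fst x, y)) (snd (snd x)) - deriv (%y. phi (fst x, y)) (fst (snd x))"
  for phi :: "real * real => real" and x :: "real * (real * real)"
 define q where "q phi t = qform e (g t) (%x. deriv (%y. phi (t, y)) x)" for phi t
 define P where "P = (%phi. (u phi, - timeL T g phi)) ` C1c T"
 have um: "u phi : Bor" and ub: "EX C. ALL x. abs (u phi x) <= C" and qi: "integrable lborel (%t. q phi t * ind {0..T} t)"
  and uq: "(LINT z|(sq (g t)). wt e z * (u phi (t, z))^2) = q phi t"
  and uqi: "integrable (sq (g t)) (%z. wt e z * (u phi (t, z))^2)"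
  and ulip: "EX C. ALL t. lipC1 (%x. phi (t, x)) (%x. deriv (%y. phi (t, y)) x) C"
  if phi: "phi : C1c T" for phi t
 proof -
  obtain phit phiv a b R C where td: "test_data T phi phit phiv a b R C" using test_data_exists[OF phi T] by blast
  note dv = test_data_deriv(2)[OF td]
  have cv: "contU phiv" and C: "!!z. abs (phiv z) <= C" using td by (auto simp: test_data_def)
  have L: "lipC1 (%x. phi (t, x)) (%x. phiv (t, x)) C" for t by (rule test_data_lipC1[OF td])
  thus "EX C. ALL t. lipC1 (%x. phi (t, x)) (%x. deriv (%y. phi (t, y)) x) C" unfolding dv by blast
  have ueq: "u phi = (%x. phiv (fst x, snd (snd x)) - phiv (fst x, fst (snd x)))" by (simp add: u_def dv fun_eq_iff)
  show "u phi : Bor" unfolding ueq by (intro cont_bor continuous_intros continuous_on_compose2[OF cv]) auto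
  have "abs (u phi x) <= 2 * C" for x unfolding ueq using C[of "(fst x, snd (snd x))"] C[of "(fst x, fst (snd x))"] by linarith
  thus "EX C. ALL x. abs (u phi x) <= C" by blast
  show "(LINT z|(sq (g t)). wt e z * (u phi (t, z))^2) = q phi t" by (simp add: q_def qform_def u_def)
  show "integrable (sq (g t)) (%z. wt e z * (u phi (t, z))^2)" unfolding ueq using qform_integrable[OF e rd mom lipC1D(7)[OF L] lipC1D(3)[OF L], of t t] by simp
  have "contU (q phi)" unfolding q_def dv
   by (rule continuous_on_compose2[OF gradient_form_jointly_continuous[OF e td], of _ "%r. (r, r)", simplified]) (intro continuous_intros)
  hence "integrable lborel (%r. ind {0..T} r *\<^sub>R q phi r)" by (intro borel_integrable_atLeastAtMost'[unfolded set_integrable_def]) (rule continuous_on_subset, auto)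
  thus "integrable lborel (%t. q phi t * ind {0..T} t)" by (simp add: mult.commute)
 qed
 have nnq: "(nni N (%x. ennreal ((u phi x)^2))) = ennreal (LBINT t. q phi t * ind {0..T} t)" if phi: "phi : C1c T" for phi
 proof -
  have "(nni N (%x. ennreal ((u phi x)^2))) = (nni lborel (%t. ind {0..T} t * (nni (sq (g t)) (%z. ennreal (wt e z) * ennreal ((u phi (t, z))^2)))))"
   unfolding N_def by (rule nn_integral_st) (use um[OF phi] in measurable)
  also have "... = (nni lborel (%t. ennreal (q phi t * ind {0..T} t)))"
  proof (rule nn_integral_cong)
   fix t
   have "(nni (sq (g t)) (%z. ennreal (wt e z) * ennreal ((u phi (t, z))^2))) = (nni (sq (g t)) (%z. ennreal (wt e z * (u phi (t, z))^2)))"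
    using w0 by (simp add: ennreal_mult)
   also have "... = ennreal (q phi t)" using nn_integral_eq_integral[OF uqi[OF phi, of t]] w0 uq[OF phi, of t] by simp
   finally show "ind {0..T} t * (nni (sq (g t)) (%z. ennreal (wt e z) * ennreal ((u phi (t, z))^2))) = ennreal (q phi t * ind {0..T} t)" by (simp add: indicator_def)
  qed
  also have "... = ennreal (LBINT t. q phi t * ind {0..T} t)" by (rule nn_integral_eq_integral[OF qi[OF phi]]) (simp add: q_def qform_nonneg e)
  finally show ?thesis .
 qed
 have usq: "integrable N (%x. (u phi x)^2)" "(LINT x|N. (u phi x)^2) = (LBINT t. q phi t * ind {0..T} t)" if phi: "phi : C1c T" for phi
 proof -
  show i: "integrable N (%x. (u phi x)^2)" by (rule integrableI_bounded) (use um[OF phi] nnq[OF phi] in auto)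
  have "0 <= (LBINT t. q phi t * ind {0..T} t)" by (intro lint_nonneg) (simp add: q_def qform_nonneg e)
  thus "(LINT x|N. (u phi x)^2) = (LBINT t. q phi t * ind {0..T} t)" using nnq[OF phi] nn_integral_eq_integral[OF i] by simp
 qed
 have lin: "u (%z. a * phi z + b * phi' z) = (%x. a * u phi x + b * u phi' x)" "timeL T g (%z. a * phi z + b * phi' z) = a * timeL T g phi + b * timeL T g phi'"
  if phi: "phi : C1c T" "phi' : C1c T" for phi phi' a b
 proof -
  obtain phit phiv c d R C where td: "test_data T phi phit phiv c d R C" using test_data_exists[OF phi(1) T] by blast
  obtain phit' phiv' c' d' R' C' where td': "test_data T phi' phit' phiv' c' d' R' C'" using test_data_exists[OF phi(2) T] by blast
  have D: "((%x. phi (t, x)) has_real_derivative phiv (t, v)) (at v)" "((%x. phi' (t, x)) has_real_derivative phiv' (t, v)) (at v)"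
   "((%s. phi (s, v)) has_real_derivative phit (t, v)) (at t)" "((%s. phi' (s, v)) has_real_derivative phit' (t, v)) (at t)" for t v
   using td td' by (auto simp: test_data_def)
  have "deriv (%y. a * phi (t, y) + b * phi' (t, y)) v = a * phiv (t, v) + b * phiv' (t, v)" for t v by (rule DERIV_imp_deriv) (intro DERIV_add DERIV_cmult D)
  thus "u (%z. a * phi z + b * phi' z) = (%x. a * u phi x + b * u phi' x)"
   by (auto simp: u_def fun_eq_iff test_data_deriv(2)[OF td] test_data_deriv(2)[OF td'] algebra_simps)
  have dt: "deriv (%s. a * phi (s, v) + b * phi' (s, v)) t = a * phit (t, v) + b * phit' (t, v)" for t v by (rule DERIV_imp_deriv) (intro DERIV_add DERIV_cmult D)
  have key: "integrable (g t) (%v. h (t, v))" "integrable (leb T) (%t. LINT v|g t. h (t, v))"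
   if h: "contU h" "!!z. abs (h z) <= B" for h :: "real * real => real" and B t
  proof -
   have hm: "(%v. h (t, v)) : Bor" for t by (intro cont_bor continuous_on_compose2[OF h(1)] continuous_intros) auto
   show i: "integrable (g t) (%v. h (t, v))" for t by (rule bounded_integrable1[OF rd hm h(2)])
   have m: "(%t. LINT v|g t. h (t, v)) : Bor"
   proof -
    have "(%t. \<integral>z. h (t, fst z) \<partial>(sq (g t))) : Bor" by (rule integral_measurable2[where h="%x. h (fst x, fst (snd x))", simplified])
      (intro cont_bor continuous_on_compose2[OF h(1)] continuous_intros, auto)
    thus ?thesis using integral_pair_marginals(3)[OF real_distribution_prob[OF rd] real_distribution_measurable(1)[OF rd hm]] by simp
   qed
   have "abs (LINT v|g t. h (t, v)) <= B" for t
   proof -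
    interpret gt: real_distribution "g t" by (rule rd)
    have "abs (LINT v|g t. h (t, v)) <= (LINT v|g t. abs (h (t, v)))" by (rule integral_abs_bound)
    also have "... <= (LINT v|g t. B)" using i h(2) by (intro integral_mono integrable_abs) auto
    finally show ?thesis using gt.prob_space by simp
   qed
   thus "integrable (leb T) (%t. LINT v|g t. h (t, v))" unfolding lebesgue_on_integral(2)[OF m] by (intro integrable_bounded_interval[OF m])
  qed
  have c: "contU phit" "!!z. abs (phit z) <= C" "contU phit'" "!!z. abs (phit' z) <= C'" using td td' by (auto simp: test_data_def)
  show "timeL T g (%z. a * phi z + b * phi' z) = a * timeL T g phi + b * timeL T g phi'" unfolding timeL_def test_data_deriv(1)[OF td] test_data_deriv(1)[OF td'] dt
   using key[OF c(1,2)] key[OF c(3,4)] by simp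
 qed
 obtain Us Ls z where R: "!!k. (Us k, Ls k) : P" "z = (%x. if convergent (%k. Us k x) then lim (%k. Us k x) else 0)"
  "AE x in N. (%k. Us k x) ---> z x" "integrable N (%x. (z x)^2)" "(LINT x|N. (z x)^2) <= K"
  "!!v l. (v, l) : P ==> l = (LINT x|N. z x * v x)" "!!k. (nni N (%x. ennreal ((z x - Us k x)^2))) <= ennreal (4 * (1/16)^k)"
 proof (rule riesz_representation_L2[of P N K])
  show "(%x. a * v x + b * v' x, a * l + b * l') : P" if h: "(v, l) : P" "(v', l') : P" for v l v' l' a b
  proof -
   obtain phi phi' where phi: "phi : C1c T" "v = u phi" "l = - timeL T g phi" "phi' : C1c T" "v' = u phi'" "l' = - timeL T g phi'" using h by (auto simp: P_def)
   thus ?thesis unfolding P_def by (intro image_eqI[where x="%z. a * phi z + b * phi' z"] C1c_lin) (simp_all add: lin)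
  qed
  have "(%z. 0) : C1c T" unfolding C1c_alt using C1fun_fst[of "%_. 0" "%_. 0"] by (auto intro!: exI[of _ "{}"])
  thus "P ~= {}" by (auto simp: P_def)
  show "v : borel_measurable N" if "(v, l) : P" for v l using that um by (auto simp: P_def)
  show "integrable N (%x. (v x)^2)" if "(v, l) : P" for v l using that usq(1) by (auto simp: P_def)
  show "l^2 <= K * (LINT x|N. (v x)^2)" if "(v, l) : P" for v l using that W(1) usq(2) by (auto simp: P_def weak_bound_def q_def)
 qed (use W(2) in blast)+
 have "EX phi. phi : C1c T & Us k = u phi" for k using R(1)[of k] by (auto simp: P_def)
 then obtain phis where phis: "!!k. phis k : C1c T" "!!k. Us k = u (phis k)" by metis
 have Usm[measurable]: "Us k : Bor" for k unfolding phis(2) by (rule um[OF phis(1)])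
 have zm[measurable]: "z : Bor" unfolding R(2) Cauchy_convergent_iff[symmetric] by (intro measurable_If borel_measurable_lim_metric sets_Collect_Cauchy Usm) auto
 define A where "A t = (nni (sq (g t)) (%z'. ennreal (wt e z') * ennreal ((z (t, z'))^2)))" for t
 define E where "E k t = (nni (sq (g t)) (%z'. ennreal (wt e z') * ennreal ((z (t, z') - Us k (t, z'))^2)))" for k t
 define B where "B t = (nni (prod_off_diag (g t)) (%z'. ennreal (abs (z (t, z')))))" for t
 have [measurable]: "A : Bor" "E k : Bor" "B : Bor" for k
 proof -
  show "A : Bor" unfolding A_def by (rule nn_measurable2[where h="%x. ennreal (wt e (snd x)) * ennreal ((z x)^2)", simplified]) measurable
  show "E k : Bor" unfolding E_def by (rule nn_measurable2[where h="%x. ennreal (wt e (snd x)) * ennreal ((z x - Us k x)^2)", simplified]) measurable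
  have "(%x :: real * (real * real). snd x) : borel \<rightarrow>\<^sub>M borel" by (intro cont_bor continuous_intros)
  hence [measurable]: "(%x :: real * (real * real). ind off_diag (snd x) :: ennreal) : Bor" by (rule measurable_compose) measurable
  show "B : Bor" unfolding B_def nn_integral_prod_off_diag[OF rd]
   by (rule nn_measurable2[where h="%x. ennreal (abs (z x)) * ind off_diag (snd x)", simplified]) measurable
 qed
 have nnA: "(nni lborel (%t. ind {0..T} t * A t)) = ennreal (LINT x|N. (z x)^2)"
  unfolding A_def using nn_integral_st[of "%x. ennreal ((z x)^2)" e T] nn_integral_eq_integral[OF R(4)] by (simp add: N_def)
 have nnE: "(nni lborel (%t. ind {0..T} t * E k t)) <= ennreal (4 * (1/16)^k)" for k
  unfolding E_def using nn_integral_st[of "%x. ennreal ((z x - Us k x)^2)" e T] R(7)[of k] by (simp add: N_def)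
 have Afin: "AE t in lborel. t : {0..T} --> A t < \<infinity>"
 proof -
  have "AE t in lborel. ind {0..T} t * A t ~= \<infinity>" by (rule nn_integral_PInf_AE) (use nnA in auto)
  thus ?thesis by eventually_elim (auto simp: indicator_def less_top)
 qed
 have Efin: "AE t in lborel. t : {0..T} --> (\<Sum>k. E k t) < \<infinity>"
 proof -
  have "(nni lborel (%t. (\<Sum>k. ind {0..T} t * E k t))) = (\<Sum>k. \<integral>\<^sup>+t. ind {0..T} t * E k t \<partial>lborel)" by (rule nn_integral_suminf) measurable
  also have "... <= (\<Sum>k. ennreal (4 * (1/16)^k))" by (intro suminf_le nnE) auto
  also have "... < \<infinity>" by (subst suminf_ennreal2) (auto intro!: summable_mult summable_geometric)
  finally have "AE t in lborel. (\<Sum>k. ind {0..T} t * E k t) ~= \<infinity>" by (intro nn_integral_PInf_AE) auto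
  thus ?thesis by eventually_elim (auto simp: indicator_def less_top)
 qed
 have conv: "AE t in lborel. t : {0..T} --> (AE z' in prod_off_diag (g t). convergent (%k. Us k (t, z')))"
 proof (rule AE_st[OF e(2)])
  have "{x : space borel. Cauchy (%k. Us k x)} : sets borel" by (rule sets_Collect_Cauchy) measurable
  thus "{x. convergent (%k. Us k x)} : sets borel" by (simp add: Cauchy_convergent_iff)
  show "AE x in st_measure e T g. convergent (%k. Us k x)" using R(3) unfolding N_def by eventually_elim (auto simp: convergent_def)
 qed
 have qU: "q (phis k) t <= 2 * enn2real (A t) + 2 * enn2real (E k t)" if fin: "A t < \<infinity>" "E k t < \<infinity>" for k t
 proof -
  have "ennreal (q (phis k) t) = (nni (sq (g t)) (%z'. ennreal (wt e z' * (u (phis k) (t, z'))^2)))"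
   using nn_integral_eq_integral[OF uqi[OF phis(1)[of k], of t]] w0 uq[OF phis(1)[of k], of t] by simp
  also have "... <= (nni (sq (g t)) (%z'. 2 * (ennreal (wt e z') * ennreal ((z (t, z'))^2)) + 2 * (ennreal (wt e z') * ennreal ((z (t, z') - Us k (t, z'))^2))))"
  proof (rule nn_integral_mono)
   fix z' :: "real * real"
   have "(u (phis k) (t, z'))^2 <= 2 * (z (t, z'))^2 + 2 * (z (t, z') - Us k (t, z'))^2"
    unfolding phis(2)[symmetric] using zero_le_power2[of "2 * z (t, z') - Us k (t, z')"] by (simp add: power2_eq_square algebra_simps)
   hence "wt e z' * (u (phis k) (t, z'))^2 <= wt e z' * (2 * (z (t, z'))^2 + 2 * (z (t, z') - Us k (t, z'))^2)" by (intro mult_left_mono w0)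
   hence "ennreal (wt e z' * (u (phis k) (t, z'))^2) <= ennreal (2 * (wt e z' * (z (t, z'))^2) + 2 * (wt e z' * (z (t, z') - Us k (t, z'))^2))"
    by (intro ennreal_leI) (simp add: algebra_simps)
   thus "ennreal (wt e z' * (u (phis k) (t, z'))^2) <= 2 * (ennreal (wt e z') * ennreal ((z (t, z'))^2)) + 2 * (ennreal (wt e z') * ennreal ((z (t, z') - Us k (t, z'))^2))"
    using w0 by (simp add: ennreal_mult ennreal_plus)
  qed
  also have "... = 2 * A t + 2 * E k t"
  proof -
   have m: "(%z'. ennreal (wt e z') * ennreal ((z (t, z'))^2)) : borel_measurable (sq (g t))"
    "(%z'. ennreal (wt e z') * ennreal ((z (t, z') - Us k (t, z'))^2)) : borel_measurable (sq (g t))"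
    using Pair_section[OF zm, of t] Pair_section[OF Usm[of k], of t] by (intro gg_measurable, measurable)+
   show ?thesis unfolding A_def E_def using m by (simp add: nn_integral_add nn_integral_cmult)
  qed
  also have "... = ennreal (2 * enn2real (A t) + 2 * enn2real (E k t))" using fin by (simp add: ennreal_plus ennreal_mult less_top)
  finally show ?thesis by (subst (asm) ennreal_le_iff) auto
 qed
 have Bfin: "AE t in lborel. t : {0..T} --> B t < \<infinity>" using Afin Efin conv
 proof eventually_elim
  case (elim t)
  show ?case
  proof
   assume t: "t : {0..T}"
   hence fin: "A t < \<infinity>" "(\<Sum>k. E k t) < \<infinity>" and cv: "AE z' in prod_off_diag (g t). convergent (%k. Us k (t, z'))" using elim by auto
   have Ek: "E k t <= (\<Sum>k. E k t)" for k using sum_le_suminf[of "%k. E k t" "{k}"] by simp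
   have qb: "q (phis k) t <= 2 * enn2real (A t) + 2 * enn2real (\<Sum>k. E k t)" for k
    using qU[OF fin(1) le_less_trans[OF Ek fin(2)], of k] enn2real_mono[OF Ek[of k]] fin(2) by (simp add: less_top)
   have "EX C. ALL k. lipC1 (%x. phis k (t, x)) (%x. deriv (%y. phis k (t, y)) x) (C k)" using ulip[OF phis(1)] by metis
   then obtain C where C: "!!k. lipC1 (%x. phis k (t, x)) (%x. deriv (%y. phis k (t, y)) x) (C k)" by blast
   show "B t < \<infinity>" unfolding B_def
   proof (rule gradient_limit_L1[OF e rd mom, where psi="%k x. deriv (%y. phis k (t, y)) x" and C=C])
    show "AE z' in prod_off_diag (g t). (%k. deriv (%y. phis k (t, y)) (snd z') - deriv (%y. phis k (t, y)) (fst z')) ---> z (t, z')" using cv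
    proof eventually_elim
     case (elim z')
     hence "(%k. Us k (t, z')) ---> z (t, z')" by (simp add: R(2) convergent_LIMSEQ_iff)
     thus ?case by (simp add: phis(2) u_def)
    qed
    show "qform e (g t) (%x. deriv (%y. phis k (t, y)) x) <= 2 * enn2real (A t) + 2 * enn2real (\<Sum>k. E k t)" for k using qb[of k] by (simp add: q_def)
    show "(%z'. z (t, z')) : Bor" by (rule Pair_section[OF zm])
   qed (use lipC1D(3,7)[OF C] in auto)
  qed
 qed
 \<comment> \<open>changing the density on a null set of times makes every slice integrable\<close>
 define zt where "zt x = (if A (fst x) < \<infinity> & B (fst x) < \<infinity> then z x else 0)" for x
 have fm: "(%x :: real * (real * real). fst x) : borel \<rightarrow>\<^sub>M borel" by (intro cont_bor continuous_intros)
 have ztm[measurable]: "zt : Bor" unfolding zt_def using measurable_compose[OF fm `A : Bor`] measurable_compose[OF fm `B : Bor`] by measurable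
 have zts: "(%z'. zt (t, z')) : Bor" for t by (rule Pair_section[OF ztm])
 have om: "k : borel_measurable (prod_off_diag (g t))" if "k : Bor" for k :: "real * real => real" and t
  using measurable_borel_off_diag[OF that] sets_prod_off_diag[OF rd] by (simp cong: measurable_cong_sets)
 have zt1: "integrable (prod_off_diag (g t)) (%z'. zt (t, z'))" for t
 proof (rule integrableI_bounded[OF om[OF zts]])
  show "(nni (prod_off_diag (g t)) (%z'. ennreal (norm (zt (t, z'))))) < \<infinity>" by (cases "A t < \<infinity> & B t < \<infinity>") (auto simp: zt_def B_def)
 qed
 have zt2: "integrable (sq (g t)) (%z'. wt e z' * (zt (t, z'))^2)" for t
 proof (rule integrableI_bounded)
  show "(%z'. wt e z' * (zt (t, z'))^2) : borel_measurable (sq (g t))" using zts[of t] by (intro gg_measurable) measurable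
  have "(nni (sq (g t)) (%z'. ennreal (norm (wt e z' * (zt (t, z'))^2)))) = (if A t < \<infinity> & B t < \<infinity> then A t else 0)"
   unfolding A_def zt_def using w0 by (auto simp: abs_mult ennreal_mult)
  thus "(nni (sq (g t)) (%z'. ennreal (norm (wt e z' * (zt (t, z'))^2)))) < \<infinity>" by simp
 qed
 define a where "a = flux_form e g zt"
 have a0: "0 <= a t" for t unfolding a_def flux_form_def using w0 by (intro lint_nonneg) auto
 have am[measurable]: "a : Bor" unfolding a_def flux_form_def by (rule integral_measurable2[where h="%x. wt e (snd x) * (zt x)^2", simplified]) measurable
 have nna: "(nni (sq (g t)) (%z'. ennreal (wt e z' * (zt (t, z'))^2))) = ennreal (a t)" for t
  unfolding a_def flux_form_def by (rule nn_integral_eq_integral[OF zt2]) (simp add: w0)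
 have good: "AE t in lborel. t : {0..T} --> A t < \<infinity> & B t < \<infinity>" using Afin Bfin by eventually_elim auto
 have aA: "AE t in lborel. ennreal (a t * ind {0..T} t) = ind {0..T} t * A t" using good
 proof eventually_elim
  case (elim t)
  show ?case
  proof (cases "t : {0..T}")
   case True
   hence "A t = ennreal (a t)" using elim nna[of t] w0 by (simp add: A_def zt_def ennreal_mult)
   thus ?thesis using True by simp
  qed simp
 qed
 have nnaT: "(nni lborel (%t. ennreal (a t * ind {0..T} t))) = ennreal (LINT x|N. (z x)^2)" unfolding nnA[symmetric] by (rule nn_integral_cong_AE[OF aA])
 have ai: "integrable lborel (%t. a t * ind {0..T} t)" by (rule integrableI_bounded) (use nnaT a0 in auto)
 have aK: "(LBINT t. a t * ind {0..T} t) <= K"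
 proof -
  have "ennreal (LBINT t. a t * ind {0..T} t) = ennreal (LINT x|N. (z x)^2)" using nnaT nn_integral_eq_integral[OF ai] a0 by simp
  hence "(LBINT t. a t * ind {0..T} t) = (LINT x|N. (z x)^2)" by (subst (asm) ennreal_inj) (auto intro!: lint_nonneg simp: a0)
  thus ?thesis using R(5) by simp
 qed
 have pair: "pairing e g zt phi t = (LINT z'|(sq (g t)). wt e z' * (zt (t, z') * u phi (t, z')))" for phi t by (simp add: pairing_def u_def)
 have pm: "pairing e g zt phi : Bor" if phi: "phi : C1c T" for phi unfolding pair[abs_def] using um[OF phi]
  by (intro integral_measurable2[where h="%x. wt e (snd x) * (zt x * u phi x)", simplified]) measurable
 have us: "(%z'. u phi (t, z')) : Bor" if phi: "phi : C1c T" for phi t by (rule Pair_section[OF um[OF phi]])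
 have pi: "integrable (sq (g t)) (%z'. wt e z' * (zt (t, z') * u phi (t, z')))"
  if phi: "phi : C1c T" for phi t
  by (rule weight_times_product(1)[OF e(2) zt2 uqi[OF phi] gg_measurable[OF weight_measurable(1)] gg_measurable[OF zts] gg_measurable[OF us[OF phi]]])
 have ztz: "AE t in lborel. t : {0..T} --> (ALL z'. zt (t, z') = z (t, z'))" using good by eventually_elim (auto simp: zt_def)
 have tL: "timeL T g phi = - (LBINT t. pairing e g zt phi t * ind {0..T} t)" if phi: "phi : C1c T" for phi
 proof -
  have "(u phi, - timeL T g phi) : P" using phi by (auto simp: P_def)
  hence "- timeL T g phi = (LINT x|N. z x * u phi x)" by (rule R(6))
  also have "... = (LBINT t. (LINT z'|(sq (g t)). wt e z' * (z (t, z') * u phi (t, z'))) * ind {0..T} t)" unfolding N_def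
  proof (rule integral_st(3)[OF e(2)])
   show "(%x. z x * u phi x) : Bor" using um[OF phi] by measurable
   show "integrable (st_measure e T g) (%x. z x * u phi x)" unfolding N_def[symmetric]
    by (rule cauchy_schwarz_integral(1)[OF _ _ R(4) usq(1)[OF phi]]) (use um[OF phi] in measurable)
  qed
  also have "... = (LBINT t. pairing e g zt phi t * ind {0..T} t)"
  proof (rule integral_cong_AE)
   show "AE t in lborel. (LINT z'|(sq (g t)). wt e z' * (z (t, z') * u phi (t, z'))) * ind {0..T} t = pairing e g zt phi t * ind {0..T} t"
    using ztz by eventually_elim (auto simp: pair indicator_def simp del: split_paired_All)
   show "(%t. (LINT z'|(sq (g t)). wt e z' * (z (t, z') * u phi (t, z'))) * ind {0..T} t) : borel_measurable lborel"
    using integral_measurable2[where h="%x. wt e (snd x) * (z x * u phi x)"] um[OF phi] by simp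
  qed (use pm[OF phi] in simp)
  finally show ?thesis by simp
 qed
 have lims: "AE t in lborel. t : {0..T} --> (%k. pairing e g zt (phis k) t) ---> a t & (%k. q (phis k) t) ---> a t" using Efin ztz
 proof eventually_elim
  case (elim t)
  show ?case
  proof
   assume t: "t : {0..T}"
   hence S: "(\<Sum>k. E k t) < \<infinity>" and eq: "!!z'. zt (t, z') = z (t, z')" using elim by auto
   have Ek: "E k t < \<infinity>" for k using sum_le_suminf[of "%k. E k t" "{k}"] S by (simp add: le_less_trans)
   define eps where "eps k = enn2real (E k t)" for k
   have Eeps: "E k t = ennreal (eps k)" for k using Ek[of k] by (simp add: eps_def)
   have "summable eps"
   proof (rule summable_suminf_not_top)
    show "(\<Sum>k. ennreal (eps k)) ~= \<top>" using S by (simp add: Eeps less_top)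
   qed (simp add: eps_def)
   hence eps0: "eps ---> 0" by (rule summable_LIMSEQ_zero)
   have dE: "integrable (sq (g t)) (%z'. wt e z' * (zt (t, z') - u (phis k) (t, z'))^2)"
    "(LINT z'|(sq (g t)). wt e z' * (zt (t, z') - u (phis k) (t, z'))^2) = a t - 2 * pairing e g zt (phis k) t + q (phis k) t" for k
   proof -
    have eqf: "(%z'. wt e z' * (zt (t, z') - u (phis k) (t, z'))^2) =
     (%z'. wt e z' * (zt (t, z'))^2 - 2 * (wt e z' * (zt (t, z') * u (phis k) (t, z'))) + wt e z' * (u (phis k) (t, z'))^2)"
     by (auto simp: power2_eq_square algebra_simps)
    show "integrable (sq (g t)) (%z'. wt e z' * (zt (t, z') - u (phis k) (t, z'))^2)"
     unfolding eqf using zt2[of t] pi[OF phis(1)[of k], of t] uqi[OF phis(1)[of k], of t] by simp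
    show "(LINT z'|(sq (g t)). wt e z' * (zt (t, z') - u (phis k) (t, z'))^2) = a t - 2 * pairing e g zt (phis k) t + q (phis k) t"
     unfolding eqf using zt2[of t] pi[OF phis(1)[of k], of t] uqi[OF phis(1)[of k], of t] uq[OF phis(1)[of k], of t] by (simp add: a_def flux_form_def pair)
   qed
   have eps: "a t - 2 * pairing e g zt (phis k) t + q (phis k) t = eps k" for k
   proof -
    have "E k t = (nni (sq (g t)) (%z'. ennreal (wt e z' * (zt (t, z') - u (phis k) (t, z'))^2)))" unfolding E_def eq phis(2) using w0 by (simp add: ennreal_mult)
    also have "... = ennreal (a t - 2 * pairing e g zt (phis k) t + q (phis k) t)" using nn_integral_eq_integral[OF dE(1)[of k]] w0 unfolding dE(2) by simp
    finally have "ennreal (eps k) = ennreal (a t - 2 * pairing e g zt (phis k) t + q (phis k) t)" by (simp add: Eeps)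
    moreover have "0 <= a t - 2 * pairing e g zt (phis k) t + q (phis k) t" unfolding dE(2)[symmetric] using w0 by (intro lint_nonneg) auto
    ultimately show ?thesis by (simp add: eps_def)
   qed
   \<comment> \<open>Cauchy-Schwarz for the density and its distance to the gradient\<close>
   have pd: "(a t - pairing e g zt (phis k) t)^2 <= a t * eps k" for k
   proof -
    have m: "(%z'. zt (t, z') - u (phis k) (t, z')) : Bor" using zts[of t] us[OF phis(1)[of k], of t] by measurable
    have "(LINT z'|(sq (g t)). wt e z' * (zt (t, z') * (zt (t, z') - u (phis k) (t, z')))) = a t - pairing e g zt (phis k) t"
     using zt2[of t] pi[OF phis(1)[of k], of t] by (simp add: a_def flux_form_def pair right_diff_distrib power2_eq_square)
    moreover have "(LINT z'|(sq (g t)). wt e z' * (zt (t, z') * (zt (t, z') - u (phis k) (t, z'))))^2 <= a t * eps k"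
     using weight_times_product(2)[OF e(2) zt2[of t] dE(1)[of k] gg_measurable[OF weight_measurable(1)] gg_measurable[OF zts] gg_measurable[OF m]]
     unfolding dE(2) eps by (simp add: a_def flux_form_def)
    ultimately show ?thesis by simp
   qed
   have "(%k. sqrt (a t * eps k)) ---> sqrt (a t * 0)" by (intro tendsto_intros eps0)
   hence s0: "(%k. sqrt (a t * eps k)) ---> 0" by simp
   have "(%k. a t - pairing e g zt (phis k) t) ---> 0" by (rule Lim_null_comparison[OF always_eventually s0]) (use pd in "auto intro!: real_le_rsqrt")
   hence p: "(%k. pairing e g zt (phis k) t) ---> a t" using tendsto_diff[OF tendsto_const[of "a t"]] by fastforce
   have "(%k. eps k - a t + 2 * pairing e g zt (phis k) t) ---> 0 - a t + 2 * a t" by (intro tendsto_intros eps0 p)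
   moreover have "(%k. eps k - a t + 2 * pairing e g zt (phis k) t) = (%k. q (phis k) t)" unfolding eps[symmetric] by auto
   ultimately show "(%k. pairing e g zt (phis k) t) ---> a t & (%k. q (phis k) t) ---> a t" using p by simp
  qed
 qed
 have fin: "finite_measure (prod_off_diag (g t))" for t by (rule finite_prod_off_diag[OF rd])
 have df: "density_flux g zt t = (%A. LINT z'|prod_off_diag (g t). ind A z' * zt (t, z'))" for t by (simp add: density_flux_def fun_eq_iff)
 have act: "action e (g t) (density_flux g zt t) = ennreal (a t)" for t
 proof -
  have "action e (g t) (density_flux g zt t) = (nni (prod_off_diag (g t)) (%z'. ennreal ((zt (t, z'))^2) * ennreal (wt e z')))"
   unfolding df by (rule action_density_flux[OF rd zt1])
  also have "... = (nni (sq (g t)) (%z'. ennreal (wt e z' * (zt (t, z'))^2)))" unfolding nn_integral_prod_off_diag[OF rd]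
   by (intro nn_integral_cong) (auto simp: off_diag_def indicator_def ennreal_mult w0 mult.commute)
  finally show ?thesis by (simp add: nna)
 qed
 have si: "signed_integral borel_off_diag (density_flux g zt t) h = (LINT z'|prod_off_diag (g t). zt (t, z') * h z')"
  if "h : borel_measurable borel_off_diag" "integrable (prod_off_diag (g t)) (%z'. zt (t, z') * h z')" for h t
  unfolding df by (rule signed_integral_density_flux[OF fin sets_prod_off_diag[OF rd] zt1])
   (use that sets_prod_off_diag[OF rd] in "simp_all cong: measurable_cong_sets")
 have CE: "CE e T g (density_flux g zt)" unfolding CE_def
 proof (intro conjI ballI)
  show "rdist (g t)" for t by (rule rd)
  show "narrowly_continuous_on {0..T} g" by (rule narrow_curve_restrict[OF narrow_curve_axioms]) simp
  show "signed_measure borel_off_diag (density_flux g zt t)" for t unfolding df by (rule signed_density(1)[OF fin sets_prod_off_diag[OF rd] zt1])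
  show "(%t. LINT v|g t. phi v) : borel_measurable (leb T)" if phi: "phi : C0 UNIV" for phi
  proof -
   obtain D where "ALL x:UNIV. abs (phi x) <= D" using C0_bounded[OF phi] by blast
   hence "bounded (range phi)" by (intro boundedI[where B=D]) auto
   hence "contU (%t. LINT v|g t. phi v)" using that by (intro cont) (auto simp: C0_def)
   thus ?thesis by (intro borel_measurable_lebesgue_on cont_bor)
  qed
  show "(%t. signed_integral borel_off_diag (density_flux g zt t) phi) : borel_measurable (leb T)" if phi: "phi : C0 off_diag" for phi
  proof -
   have pm: "phi : borel_measurable borel_off_diag" using phi by (intro borel_measurable_continuous_on_restrict) (auto simp: C0_def)
   obtain D where D: "ALL x:off_diag. abs (phi x) <= D" using C0_bounded[OF phi] by blast
   have pi: "integrable (prod_off_diag (g t)) (%z'. zt (t, z') * phi z')" for t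
   proof (rule integrable_bd[OF integrable_mult_right[where c=D, OF zt1]])
    show "(%z'. zt (t, z') * phi z') : borel_measurable (prod_off_diag (g t))"
     using zt1[of t] pm sets_prod_off_diag[OF rd, of t] by (intro borel_measurable_times) (auto cong: measurable_cong_sets)
    show "AE z' in prod_off_diag (g t). norm (zt (t, z') * phi z') <= norm (D * zt (t, z'))"
     using D by (intro AE_I2) (auto simp: space_prod_off_diag[OF rd] abs_mult mult.commute intro!: mult_right_mono intro: order_trans[OF _ abs_ge_self])
   qed
   define phi' where "phi' z' = phi z' * ind off_diag z'" for z'
   have phim: "phi' : Bor" unfolding phi'_def using borel_measurable_restrict_space_iff[of off_diag borel phi] pm by (simp add: mult.commute)
   have sm: "(%x :: real * (real * real). snd x) : borel \<rightarrow>\<^sub>M borel" by (intro cont_bor continuous_intros)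
   have "signed_integral borel_off_diag (density_flux g zt t) phi = (LINT z'|(sq (g t)). zt (t, z') * phi' z')" for t
   proof -
    have "signed_integral borel_off_diag (density_flux g zt t) phi = (LINT z'|prod_off_diag (g t). zt (t, z') * phi z')" by (rule si[OF pm pi])
    also have "... = (LINT z'|prod_off_diag (g t). zt (t, z') * phi' z')" by (intro lint_cong) (auto simp: phi'_def space_prod_off_diag[OF rd])
    also have "... = (LINT z'|(sq (g t)). zt (t, z') * phi' z')" by (rule integrable_prod_off_diag(2)[OF rd]) (simp add: phi'_def off_diag_def)
    finally show ?thesis .
   qed
   moreover have "(%t. \<integral>z'. zt (t, z') * phi' z' \<partial>(sq (g t))) : Bor" using measurable_compose[OF sm phim]
    by (intro integral_measurable2[where h="%x. zt x * phi' (snd x)", simplified]) measurable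
   ultimately show ?thesis by (simp add: borel_measurable_lebesgue_on)
  qed
  show "(nni (leb T) (%t. (nni (total_variation borel_off_diag (density_flux g zt t)) (%(v, w). ennreal (\<sigma> e (abs (v - w))))))) < \<infinity>"
  proof -
   obtain M where M: "ALL t:{0..T}. jmean (g t) <= M" using tame_bounded[OF g] by blast
   have inner: "(nni (total_variation borel_off_diag (density_flux g zt t)) (%(v, w). ennreal (\<sigma> e (abs (v - w))))) <= ennreal (jmean (g t)) + ennreal (a t)" for t
   proof -
    have wm: "(%z'. ennreal (wt e z')) : borel_measurable (prod_off_diag (g t))" using om[OF weight_measurable(1)] by measurable
    have "(nni (total_variation borel_off_diag (density_flux g zt t)) (%(v, w). ennreal (\<sigma> e (abs (v - w))))) =
     (nni (prod_off_diag (g t)) (%z'. ennreal (abs (zt (t, z'))) * ennreal (wt e z')))"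
     unfolding df signed_density(4)[OF fin sets_prod_off_diag[OF rd] zt1] case_prod_beta' using zt1[of t] wm by (subst nn_integral_density) auto
    also have "... <= (nni (prod_off_diag (g t)) (%z'. ennreal (wt e z' * 1) + ennreal (wt e z' * (zt (t, z'))^2)))"
    proof (rule nn_integral_mono)
     fix z' :: "real * real"
     have "abs (zt (t, z')) <= 1 + (zt (t, z'))^2" using zero_le_power2[of "abs (zt (t, z')) - 1/2"] by (simp add: power2_eq_square algebra_simps)
     hence "ennreal (abs (zt (t, z')) * wt e z') <= ennreal ((1 + (zt (t, z'))^2) * wt e z')" by (intro ennreal_leI mult_right_mono w0)
     thus "ennreal (abs (zt (t, z'))) * ennreal (wt e z') <= ennreal (wt e z' * 1) + ennreal (wt e z' * (zt (t, z'))^2)"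
      using w0 by (simp add: ennreal_mult'[symmetric] ennreal_plus[symmetric] algebra_simps del: ennreal_plus)
    qed
    also have "... <= (nni (sq (g t)) (%z'. ennreal (wt e z' * 1) + ennreal (wt e z' * (zt (t, z'))^2)))"
     unfolding nn_integral_prod_off_diag[OF rd] by (intro nn_integral_mono) (auto simp: indicator_def)
    also have "... = (nni (sq (g t)) (%z'. ennreal (wt e z' * 1))) + ennreal (a t)"
     unfolding nna[symmetric] using borel_measurable_integrable[OF zt2[of t]] gg_measurable[OF weight_measurable(1)[of e], of t] by (subst nn_integral_add) auto
    also have "(nni (sq (g t)) (%z'. ennreal (wt e z' * 1))) <= (nni (sq (g t)) (%z'. ennreal ((jap (fst z') + jap (snd z')) / 4)))"
     using \<sigma>_le[OF e] by (intro nn_integral_mono ennreal_leI) auto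
    also have "... = ennreal (2 * jmean (g t) / 4)"
     using integrable_jap_sum[OF rd mom, of t] by (subst nn_integral_eq_integral) (auto simp: jap_pos less_imp_le add_nonneg_nonneg)
    also have "... <= ennreal (jmean (g t))" using jmean_ge_1[OF rd mom, of t] by (intro ennreal_leI) auto
    finally show ?thesis by (simp add: add_mono)
   qed
   have "(nni (leb T) (%t. (nni (total_variation borel_off_diag (density_flux g zt t)) (%(v, w). ennreal (\<sigma> e (abs (v - w))))))) <=
    (nni (leb T) (%t. ennreal M + ennreal (a t)))" by (rule nn_integral_mono) (use M in "auto intro!: order_trans[OF inner] add_mono ennreal_leI")
   also have "... = (nni lborel (%t. (ennreal M + ennreal (a t)) * ind {0..T} t))" by (rule lebesgue_on_nn_integral) measurable
   also have "... = (nni lborel (%t. ennreal M * ind {0..T} t)) + (nni lborel (%t. ennreal (a t * ind {0..T} t)))"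
    by (subst nn_integral_add[symmetric]) (auto simp: indicator_def intro!: nn_integral_cong)
   also have "... < \<infinity>" unfolding nnaT by (subst nn_integral_cmult_indicator) (auto simp: ennreal_mult_less_top emeasure_lborel_Icc_eq)
   finally show ?thesis .
  qed
  show "(LINT t|leb T. (LINT v|g t. deriv (%s. phi (s, v)) t)) +
    (LINT t|leb T. signed_integral borel_off_diag (density_flux g zt t) (%(v, w). \<sigma> e (abs (v - w)) * nl_grad (%x. phi (t, x)) (v, w))) = 0"
   if phi: "phi : C1c T" for phi
  proof -
   have "signed_integral borel_off_diag (density_flux g zt t) (%(v, w). \<sigma> e (abs (v - w)) * nl_grad (%x. phi (t, x)) (v, w)) = pairing e g zt phi t" for t
   proof -
    define h where "h z' = wt e z' * u phi (t, z')" for z'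
    have hm: "h : Bor" unfolding h_def using us[OF phi, of t] by measurable
    have pi': "integrable (prod_off_diag (g t)) (%z'. zt (t, z') * h z')" "(LINT z'|prod_off_diag (g t). zt (t, z') * h z') = pairing e g zt phi t"
     using integrable_prod_off_diag[OF rd, of "%z'. zt (t, z') * h z'" t] pi[OF phi, of t] by (simp_all add: h_def pair mult_ac)
    have "(%(v, w). \<sigma> e (abs (v - w)) * nl_grad (%x. phi (t, x)) (v, w)) = h" by (auto simp: h_def nl_grad_def u_def fun_eq_iff)
    thus ?thesis using si[OF measurable_borel_off_diag[OF hm] pi'(1)] pi'(2) by simp
   qed
   moreover have "(LINT t|leb T. pairing e g zt phi t) = (LBINT t. pairing e g zt phi t * ind {0..T} t)" by (rule lebesgue_on_integral(1)[OF pm[OF phi]])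
   ultimately show ?thesis using tL[OF phi] by (simp add: timeL_def)
  qed
 qed
 show ?thesis by (intro exI[of _ zt] exI[of _ phis]) (use ztm ai aK CE act tL zt2 phis(1) lims in "auto simp: a_def q_def")
qed

section \<open>Increments along a curve driven by a flux\<close>

text \<open>A curve together with a flux of density \<open>zt\<close> with respect to the product measures.\<close>

locale driven_curve = tame_curve +
 fixes e T :: real and zt :: "real * (real * real) => real"
 assumes e: "0 <= e" "e < 1" and T: "0 < T"
  and ztm: "zt : Bor"
  and zt2: "integrable (sq (g t)) (%z. wt e z * (zt (t, z))^2)"
  and ai: "integrable lborel (%t. flux_form e g zt t * ind {0..T} t)"
  and tL: "phi : C1c T ==> timeL T g phi = - (LBINT t. pairing e g zt phi t * ind {0..T} t)"
begin

definition grad_pairing :: "(real => real) => real => real" where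
 "grad_pairing psi t = (LINT z|(sq (g t)). wt e z * (zt (t, z) * (psi (snd z) - psi (fst z))))"

definition speed :: "real => real" where
 "speed t = sqrt (flux_form e g zt t) * ind {0..T} t"

lemma flux_form_nonneg: "0 <= flux_form e g zt t" unfolding flux_form_def using e by (intro lint_nonneg) (simp add: \<sigma>_nonneg)

lemma flux_form_measurable [measurable]: "flux_form e g zt : Bor" unfolding flux_form_def[abs_def]
 by (rule integral_measurable2[where h="%x. wt e (snd x) * (zt x)^2", simplified])
  (intro borel_measurable_times weight_measurable borel_measurable_power ztm)

lemma speed_measurable [measurable]: "speed : Bor" unfolding speed_def by measurable

lemma speed_nonneg: "0 <= speed t" by (simp add: speed_def flux_form_nonneg)

lemma speed_sq: "(speed t)^2 = flux_form e g zt t * ind {0..T} t" using flux_form_nonneg by (simp add: speed_def power_mult_distrib indicator_def)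

lemma speed_integrable: "integrable lborel speed" "integrable lborel (%t. (speed t)^2)"
proof -
 show 2: "integrable lborel (%t. (speed t)^2)" unfolding speed_sq by (rule ai)
 have "integrable lborel (%t. ind {0..T} t + (speed t)^2)" by (intro integrable_plus 2 integrable_real_indicator) (auto simp: emeasure_lborel_Icc_eq)
 thus "integrable lborel speed"
 proof (rule integrable_bd)
  have "speed t <= ind {0..T} t + (speed t)^2" for t
  proof (cases "t : {0..T}")
   case True
   thus ?thesis using zero_le_power2[of "speed t - 1/2"] by (simp add: power2_eq_square algebra_simps)
  qed (simp add: speed_def)
  thus "AE t in lborel. norm (speed t) <= norm (ind {0..T} t + (speed t)^2)" using speed_nonneg by (intro AE_I2) (auto simp: abs_of_nonneg)
 qed simp
qed

lemma grad_pairing_integrand: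
 assumes "psi : Bor"
 shows "(%x. wt e (snd x) * (zt x * (psi (snd (snd x)) - psi (fst (snd x))))) : Bor"
 by (intro borel_measurable_times weight_measurable ztm borel_measurable_diff measurable_compose[OF _ assms]
   cont_bor continuous_intros)

lemma grad_pairing_measurable:
 assumes "psi : Bor" shows "grad_pairing psi : Bor" unfolding grad_pairing_def[abs_def] using integral_measurable2[OF grad_pairing_integrand[OF assms]] by simp

lemma grad_pairing_bound:
 assumes psi: "psi : Bor" "!!v. abs (psi v) <= C"
 shows "integrable (sq (g t)) (%z. wt e z * (zt (t, z) * (psi (snd z) - psi (fst z))))"
  "(grad_pairing psi t)^2 <= flux_form e g zt t * qform e (g t) psi"
proof -
 have m: "(%z. psi (snd z) - psi (fst z)) : Bor" by (intro borel_measurable_diff measurable_compose[OF _ psi(1)] cont_bor continuous_intros)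
 note w = weight_times_product[OF e(2) zt2[of t] qform_integrable[OF e rd mom psi] gg_measurable[OF weight_measurable(1)]
   gg_measurable[OF Pair_section[OF ztm]] gg_measurable[OF m]]
 show "integrable (sq (g t)) (%z. wt e z * (zt (t, z) * (psi (snd z) - psi (fst z))))" by (rule w(1))
 show "(grad_pairing psi t)^2 <= flux_form e g zt t * qform e (g t) psi" unfolding grad_pairing_def flux_form_def qform_def by (rule w(2))
qed

lemma grad_pairing_le:
 assumes psi: "psi : Bor" "!!v. abs (psi v) <= C" and Q: "qform e (g t) psi <= Q^2" "0 <= Q" and t: "t : {0..T}"
 shows "abs (grad_pairing psi t) <= Q * speed t"
proof (rule power2_le_imp_le)
 have "(grad_pairing psi t)^2 <= flux_form e g zt t * Q^2" using grad_pairing_bound(2)[OF psi, of t] mult_left_mono[OF Q(1) flux_form_nonneg[of t]] by linarith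
 thus "(abs (grad_pairing psi t))^2 <= (Q * speed t)^2" using t by (simp add: power_mult_distrib speed_sq mult.commute)
qed (use Q speed_nonneg in simp)

lemma grad_pairing_dominated:
 shows "EX D>=0. ALL psi C t. psi : Bor --> (ALL v. abs (psi v) <= C) --> t : {0..T} --> abs (grad_pairing psi t) <= C * D * speed t"
proof -
 obtain M where M: "ALL t:{0..T}. jmean (g t) <= M" using tame_bounded[OF tame_curve_axioms] by blast
 show ?thesis
 proof (intro exI[of _ "sqrt (2 * max M 0)"] conjI allI impI)
  show "0 <= sqrt (2 * max M 0)" by simp
  fix psi :: "real => real" and C t assume psi: "psi : Bor" and b: "ALL v. abs (psi v) <= C" and t: "t : {0..T}"
  note psi = psi b[rule_format]
  show "abs (grad_pairing psi t) <= C * sqrt (2 * max M 0) * speed t"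
  proof (rule grad_pairing_le[OF psi _ _ t])
   have "qform e (g t) psi <= 2 * C^2 * jmean (g t)" by (rule qform_le[OF e rd mom psi])
   also have "... <= 2 * C^2 * max M 0" using M t by (intro mult_left_mono) (auto simp: le_max_iff_disj)
   finally show "qform e (g t) psi <= (C * sqrt (2 * max M 0))^2" by (simp add: power_mult_distrib mult_ac)
   have "0 <= C" using psi(2)[of 0] by linarith
   thus "0 <= C * sqrt (2 * max M 0)" by simp
  qed
 qed
qed

lemma grad_pairing_integrable:
 assumes L: "lipC1 phi psi C" and A: "A : sets borel" "A \<subseteq> {0..T}"
 shows "integrable lborel (%t. grad_pairing psi t * ind A t)"
proof -
 obtain D where D: "ALL t:{0..T}. abs (grad_pairing psi t) <= C * D * speed t" using grad_pairing_dominated lipC1D(3,7)[OF L] by blast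
 have [measurable]: "grad_pairing psi : Bor" by (rule grad_pairing_measurable[OF lipC1D(7)[OF L]])
 show ?thesis
 proof (rule integrable_bd[OF integrable_mult_right[OF speed_integrable(1), of "C * D"]])
  show "AE t in lborel. norm (grad_pairing psi t * ind A t) <= norm (C * D * speed t)"
   using D A(2) by (intro AE_I2) (auto simp: indicator_def intro: order_trans[OF _ abs_ge_self])
 qed (use A in measurable)
qed

lemma increment_compact:
 assumes Lc: "lipC1c phi psi C" and st: "0 <= s" "s < t" "t <= T"
 shows "(LINT v|g t. phi v) - (LINT v|g s. phi v) = (LBINT r. grad_pairing psi r * ind {s..t} r)"
proof -
 obtain R where L: "lipC1 phi psi C" and b: "bounded (range phi)" and R: "!!v. R < abs v ==> phi v = 0" using Lc by (auto simp: lipC1c_def)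
 obtain eta eta' a b where H: "!!n::nat. (ALL r. (eta n has_real_derivative eta' n r) (at r)) & contU (eta' n) &
   s < a n & b n < t & (ALL r. r \<notin> {a n..b n} --> eta n r = 0) & (ALL r. 0 <= eta n r & eta n r <= 1)"
  "!!r. s < r ==> r < t ==> (%n. eta n r) ---> 1"
  "!!Phi. contU Phi ==> (%n. LBINT r. eta' n r * Phi r) ---> Phi s - Phi t" using time_cutoffs[OF st(2)] by blast
 have Hd: "(eta n has_real_derivative eta' n r) (at r)" "contU (eta' n)" "s < a n" "b n < t" "0 <= eta n r" "eta n r <= 1"
  "r \<notin> {a n..b n} ==> eta n r = 0" for n r using H(1)[of n] by auto
 have [measurable]: "eta n : Bor" for n using Hd(1) by (intro cont_bor continuous_at_imp_continuous_on ballI DERIV_isCont)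
 have [measurable]: "grad_pairing psi : Bor" by (rule grad_pairing_measurable[OF lipC1D(7)[OF L]])
 define p where "p r = grad_pairing psi r * ind {0..T} r" for r
 have pint: "integrable lborel p" unfolding p_def by (rule grad_pairing_integrable[OF L]) auto
 have eq: "(LBINT r. eta' n r * (LINT v|g r. phi v)) = - (LBINT r. eta n r * p r)" for n
 proof -
  have inC: "(%z. eta n (fst z) * phi (snd z)) : C1c T"
  proof (rule C1c_times_step[where u="%z. phi (snd z)" and R=R and a="a n" and b="b n", OF C1fun_snd[OF lipC1D(1,2)[OF L]] _ Hd(1,2)])
   show "phi (snd (r, v)) = 0" if "R < abs v" for r v using R[OF that] by simp
  qed (use Hd(3)[of n] Hd(4)[of n] Hd(7) st in auto)
  have d: "deriv (%y. eta n (fst (r, y)) * phi (snd (r, y))) x = eta n r * psi x" for r x by (simp add: DERIV_imp_deriv[OF DERIV_cmult[OF lipC1D(1)[OF L]]])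
  have pr: "pairing e g zt (%z. eta n (fst z) * phi (snd z)) r = eta n r * grad_pairing psi r" for r
  proof -
   have "pairing e g zt (%z. eta n (fst z) * phi (snd z)) r =
    (LINT z|(sq (g r)). eta n r * (wt e z * (zt (r, z) * (psi (snd z) - psi (fst z)))))" unfolding pairing_def d by (intro lint_cong) (auto simp: algebra_simps)
   thus ?thesis by (simp add: grad_pairing_def)
  qed
  have "(LBINT r. eta' n r * (LINT v|g r. phi v)) = timeL T g (%z. eta n (fst z) * phi (snd z))"
   by (rule timeL_step[symmetric, OF Hd(1,7) _ _ Hd(2) lipC1D(5)[OF L] b]) (use Hd(3)[of n] Hd(4)[of n] st in auto)
  also have "... = - (LBINT r. eta n r * p r)" unfolding tL[OF inC] pr p_def by (simp add: mult.assoc)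
  finally show ?thesis .
 qed
 have "(%n. LBINT r. eta n r * p r) ---> (LBINT r. grad_pairing psi r * ind {s..t} r)"
 proof (rule integral_dominated_convergence[where w="%r. abs (p r)"])
  show "integrable lborel (%r. abs (p r))" using pint by simp
  show "AE r in lborel. (%n. eta n r * p r) ---> grad_pairing psi r * ind {s..t} r" using AE_lborel_singleton[of s] AE_lborel_singleton[of t]
  proof eventually_elim
   case (elim r)
   show ?case
   proof (cases "s < r & r < t")
    case True
    hence "(%n. eta n r * p r) ---> 1 * p r" by (intro tendsto_intros H(2)) auto
    moreover have "1 * p r = grad_pairing psi r * ind {s..t} r" using True st by (simp add: p_def indicator_def)
    ultimately show ?thesis by simp
   next
    case False
    hence "r \<notin> {s..t}" using elim by auto
    moreover from this have "eta n r = 0" for n using Hd(3,4)[of n] by (intro Hd(7)) auto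
    ultimately show ?thesis by simp
   qed
  qed
  show "AE r in lborel. norm (eta n r * p r) <= abs (p r)" for n using Hd(5,6)[of n] by (intro AE_I2) (auto simp: abs_mult intro: mult_left_le_one_le)
 qed (simp_all add: p_def)
 from LIMSEQ_unique[OF tendsto_minus[OF this] H(3)[OF lipC1_cont[OF L], unfolded eq]]
 show ?thesis by simp
qed

lemma driven_speed_bound: "speed_bound e g (primitive speed) 0 T" unfolding speed_bound_def
proof (intro allI impI, elim conjE)
 fix phi psi C and x eps :: real
 assume L: "lipC1c phi psi C" and x: "x : {0..T}" and eps: "(0::real) < eps"
 have L1: "lipC1 phi psi C" using L by (simp add: lipC1c_def)
 define Q where "Q = sqrt (qform e (g x) psi) + eps"
 have Q0: "0 < Q" "sqrt (qform e (g x) psi) < Q" using eps e by (simp_all add: Q_def qform_nonneg add_nonneg_pos)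
 have "isCont (%r. qform e (g r) psi) x"
 proof (rule continuous_at_sequentiallyI)
  fix u assume u: "u ---> x"
  show "(%n. qform e (g (u n)) psi) ---> qform e (g x) psi"
  proof (rule qform_conv[OF e rd rd weak_conv_seq[OF u] mom mom _ lipC1D(7)[OF L1] lipC1D(7)[OF L1] lipC1D(3)[OF L1]])
   show "(%n. jmean (g (u n))) ---> jmean (g x)"
    using mom_cont u by (intro isCont_tendsto_compose[where g="%t. jmean (g t)"]) (auto simp: continuous_on_eq_continuous_at)
   show "(%n. psi (X n)) ---> psi v" if "X ---> v" for v X
    using lipC1D(2)[OF L1] that by (intro isCont_tendsto_compose[where g=psi]) (auto simp: continuous_on_eq_continuous_at)
  qed
 qed
 hence "isCont (%r. sqrt (qform e (g r) psi)) x" by (intro continuous_intros)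
 hence "\<forall>\<^sub>F r in at x. sqrt (qform e (g r) psi) < Q" using Q0(2) by (intro order_tendstoD(2)) (auto simp: continuous_at)
 then obtain d where d: "0 < d" "!!r. abs (r - x) < d ==> sqrt (qform e (g r) psi) < Q" using Q0(2) by (auto simp: eventually_at dist_real_def) (metis)
 have st: "abs ((LINT v|g t. phi v) - (LINT v|g s. phi v)) <= Q * (primitive speed t - primitive speed s)"
  if st: "0 <= s" "s < t" "t <= T" and near: "!!r. r : {s..t} ==> abs (r - x) < d" for s t
 proof -
  have "abs ((LINT v|g t. phi v) - (LINT v|g s. phi v)) <= (LBINT r. abs (grad_pairing psi r * ind {s..t} r))"
   unfolding increment_compact[OF L st] by (rule integral_abs_bound)
  also have "... <= (LBINT r. Q * (speed r * ind {s..t} r))"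
  proof (rule integral_mono)
   show "integrable lborel (%r. abs (grad_pairing psi r * ind {s..t} r))" using grad_pairing_integrable[OF L1, of "{s..t}"] st by simp
   show "integrable lborel (%r. Q * (speed r * ind {s..t} r))" by (intro integrable_mult_right integrable_times_indicator speed_integrable) simp
   fix r
   have "qform e (g r) psi <= Q^2" if "r : {s..t}" using d(2)[OF near[OF that]] Q0(1) by (intro sqrt_le_D) auto
   thus "abs (grad_pairing psi r * ind {s..t} r) <= Q * (speed r * ind {s..t} r)"
    using grad_pairing_le[OF lipC1D(7)[OF L1] lipC1D(3)[OF L1], of r Q] Q0(1) st by (auto simp: indicator_def)
  qed
  finally show ?thesis using primitive_diff[OF speed_integrable(1), of s t] st by simp
 qed
 show "EX d>0. ALL y:{0..T}. abs (y - x) < d --> abs ((LINT v|g y. phi v) - (LINT v|g x. phi v)) <=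
   abs (primitive speed y - primitive speed x) * (sqrt (qform e (g x) psi) + eps)"
 proof (intro exI[of _ d] conjI ballI impI d(1))
  fix y assume y: "y : {0..T}" "abs (y - x) < d"
  consider "y = x" | "x < y" | "y < x" by linarith
  thus "abs ((LINT v|g y. phi v) - (LINT v|g x. phi v)) <= abs (primitive speed y - primitive speed x) * (sqrt (qform e (g x) psi) + eps)"
  proof cases
   case 2
   thus ?thesis using st[of x y] x y primitive_mono[OF speed_integrable(1) speed_nonneg, of x y] by (simp add: Q_def mult.commute)
  next
   case 3
   thus ?thesis using st[of y x] x y primitive_mono[OF speed_integrable(1) speed_nonneg, of y x] by (simp add: Q_def mult.commute abs_minus_commute)
  qed simp
 qed
qed

end

section \<open>The collision cost is at most the length\<close>

lemma tame_compose:
 assumes g: "tame_curve g" and th: "contU th"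
 shows "tame_curve (%x. g (th x))"
proof -
 interpret tame_curve g by fact
 show ?thesis by (intro tame_curve.intro narrow_curve.intro tame_curve_axioms.intro rd mom
    continuous_on_compose2[OF cont th] continuous_on_compose2[OF mom_cont th]) auto
qed

lemma tame_driven_curve:
 assumes e: "0 <= e" "e < 1" and T: "0 < T" and g: "tame_curve g" and W: "weak_bound e T g K" "0 <= K"
 shows "EX zt phis. driven_curve g e T zt & (LBINT t. flux_form e g zt t * ind {0..T} t) <= K &
  CE e T g (density_flux g zt) & (ALL t. action e (g t) (density_flux g zt t) = ennreal (flux_form e g zt t)) &
  (ALL k::nat. phis k : C1c T) &
  (AE t in lborel. t : {0..T} --> (%k. pairing e g zt (phis k) t) ---> flux_form e g zt t &
   (%k. qform e (g t) (%x. deriv (%y. phis k (t, y)) x)) ---> flux_form e g zt t)" using optimal_flux_exists[OF assms]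
proof (elim exE conjE)
 fix zt and phis :: "nat => real * real => real"
 assume H: "zt : Bor" "integrable lborel (%t. flux_form e g zt t * ind {0..T} t)"
  "(LBINT t. flux_form e g zt t * ind {0..T} t) <= K" "CE e T g (density_flux g zt)"
  "ALL t. action e (g t) (density_flux g zt t) = ennreal (flux_form e g zt t)"
  "ALL t. integrable (sq (g t)) (%z. wt e z * (zt (t, z))^2)"
  "ALL phi:C1c T. timeL T g phi = - (LBINT t. pairing e g zt phi t * ind {0..T} t)" "ALL k. phis k : C1c T"
  "AE t in lborel. t : {0..T} --> (%k. pairing e g zt (phis k) t) ---> flux_form e g zt t &
   (%k. qform e (g t) (%x. deriv (%y. phis k (t, y)) x)) ---> flux_form e g zt t"
 have "driven_curve g e T zt" using H e T by (intro driven_curve.intro g driven_curve_axioms.intro) auto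
 thus ?thesis using H by blast
qed

text \<open>The curve itself competes in the definition of the cost, with the flux that represents it.\<close>

lemma weak_bound_dA:
 assumes e: "0 <= e" "e < 1" and g: "tame_curve g" and W: "weak_bound e 1 g (La^2)" "0 <= La"
 shows "dA e (g 0) (g 1) <= ennreal La"
proof -
 obtain zt where d: "driven_curve g e 1 zt" and K: "(LBINT t. flux_form e g zt t * ind {0..1} t) <= La^2"
  and CE: "CE e 1 g (density_flux g zt)" and act: "ALL t. action e (g t) (density_flux g zt t) = ennreal (flux_form e g zt t)"
  using tame_driven_curve[OF e _ g W(1)] by auto
 interpret driven_curve g e 1 zt by fact
 have "(nni (lebesgue_on {0..1}) (%t. action e (g t) (density_flux g zt t))) = (nni lborel (%t. ennreal (flux_form e g zt t) * ind {0..1} t))"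
  unfolding act[rule_format] by (rule lebesgue_on_nn_integral) measurable
 also have "... = (nni lborel (%t. ennreal (flux_form e g zt t * ind {0..1} t)))" by (intro nn_integral_cong) (simp add: indicator_def)
 also have "... = ennreal (LBINT t. flux_form e g zt t * ind {0..1} t)" by (rule nn_integral_eq_integral[OF ai]) (simp add: flux_form_nonneg)
 also have "... <= ennreal (La^2)" using K by (rule ennreal_leI)
 finally have le: "(nni (lebesgue_on {0..1}) (%t. action e (g t) (density_flux g zt t))) <= ennreal (La^2)" .
 define I where "I = (INF (f, U) \<in> CE_between e 1 (g 0) (g 1). \<integral>\<^sup>+t. action e (f t) (U t) \<partial>lebesgue_on {0..1})"
 have "I <= (nni (lebesgue_on {0..1}) (%t. action e (g t) (density_flux g zt t)))"
  unfolding I_def by (rule INF_lower2[of "(g, density_flux g zt)"]) (use CE in "auto simp: CE_between_def")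
 hence I: "I <= ennreal (La^2)" using le by (rule order_trans)
 hence "enn2real I <= La^2" by (intro enn2real_leI) auto
 hence "sqrt (enn2real I) <= La" using W(2) real_sqrt_le_mono by fastforce
 moreover have "I ~= \<infinity>" using I by (auto simp: top_unique)
 ultimately show ?thesis unfolding dA_def I_def[symmetric] ennreal_sqrt_def by (auto intro: ennreal_leI)
qed

lemma constant_speed_dA:
 assumes e: "0 <= e" "e < 1" and h: "tame_curve h" and La: "0 <= La" and S: "speed_bound e h (%x. La * x) 0 1"
 shows "dA e (h 0) (h 1) <= ennreal La" "dA e (h 1) (h 0) <= ennreal La"
proof -
 have *: "dA e (k 0) (k 1) <= ennreal La" if k: "tame_curve k" and S: "speed_bound e k (%x. La * x) 0 1" for k
 proof (rule weak_bound_dA[OF e k _ La])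
  have W: "La * y - La * x = (LBINT r. La * ind {0..1} r * ind {x..y} r)" if "0 <= x" "x <= y" "y <= 1" for x y :: real
  proof -
   have "(LBINT r. La * ind {0..1} r * ind {x..y} r) = (LBINT r. La * ind {x..y} r)" using that by (intro lint_cong) (auto simp: indicator_def)
   thus ?thesis using that by (simp add: right_diff_distrib)
  qed
  show "weak_bound e 1 k (La^2)" unfolding weak_bound_def
  proof
   fix phi assume "phi : C1c 1"
   then obtain phit phiv a b R C where td: "test_data 1 phi phit phiv a b R C" using test_data_exists by fastforce
   hence ab: "0 < a" "b < 1" by (auto simp: test_data_def)
   have sq: "(%r :: real. (La * ind {0..1} r)^2) = (%r. La^2 * ind {0..1} r)" by (auto simp: indicator_def)
   have ii: "integrable lborel (%r :: real. c * ind {0..1} r :: real)" for c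
    by (intro integrable_mult_right integrable_real_indicator) (auto simp: emeasure_lborel_Icc_eq)
   have "(timeL 1 k phi)^2 <= (LBINT x. (La * ind {0..1} (x::real))^2) * (LBINT t. qform e (k t) (%x. deriv (%y. phi (t, y)) x) * ind {0..1} t)"
    by (rule speed_bound_weak_bound[OF e k td _ _ _ _ S W ab]) (use La ii in "simp_all add: sq")
   thus "(timeL 1 k phi)^2 <= La^2 * (LBINT t. qform e (k t) (%x. deriv (%y. phi (t, y)) x) * ind {0..1} t)" unfolding sq by simp
  qed
 qed
 show "dA e (h 0) (h 1) <= ennreal La" by (rule *[OF h S])
 have "dA e (h (1 - 0)) (h (1 - 1)) <= ennreal La"
 proof (rule *)
  show "tame_curve (%x. h (1 - x))" by (intro tame_compose[OF h] continuous_intros)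
  show "speed_bound e (%x. h (1 - x)) (%x. La * x) 0 1" unfolding speed_bound_def
  proof (intro allI impI, elim conjE)
   fix phi psi C and x eps :: real assume L: "lipC1c phi psi C" and x: "x : {0..1}" and eps: "(0::real) < eps"
   obtain d where d: "0 < d" "!!y. y : {0..1} ==> abs (y - (1 - x)) < d ==>
     abs ((LINT v|h y. phi v) - (LINT v|h (1 - x). phi v)) <= abs (La * y - La * (1 - x)) * (sqrt (qform e (h (1 - x)) psi) + eps)"
    using S[unfolded speed_bound_def, rule_format, of phi psi C "1 - x" eps] L x eps by auto
   have "abs (La * (1 - y) - La * (1 - x)) = abs (La * y - La * x)" for y by (simp add: algebra_simps abs_minus_commute)
   thus "EX d>0. ALL y:{0..1}. abs (y - x) < d -->
     abs ((LINT v|h (1 - y). phi v) - (LINT v|h (1 - x). phi v)) <= abs (La * y - La * x) * (sqrt (qform e (h (1 - x)) psi) + eps)"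
    using d(1) d(2)[of "1 - _"] by (intro exI[of _ d]) (auto simp: abs_minus_commute)
  qed
 qed
 thus "dA e (h 1) (h 0) <= ennreal La" by simp
qed

text \<open>The inverse of the normalised arclength; the term with \<open>eps\<close> makes the arclength strictly
 increasing.\<close>

lemma arclength_parametrisation:
 fixes m :: "real => real"
 assumes m: "integrable lborel m" "!!x. 0 <= m x" and st: "s < t" and eps: "0 < eps"
 shows "EX th. contU th & th 0 = s & th 1 = t & (ALL x y. 0 <= x & x <= y & y <= 1 --> th x <= th y & s <= th x & th y <= t &
  (LBINT r. m r * ind {th x..th y} r) <= ((LBINT r. m r * ind {s..t} r) + eps) * (y - x))"
proof -
 define La where "La = (LBINT r. m r * ind {s..t} r) + eps"
 have "0 <= (LBINT r. m r * ind {s..t} r)" using m(2) by (intro lint_nonneg) auto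
 hence La0: "0 < La" using eps by (simp add: La_def)
 define ta where "ta r = (primitive m r - primitive m s + eps * ((r - s) / (t - s))) / La" for r
 have tast: "ta s = 0" "ta t = 1" using st La0 primitive_diff[OF m(1), of s t] by (simp_all add: ta_def La_def)
 have inc: "ta x < ta y" if "x < y" for x y
 proof -
  have "primitive m x <= primitive m y" using primitive_mono[OF m] that by simp
  moreover have "eps * ((x - s) / (t - s)) < eps * ((y - s) / (t - s))" using that st eps by (intro mult_strict_left_mono divide_strict_right_mono) auto
  ultimately show ?thesis using La0 unfolding ta_def by (intro divide_strict_right_mono) auto
 qed
 hence inc': "x <= y" if "ta x <= ta y" for x y using that by (meson leD leI)
 have inj: "x = y" if "ta x = ta y" for x y using inc'[of x y] inc'[of y x] that by simp
 have tac: "continuous_on {s..t} ta" unfolding ta_def using st La0 by (intro continuous_intros continuous_on_subset[OF primitive_cont[OF m(1)]]) auto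
 have img: "ta ` {s..t} = {0..1}"
 proof
  show "ta ` {s..t} \<subseteq> {0..1}"
  proof
   fix y assume "y : ta ` {s..t}"
   then obtain x where x: "s <= x" "x <= t" "y = ta x" by auto
   have "ta s <= ta x" "ta x <= ta t" using inc[of s x] inc[of x t] x by (auto simp: le_less)
   thus "y : {0..1}" using tast x by simp
  qed
  show "{0..1} \<subseteq> ta ` {s..t}"
  proof
   fix y :: real assume "y : {0..1}"
   thus "y : ta ` {s..t}" using IVT'[of ta s y t] tac tast st by auto
  qed
 qed
 define ka where "ka = inv_into {s..t} ta"
 have kata: "ka (ta x) = x" if "x : {s..t}" for x unfolding ka_def by (rule inv_into_f_f) (use that inj in "auto intro: inj_onI")
 have taka: "ta (ka y) = y" "ka y : {s..t}" if "y : {0..1}" for y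
  unfolding ka_def using f_inv_into_f[of y ta "{s..t}"] inv_into_into[of y ta "{s..t}"] that img by auto
 have kac: "continuous_on {0..1} ka" using continuous_on_inv[OF tac compact_Icc, of ka] kata unfolding img by auto
 define th where "th x = ka (clamp_time 0 1 x)" for x
 have th: "th x = ka x" if "x : {0..1}" for x using that by (simp add: th_def)
 show ?thesis
 proof (intro exI conjI allI impI)
  show "contU th" unfolding th_def by (rule continuous_on_compose2[OF kac clamp_time_cont]) (use clamp_time_in(1)[of 0 "1::real"] in auto)
  show "th 0 = s" "th 1 = t" using kata[of s] kata[of t] st tast by (simp_all add: th)
  fix x y :: real assume "0 <= x & x <= y & y <= 1"
  hence xy: "x : {0..1}" "y : {0..1}" "x <= y" by auto
  show le: "th x <= th y" using inc'[of "ka x" "ka y"] taka xy by (simp add: th)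
  show "s <= th x" "th y <= t" using taka(2)[of x] taka(2)[of y] xy by (auto simp: th)
  have "(LBINT r. m r * ind {th x..th y} r) = primitive m (th y) - primitive m (th x)" using primitive_diff[OF m(1) le] by simp
  also have "... <= La * (ta (th y) - ta (th x))"
  proof -
   have "eps * ((th x - s) / (t - s)) <= eps * ((th y - s) / (t - s))" using le st eps by (intro mult_left_mono divide_right_mono) auto
   thus ?thesis using La0 by (simp add: ta_def right_diff_distrib)
  qed
  also have "... = La * (y - x)" using taka xy by (simp add: th)
  finally show "(LBINT r. m r * ind {th x..th y} r) <= ((LBINT r. m r * ind {s..t} r) + eps) * (y - x)" by (simp add: La_def)
 qed
qed

text \<open>Parametrised by arclength the curve has constant speed, so that the square of the cost is at most the
 square of the length; in the given parametrisation the action may be much larger.\<close>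

lemma dA_le_length:
 assumes e: "0 <= e" "e < 1" and g: "tame_curve g" and S: "speed_bound e g (primitive m) al be"
  and m: "integrable lborel m" "!!x. 0 <= m x" and st: "al <= s" "s <= t" "t <= be"
 shows "dA e (g s) (g t) <= ennreal (LBINT r. m r * ind {s..t} r)"
  "dA e (g t) (g s) <= ennreal (LBINT r. m r * ind {s..t} r)"
proof -
 define I where "I = (LBINT r. m r * ind {s..t} r)"
 have I0: "0 <= I" unfolding I_def using m(2) by (intro lint_nonneg) auto
 have "dA e (g s) (g t) <= ennreal (I + eps) & dA e (g t) (g s) <= ennreal (I + eps)" if eps: "0 < eps" for eps
 proof (cases "s = t")
  case True
  have c: "tame_curve (%x. g s)" by (intro tame_compose[OF g] continuous_intros)
  have "speed_bound e (%x. g s) (%x. (I + eps) * x) 0 1"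
   unfolding speed_bound_def using e I0 eps by (auto simp: qform_nonneg intro!: exI[of _ 1] mult_nonneg_nonneg add_nonneg_nonneg)
  from constant_speed_dA[OF e c _ this] show ?thesis using I0 eps by (simp add: True)
 next
  case False
  hence "s < t" using st by simp
  from arclength_parametrisation[OF m this eps, folded I_def]
  obtain th where th: "contU th" "th 0 = s" "th 1 = t"
   "ALL x y. 0 <= x & x <= y & y <= 1 --> th x <= th y & s <= th x & th y <= t & (LBINT r. m r * ind {th x..th y} r) <= (I + eps) * (y - x)" by (elim exE conjE)
  have h: "tame_curve (%x. g (th x))" by (rule tame_compose[OF g th(1)])
  have *: "abs (primitive m (th y) - primitive m (th x)) <= abs ((I + eps) * y - (I + eps) * x)" if "x : {0..1}" "y : {0..1}" for x y
  proof -
   have "primitive m (th y) - primitive m (th x) <= (I + eps) * (y - x)" "primitive m (th x) <= primitive m (th y)" if "0 <= x" "x <= y" "y <= 1" for x y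
    using th(4)[rule_format, of x y] that primitive_diff[OF m(1)] primitive_mono[OF m] by auto
   from this[of x y] this[of y x] show ?thesis using that by (cases "x <= y") (auto simp: right_diff_distrib abs_le_iff)
  qed
  have "speed_bound e (%x. g (th x)) (%x. (I + eps) * x) 0 1" unfolding speed_bound_def
  proof (intro allI impI, elim conjE)
   fix phi psi C and x eta :: real assume L: "lipC1c phi psi C" and x: "x : {0..1}" and eta: "(0::real) < eta"
   have in01: "th y : {al..be}" if "y : {0..1}" for y using th(4)[rule_format, of y y] that st by auto
   obtain d where d: "0 < d" "!!y. y : {al..be} ==> abs (y - th x) < d ==>
     abs ((LINT v|g y. phi v) - (LINT v|g (th x). phi v)) <= abs (primitive m y - primitive m (th x)) * (sqrt (qform e (g (th x)) psi) + eta)"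
    using S[unfolded speed_bound_def, rule_format, of phi psi C "th x" eta] L in01[OF x] eta by auto
   obtain d' where d': "0 < d'" "!!y. abs (y - x) < d' ==> abs (th y - th x) < d" using th(1) d(1) unfolding continuous_on_iff dist_real_def by (metis UNIV_I)
   show "EX d>0. ALL y:{0..1}. abs (y - x) < d -->
     abs ((LINT v|g (th y). phi v) - (LINT v|g (th x). phi v)) <= abs ((I + eps) * y - (I + eps) * x) * (sqrt (qform e (g (th x)) psi) + eta)"
   proof (intro exI[of _ d'] conjI ballI impI d'(1))
    fix y assume y: "y : {0..1}" "abs (y - x) < d'"
    show "abs ((LINT v|g (th y). phi v) - (LINT v|g (th x). phi v)) <= abs ((I + eps) * y - (I + eps) * x) * (sqrt (qform e (g (th x)) psi) + eta)"
     by (rule order_trans[OF d(2)[OF in01[OF y(1)] d'(2)[OF y(2)]] mult_right_mono[OF *[OF x y(1)]]])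
      (use e eta in "simp add: qform_nonneg add_nonneg_nonneg")
   qed
  qed
  from constant_speed_dA[OF e h _ this] show ?thesis using I0 eps th(2,3) by simp
 qed
 hence *: "dA e (g s) (g t) <= ennreal I + ennreal eps" "dA e (g t) (g s) <= ennreal I + ennreal eps" if "0 < eps" for eps
  using that I0 by (simp_all add: ennreal_plus[symmetric] del: ennreal_plus)
 show "dA e (g s) (g t) <= ennreal (LBINT r. m r * ind {s..t} r)"
  "dA e (g t) (g s) <= ennreal (LBINT r. m r * ind {s..t} r)" unfolding I_def[symmetric] by (rule ennreal_le_epsilon, rule *, assumption)+
qed

section \<open>The metric derivative\<close>

context driven_curve
begin

lemma gradient_difference_small:
 assumes phi: "phi : C1c T" and ka: "0 < ka"
 shows "EX dl>0. ALL r. abs (r - t) < dl --> qform e (g r) (%x. deriv (%y. phi (t, y)) x - deriv (%y. phi (r, y)) x) < ka"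
proof -
 obtain phit phiv a b R C where td: "test_data T phi phit phiv a b R C" using test_data_exists[OF phi T] by blast
 have cv: "contU phiv" and bd: "!!z. abs (phiv z) <= C" using td by (auto simp: test_data_def)
 have sm: "(%x. phiv (r, x)) : Bor" for r by (rule lipC1D(7)[OF test_data_lipC1[OF td]])
 define F where "F r = qform e (g r) (%x. phiv (t, x) - phiv (r, x))" for r
 have "isCont F t"
 proof (rule continuous_at_sequentiallyI)
  fix u assume u: "u ---> t"
  show "(%n. F (u n)) ---> F t" unfolding F_def
  proof (rule qform_conv[OF e rd rd weak_conv_seq[OF u] mom mom, where C="2 * C"])
   show "(%n. jmean (g (u n))) ---> jmean (g t)"
    using mom_cont u by (intro isCont_tendsto_compose[where g="%t. jmean (g t)"]) (auto simp: continuous_on_eq_continuous_at)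
   show "(%x. phiv (t, x) - phiv (u n, x)) : Bor" "(%x. phiv (t, x) - phiv (t, x)) : Bor" for n by (intro borel_measurable_diff sm)+
   show "abs (phiv (t, x) - phiv (u n, x)) <= 2 * C" for n x using bd[of "(t, x)"] bd[of "(u n, x)"] by linarith
   show "(%n. phiv (t, X n) - phiv (u n, X n)) ---> phiv (t, x) - phiv (t, x)" if X: "X ---> x" for x X
    using cv tendsto_Pair[OF u X] tendsto_Pair[OF tendsto_const[of t] X]
    by (intro tendsto_diff isCont_tendsto_compose[where g=phiv]) (auto simp: continuous_on_eq_continuous_at)
  qed
 qed
 moreover have "F t = 0" by (simp add: F_def)
 ultimately obtain dl where dl: "dl > 0" "!!r. dist r t < dl ==> dist (F r) 0 < ka" using ka unfolding continuous_at_eps_delta by metis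
 have "F r < ka" if "abs (r - t) < dl" for r using dl(2)[of r] that by (simp add: dist_real_def abs_less_iff)
 thus ?thesis using dl(1) unfolding F_def test_data_deriv(2)[OF td] by blast
qed

lemma pairing_integrable:
 assumes phi: "phi : C1c T"
 shows "integrable lborel (%r. pairing e g zt phi r * ind {0..T} r)"
proof -
 obtain phit phiv a b R C where td: "test_data T phi phit phiv a b R C" using test_data_exists[OF phi T] by blast
 note L = test_data_lipC1[OF td]
 have cv: "contU phiv" using td by (auto simp: test_data_def)
 have Pg: "pairing e g zt phi r * ind {0..T} r = grad_pairing (%x. phiv (r, x)) r * ind {0..T} r" for r
  by (simp add: pairing_def grad_pairing_def test_data_deriv(2)[OF td])
 have vm: "(%x. phiv (fst x, snd (snd x)) - phiv (fst x, fst (snd x))) : borel_measurable (borel :: (real * real * real) measure)"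
  by (intro cont_bor continuous_intros continuous_on_compose2[OF cv]) auto
 have Pm: "(%r. grad_pairing (%x. phiv (r, x)) r) : Bor" unfolding grad_pairing_def
  using integral_measurable2[OF borel_measurable_times[OF weight_measurable(2) borel_measurable_times[OF ztm vm]]] by simp
 obtain D where D: "0 <= D" "ALL psi C t. psi : Bor --> (ALL v. abs (psi v) <= C) --> t : {0..T} --> abs (grad_pairing psi t) <= C * D * speed t"
  using grad_pairing_dominated by blast
 show ?thesis unfolding Pg
 proof (rule integrable_bd[OF integrable_mult_right[OF speed_integrable(1), of "C * D"]])
  show "AE r in lborel. norm (grad_pairing (%x. phiv (r, x)) r * ind {0..T} r) <= norm (C * D * speed r)"
   using D(2)[rule_format, OF lipC1D(7)[OF L] lipC1D(3)[OF L]] by (intro AE_I2) (auto simp: indicator_def intro: order_trans[OF _ abs_ge_self])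
 qed (use Pm in measurable)
qed

text \<open>At a common Lebesgue point of the speed and of the pairing with \<open>phi\<close>, the increments of
 the integral of \<open>phi (t, _)\<close> have slope at least the pairing: the test function is frozen
 at time \<open>t\<close>, and the error is controlled by the continuity of the gradient form.\<close>

lemma increment_slope:
 assumes phi: "phi : C1c T" and t: "0 < t" "t < T"
  and ls: "lebesgue_point speed t" and lp: "lebesgue_point (%r. pairing e g zt phi r * ind {0..T} r) t" and eta: "0 < eta"
 shows "EX dl>0. ALL h. 0 < abs h & abs h < dl -->
  (pairing e g zt phi t - eta) * abs h <= abs ((LINT v|g (t + h). phi (t, v)) - (LINT v|g t. phi (t, v)))"
proof -
 obtain phit phiv a b R C where td: "test_data T phi phit phiv a b R C" using test_data_exists[OF phi T] by blast
 have LL: "lipC1 (%x. phi (r, x)) (%x. phiv (r, x)) C" for r by (rule test_data_lipC1[OF td])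
 note dv = test_data_deriv(2)[OF td]
 define P where "P r = pairing e g zt phi r * ind {0..T} r" for r
 have Pg: "P r = grad_pairing (%x. phiv (r, x)) r * ind {0..T} r" for r by (simp add: P_def pairing_def grad_pairing_def dv)
 define L where "L = speed t + 1"
 have L0: "0 < L" using speed_nonneg[of t] by (simp add: L_def)
 define ka where "ka = eta / (2 * L)"
 have ka0: "0 < ka" using eta L0 by (simp add: ka_def)
 obtain dl1 where dl1: "dl1 > 0" "!!r. abs (r - t) < dl1 ==> qform e (g r) (%x. phiv (t, x) - phiv (r, x)) < ka^2"
  using gradient_difference_small[OF phi, of "ka^2" t] ka0 unfolding dv by auto
 obtain dl2 where dl2: "dl2 > 0" "!!a b. a <= t ==> t <= b ==> a < b ==> b - a < dl2 ==> abs ((LBINT x. speed x * ind {a..b} x) - speed t * (b - a)) <= 1 * (b - a)"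
  using ls[unfolded lebesgue_point_def, rule_format, of 1] by auto
 obtain dl3 where dl3: "dl3 > 0" "!!a b. a <= t ==> t <= b ==> a < b ==> b - a < dl3 ==> abs ((LBINT x. P x * ind {a..b} x) - P t * (b - a)) <= eta / 2 * (b - a)"
  using lp[unfolded lebesgue_point_def, rule_format, of "eta / 2"] eta unfolding P_def by auto
 define dl where "dl = Min {dl1, dl2, dl3, t, T - t}"
 have dl: "0 < dl" "dl <= dl1" "dl <= dl2" "dl <= dl3" "dl <= t" "dl <= T - t" using dl1(1) dl2(1) dl3(1) t by (auto simp: dl_def)
 show ?thesis
 proof (intro exI conjI allI impI)
  show "0 < dl" by (rule dl)
  fix h assume "0 < abs h & abs h < dl"
  hence h: "0 < abs h" "abs h < dl" by auto
  define x where "x = min t (t + h)"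
  define y where "y = max t (t + h)"
  have xy: "x <= t" "t <= y" "x < y" "y - x = abs h" "0 <= x" "x <= y" "y <= T" using h dl(5,6) by (auto simp: x_def y_def)
  define psi where "psi x = phiv (t, x)" for x
  have Lpsi: "lipC1 (%v. phi (t, v)) psi C" unfolding psi_def by (rule LL)
  have Lc: "lipC1c (%v. phi (t, v)) psi C" unfolding psi_def by (rule test_data_lipC1c[OF td])
  have psi: "psi : Bor" "!!v. abs (psi v) <= C" by (rule lipC1D(7)[OF Lpsi], rule lipC1D(3)[OF Lpsi])
  have v: "(%x. phiv (r, x)) : Bor" "!!v. abs (phiv (r, v)) <= C" for r using lipC1D(3,7)[OF LL] by auto
  have near: "P r * ind {x..y} r - ka * (speed r * ind {x..y} r) <= grad_pairing psi r * ind {x..y} r" for r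
  proof (cases "r : {x..y}")
   case True
   hence r: "r : {0..T}" "abs (r - t) < dl1" using xy h dl(2) by auto
   have db: "abs (psi v - phiv (r, v)) <= 2 * C" for v using psi(2)[of v] v(2)[of r v] by linarith
   have dm: "(%x. psi x - phiv (r, x)) : Bor" by (intro borel_measurable_diff psi v)
   have "grad_pairing (%x. psi x - phiv (r, x)) r = grad_pairing psi r - grad_pairing (%x. phiv (r, x)) r" unfolding grad_pairing_def
    by (subst lint_diff[symmetric, OF grad_pairing_bound(1)[OF psi] grad_pairing_bound(1)[OF v]])
     (intro lint_cong refl, simp add: algebra_simps)
   moreover have "abs (grad_pairing (%x. psi x - phiv (r, x)) r) <= ka * speed r"
    by (rule grad_pairing_le[OF dm db _ _ r(1)]) (use dl1(2)[OF r(2)] ka0 in "auto simp: psi_def")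
   ultimately show ?thesis using True r by (simp add: Pg)
  qed simp
  have cP: "integrable lborel P" unfolding P_def by (rule pairing_integrable[OF phi])
  have Pt: "P t = pairing e g zt phi t" using t by (simp add: P_def)
  have I: "integrable lborel (%r. P r * ind {x..y} r)" "integrable lborel (%r. ka * (speed r * ind {x..y} r))"
   by (intro integrable_mult_right integrable_times_indicator cP speed_integrable; simp)+
  have "(LBINT r. P r * ind {x..y} r) - ka * (LBINT r. speed r * ind {x..y} r) =
   (LBINT r. P r * ind {x..y} r - ka * (speed r * ind {x..y} r))" using lint_diff[OF I] by simp
  also have "... <= (LBINT r. grad_pairing psi r * ind {x..y} r)" by (intro integral_mono near integrable_dif I grad_pairing_integrable[OF Lpsi]) (use xy in auto)
  finally have 1: "(LBINT r. P r * ind {x..y} r) - ka * (LBINT r. speed r * ind {x..y} r) <= (LBINT r. grad_pairing psi r * ind {x..y} r)" .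
  have 2: "P t * abs h - eta / 2 * abs h <= (LBINT r. P r * ind {x..y} r)"
  proof -
   have "abs ((LBINT r. P r * ind {x..y} r) - P t * abs h) <= eta / 2 * abs h" using dl3(2)[OF xy(1-3)] h dl(4) unfolding xy(4) by simp
   thus ?thesis by linarith
  qed
  have "(LBINT r. speed r * ind {x..y} r) <= L * abs h" using dl2(2)[OF xy(1-3)] xy(4) h dl(3) by (simp add: abs_le_iff L_def algebra_simps)
  hence "ka * (LBINT r. speed r * ind {x..y} r) <= ka * (L * abs h)" using ka0 by (intro mult_left_mono) auto
  also have "... = eta / 2 * abs h" using L0 by (simp add: ka_def)
  finally have "(pairing e g zt phi t - eta) * abs h <= (LBINT r. grad_pairing psi r * ind {x..y} r)" using 1 2 unfolding Pt by (simp add: algebra_simps)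
  also have "... = (LINT v|g y. phi (t, v)) - (LINT v|g x. phi (t, v))" by (rule increment_compact[symmetric, OF Lc xy(5,3,7)])
  also have "... <= abs ((LINT v|g (t + h). phi (t, v)) - (LINT v|g t. phi (t, v)))" by (cases "0 <= h") (auto simp: x_def y_def min_def max_def)
  finally show "(pairing e g zt phi t - eta) * abs h <= abs ((LINT v|g (t + h). phi (t, v)) - (LINT v|g t. phi (t, v)))" .
 qed
qed

text \<open>The upper bound is the length estimate at a Lebesgue point of the speed. For the lower bound, the
 increments tested with the approximating potential \<open>phis k\<close> have slope at least the pairing and are at most
 the cost times the root of the gradient form. Both quantities tend to the action as \<open>k\<close> grows, because
 the density of the flux is the limit of these gradients. It is here that an arbitrary flux would not do.\<close>

lemma metric_derivative:
 assumes phis: "!!k::nat. phis k : C1c T"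
  and lim: "AE t in lborel. t : {0..T} --> (%k. pairing e g zt (phis k) t) ---> flux_form e g zt t &
   (%k. qform e (g t) (%x. deriv (%y. phis k (t, y)) x)) ---> flux_form e g zt t"
 shows "AE t in lborel. t : {0<..<T} -->
  ((%h. dA e (g (t + h)) (g t) / ennreal (abs h)) \<longlongrightarrow> ennreal (sqrt (flux_form e g zt t))) (at 0)"
proof -
 have pint: "integrable lborel (%r. pairing e g zt phi r * ind {0..T} r)" if phi: "phi : C1c T" for phi by (rule pairing_integrable[OF phi])
 have "AE t in lborel. ALL k. lebesgue_point (%r. pairing e g zt (phis k) r * ind {0..T} r) t"
  unfolding AE_all_countable using pint[OF phis] by (auto intro!: AE_lebesgue_point)
 thus ?thesis using lim AE_lebesgue_point[OF speed_measurable speed_integrable(1)]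
 proof eventually_elim
  case (elim t)
  show ?case
  proof
   assume t: "t : {0<..<T}"
   hence t': "0 < t" "t < T" by auto
   define l where "l = sqrt (flux_form e g zt t)"
   have l: "0 <= l" "l^2 = flux_form e g zt t" "speed t = l" using flux_form_nonneg[of t] t by (auto simp: l_def speed_def)
   define d where "d h = enn2real (dA e (g (t + h)) (g t))" for h
   have up: "EX dl>0. ALL h. 0 < abs h & abs h < dl --> dA e (g (t + h)) (g t) = ennreal (d h) & d h <= (l + eps) * abs h" if eps: "0 < eps" for eps
   proof -
    obtain dl where dl: "dl > 0" "!!a b. a <= t ==> t <= b ==> a < b ==> b - a < dl ==> abs ((LBINT x. speed x * ind {a..b} x) - l * (b - a)) <= eps * (b - a)"
     using elim(3)[unfolded lebesgue_point_def l(3)] eps by meson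
    show ?thesis
    proof (intro exI[of _ "min dl (min t (T - t))"] conjI allI impI)
     show "0 < min dl (min t (T - t))" using dl t by auto
     fix h assume "0 < abs h & abs h < min dl (min t (T - t))"
     hence h: "0 < abs h" "abs h < dl" "abs h < t" "abs h < T - t" by auto
     define x where "x = min t (t + h)"
     define y where "y = max t (t + h)"
     have xy: "x <= t" "t <= y" "x < y" "y - x = abs h" "0 <= x" "x <= y" "y <= T" using h by (auto simp: x_def y_def)
     have "(LBINT r. speed r * ind {x..y} r) <= (l + eps) * abs h" using dl(2)[OF xy(1-3)] xy(4) h by (simp add: abs_le_iff algebra_simps)
     moreover have "dA e (g (t + h)) (g t) <= ennreal (LBINT r. speed r * ind {x..y} r)"
      using dA_le_length[OF e tame_curve_axioms driven_speed_bound speed_integrable(1) speed_nonneg xy(5-7)]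
      by (cases "0 <= h") (auto simp: x_def y_def min_def max_def)
     ultimately have le: "dA e (g (t + h)) (g t) <= ennreal ((l + eps) * abs h)" by (meson ennreal_leI order_trans)
     hence "dA e (g (t + h)) (g t) < top" using le_less_trans by fastforce
     thus "dA e (g (t + h)) (g t) = ennreal (d h)" by (simp add: d_def)
     show "d h <= (l + eps) * abs h" unfolding d_def using le l eps by (intro enn2real_leI) auto
    qed
   qed
   have low: "EX dl>0. ALL h. 0 < abs h & abs h < dl --> (l - eps) * abs h <= d h" if eps: "0 < eps" for eps
   proof (cases "l = 0")
    case True
    thus ?thesis using eps by (intro exI[of _ 1]) (auto simp: d_def intro: order_trans[of _ 0])
   next
    case False
    define p where "p k = pairing e g zt (phis k) t" for k
    define q where "q k = qform e (g t) (%x. deriv (%y. phis k (t, y)) x)" for k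
    have "p ---> l^2" "q ---> l^2" using elim(2) t by (auto simp: p_def[abs_def] q_def[abs_def] l)
    hence "(%k. p k / sqrt (q k)) ---> l^2 / sqrt (l^2)" using False by (intro tendsto_intros) auto
    hence "(%k. p k / sqrt (q k)) ---> l" using l(1) False by (simp add: power2_eq_square)
    moreover have "l - eps < l" using eps by simp
    ultimately have "\<forall>\<^sub>F k in sequentially. l - eps < p k / sqrt (q k)" by (rule order_tendstoD(1))
    moreover have "\<forall>\<^sub>F k in sequentially. 0 < q k" using `q ---> l^2` False by (intro order_tendstoD(1)) auto
    ultimately have "\<forall>\<^sub>F k in sequentially. l - eps < p k / sqrt (q k) & 0 < q k" by eventually_elim auto
    then obtain k where k: "l - eps < p k / sqrt (q k)" "0 < q k" by (auto simp: eventually_sequentially)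
    have "((%eta. (p k - eta) / (sqrt (q k) + eta)) \<longlongrightarrow> (p k - 0) / (sqrt (q k) + 0)) (at_right 0)" using k(2) by (intro tendsto_intros) auto
    from order_tendstoD(1)[OF this, of "l - eps"] k(1)
    have "\<forall>\<^sub>F eta in at_right 0. l - eps < (p k - eta) / (sqrt (q k) + eta)" by simp
    hence "\<forall>\<^sub>F eta in at_right 0. l - eps < (p k - eta) / (sqrt (q k) + eta) & 0 < eta" using eventually_at_right_less[of 0] by eventually_elim auto
    then obtain eta where eta: "l - eps < (p k - eta) / (sqrt (q k) + eta)" "0 < eta" using eventually_happens'[of "at_right (0::real)"] by auto
    obtain dl1 where dl1: "dl1 > 0" "!!h. 0 < abs h ==> abs h < dl1 ==> (p k - eta) * abs h <= abs ((LINT v|g (t + h). phis k (t, v)) - (LINT v|g t. phis k (t, v)))"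
     using increment_slope[OF phis t' elim(3) elim(1)[rule_format] eta(2), of k] unfolding p_def by blast
    obtain phit phiv a b R C where td: "test_data T (phis k) phit phiv a b R C" using test_data_exists[OF phis T] by blast
    have L: "lipC1 (%v. phis k (t, v)) (%x. deriv (%y. phis k (t, y)) x) C" unfolding test_data_deriv(2)[OF td] by (rule test_data_lipC1[OF td])
    obtain dl2 where dl2: "dl2 > 0" "!!nu a. 0 <= a ==> a < dl2 ==> dA e nu (g t) <= ennreal a ==>
      abs ((LINT v|nu. phis k (t, v)) - (LINT v|g t. phis k (t, v))) <= a * (sqrt (q k) + eta)"
     using near_increment[OF e rd mom L eta(2), of t] unfolding q_def by meson
    obtain dl3 where dl3: "dl3 > 0" "!!h. 0 < abs h ==> abs h < dl3 ==> dA e (g (t + h)) (g t) = ennreal (d h) & d h <= (l + 1) * abs h" using up[of 1] by auto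
    show ?thesis
    proof (intro exI[of _ "min dl1 (min (dl2 / (l + 1)) dl3)"] conjI allI impI)
     show "0 < min dl1 (min (dl2 / (l + 1)) dl3)" using dl1 dl2 dl3 l by (auto intro!: divide_pos_pos)
     fix h assume "0 < abs h & abs h < min dl1 (min (dl2 / (l + 1)) dl3)"
     hence h: "0 < abs h" "abs h < dl1" "abs h < dl2 / (l + 1)" "abs h < dl3" by auto
     note dh = dl3(2)[OF h(1,4)]
     have "(l + 1) * abs h < dl2" using h(3) l(1) by (simp add: less_divide_eq mult.commute)
     hence "abs ((LINT v|g (t + h). phis k (t, v)) - (LINT v|g t. phis k (t, v))) <= d h * (sqrt (q k) + eta)" using dh by (intro dl2(2)) (auto simp: d_def)
     hence "(p k - eta) * abs h <= d h * (sqrt (q k) + eta)" using dl1(2)[OF h(1,2)] by linarith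
     hence "(p k - eta) / (sqrt (q k) + eta) * abs h <= d h" using k(2) eta(2) by (simp add: divide_le_eq add_pos_pos)
     moreover have "(l - eps) * abs h <= (p k - eta) / (sqrt (q k) + eta) * abs h" using eta(1) by (intro mult_right_mono) auto
     ultimately show "(l - eps) * abs h <= d h" by linarith
    qed
   qed
   have "((%h. d h / abs h) \<longlongrightarrow> l) (at 0)" unfolding tendsto_iff
   proof (intro allI impI)
    fix eps :: real assume eps: "0 < eps"
    obtain dl1 where dl1: "dl1 > 0" "!!h. 0 < abs h ==> abs h < dl1 ==> d h <= (l + eps / 2) * abs h" using up[of "eps / 2"] eps by auto
    obtain dl2 where dl2: "dl2 > 0" "!!h. 0 < abs h ==> abs h < dl2 ==> (l - eps / 2) * abs h <= d h" using low[of "eps / 2"] eps by auto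
    have "dist (d h / abs h) l < eps" if "h ~= 0" "dist h 0 < min dl1 dl2" for h
    proof -
     have "d h / abs h <= l + eps / 2" "l - eps / 2 <= d h / abs h" using dl1(2)[of h] dl2(2)[of h] that by (auto simp: divide_le_eq le_divide_eq)
     thus ?thesis using eps by (simp add: dist_real_def abs_le_iff)
    qed
    thus "\<forall>\<^sub>F h in at 0. dist (d h / abs h) l < eps" unfolding eventually_at using dl1(1) dl2(1) by (intro exI[of _ "min dl1 dl2"]) auto
   qed
   hence lim: "((%h. ennreal (d h / abs h)) \<longlongrightarrow> ennreal l) (at 0)" by (rule tendsto_ennrealI)
   have d0: "0 <= d h" for h by (simp add: d_def)
   obtain dl where dl: "dl > 0" "!!h. 0 < abs h ==> abs h < dl ==> dA e (g (t + h)) (g t) = ennreal (d h)" using up[of 1] by auto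
   have "\<forall>\<^sub>F h in at 0. ennreal (d h / abs h) = dA e (g (t + h)) (g t) / ennreal (abs h)"
    unfolding eventually_at using dl d0 by (intro exI[of _ dl]) (auto simp: divide_ennreal)
   from Lim_transform_eventually[OF lim this]
   show "((%h. dA e (g (t + h)) (g t) / ennreal (abs h)) \<longlongrightarrow> ennreal (sqrt (flux_form e g zt t))) (at 0)" by (simp add: l_def)
  qed
 qed
qed

end

lemma curve_has_optimal_flux:
 assumes e: "0 <= e" "e < 1" and T: "0 < T" and g: "tame_curve g" and W: "weak_bound e T g K" "0 <= K"
 shows "EX U m. CE e T g U & m : Bor & (ALL t. 0 <= m t) & integrable lborel (%t. (m t)^2) & integrable lborel m &
  (LBINT t. (m t)^2) <= K & (ALL t:{0..T}. action e (g t) (U t) = ennreal ((m t)^2)) &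
  (ALL s t. 0 <= s & s <= t & t <= T --> dA e (g s) (g t) <= ennreal (LBINT r. m r * ind {s..t} r)) &
  (AE t in lborel. t : {0<..<T} --> ((%h. dA e (g (t + h)) (g t) / ennreal (abs h)) \<longlongrightarrow> ennreal (m t)) (at 0))"
proof -
 obtain zt and phis :: "nat => real * real => real" where d: "driven_curve g e T zt"
  and H: "(LBINT t. flux_form e g zt t * ind {0..T} t) <= K"
  "CE e T g (density_flux g zt)" "ALL t. action e (g t) (density_flux g zt t) = ennreal (flux_form e g zt t)" "ALL k::nat. phis k : C1c T"
  "AE t in lborel. t : {0..T} --> (%k. pairing e g zt (phis k) t) ---> flux_form e g zt t &
   (%k. qform e (g t) (%x. deriv (%y. phis k (t, y)) x)) ---> flux_form e g zt t" using tame_driven_curve[OF e T g W] by blast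
 interpret driven_curve g e T zt by fact
 have md: "AE t in lborel. t : {0<..<T} --> ((%h. dA e (g (t + h)) (g t) / ennreal (abs h)) \<longlongrightarrow> ennreal (speed t)) (at 0)"
  using metric_derivative[OF H(4)[rule_format] H(5)] by eventually_elim (auto simp: speed_def)
 show ?thesis by (intro exI[of _ "density_flux g zt"] exI[of _ speed] conjI allI impI ballI)
   (use H(1-3) md dA_le_length(1)[OF e g driven_speed_bound speed_integrable(1) speed_nonneg] speed_integrable speed_nonneg
    in "auto simp: speed_sq")
qed

section \<open>Absolutely continuous curves and their flux\<close>

lemma CE_cong:
 assumes "CE e T g U" "!!t. t : {0..T} ==> f t = g t" shows "CE e T f U"
proof -
 have "(%t. LINT v|f t. phi v) : borel_measurable (leb T) \<longleftrightarrow> (%t. LINT v|g t. phi v) : borel_measurable (leb T)" for phi :: "real => real"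
  using assms(2) by (intro measurable_cong) auto
 moreover have "(LINT t|leb T. (LINT v|f t. h t v)) = (LINT t|leb T. (LINT v|g t. h t v))" for h :: "real => real => real" using assms(2) by (intro lint_cong) auto
 moreover have "narrowly_continuous_on {0..T} f \<longleftrightarrow> narrowly_continuous_on {0..T} g" unfolding narrowly_continuous_on_def narrow_lim_def
  using assms(2) by (intro ball_cong all_cong refl imp_cong filterlim_cong) (auto simp: eventually_at_filter)
 ultimately show ?thesis using assms unfolding CE_def by simp
qed

text \<open>A weak bound together with the regularity of the values yields absolute continuity, and the
 optimal flux is the one realising the metric derivative.\<close>

lemma weak_bound_AC:
 assumes e: "0 <= e" "e < 1" and T: "0 < T" and P: "!!t. t : {0..T} ==> f t : P2cm"
  and c: "narrowly_continuous_on {0..T} f" and W: "weak_bound e T f K" "0 <= K"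
  and M: "!!t. t : {0..T} ==> jmean (f t) <= M"
 shows "tame_curve (f \<circ> clamp_time 0 T)" "f : AC e T P2cm" "CE e T f (flux e T f)"
  "(nni (leb T) (%t. action e (f t) (flux e T f t))) <= ennreal K"
proof -
 define g where "g = f \<circ> clamp_time 0 T"
 have gf: "g t = f t" if "t : {0..T}" for t using that by (simp add: g_def)
 have Wg: "weak_bound e T g K" using weak_bound_cong[of T g f e K] gf W(1) by simp
 have tg: "tame_curve g"
 proof (rule weak_bound_tame[OF e less_imp_le[OF T] _ _ Wg W(2)])
  show "narrow_curve g" unfolding g_def by (rule narrow_curve_clamp[OF P2cm_D(1)[OF P] c less_imp_le[OF T]])
  show "g t = g (clamp_time 0 T t)" for t using T by (simp add: g_def)
  show "integrable (g t) jap & jmean (g t) <= M" if "t : {0..T}" for t using P2cm_D(4)[OF P[OF that]] M[OF that] gf[OF that] by simp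
 qed
 thus "tame_curve (f \<circ> clamp_time 0 T)" by (simp add: g_def)
 obtain U m where U: "CE e T g U" and m: "m : Bor" "ALL t. 0 <= m t" "integrable lborel (%t. (m t)^2)" "integrable lborel m"
  "(LBINT t. (m t)^2) <= K" and act: "ALL t:{0..T}. action e (g t) (U t) = ennreal ((m t)^2)"
  and len: "ALL s t. 0 <= s & s <= t & t <= T --> dA e (g s) (g t) <= ennreal (LBINT r. m r * ind {s..t} r)"
  and md: "AE t in lborel. t : {0<..<T} --> ((%h. dA e (g (t + h)) (g t) / ennreal (abs h)) \<longlongrightarrow> ennreal (m t)) (at 0)"
  using curve_has_optimal_flux[OF e T tg Wg W(2)] by blast
 note [measurable] = m(1)
 show "f : AC e T P2cm" unfolding AC_def
 proof (intro CollectI conjI ballI exI[of _ m] allI impI P c)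
  show "m : borel_measurable (lebesgue_on {0<..<T})" by (rule borel_measurable_lebesgue_on[OF m(1)])
  show "integrable (lebesgue_on {0<..<T}) (%t. (m t)^2)" using integrable_completion[of "%t. (m t)^2" lborel] m(3)
   by (subst integrable_restrict_space) (auto intro!: integrable_mult_indicator[where 'b=real, simplified])
  fix s t assume st: "0 < s & s <= t & t < T"
  hence "dA e (f s) (f t) <= ennreal (LBINT r. m r * ind {s..t} r)" using len[rule_format, of s t] gf[of s] gf[of t] by auto
  hence "enn2ereal (dA e (f s) (f t)) <= enn2ereal (ennreal (LBINT r. m r * ind {s..t} r))" by (simp add: less_eq_ennreal.rep_eq)
  also have "... = ereal (LBINT r. m r * ind {s..t} r)" using m(2) by (intro enn2ereal_ennreal lint_nonneg) auto
  finally show "enn2ereal (dA e (f s) (f t)) <= ereal (LINT t|lebesgue_on {s..t}. m t)" by (simp add: lebesgue_on_integral(1))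
 qed
 have "AE t in lborel. t : {0..T} --> metric_deriv e f t = ennreal (m t)" using md AE_lborel_singleton[of 0] AE_lborel_singleton[of T]
 proof eventually_elim
  case (elim t)
  show ?case
  proof
   assume "t : {0..T}"
   hence t: "t : {0<..<T}" using elim(2,3) by auto
   hence l: "((%h. dA e (g (t + h)) (g t) / ennreal (abs h)) \<longlongrightarrow> ennreal (m t)) (at 0)" using elim(1) by blast
   have "\<forall>\<^sub>F h in at 0. dA e (g (t + h)) (g t) / ennreal (abs h) = dA e (f (t + h)) (f t) / ennreal (abs h)"
    unfolding eventually_at using t gf by (intro exI[of _ "min t (T - t)"]) (auto simp: dist_real_def abs_less_iff)
   from Lim_transform_eventually[OF l this]
   show "metric_deriv e f t = ennreal (m t)" unfolding metric_deriv_def by (intro tendsto_Lim) auto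
  qed
 qed
 from AE_lebesgue_on[OF this, of 0 T]
 have md': "AE t in leb T. (metric_deriv e f t)^2 = ennreal ((m t)^2)"
  using AE_space[of "leb T"] by eventually_elim (use m(2) in "auto simp: power2_eq_square ennreal_mult")
 define Q where "Q U \<longleftrightarrow> CE e T f U & (AE t in leb T. (metric_deriv e f t)^2 = action e (f t) (U t))" for U
 have "Q U" unfolding Q_def
 proof
  show "CE e T f U" by (rule CE_cong[OF U]) (simp add: gf)
  show "AE t in leb T. (metric_deriv e f t)^2 = action e (f t) (U t)" using md' AE_space[of "leb T"] by eventually_elim (use act gf in auto)
 qed
 hence "Q (SOME U. Q U)" by (rule someI[of Q])
 moreover have "flux e T f = (SOME U. Q U)" by (simp add: flux_def Q_def)
 ultimately have fl: "CE e T f (flux e T f) & (AE t in leb T. (metric_deriv e f t)^2 = action e (f t) (flux e T f t))" unfolding Q_def by simp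
 thus "CE e T f (flux e T f)" ..
 have "(nni (leb T) (%t. action e (f t) (flux e T f t))) = (nni (leb T) (%t. ennreal ((m t)^2)))"
  by (rule nn_integral_cong_AE, use fl[THEN conjunct2] md' in eventually_elim) simp
 also have "... = (nni lborel (%t. ennreal ((m t)^2) * ind {0..T} t))" by (rule lebesgue_on_nn_integral) measurable
 also have "... <= (nni lborel (%t. ennreal ((m t)^2)))" by (intro nn_integral_mono) (auto simp: indicator_def)
 also have "... = ennreal (LBINT t. (m t)^2)" by (rule nn_integral_eq_integral[OF m(3)]) simp
 also have "... <= ennreal K" using m(5) by (rule ennreal_leI)
 finally show "(nni (leb T) (%t. action e (f t) (flux e T f t))) <= ennreal K" .
qed

lemma AC_curve:
 assumes e: "0 <= e" "e < 1" and T: "0 < T" and f: "f : AC e T P2cm"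
  and K: "(nni (leb T) (%t. action e (f t) (flux e T f t))) <= ennreal K" "0 <= K"
 shows "tame_curve (f \<circ> clamp_time 0 T)" "weak_bound e T f K"
proof -
 have P: "f t : P2cm" if "t : {0..T}" for t using f that by (auto simp: AC_def)
 have c: "narrowly_continuous_on {0..T} f" using f by (auto simp: AC_def)
 obtain K' where K': "0 <= K'" "weak_bound e T f K'" using AC_weak_bound(1)[OF e T f] by blast
 obtain M where M: "ALL t:{0..T}. integrable (f t) jap & jmean (f t) <= M" using AC_weak_bound(2)[OF e T f] by blast
 note A = weak_bound_AC[OF e T P c K'(2,1), of M]
 show "tame_curve (f \<circ> clamp_time 0 T)" using A(1) M by blast
 have "CE e T f (flux e T f)" using A(3) M by blast
 thus "weak_bound e T f K" by (rule CE_weak_bound[OF e T _ K]) (use M in blast)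
qed

section \<open>Propagation of the second moment\<close>

text \<open>A smooth function of linear growth that approximates half the square from below;
 its derivative is a contraction, so its gradient form is at most the dissipation.\<close>

definition huber :: "real => real => real" where "huber R v = R^2 * (jap (v / R) - 1)"
definition huber' :: "real => real => real" where "huber' R v = R * ((v / R) / jap (v / R))"

lemma huber_props:
 assumes R: "0 < R"
 shows "lipC1 (huber R) (huber' R) R" "abs (huber' R v - huber' R w) <= abs (v - w)" "0 <= huber R v" "huber R v <= v^2 / 2"
proof -
 note J = lipC1D[OF lipC1_jap]
 have "(huber R has_real_derivative huber' R x) (at x)" for x
 proof -
  have "((%v. jap (v / R)) has_real_derivative ((x / R) / jap (x / R)) * (1 / R)) (at x)"
   by (rule DERIV_chain2[OF J(1)]) (use R in "auto intro!: derivative_eq_intros")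
  hence "((%v. R^2 * (jap (v / R) - 1)) has_real_derivative R\<^sup>2 * (((x / R) / jap (x / R)) * (1 / R) - 0)) (at x)" by (intro DERIV_cmult DERIV_diff DERIV_const)
  thus ?thesis using R unfolding huber_def[abs_def] huber'_def by (simp add: power2_eq_square)
 qed
 moreover have "contU (huber' R)" unfolding huber'_def using R by (intro continuous_on_mult_left continuous_on_compose2[OF J(2)] continuous_intros) auto
 moreover have "abs (huber' R v) <= R" for v using mult_left_mono[OF J(3)[of "v / R"], of R] R by (simp add: huber'_def abs_mult)
 ultimately show "lipC1 (huber R) (huber' R) R" by (auto simp: lipC1_def)
 have d: "((%x. x / jap x) has_real_derivative 1 / jap x ^ 3) (at x)" for x
 proof -
  have "((%x. x / jap x) has_real_derivative (1 * jap x - x * (x / jap x)) / (jap x * jap x)) (at x)"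
   by (rule DERIV_divide[OF DERIV_ident J(1)]) (use jap_pos(1)[of x] in simp)
  moreover have "(1 * jap x - x * (x / jap x)) / (jap x * jap x) = 1 / jap x ^ 3"
  proof -
   have "jap x * jap x = 1 + x^2" by (simp add: jap_def)
   hence "1 * jap x - x * (x / jap x) = 1 / jap x" using jap_pos(1)[of x] by (simp add: field_simps power2_eq_square)
   thus ?thesis by (simp add: power3_eq_cube)
  qed
  ultimately show ?thesis by simp
 qed
 have "abs (1 / jap x ^ 3) <= 1" for x using one_le_power[OF jap_pos(2), of x 3] jap_pos(1)[of x] by (simp add: divide_le_eq_1)
 moreover have "contU (%x. 1 / jap x ^ 3)" using jap_pos(1) by (intro continuous_intros J(5)) (metis less_irrefl zero_less_power)
 ultimately have "lipC1 (%x. x / jap x) (%x. 1 / jap x ^ 3) 1" using d by (auto simp: lipC1_def)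
 from lipC1_lipschitz[OF this, of "v / R" "w / R"] have "abs ((v / R) / jap (v / R) - (w / R) / jap (w / R)) <= abs (v - w) / R"
  using R by (simp add: diff_divide_distrib[symmetric] abs_divide)
 hence "R * abs ((v / R) / jap (v / R) - (w / R) / jap (w / R)) <= R * (abs (v - w) / R)" using R by (intro mult_left_mono) auto
 moreover have "abs (huber' R v - huber' R w) = R * abs ((v / R) / jap (v / R) - (w / R) / jap (w / R))"
  unfolding huber'_def right_diff_distrib[symmetric] abs_mult abs_of_pos[OF R] ..
 ultimately show "abs (huber' R v - huber' R w) <= abs (v - w)" using R by simp
 show "0 <= huber R v" using jap_pos(2)[of "v / R"] by (simp add: huber_def)
 have "1 + x^2 <= (1 + x^2 / 2)^2" for x :: real
 proof -
  have "(1 + x^2 / 2)^2 = 1 + x^2 + (x^2 / 2)^2" by (simp add: power2_sum)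
  thus ?thesis by simp
 qed
 hence "jap (v / R) <= 1 + (v / R)^2 / 2" unfolding jap_def by (intro real_le_lsqrt) auto
 hence "R^2 * (jap (v / R) - 1) <= R^2 * ((v / R)^2 / 2)" by (intro mult_left_mono) auto
 thus "huber R v <= v^2 / 2" using R by (simp add: huber_def power_divide)
qed

lemma huber_limit: "(%n. huber (real (Suc n)) v) ---> v^2 / 2"
proof -
 have l: "(%n. v / real (Suc n)) ---> 0" using LIMSEQ_inverse_real_of_nat[THEN tendsto_mult_left, of v] by (simp add: divide_inverse)
 have "(%n. v^2 / (jap (v / real (Suc n)) + 1)) ---> v^2 / (jap 0 + 1)"
 proof (intro tendsto_intros)
  show "(%n. jap (v / real (Suc n))) ---> jap 0"
   using lipC1D(5)[OF lipC1_jap] l by (intro isCont_tendsto_compose[where g=jap]) (auto simp: continuous_on_eq_continuous_at)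
 qed (simp add: jap_def)
 moreover have "v^2 / (jap (v / R) + 1) = huber R v" if "0 < R" for R
 proof -
  have "(jap (v / R) - 1) * (jap (v / R) + 1) = (v / R)^2" by (simp add: jap_def algebra_simps)
  hence "huber R v * (jap (v / R) + 1) = v^2" using that by (simp add: huber_def power_divide mult.assoc)
  thus ?thesis using jap_pos(1)[of "v / R"] by (simp add: divide_eq_eq)
 qed
 ultimately show ?thesis by (simp add: jap_def)
qed

lemma dissipation_eq:
 assumes "rdist f"
 shows "dissipation e f = (nni (sq f) (%z. ennreal ((abs (fst z - snd z))^2 * wt e z)))"
 unfolding dissipation_def case_prod_beta' nn_integral_prod_off_diag[OF assms] by (intro nn_integral_cong) (auto simp: off_diag_def indicator_def \<sigma>_0)

lemma huber_qform_le:
 assumes e: "0 <= e" "e < 1" and f: "rdist f" "integrable f jap" and R: "0 < R"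
 shows "ennreal (qform e f (huber' R)) <= dissipation e f"
proof -
 note H = huber_props[OF R]
 have "ennreal (qform e f (huber' R)) = (nni (sq f) (%z. ennreal (wt e z * (huber' R (snd z) - huber' R (fst z))^2)))" unfolding qform_def
  by (rule nn_integral_eq_integral[symmetric, OF qform_integrable[OF e f lipC1D(7)[OF H(1)] lipC1D(3)[OF H(1)]]]) (use e in "simp add: \<sigma>_nonneg")
 also have "... <= dissipation e f" unfolding dissipation_eq[OF f(1)]
 proof (intro nn_integral_mono ennreal_leI)
  fix z :: "real * real"
  have "(abs (huber' R (snd z) - huber' R (fst z)))^2 <= (abs (fst z - snd z))^2" using H(2)[of "snd z" "fst z"] by (intro power_mono) (auto simp: abs_minus_commute)
  thus "wt e z * (huber' R (snd z) - huber' R (fst z))^2 <= (abs (fst z - snd z))^2 * wt e z"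
   using e by (subst mult.commute) (intro mult_right_mono, auto simp: \<sigma>_nonneg)
 qed
 finally show ?thesis .
qed

text \<open>The square of the increment of the truncated energy is at most the action times the time integral of
 its gradient form, which is at most the dissipation.\<close>

lemma energy_growth:
 assumes e: "0 <= e" "e < 1" and T: "0 < T" and f: "!!t. t : {0..T} ==> f t : P2cm" and g: "tame_curve (f \<circ> clamp_time 0 T)"
  and W: "weak_bound e T f A" "0 <= A" and D: "(nni (leb T) (%t. dissipation e (f t))) <= ennreal D" "0 <= D" and t: "t : {0..T}"
 shows "energy (f t) <= energy (f 0) + sqrt (A * D)"
proof -
 define g where "g = f \<circ> clamp_time 0 T"
 have gf: "g t = f t" if "t : {0..T}" for t using that by (simp add: g_def)
 interpret tame_curve g using g by (simp add: g_def)
 have Wg: "weak_bound e T g A" using weak_bound_cong[of T g f e A] gf W(1) by simp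
 have i2: "integrable (f r) (%v. v^2)" if "r : {0..T}" for r using P2cm_D(2)[OF f[OF that]] .
 have hi: "integrable (g r) (huber R)" if "0 < R" for R r using lipC1_integrable[OF huber_props(1)[OF that] rd mom] .
 have E0: "(LINT v|g 0. huber R v) <= energy (f 0)" if R: "0 < R" for R
 proof -
  have "(LINT v|g 0. huber R v) <= (LINT v|g 0. v^2 / 2)" using hi[OF R, of 0] i2[of 0] T gf[of 0] huber_props(4)[OF R] by (intro integral_mono) auto
  thus ?thesis using gf[of 0] T by (simp add: energy_def)
 qed
 have b: "(LINT v|g t. huber R v) <= energy (f 0) + sqrt (A * D)" if R: "0 < R" for R
 proof -
  note L = huber_props(1)[OF R]
  define q where "q r = qform e (g r) (huber' R) * ind {0..t} r" for r
  have q0: "0 <= q r" for r using e by (simp add: q_def qform_nonneg)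
  have qm: "(%r. qform e (g r) (huber' R)) : Bor" by (rule qform_time_measurable1[OF lipC1D(7)[OF L]])
  have "(nni lborel (%r. ennreal (q r))) <= (nni lborel (%r. ennreal (qform e (g r) (huber' R)) * ind {0..T} r))"
   using t by (intro nn_integral_mono) (auto simp: q_def indicator_def)
  also have "... = (nni (leb T) (%r. ennreal (qform e (g r) (huber' R))))" by (rule lebesgue_on_nn_integral[symmetric]) (use qm in measurable)
  also have "... <= (nni (leb T) (%r. dissipation e (f r)))"
  proof (rule nn_integral_mono)
   fix r assume "r : space (leb T)"
   hence "g r = f r" by (simp add: gf)
   thus "ennreal (qform e (g r) (huber' R)) <= dissipation e (f r)" using huber_qform_le[OF e rd mom R, of r] by simp
  qed
  also have "... <= ennreal D" by (rule D)
  finally have qD: "(nni lborel (%r. ennreal (q r))) <= ennreal D" .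
  have "integral\<^sup>L lborel q <= D" using qD q0 qm D(2) unfolding q_def by (subst integral_eq_nn_integral) (auto intro: enn2real_leI)
  hence "A * integral\<^sup>L lborel q <= A * D" using W(2) by (rule mult_left_mono)
  moreover have "((LINT v|g t. huber R v) - (LINT v|g 0. huber R v))^2 <= A * integral\<^sup>L lborel q"
   using tame_two_time[OF e tame_curve_axioms Wg W(2) L, of 0 t] t unfolding q_def by auto
  ultimately have "((LINT v|g t. huber R v) - (LINT v|g 0. huber R v))^2 <= A * D" by linarith
  hence "(LINT v|g t. huber R v) - (LINT v|g 0. huber R v) <= sqrt (A * D)" by (rule real_le_rsqrt)
  thus ?thesis using E0[OF R] by linarith
 qed
 have "(%n. LINT v|g t. huber (real (Suc n)) v) ---> (LINT v|g t. v^2 / 2)"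
 proof (rule integral_dominated_convergence[where w="%v. v^2 / 2"])
  show "integrable (g t) (%v. v^2 / 2)" using i2[OF t] gf[OF t] by simp
  show "AE v in g t. norm (huber (real (Suc n)) v) <= v^2 / 2" for n using huber_props(3,4)[of "real (Suc n)"] by (intro AE_I2) (simp add: abs_of_nonneg)
  show "(%v. v^2 / 2) : borel_measurable (g t)" using i2[OF t] gf[OF t] by simp
  show "huber (real (Suc n)) : borel_measurable (g t)" for n using hi[of "real (Suc n)" t] by simp
 qed (intro AE_I2 huber_limit)
 hence "(LINT v|g t. v^2 / 2) <= energy (f 0) + sqrt (A * D)" by (rule LIMSEQ_le_const2) (use b in auto)
 thus ?thesis using gf[OF t] by (simp add: energy_def)
qed

section \<open>Compactness\<close>

lemma weak_conv_tendsto: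
 fixes phi :: "real => real"
 assumes mu: "!!n. rdist (mu n)" "rdist M" and w: "weak_conv_m mu M"
  and phi: "contU phi" "!!x. abs (phi x) <= B"
 shows "(%n. LINT v|mu n. phi v) ---> (LINT v|M. phi v)"
proof -
 have "bounded (range phi)" using phi(2) by (intro boundedI[where B=B]) auto
 moreover have "narrow_lim mu M sequentially" using narrow_lim_iff_weak_conv[of mu M, OF mu] w by simp
 ultimately show ?thesis using phi(1) by (simp add: narrow_lim_def)
qed

lemma second_moment_bounds:
 assumes mu: "rdist mu" and i: "integrable mu (%v. v^2)" and B: "(LINT v|mu. v^2) <= B"
 shows "integrable mu jap" "jmean mu <= 1 + B"
proof -
 interpret real_distribution mu by fact
 have le: "jap v <= 1 + v^2" for v unfolding jap_def by (rule real_le_lsqrt) (use self_le_power[of "1 + v^2" 2] in auto)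
 have i': "integrable mu (%v. 1 + v^2)" using i by simp
 show ij: "integrable mu jap" by (rule integrable_bd[OF i' real_distribution_measurable(1)[OF mu lipC1D(6)[OF lipC1_jap]]])
   (use le jap_pos(1) in "auto simp: less_imp_le abs_of_nonneg")
 have "jmean mu <= (LINT v|mu. 1 + v^2)" unfolding jmean_def by (intro integral_mono ij i' le)
 also have "... <= 1 + B" using i B prob_space by simp
 finally show "jmean mu <= 1 + B" .
qed

lemma second_moments_tight:
 assumes mu: "!!n. rdist (mu n)" and i: "!!n. integrable (mu n) (%v. v^2)" and B: "!!n. (LINT v|mu n. v^2) <= B"
 shows "tight mu" unfolding tight_def
proof (intro conjI allI impI mu)
 fix eps :: real assume eps: "0 < eps"
 define R where "R = sqrt ((abs B + 1) / eps)"
 have R2: "R^2 = (abs B + 1) / eps" using eps by (simp add: R_def)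
 have R0: "0 < R" using eps by (simp add: R_def add_nonneg_pos)
 have "1 - eps < measure (mu n) {-R<..R}" for n
 proof -
  interpret real_distribution "mu n" by (rule mu)
  have "measure (mu n) {v : space (mu n). R^2 <= v^2} <= (LINT v|mu n. v^2) / R^2" by (rule integral_Markov_inequality_measure[where A="{}"]) (use i R0 in auto)
  also have "... <= B / R^2" using B by (intro divide_right_mono) auto
  also have "... < eps" using eps R0 abs_ge_self[of B] unfolding R2 by (simp add: divide_less_eq)
  finally have "measure (mu n) {v : space (mu n). R^2 <= v^2} < eps" .
  moreover have "measure (mu n) (space (mu n) - {-R<..R}) <= measure (mu n) {v : space (mu n). R^2 <= v^2}"
  proof (rule finite_measure_mono)
   show "space (mu n) - {-R<..R} \<subseteq> {v : space (mu n). R^2 <= v^2}"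
   proof
    fix v assume "v : space (mu n) - {-R<..R}"
    hence "R <= abs v" by auto
    hence "R^2 <= (abs v)^2" using R0 by (intro power_mono) auto
    thus "v : {v : space (mu n). R^2 <= v^2}" by simp
   qed
   have "{v :: real. R^2 <= v^2} : sets borel" by measurable
   thus "{v : space (mu n). R^2 <= v^2} : sets (mu n)" by simp
  qed
  ultimately show ?thesis using prob_compl[of "{-R<..R}"] by simp
 qed
 thus "EX a b. a < b & (ALL n. 1 - eps < measure (mu n) {a<..b})" using R0 by (intro exI[of _ "-R"] exI[of _ R]) auto
qed

text \<open>The weak bound makes all curves uniformly Hoelder continuous against each test function. Hence
 convergence along a subsequence at the rational times, which tightness provides, extends to all times.\<close>

lemma curve_compactness:
 fixes G :: "nat => real => real measure"
 assumes e: "0 <= e" "e < 1" and T: "0 < T" and g: "!!n. tame_curve (G n)" and W: "!!n. weak_bound e T (G n) A" "0 <= A"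
  and cl: "!!n t. G n t = G n (clamp_time 0 T t)"
  and i: "!!n t. integrable (G n t) (%v. v^2)" and B: "!!n t. (LINT v|G n t. v^2) <= B"
 shows "EX r g. strict_mono r & narrow_curve g & (ALL t. g t = g (clamp_time 0 T t)) & (ALL t. weak_conv_m (%k. G (r k) t) (g t))"
proof -
 have rd: "rdist (G n t)" for n t
 proof -
  interpret tame_curve "G n" by (rule g)
  show ?thesis by (rule rd)
 qed
 have B0: "0 <= B" using B[of 0 0] by (meson lint_nonneg order_trans zero_le_power2)
 have tight: "tight (%n. G (r n) t)" for r :: "nat => nat" and t by (rule second_moments_tight[OF rd i B])
 define c where "c C = A * (2 * C^2 * (1 + B))" for C
 have c0: "0 <= c C" for C using W(2) B0 by (simp add: c_def)
 have equi: "abs ((LINT v|G n t. phi v) - (LINT v|G n s. phi v)) <= sqrt (c C * abs (t - s))" if L: "lipC1 phi psi C" for phi psi C n s t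
 proof -
  let ?c = "clamp_time 0 T"
  have "((LINT v|G n (?c t). phi v) - (LINT v|G n (?c s). phi v))^2 <= A * (2 * C^2 * (1 + B)) * abs (?c t - ?c s)"
  proof (rule tame_two_time_sup[OF e g W L])
   fix r
   have "qform e (G n r) psi <= 2 * C^2 * jmean (G n r)" by (rule qform_le[OF e rd second_moment_bounds(1)[OF rd i B] lipC1D(7)[OF L] lipC1D(3)[OF L]])
   also have "... <= 2 * C^2 * (1 + B)" using second_moment_bounds(2)[OF rd i B] by (intro mult_left_mono) auto
   finally show "qform e (G n r) psi <= 2 * C^2 * (1 + B)" .
  qed (rule clamp_time_in(1)[OF less_imp_le[OF T]])+
  also have "... <= c C * abs (t - s)" unfolding c_def[symmetric] by (intro mult_left_mono c0) (auto simp: clamp_time_def min_def max_def)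
  finally have "((LINT v|G n t. phi v) - (LINT v|G n s. phi v))^2 <= c C * abs (t - s)" using cl by metis
  thus ?thesis by (rule real_le_rsqrt[of "abs _", unfolded power2_abs])
 qed
 define q :: "nat => real" where "q = from_nat_into \<rat>"
 have q: "EX n. q n = x" if "x : \<rat>" for x using from_nat_into_surj[OF countable_rat that] by (auto simp: q_def)
 define P where "P n s \<longleftrightarrow> (EX M. rdist M & weak_conv_m (%k. G (s k) (q n)) M)" for n and s :: "nat => nat"
 interpret subseqs P
 proof
  fix n and s :: "nat => nat" assume "strict_mono s"
  obtain r M where "strict_mono r" "rdist M" "weak_conv_m ((%k. G (s k) (q n)) \<circ> id \<circ> r) M"
   using tight_imp_convergent_subsubsequence[OF tight[of s "q n"] strict_mono_id] by blast
  thus "EX r. strict_mono r & P n (s \<circ> r)" by (auto simp: P_def comp_def)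
 qed
 define d where "d = diagseq"
 have dm: "strict_mono d" unfolding d_def by (rule subseq_diagseq)
 have conv_rat: "convergent (%k. \<integral>v. phi v \<partial>G (d k) (q n))" if L: "lipC1 phi psi C" and b: "!!x. abs (phi x) <= 1" for phi psi C n
 proof -
  have "P n (d \<circ> (+) (Suc n))" unfolding d_def
  proof (rule diagseq_holds)
   fix s r :: "nat => nat" and m assume "strict_mono r" "P m s"
   thus "P m (s \<circ> r)" using LIMSEQ_subseq_LIMSEQ[OF _ `strict_mono r`] unfolding P_def weak_conv_m_def weak_conv_def comp_def by blast
  qed
  then obtain M where M: "rdist M" "weak_conv_m (%k. G (d (Suc n + k)) (q n)) M" by (auto simp: P_def)
  hence "(%k. \<integral>v. phi v \<partial>G (d (Suc n + k)) (q n)) ---> (LINT v|M. phi v)" by (intro weak_conv_tendsto[OF rd _ _ lipC1D(5)[OF L] b])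
  hence "(%k. \<integral>v. phi v \<partial>G (d (k + Suc n)) (q n)) ---> (LINT v|M. phi v)" by (simp add: add.commute)
  thus ?thesis using LIMSEQ_offset convergentI by fast
 qed
 have conv: "convergent (%k. \<integral>v. phi v \<partial>G (d k) t)" if L: "lipC1 phi psi C" and b: "!!x. abs (phi x) <= 1" for phi psi C t
 proof -
  have "Cauchy (%k. \<integral>v. phi v \<partial>G (d k) t)"
  proof (rule metric_CauchyI)
   fix eps :: real assume eps: "0 < eps"
   define dl where "dl = (eps / 3)^2 / (c C + 1)"
   have dl0: "0 < dl" using eps c0[of C] by (simp add: dl_def add_nonneg_pos)
   obtain ta where ta: "ta : \<rat>" "t < ta" "ta < t + dl" using Rats_dense_in_real[of t "t + dl"] dl0 by auto
   obtain n where n: "q n = ta" using q[OF ta(1)] by blast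
   have "c C * abs (t - ta) <= (c C + 1) * dl" using ta c0[of C] by (intro mult_mono) auto
   also have "... = (eps / 3)^2" using c0[of C] by (simp add: dl_def)
   finally have "sqrt (c C * abs (t - ta)) <= sqrt ((eps / 3)^2)" by (rule real_sqrt_le_mono)
   hence E: "abs ((LINT v|G k t. phi v) - (LINT v|G k ta. phi v)) <= eps / 3" for k using equi[OF L, of k t ta] eps by simp
   obtain N where N: "!!k l. N <= k ==> N <= l ==> dist (LINT v|G (d k) ta. phi v) (LINT v|G (d l) ta. phi v) < eps / 3"
    using metric_CauchyD[OF convergent_Cauchy[OF conv_rat[OF L b, of n]], of "eps / 3"] eps n by auto
   have "dist (LINT v|G (d k) t. phi v) (LINT v|G (d l) t. phi v) < eps" if "N <= k" "N <= l" for k l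
    using N[OF that] E[of "d k"] E[of "d l"] unfolding dist_real_def by linarith
   thus "EX N. ALL k>=N. ALL l>=N. dist (LINT v|G (d k) t. phi v) (LINT v|G (d l) t. phi v) < eps" by blast
  qed
  thus ?thesis by (rule Cauchy_convergent)
 qed
 have ex: "EX M. rdist M & weak_conv_m (%k. G (d k) t) M" for t
 proof -
  obtain s M where s: "strict_mono s" and M: "rdist M" "weak_conv_m ((%k. G (d k) t) \<circ> id \<circ> s) M"
   using tight_imp_convergent_subsubsequence[OF tight[of d t] strict_mono_id] by blast
  have "weak_conv_m (%k. G (d k) t) M"
  proof (rule weak_conv_by_lipC1[OF rd M(1)])
   fix phi psi C assume L: "lipC1 phi psi C" and b: "!!x. abs (phi x) <= 1"
   obtain l where l: "(%k. \<integral>v. phi v \<partial>G (d k) t) ---> l" using conv[OF L b] by (auto simp: convergent_def)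
   have "weak_conv_m (%k. G (d (s k)) t) M" using M(2) by (simp add: comp_def)
   hence "(%k. \<integral>v. phi v \<partial>G (d (s k)) t) ---> (LINT v|M. phi v)" by (rule weak_conv_tendsto[OF rd M(1) _ lipC1D(5)[OF L] b])
   hence "l = (LINT v|M. phi v)" using LIMSEQ_subseq_LIMSEQ[OF l s] LIMSEQ_unique by (auto simp: comp_def)
   thus "(%k. \<integral>v. phi v \<partial>G (d k) t) ---> (LINT v|M. phi v)" using l by simp
  qed
  thus ?thesis using M(1) by blast
 qed
 then obtain M where M: "!!t. rdist (M t)" "!!t. weak_conv_m (%k. G (d k) t) (M t)" by metis
 define h where "h t = M (clamp_time 0 T t)" for t
 have hrd: "rdist (h t)" for t by (simp add: h_def M)
 have hw: "weak_conv_m (%k. G (d k) t) (h t)" for t using M(2)[of "clamp_time 0 T t"] cl by (simp add: h_def)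

 have hequi: "abs ((LINT v|h t. phi v) - (LINT v|h s. phi v)) <= sqrt (c C * abs (t - s))" if L: "lipC1 phi psi C" and b: "!!x. abs (phi x) <= 1" for phi psi C s t
 proof -
  note l = weak_conv_tendsto[OF rd hrd hw lipC1D(5)[OF L] b]
  show ?thesis by (rule LIMSEQ_le_const2[OF tendsto_rabs[OF tendsto_diff[OF l l]]]) (use equi[OF L] in blast)
 qed
 have "narrow_curve h"
 proof (rule narrow_curve.intro[OF hrd])
  fix phi :: "real => real" assume phi: "contU phi" "bounded (range phi)"
  show "contU (%t. LINT v|h t. phi v)" unfolding continuous_on_sequentially comp_def
  proof (intro allI ballI impI, elim conjE)
   fix u :: "nat => real" and s assume u: "u ---> s"
   have "weak_conv_m (%n. h (u n)) (h s)"
   proof (rule weak_conv_by_lipC1[OF hrd hrd])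
    fix phi psi C assume L: "lipC1 phi psi C" and b: "!!x. abs (phi x) <= 1"
    have "(%n. sqrt (c C * abs (u n - s))) ---> sqrt (c C * abs (s - s))" by (intro tendsto_intros u)
    hence z: "(%n. sqrt (c C * abs (u n - s))) ---> 0" by simp
    have "(%n. (LINT v|h (u n). phi v) - (LINT v|h s. phi v)) ---> 0" by (rule Lim_null_comparison[OF always_eventually z]) (use hequi[OF L b] in auto)
    thus "(%n. LINT v|h (u n). phi v) ---> (LINT v|h s. phi v)" by (simp add: LIM_zero_iff)
   qed
   moreover obtain D where "!!x. abs (phi x) <= D" using phi(2) by (auto simp: bounded_iff)
   ultimately show "(%n. LINT v|h (u n). phi v) ---> (LINT v|h s. phi v)" by (intro weak_conv_tendsto[OF hrd hrd _ phi(1)])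
  qed
 qed
 moreover have "h t = h (clamp_time 0 T t)" for t using T by (simp add: h_def)
 ultimately show ?thesis using dm hw by blast
qed

lemma (in narrow_curve) integral_measurable1:
 fixes h :: "real * real => real"
 assumes h: "h : Bor"
 shows "(%t. LINT v|g t. h (t, v)) : Bor"
proof -
 have "(%x :: real * (real * real). (fst x, fst (snd x))) : borel \<rightarrow>\<^sub>M borel" by (intro cont_bor continuous_intros)
 hence m: "(%x :: real * (real * real). h (fst x, fst (snd x))) : Bor" using h by (rule measurable_compose)
 have "(%v :: real. (t, v)) : borel \<rightarrow>\<^sub>M borel" for t :: real by (intro cont_bor continuous_intros)
 hence s: "(%v. h (t, v)) : Bor" for t using h by (rule measurable_compose)
 have "(LINT v|g t. h (t, v)) = (LINT z|(sq (g t)). h (t, fst z))" for t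
  using integral_pair_marginals(3)[OF real_distribution_prob[OF rd] real_distribution_measurable(1)[OF rd s[of t]]] by simp
 thus ?thesis using integral_measurable2[OF m] by simp
qed

lemma weak_bound_limit:
 assumes e: "0 <= e" "e < 1" and T: "0 < T" and G: "!!n. narrow_curve (G n)" and g: "narrow_curve g"
  and w: "!!t. weak_conv_m (%k. G k t) (g t)"
  and i: "!!n t. integrable (G n t) (%v. v^2)" and B: "!!n t. (LINT v|G n t. v^2) <= B"
  and W: "!!n. weak_bound e T (G n) (A n)" and A: "A ---> K"
 shows "weak_bound e T g K" unfolding weak_bound_def
proof
 fix phi assume "phi : C1c T"
 note phi = this
 obtain phit phiv a b R C where td: "test_data T phi phit phiv a b R C" using test_data_exists[OF phi T] by blast
 have ct: "contU phit" and cv: "contU phiv" and C: "!!z. abs (phit z) <= C" "!!z. abs (phiv z) <= C" using td by (auto simp: test_data_def)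
 note L = test_data_lipC1[OF td]
 have Grd: "rdist (G n t)" and grd: "rdist (g t)" for n t using narrow_curve.rd[OF G] narrow_curve.rd[OF g] by blast+
 note M = second_moment_limit[OF Grd grd w i B]
 have [measurable]: "phit : Bor" by (rule cont_bor[OF ct])
 have tl: "(%k. timeL T (G k) phi) ---> timeL T g phi" unfolding timeL_def test_data_deriv(1)[OF td]
 proof (rule integral_dominated_convergence[where w="%_. C"])
  show "(%t. LINT v|g t. phit (t, v)) : borel_measurable (leb T)" "(%t. \<integral>v. phit (t, v) \<partial>G k t) : borel_measurable (leb T)" for k
   by (intro borel_measurable_lebesgue_on narrow_curve.integral_measurable1 G g; measurable)+
  show "integrable (leb T) (%_. C)" by (subst lebesgue_on_integral(2)) (auto intro!: integrable_mult_right integrable_real_indicator simp: emeasure_lborel_Icc_eq)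
  have sc: "contU (%v. phit (t, v))" for t by (intro continuous_on_compose2[OF ct] continuous_intros) auto
  show "AE t in leb T. (%k. \<integral>v. phit (t, v) \<partial>G k t) ---> (LINT v|g t. phit (t, v))" by (intro AE_I2 weak_conv_tendsto[OF Grd grd w sc C(1)])
  show "AE t in leb T. norm (LINT v|G k t. phit (t, v)) <= C" for k
  proof (intro AE_I2)
   fix t
   interpret real_distribution "G k t" by (rule Grd)
   have m: "(%v. phit (t, v)) : borel_measurable (G k t)" by (rule real_distribution_measurable(1)[OF Grd cont_bor[OF sc]])
   have "abs (\<integral>v. phit (t, v) \<partial>G k t) <= (LINT v|G k t. abs (phit (t, v)))" by (rule integral_abs_bound)
   also have "... <= (LINT v|G k t. C)"
   proof (rule integral_mono)
    show "integrable (G k t) (%v. abs (phit (t, v)))" by (rule integrable_const_bound[where B=C]) (use C(1) m in auto)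
   qed (use C(1) in auto)
   finally show "norm (LINT v|G k t. phit (t, v)) <= C" using prob_space by simp
  qed
 qed
 have ql: "(%k. LBINT t. qform e (G k t) (%x. phiv (t, x)) * ind {0..T} t) ---> (LBINT t. qform e (g t) (%x. phiv (t, x)) * ind {0..T} t)"
 proof (rule integral_dominated_convergence[where w="%t. 2 * C^2 * (1 + B) * ind {0..T} t"])
  have qm: "(%t. qform e (h t) (%x. phiv (t, x))) : Bor" if "narrow_curve h" for h
   using narrow_curve.qform_time_measurable[OF that, of "%t x. phiv (t, x)"] cont_bor[OF cv] by simp
  show "(%t. qform e (g t) (%x. phiv (t, x)) * ind {0..T} t) : borel_measurable lborel"
   "(%t. qform e (G k t) (%x. phiv (t, x)) * ind {0..T} t) : borel_measurable lborel" for k using qm[OF g] qm[OF G] by measurable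
  show "integrable lborel (%t. 2 * C^2 * (1 + B) * ind {0..T} t :: real)"
   by (intro integrable_mult_right integrable_real_indicator) (auto simp: emeasure_lborel_Icc_eq)
  show "AE t in lborel. (%k. qform e (G k t) (%x. phiv (t, x)) * ind {0..T} t) ---> qform e (g t) (%x. phiv (t, x)) * ind {0..T} t"
  proof (intro AE_I2 tendsto_intros)
   fix t
   show "(%k. qform e (G k t) (%x. phiv (t, x))) ---> qform e (g t) (%x. phiv (t, x))"
   proof (rule qform_conv[OF e Grd grd w M(3) M(4) M(5) lipC1D(7)[OF L] lipC1D(7)[OF L] lipC1D(3)[OF L]])
    show "(%n. phiv (t, X n)) ---> phiv (t, x)" if "X ---> x" for x X
     using lipC1D(2)[OF L] that by (intro isCont_tendsto_compose[where g="%x. phiv (t, x)"]) (auto simp: continuous_on_eq_continuous_at)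
   qed
  qed
  show "AE t in lborel. norm (qform e (G k t) (%x. phiv (t, x)) * ind {0..T} t) <= 2 * C^2 * (1 + B) * ind {0..T} t" for k
  proof (intro AE_I2)
   fix t
   have "qform e (G k t) (%x. phiv (t, x)) <= 2 * C^2 * jmean (G k t)" by (rule qform_le[OF e Grd M(3) lipC1D(7)[OF L] lipC1D(3)[OF L]])
   also have "... <= 2 * C^2 * (1 + B)" using second_moment_bounds(2)[OF Grd i B] by (intro mult_left_mono) auto
   finally show "norm (qform e (G k t) (%x. phiv (t, x)) * ind {0..T} t) <= 2 * C^2 * (1 + B) * ind {0..T} t"
    using qform_nonneg[OF e(2), of "G k t"] by (auto simp: indicator_def)
  qed
 qed
 show "(timeL T g phi)^2 <= K * (LBINT t. qform e (g t) (%x. deriv (%y. phi (t, y)) x) * ind {0..T} t)" unfolding test_data_deriv(2)[OF td]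
 proof (rule LIMSEQ_le[OF tendsto_power[OF tl] tendsto_mult[OF A ql]])
  show "EX N. ALL k>=N. (timeL T (G k) phi)^2 <= A k * (LBINT t. qform e (G k t) (%x. phiv (t, x)) * ind {0..T} t)"
   using W phi unfolding weak_bound_def test_data_deriv(2)[OF td, symmetric] by blast
 qed
qed

lemma dissipation_liminf:
 assumes e: "e < 1" and G: "!!n. narrow_curve (G n)" and g: "narrow_curve g"
  and w: "!!t. weak_conv_m (%k. G k t) (g t)"
 shows "(nni (leb T) (%t. dissipation e (g t))) <= liminf (%k. \<integral>\<^sup>+t. dissipation e (G k t) \<partial>leb T)"
proof -
 define h where "h z = (abs (fst z - snd z))^2 * wt e z" for z :: "real * real"
 have hc: "contU h" unfolding h_def \<sigma>_def by (intro continuous_intros)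
 have h0: "0 <= h z" for z using e by (simp add: h_def \<sigma>_nonneg)
 have eq: "dissipation e (k t) = (nni (sq (k t)) (%z. ennreal (h z)))" if "narrow_curve k" for k t
  unfolding h_def by (rule dissipation_eq[OF narrow_curve.rd[OF that]])
 have m: "(%t. dissipation e (k t)) : Bor" if k: "narrow_curve k" for k
 proof -
  have "(%x :: real * (real * real). ennreal (h (snd x))) : Bor"
   by (intro measurable_compose[OF _ measurable_ennreal] cont_bor continuous_on_compose2[OF hc] continuous_intros) auto
  from narrow_curve.nn_measurable2[OF k this] show ?thesis unfolding eq[OF k] by simp
 qed
 have "(nni (leb T) (%t. dissipation e (g t))) <= (nni (leb T) (%t. liminf (%k. dissipation e (G k t))))" unfolding eq[OF g] eq[OF G]
  by (intro nn_integral_mono nn_integral_liminf_weak[OF narrow_curve.rd[OF G] narrow_curve.rd[OF g] w hc h0])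
 also have "... <= liminf (%k. \<integral>\<^sup>+t. dissipation e (G k t) \<partial>leb T)" by (rule nn_integral_liminf) (intro borel_measurable_lebesgue_on m G)
 finally show ?thesis .
qed

section \<open>Compactness and lower semicontinuity of the De Giorgi functional\<close>

text \<open>The final energy is nonnegative, so the functional and the initial energy bound action and
 dissipation; in particular the extended-valued terms are real.\<close>

lemma De_Giorgi_real:
 assumes "De_Giorgi e T f <= ereal S"
 defines "a \<equiv> (nni (leb T) (%t. action e (f t) (flux e T f t)))" and "d \<equiv> (nni (leb T) (%t. dissipation e (f t)))"
 shows "a = ennreal (enn2real a)" "d = ennreal (enn2real d)"
  "De_Giorgi e T f = ereal (energy (f T) - energy (f 0) + enn2real a / 2 + enn2real d / 2)"
  "enn2real a + enn2real d <= 2 * (S + energy (f 0))"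
proof -
 have G: "De_Giorgi e T f = ereal (energy (f T) - energy (f 0)) + ereal (1 / 2) * enn2ereal a + ereal (1 / 2) * enn2ereal d" by (simp add: De_Giorgi_def a_def d_def)
 have ET: "0 <= energy (f T)" by (simp add: energy_def)
 have na: "a ~= top" and nd: "d ~= top" using assms unfolding G by (cases a; cases d; auto simp: enn2ereal_ennreal)+
 show "a = ennreal (enn2real a)" "d = ennreal (enn2real d)" using na nd by (simp_all add: less_top)
 have "enn2ereal a = ereal (enn2real a)" "enn2ereal d = ereal (enn2real d)" using na nd by (cases a; cases d; simp add: enn2ereal_ennreal)+
 thus eq: "De_Giorgi e T f = ereal (energy (f T) - energy (f 0) + enn2real a / 2 + enn2real d / 2)" by (simp add: G)
 show "enn2real a + enn2real d <= 2 * (S + energy (f 0))" using assms(1) ET unfolding eq by simp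
qed

theorem theorem3p8:
  fixes e T :: real
    and fs :: "nat \<Rightarrow> real \<Rightarrow> real measure"
    and f0 :: "real measure"
  assumes "0 \<le> e" and "e < 1"
    and "T > 0"
    and "\<And>n. fs n \<in> AC e T P2cm"
    and "(SUP n. De_Giorgi e T (fs n)) < \<infinity>"
    and "f0 \<in> P2cm"
    and "(\<lambda>n. energy (fs n 0)) \<longlonglongrightarrow> energy f0"
    and "narrow_lim (\<lambda>n. fs n 0) f0 sequentially"
  shows "\<exists>f \<in> AC e T P2cm. f 0 = f0 \<and>
           (\<exists>r :: nat \<Rightarrow> nat. strict_mono r \<and>
              (AE t in lebesgue_on {0..T}. narrow_lim (\<lambda>k. fs (r k) t) (f t) sequentially)) \<and>
           liminf (\<lambda>n. De_Giorgi e T (fs n)) \<ge> De_Giorgi e T f"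
proof -
 note e = assms(1,2) and T = assms(3) and AC = assms(4) and f0 = assms(6) and E0 = assms(7) and N0 = assms(8)
 have P: "fs n t : P2cm" if "t : {0..T}" for n t using AC[of n] that by (auto simp: AC_def)
 obtain S where S: "!!n. De_Giorgi e T (fs n) <= ereal S"
 proof -
  obtain k :: nat where "(SUP n. De_Giorgi e T (fs n)) < ereal (real k)"       using assms(5) less_PInf_Ex_of_nat[of "SUP n. De_Giorgi e T (fs n)"] by auto
  hence "De_Giorgi e T (fs n) <= ereal (real k)" for n by (meson SUP_upper UNIV_I less_imp_le order_trans)
  thus thesis by (rule that)
 qed
 obtain E where E: "!!n. energy (fs n 0) <= E" "0 <= E"
 proof -
  obtain E where "0 < E" "ALL n. norm (energy (fs n 0)) <= E" using convergent_imp_Bseq[OF convergentI[OF E0]] by (auto simp: Bseq_def)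
  thus thesis by (intro that[of E]) (auto simp: abs_le_iff)
 qed
 define a where "a n = enn2real (nni (leb T) (%t. action e (fs n t) (flux e T (fs n) t)))" for n
 define d where "d n = enn2real (nni (leb T) (%t. dissipation e (fs n t)))" for n
 note ad = De_Giorgi_real[OF S, folded a_def d_def]
 have ad0: "0 <= a n" "0 <= d n" for n by (simp_all add: a_def d_def)
 define H where "H = 2 * (S + E)"
 have aH: "a n <= H" "d n <= H" and H0: "0 <= H" for n using ad0[of n] ad(4)[of n] E(1)[of n] by (auto simp: H_def)
 define g where "g n = fs n \<circ> clamp_time 0 T" for n
 have gf: "g n t = fs n t" if "t : {0..T}" for n t using that by (simp add: g_def)
 have gcl: "g n t = g n (clamp_time 0 T t)" for n t using T by (simp add: g_def)
 have tame: "tame_curve (g n)" and Wa: "weak_bound e T (g n) (a n)" and WH: "weak_bound e T (g n) H" for n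
 proof -
  have "(nni (leb T) (%t. action e (fs n t) (flux e T (fs n) t))) <= ennreal H" unfolding ad(1) by (rule ennreal_leI[OF aH(1)])
  note A = AC_curve[OF e T AC this H0] and A' = AC_curve[OF e T AC eq_refl[OF ad(1)] ad0(1)]
  show "tame_curve (g n)" using A(1) by (simp add: g_def)
  show "weak_bound e T (g n) (a n)" "weak_bound e T (g n) H" using A(2) A'(2) weak_bound_cong[of T "g n" "fs n"] gf by blast+
 qed
 have En: "energy (fs n t) <= E + H" if "t : {0..T}" for n t
 proof -
  have "energy (fs n t) <= energy (fs n 0) + sqrt (a n * d n)" by (rule energy_growth[OF e T P tame[of n, unfolded g_def] _ ad0(1) eq_refl[OF ad(2)] ad0(2) that])
    (use Wa[of n] weak_bound_cong[of T "g n" "fs n"] gf in blast)+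
  also have "sqrt (a n * d n) <= sqrt (H * H)" using aH ad0 H0 by (intro real_sqrt_le_mono mult_mono) auto
  finally show ?thesis using E(1)[of n] H0 by simp
 qed
 define B where "B = 2 * (E + H)"
 have Pg: "g n t : P2cm" for n t using P[OF clamp_time_in(1)[OF less_imp_le[OF T]]] by (simp add: g_def)
 have gB: "integrable (g n t) (%v. v^2)" "(LINT v|g n t. v^2) <= B" for n t
  using P2cm_D(2)[OF Pg] En[OF clamp_time_in(1)[OF less_imp_le[OF T]], of n t] by (auto simp: B_def energy_def g_def)
 obtain r0 where r0: "strict_mono r0" "((%n. De_Giorgi e T (fs n)) \<circ> r0) ---> liminf (%n. De_Giorgi e T (fs n))"
  using liminf_subseq_lim[of "%n. De_Giorgi e T (fs n)"] by blast
 obtain r1 h where r1: "strict_mono r1" and h: "narrow_curve h" "!!t. h t = h (clamp_time 0 T t)"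
  and w1: "!!t. weak_conv_m (%k. g (r0 (r1 k)) t) (h t)" using curve_compactness[OF e T tame WH H0 gcl gB, of "%k. r0 k"] by blast
 define x where "x k = (let n = r0 (r1 k) in (energy (fs n T), a n, d n))" for k
 have "bounded (range x)"
 proof (rule bounded_subset)
  show "bounded ({0..E + H} \<times> {0..H} \<times> {0..H})" by (intro bounded_Times bounded_closed_interval)
  show "range x \<subseteq> {0..E + H} \<times> {0..H} \<times> {0..H}" using En T ad0 aH by (auto simp: x_def Let_def energy_def)
 qed
 then obtain l r2 where r2: "strict_mono r2" and l: "(x \<circ> r2) ---> l" using bounded_imp_convergent_subsequence by blast
 obtain eT aL dL where leq: "l = (eT, aL, dL)" by (cases l)
 define r where "r k = r0 (r1 (r2 k))" for k
 have rm: "strict_mono r" using r0(1) r1 r2 by (simp add: r_def strict_mono_def)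
 have lE: "(%k. energy (fs (r k) T)) ---> eT" and la: "(%k. a (r k)) ---> aL" and ld: "(%k. d (r k)) ---> dL"
  using tendsto_fst[OF l] tendsto_fst[OF tendsto_snd[OF l]] tendsto_snd[OF tendsto_snd[OF l]] by (simp_all add: x_def r_def Let_def comp_def leq)
 have aL0: "0 <= aL" "0 <= dL" using LIMSEQ_le_const[OF la] LIMSEQ_le_const[OF ld] ad0 by auto
 have w: "weak_conv_m (%k. g (r k) t) (h t)" for t using w1[of t] LIMSEQ_subseq_LIMSEQ[OF _ r2] unfolding weak_conv_m_def weak_conv_def r_def comp_def by blast
 have nc: "narrow_curve (g n)" for n using tame by (simp add: tame_curve_def)
 have grd: "rdist (g n t)" and hrd: "rdist (h t)" for n t using narrow_curve.rd[OF nc] narrow_curve.rd[OF h(1)] by blast+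
 note SM = second_moment_limit[OF grd hrd w gB]
 have hP: "h t : P2cm" for t
 proof -
  have "(%n. 0 :: real) ---> (LINT v|h t. v)" using SM(6)[of t] P2cm_D(3)[OF Pg] by simp
  hence "(LINT v|h t. v) = 0" using LIMSEQ_unique tendsto_const by metis
  thus ?thesis using hrd SM(1)[of t] by (simp add: P2cm_def)
 qed
 have Wh: "weak_bound e T h aL" by (rule weak_bound_limit[OF e T nc h(1) w gB Wa la])
 have hM: "jmean (h t) <= 1 + B" for t by (rule LIMSEQ_le_const2[OF SM(5)]) (use second_moment_bounds(2)[OF grd gB] in blast)
 have hnc: "narrowly_continuous_on {0..T} h" by (rule narrow_curve_restrict[OF h(1)]) simp
 note hAC = weak_bound_AC[OF e T hP hnc Wh aL0(1) hM]
 have narrow: "narrow_lim (%k. fs (r k) t) (h t) sequentially" if "t : {0..T}" for t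
  using narrow_lim_iff_weak_conv[OF grd hrd, of r "%_. t" t] w[of t] gf[OF that] by simp
 have h0: "h 0 = f0"
 proof (rule real_distribution_eqI[OF hrd P2cm_D(1)[OF f0]])
  fix phi psi C assume L: "lipC1 phi psi C" and b: "!!x. abs (phi x) <= 1"
  have phi: "contU phi & bounded (range phi)" using lipC1D(5)[OF L] b by (auto intro: boundedI[where B=1])
  have "(%k. \<integral>v. phi v \<partial>fs (r k) 0) ---> (LINT v|h 0. phi v)" using narrow[of 0] T phi unfolding narrow_lim_def by auto
  moreover have "(%n. \<integral>v. phi v \<partial>fs n 0) ---> (LINT v|f0. phi v)" using N0 phi unfolding narrow_lim_def by blast
  from LIMSEQ_subseq_LIMSEQ[OF this rm] have "(%k. \<integral>v. phi v \<partial>fs (r k) 0) ---> (LINT v|f0. phi v)" by (simp add: comp_def)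
  ultimately show "(LINT v|h 0. phi v) = (LINT v|f0. phi v)" by (rule LIMSEQ_unique)
 qed
 have eh: "energy (h T) <= eT"
 proof -
  have "(%k. ennreal (LINT v|g (r k) T. v^2)) ---> ennreal (2 * eT)"
   using tendsto_mult_left[OF lE, of 2] T gf[of T] by (intro tendsto_ennrealI) (simp add: energy_def)
  hence "ennreal (LINT v|h T. v^2) <= ennreal (2 * eT)" using SM(2)[of T] lim_imp_Liminf[OF trivial_limit_sequentially] by metis
  moreover have "0 <= eT" by (rule LIMSEQ_le_const[OF lE]) (auto simp: energy_def)
  ultimately show ?thesis by (simp add: energy_def ennreal_le_iff)
 qed
 have dh: "(nni (leb T) (%t. dissipation e (h t))) <= ennreal dL"
 proof -
  have "(nni (leb T) (%t. dissipation e (g n t))) = ennreal (d n)" for n unfolding ad(2)[symmetric] by (intro nn_integral_cong) (simp add: gf)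
  hence "(%k. \<integral>\<^sup>+t. dissipation e (g (r k) t) \<partial>leb T) ---> ennreal dL" using ld by (simp add: tendsto_ennrealI)
  thus ?thesis using dissipation_liminf[OF e(2) nc h(1) w, of T] lim_imp_Liminf[OF trivial_limit_sequentially] by metis
 qed
 have "De_Giorgi e T h <= ereal (eT - energy f0) + ereal (1 / 2) * ereal aL + ereal (1 / 2) * ereal dL"
 proof -
  have "enn2ereal x <= ereal y" if "x <= ennreal y" "0 <= y" for x y using that by (metis enn2ereal_ennreal less_eq_ennreal.rep_eq)
  from this[OF hAC(4) aL0(1)] this[OF dh aL0(2)] show ?thesis unfolding De_Giorgi_def h0 using eh by (intro add_mono ereal_mult_left_mono) auto
 qed
 also have "... = ereal (eT - energy f0 + aL / 2 + dL / 2)" by simp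
 also have "... = liminf (%n. De_Giorgi e T (fs n))"
 proof (rule LIMSEQ_unique)
  have "(%k. energy (fs (r k) T) - energy (fs (r k) 0) + a (r k) / 2 + d (r k) / 2) ---> eT - energy f0 + aL / 2 + dL / 2"
   using LIMSEQ_subseq_LIMSEQ[OF E0 rm] by (intro tendsto_intros lE la ld) (simp_all add: comp_def)
  thus "(%k. De_Giorgi e T (fs (r k))) ---> ereal (eT - energy f0 + aL / 2 + dL / 2)" unfolding ad(3) by (rule tendsto_ereal)
  have "strict_mono (r1 \<circ> r2)" using r1 r2 by (rule strict_mono_o)
  from LIMSEQ_subseq_LIMSEQ[OF r0(2) this]
  show "(%k. De_Giorgi e T (fs (r k))) ---> liminf (%n. De_Giorgi e T (fs n))" by (simp add: comp_def r_def)
 qed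
 finally have "De_Giorgi e T h <= liminf (%n. De_Giorgi e T (fs n))" .
 moreover have "AE t in leb T. narrow_lim (%k. fs (r k) t) (h t) sequentially" using narrow by (intro AE_I2) simp
 ultimately show ?thesis using hAC(2) h0 rm by blast
qed

end
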